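(* Let $\chi\in\widehat{\mathcal O_{\mathbb E}^\times}$, $\eta\in\widehat{\mathcal O_{\mathbb F}^\times}$ and $s,t\in\mathbb C$. Then $$\operatorname{Hom}_{G'}(\pi_{\chi,s}|_{G'},\tau_{\eta,t})\simeq\mathcal D'(\mathbb E)_{s,t}^{\chi,\eta}=\begin{cases}\mathbb C\,\widetilde K_{s,t}^{\chi,\eta}&\text{for }(\chi,s,\eta,t)\notin L,\\ \mathbb C\,\delta\oplus\mathbb C\,\widetilde{\widetilde K}{}_{s,t}^{\chi,\eta}&\text{for }(\chi,s,\eta,t)\in L,\end{cases}$$ where $\delta$ is the Dirac distribution at $0\in\mathbb E$ and, for $(\chi,s,\eta,t)\in L$, $\widetilde{\widetilde K}{}_{s,t}^{\chi,\eta}:=(1-q_{\mathbb F}^{-2z})^{-1}\widetilde K_{s+z,t}^{\chi,\eta}\big|_{z=0}$.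
   Context: Fields. $\mathbb E/\mathbb F$ is a quadratic extension of non-archimedean local fields, $\mathbb E=\mathbb F(\alpha)$ with $\alpha\in\mathbb E\setminus\mathbb F$, $\alpha^2\in\mathbb F^\times\setminus\mathbb F^{\times2}$. For $k\in\{\mathbb E,\mathbb F\}$: $\mathcal O_k$ is the ring of integers, $\mathcal O_k^\times$ its units, $\varpi_k$ a chosen uniformizer, $q_k$ the residue cardinality, $\nu_k$ the valuation, $|\cdot|_k$ the absolute value with $d(ax)=|a|_k\,dx$ for Haar measure $dx$ on $k$ (so $|\varpi_k|_k=q_k^{-1}$). After possibly multiplying $\alpha$ by a power of $\varpi_{\mathbb F}$, either $\alpha^2\in\mathcal O_{\mathbb F}^\times$ (the case where $\mathbb E/\mathbb F$ is unramified, $q_{\mathbb E}=q_{\mathbb F}^2$) or $\alpha^2\in\varpi_{\mathbb F}\mathcal O_{\mathbb F}^\times$ (the case where $\mathbb E/\mathbb F$ is ramified, $q_{\mathbb E}=q_{\mathbb F}$). Elements of $\mathbb E$ are written $x=x_1+x_2\alpha$ with $x_1,x_2\in\mathbb F$. Haar measures are normalized so that $\mathcal O_k$ has measure $1$, and $dx=dx_1\,dx_2$. Characters. $\widehat{\mathcal O_k^\times}$ is the set of (continuous) characters of $\mathcal O_k^\times$; for $\chi\in\widehat{\mathcal O_k^\times}$, $s\in\mathbb C$, $\chi_s(x)=\chi(\varpi_k^{-\nu_k(x)}x)|x|_k^s$ ($x\in k^\times$). Representations. $G=\mathrm{PGL}(2,\mathbb E)\supseteq G'=\mathrm{PGL}(2,\mathbb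 F)$, with upper triangular Borel subgroups $B,B'$; $\chi_s\begin{pmatrix}a&b\\ 0&1\end{pmatrix}=\chi_s(a)$ on $B$. $\pi_{\chi,s}$ is left translation on $\operatorname{Ind}_B^G(\chi_s)=\{f\in C^\infty(G):f(gb)=\chi_{s+\frac12}(b)^{-1}f(g)\ \forall g\in G,b\in B\}$ ($C^\infty$ = locally constant); $\tau_{\eta,t}$ is defined likewise for $G'$, $B'$, $\eta_t$. $\overline n_x=\begin{pmatrix}1&0\\ x&1\end{pmatrix}$. $\operatorname{Hom}_{G'}$ denotes $G'$-equivariant linear maps. Distributions. $\mathcal D'(\mathbb E)$ is the space of all linear functionals on $C_c^\infty(\mathbb E)$ (locally constant compactly supported functions); locally integrable functions are viewed as distributions via $dx$. $\mathcal D'(\mathbb E)_{s,t}^{\chi,\eta}$ is the space of $u\in\mathcal D'(\mathbb E)$ such that, in the sense of distributions, (a) for all $a\in\mathbb F^\times$: $u(ax)=\chi_{s-\frac12}(a)\eta_{t+\frac12}(a)^{-1}u(x)$ on $\mathbb E$; (b) for all $b\in\mathbb F^\times$: $u(\frac{x}{1-bx})=\chi_{s-\frac12}((1-bx)^2)^{-1}u(x)$ on $\mathbb E\setminus\{b^{-1}\}$. (Here $\langle u(a\cdot),\varphi\rangle=|a|_{\mathbb E}^{-1}\langle u,\varphi(a^{-1}\cdot)\rangle$, and $\langle u(\frac{\cdot}{1-b\cdot}),\varphi\rangle=\langle u,|1+b\cdot|_{\mathbb E}^{-2}\varphi(\frac{\cdot}{1+b\cdot})\rangle$ for $\varphi\in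 C_c^\infty(\mathbb E\setminus\{b^{-1}\})$.) The isomorphism $\operatorname{Hom}_{G'}(\pi_{\chi,s}|_{G'},\tau_{\eta,t})\simeq\mathcal D'(\mathbb E)_{s,t}^{\chi,\eta}$ sends $A$ to the distribution $u$ with $\langle u,\varphi\rangle=(Af)(1)$, where $f\in\operatorname{Ind}_B^G(\chi_s)$ is the function supported in $\overline NB$ ($\overline N=\{\overline n_x:x\in\mathbb E\}$) with $f(\overline n_x)=\varphi(x)$. Kernels. For $x\in\mathbb E\setminus\mathbb F$ put $K_{s,t}^{\chi,\eta}(x)=\chi_{s-\frac12}(x^2)\,(\chi_{s-\frac12}\eta_{t+\frac12})\big(\frac{x_2}{x_1^2-x_2^2\alpha^2}\big)$. This is locally integrable on $\mathbb E$ for $\operatorname{Re}(2s\pm t+\frac12)>0$ and extends to a meromorphic family of distributions in $(s,t)\in\mathbb C^2$ (i.e. meromorphic when paired with every test function). Put $\widetilde K_{s,t}^{\chi,\eta}=\lambda_+\lambda_-K_{s,t}^{\chi,\eta}$, where $\lambda_\pm=1-q_{\mathbb F}^{-(2s\pm t+\frac12)}$ if $\chi|_{\mathcal O_{\mathbb F}^\times}\cdot\eta^{\pm1}=1$ and $\lambda_\pm=1$ otherwise (the inverse local $L$-factors $L(\frac12,\chi_s|_{\mathbb F^\times}\cdot\eta_t^{\pm1})^{-1}$); this family is holomorphic on $\mathbb C^2$. For $(\chi,s,\eta,t)\in L$ one has $\widetilde K_{s,t}^{\chi,\eta}=0$, so $z\mapsto(1-q_{\mathbb F}^{-2z})^{-1}\widetilde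 K^{\chi,\eta}_{s+z,t}$ is holomorphic at $z=0$. The set $L$. $L=\{(\chi,s,\eta,t):(s,t)\in L^{\chi,\eta}\}$, where $s$ is taken modulo $\frac{2\pi i}{\ln q_{\mathbb E}}\mathbb Z$ and $t$ modulo $\frac{2\pi i}{\ln q_{\mathbb F}}\mathbb Z$; $L^{\chi,\eta}=\emptyset$ if $\chi|_{\mathcal O_{\mathbb F}^\times}\cdot\eta\ne1$ or $\chi|_{\mathcal O_{\mathbb F}^\times}\cdot\eta^{-1}\neq1$; and if both equal $1$: - $\{(0,\frac12),(\frac{\pi i}{\ln q_{\mathbb E}},\frac12+\frac{\pi i}{\ln q_{\mathbb F}})\}$ if $\chi^2\ne1$ and $\mathbb E/\mathbb F$ is unramified; - $\{(0,\frac12),(\frac{\pi i}{\ln q_{\mathbb E}},\frac12),(\frac{\pi i}{2\ln q_{\mathbb E}},\frac12+\frac{\pi i}{\ln q_{\mathbb F}}),(\frac{3\pi i}{2\ln q_{\mathbb E}},\frac12+\frac{\pi i}{\ln q_{\mathbb F}})\}$ if $\chi^2\neq1$ and $\mathbb E/\mathbb F$ is ramified; - $\{(-\frac12,-\frac12),(-\frac12+\frac{\pi i}{\ln q_{\mathbb E}},-\frac12+\frac{\pi i}{\ln q_{\mathbb F}})\}$ if $\chi^2=1$ and $\mathbb E/\mathbb F$ is unramified; - $\{(-\frac12,-\frac12),(-\frac12+\frac{\pi i}{\ln q_{\mathbb E}},-\frac12),(\frac{\pi i}{2\ln q_{\mathbb E}},\frac12+\frac{\pi i}{\ln q_{\mathbb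 F}}),(\frac{3\pi i}{2\ln q_{\mathbb E}},\frac12+\frac{\pi i}{\ln q_{\mathbb F}})\}$ if $\chi^2=1$ and $\mathbb E/\mathbb F$ is ramified.
   Formalization: The chosen uniformizers are taken compatible: ϖ_E = ϖ_F if E/F is unramified and ϖ_E² = ϖ_F if ramified. For other choices χ_s(ϖ_F) picks up a value of χ, the factors λ± no longer cancel the poles of K, and K̃ is not defined everywhere. *)

theory Defs
  imports "HOL-Analysis.Analysis"
begin

section \<open>Non-archimedean local fields\<close>

text \<open>
  A non-archimedean local field is a field carrying a non-trivial ultrametric absolute value for
  which it is locally compact.  The class parameter \<open>vnorm\<close> is an arbitrary absolute value that
  induces the topology; the normalised one is \<open>absv\<close> below.
\<close>

class nonarch_local_field = field + metric_space +
  fixes vnorm :: "'a \<Rightarrow> real"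
  assumes dist_vnorm: "dist x y = vnorm (x - y)"
    and vnorm_mult: "vnorm (x * y) = vnorm x * vnorm y"
    and vnorm_ultrametric: "vnorm (x + y) \<le> max (vnorm x) (vnorm y)"
    and vnorm_nontrivial: "\<exists>x. x \<noteq> 0 \<and> vnorm x \<noteq> 1"
    and compact_unit_ball: "compact {x. vnorm x \<le> 1}"

definition int_ring :: "'a::nonarch_local_field set" where
  "int_ring = {x. vnorm x \<le> 1}"

definition int_units :: "'a::nonarch_local_field set" where
  "int_units = {x. vnorm x = 1}"

definition uniformizer :: "'a::nonarch_local_field \<Rightarrow> bool" where
  "uniformizer p \<longleftrightarrow> p \<noteq> 0 \<and> {x. vnorm x < 1} = (*) p ` int_ring"

definition residue_card :: "'a::nonarch_local_field itself \<Rightarrow> nat" where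
  "residue_card _ = card ((int_ring :: 'a set) //
     {(x, y). x \<in> int_ring \<and> y \<in> int_ring \<and> vnorm (x - y) < 1})"

text \<open>The value of \<open>val\<close> at \<open>0\<close> is unspecified and never relevant.\<close>

definition val :: "'a::nonarch_local_field \<Rightarrow> int" where
  "val x = (THE n. \<exists>p::'a. uniformizer p \<and> vnorm x = vnorm p powi n)"

text \<open>The normalised absolute value, i.e. the modulus of multiplication for additive Haar measure.\<close>

definition absv :: "'a::nonarch_local_field \<Rightarrow> real" where
  "absv x = (if x = 0 then 0 else real (residue_card TYPE('a)) powi (- val x))"

text \<open>Haar measure on the additive group, giving the ring of integers mass \<open>1\<close>.\<close>

definition normalized_haar :: "'a::nonarch_local_field measure \<Rightarrow> bool" where
  "normalized_haar M \<longleftrightarrow> sets M = sets borel \<and> (\<forall>a. distr M borel ((+) a) = M) \<and>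
     emeasure M int_ring = 1"

text \<open>
  A continuous character of the unit group is represented by a function on the whole field whose
  values off the unit group are irrelevant.
\<close>

definition unit_character :: "('a::nonarch_local_field \<Rightarrow> complex) \<Rightarrow> bool" where
  "unit_character chi \<longleftrightarrow> continuous_on int_units chi \<and> chi 1 = 1 \<and>
     (\<forall>x\<in>int_units. \<forall>y\<in>int_units. chi (x * y) = chi x * chi y)"

text \<open>The quasi-character \<open>\<chi>\<^sub>s\<close> attached to \<open>chi\<close>, \<open>s\<close> and the chosen uniformizer \<open>p\<close>.\<close>

definition quasi_char ::
    "'a::nonarch_local_field \<Rightarrow> ('a \<Rightarrow> complex) \<Rightarrow> complex \<Rightarrow> 'a \<Rightarrow> complex" where
  "quasi_char p chi s x = chi (p powi (- val x) * x) * of_real (absv x) powr s"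

definition locally_constant :: "('a::topological_space \<Rightarrow> 'b) \<Rightarrow> bool" where
  "locally_constant f \<longleftrightarrow> (\<forall>x. \<exists>U. open U \<and> x \<in> U \<and> f constant_on U)"


section \<open>The group PGL(2)\<close>

definition pgl_rel :: "('a::field)^2^2 \<Rightarrow> 'a^2^2 \<Rightarrow> bool" where
  "pgl_rel A B \<longleftrightarrow> det A \<noteq> 0 \<and> (\<exists>c. c \<noteq> 0 \<and> B = mat c ** A)"

lemma mat_mult_nth: "(mat c ** A) $ i $ j = c * (A $ i $ j :: 'a::semiring_1)"
proof -
  have "(mat c ** A) $ i $ j = (\<Sum>k\<in>UNIV. if i = k then c * A $ k $ j else 0)"
    unfolding matrix_matrix_mult_def mat_def by (simp only: vec_lambda_beta) (rule sum.cong, auto)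
  then show ?thesis
    by (simp only: sum.delta' finite UNIV_I if_True)
qed

lemma mult_mat_nth: "(A ** mat c) $ i $ j = (A $ i $ j :: 'a::semiring_1) * c"
proof -
  have "(A ** mat c) $ i $ j = (\<Sum>k\<in>UNIV. if k = j then A $ i $ k * c else 0)"
    unfolding matrix_matrix_mult_def mat_def by (simp only: vec_lambda_beta) (rule sum.cong, auto)
  then show ?thesis
    by (simp only: sum.delta finite UNIV_I if_True)
qed

lemma mat_mult_mat: "mat c ** mat d = (mat (c * d) :: ('a::semiring_1)^'n^'n)"
  unfolding vec_eq_iff mat_mult_nth by (simp add: mat_def)

lemma mat_mult_commute: "mat c ** A = A ** (mat c :: ('a::comm_semiring_1)^'n^'n)"
  unfolding vec_eq_iff mat_mult_nth mult_mat_nth by (simp add: mult.commute)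

lemma det_mat_mult_nz: "c \<noteq> 0 \<Longrightarrow> det A \<noteq> 0 \<Longrightarrow> det (mat c ** A :: ('a::field)^2^2) \<noteq> 0"
  by (simp only: det_mul) (simp add: det_2 mat_def)

lemma pgl_rel_refl: "det A \<noteq> 0 \<Longrightarrow> pgl_rel A A"
  by (auto simp: pgl_rel_def intro!: exI[of _ 1])

lemma pgl_rel_det: "pgl_rel A B \<Longrightarrow> det A \<noteq> 0"
  by (simp add: pgl_rel_def)

lemma part_equivp_pgl_rel: "part_equivp (pgl_rel :: ('a::field)^2^2 \<Rightarrow> _)"
proof (rule part_equivpI)
  show "\<exists>A :: 'a^2^2. pgl_rel A A"
    by (intro exI[of _ "mat 1"]) (auto simp: pgl_rel_def intro!: exI[of _ 1])
  show "symp (pgl_rel :: 'a^2^2 \<Rightarrow> _)"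
  proof (rule sympI)
    fix A B :: "'a^2^2"
    assume "pgl_rel A B"
    then obtain c where c: "c \<noteq> 0" "B = mat c ** A" "det A \<noteq> 0"
      by (auto simp: pgl_rel_def)
    then have "A = mat (inverse c) ** B"
      by (simp add: matrix_mul_assoc mat_mult_mat)
    then show "pgl_rel B A"
      using c by (auto simp: pgl_rel_def det_mat_mult_nz intro!: exI[of _ "inverse c"])
  qed
  show "transp (pgl_rel :: 'a^2^2 \<Rightarrow> _)"
  proof (rule transpI)
    fix A B C :: "'a^2^2"
    assume "pgl_rel A B" "pgl_rel B C"
    then obtain c d where "det A \<noteq> 0" "c \<noteq> 0" "d \<noteq> 0" "B = mat c ** A" "C = mat d ** B"
      by (auto simp: pgl_rel_def)
    then show "pgl_rel A C"
      by (auto simp: pgl_rel_def matrix_mul_assoc mat_mult_mat intro!: exI[of _ "d * c"])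
  qed
qed

quotient_type (overloaded) 'a pgl2 = "('a::field)^2^2" / partial: pgl_rel
  by (rule part_equivp_pgl_rel)

text \<open>The class of an invertible matrix; singular matrices are sent to the identity.\<close>

lift_definition pgl :: "('a::field)^2^2 \<Rightarrow> 'a pgl2" is "\<lambda>A. if det A = 0 then mat 1 else A"
  by (auto simp: pgl_rel_def intro: exI[of _ 1])

lemma matrix_inv_mat_mult:
  fixes A :: "('a::field)^2^2"
  assumes "det A \<noteq> 0" "c \<noteq> 0"
  shows "matrix_inv (mat c ** A) = mat (inverse c) ** matrix_inv A" "det (matrix_inv A) \<noteq> 0"
proof -
  have inv: "invertible A"
    using assms by (simp add: invertible_det_nz)
  then have A: "A ** matrix_inv A = mat 1" "matrix_inv A ** A = mat 1"
    using someI_ex[of "\<lambda>A'. A ** A' = mat 1 \<and> A' ** A = mat 1"]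
    by (auto simp: invertible_def matrix_inv_def)
  have "invertible (mat c ** A)"
    using assms by (simp add: invertible_det_nz det_mat_mult_nz)
  then have L: "matrix_inv (mat c ** A) ** (mat c ** A) = mat 1"
    using someI_ex[of "\<lambda>A'. (mat c ** A) ** A' = mat 1 \<and> A' ** (mat c ** A) = mat 1"]
    by (auto simp: invertible_def matrix_inv_def)
  have "(mat c ** A) ** (mat (inverse c) ** matrix_inv A) =
      mat c ** (A ** mat (inverse c)) ** matrix_inv A"
    by (simp only: matrix_mul_assoc)
  also have "A ** mat (inverse c) = mat (inverse c) ** A"
    by (simp only: mat_mult_commute)
  also have "mat c ** (mat (inverse c) ** A) ** matrix_inv A =
      (mat c ** mat (inverse c)) ** (A ** matrix_inv A)"
    by (simp only: matrix_mul_assoc)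
  also have "\<dots> = mat 1"
    using assms by (simp add: mat_mult_mat A)
  finally have R: "(mat c ** A) ** (mat (inverse c) ** matrix_inv A) = mat 1" .
  have "matrix_inv (mat c ** A) =
      matrix_inv (mat c ** A) ** ((mat c ** A) ** (mat (inverse c) ** matrix_inv A))"
    by (simp only: R matrix_mul_rid)
  also have "\<dots> = (matrix_inv (mat c ** A) ** (mat c ** A)) ** (mat (inverse c) ** matrix_inv A)"
    by (simp only: matrix_mul_assoc)
  also have "\<dots> = mat (inverse c) ** matrix_inv A"
    by (simp only: L matrix_mul_lid)
  finally show "matrix_inv (mat c ** A) = mat (inverse c) ** matrix_inv A" .
  have "det A * det (matrix_inv A) = 1"
    by (simp only: A(1) det_I flip: det_mul)
  then show "det (matrix_inv A) \<noteq> 0"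
    by auto
qed

instantiation pgl2 :: (field) "{monoid_mult, inverse}"
begin

lift_definition one_pgl2 :: "'a pgl2" is "mat 1"
  by (auto simp: pgl_rel_def intro: exI[of _ 1])

lift_definition times_pgl2 :: "'a pgl2 \<Rightarrow> 'a pgl2 \<Rightarrow> 'a pgl2" is "(**)"
proof -
  fix A A' B B' :: "'a^2^2"
  assume "pgl_rel A A'" "pgl_rel B B'"
  then obtain c d where *: "det A \<noteq> 0" "det B \<noteq> 0" "c \<noteq> 0" "d \<noteq> 0"
      "A' = mat c ** A" "B' = mat d ** B"
    by (auto simp: pgl_rel_def)
  have "A' ** B' = mat c ** (A ** mat d) ** B"
    by (simp add: * matrix_mul_assoc)
  also have "A ** mat d = mat d ** A"
    by (simp only: mat_mult_commute)
  also have "mat c ** (mat d ** A) ** B = mat (c * d) ** (A ** B)"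
    by (simp add: matrix_mul_assoc mat_mult_mat)
  finally have "A' ** B' = mat (c * d) ** (A ** B)" .
  moreover have "det (A ** B) \<noteq> 0" "c * d \<noteq> 0"
    using *(1-4) by (simp_all add: det_mul)
  ultimately show "pgl_rel (A ** B) (A' ** B')"
    unfolding pgl_rel_def by blast
qed

lift_definition inverse_pgl2 :: "'a pgl2 \<Rightarrow> 'a pgl2" is matrix_inv
proof -
  fix A B :: "'a^2^2"
  assume "pgl_rel A B"
  then obtain c where c: "det A \<noteq> 0" "c \<noteq> 0" and B: "B = mat c ** A"
    by (auto simp: pgl_rel_def)
  have "matrix_inv B = mat (inverse c) ** matrix_inv A" "det (matrix_inv A) \<noteq> 0" "inverse c \<noteq> 0"
    unfolding B using c by (simp_all add: matrix_inv_mat_mult)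
  then show "pgl_rel (matrix_inv A) (matrix_inv B)"
    unfolding pgl_rel_def by blast
qed

definition divide_pgl2 :: "'a pgl2 \<Rightarrow> 'a pgl2 \<Rightarrow> 'a pgl2" where
  "divide_pgl2 x y = x * inverse y"

instance
proof
  fix x y z :: "'a pgl2"
  show "x * y * z = x * (y * z)"
    by transfer (simp only: matrix_mul_assoc,
        auto dest!: pgl_rel_det intro!: pgl_rel_refl simp: det_mul)
  show "1 * x = x"
    by transfer simp
  show "x * 1 = x"
    by transfer simp
qed

end

text \<open>The quotient topology from GL(2), itself a subspace of the space of matrices.\<close>

instantiation pgl2 :: ("{field, topological_space}") topological_space
begin

definition open_pgl2 :: "'a pgl2 set \<Rightarrow> bool" where
  "open_pgl2 U \<longleftrightarrow> openin (top_of_set {A. det A \<noteq> 0}) {A. det A \<noteq> 0 \<and> pgl A \<in> U}"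

instance
proof
  let ?G = "top_of_set {A::'a^2^2. det A \<noteq> 0}"
  show "open (UNIV :: 'a pgl2 set)"
    unfolding open_pgl2_def by (simp only: UNIV_I simp_thms openin_subtopology_self)
  fix S T :: "'a pgl2 set"
  assume "open S" "open T"
  then have "openin ?G ({A. det A \<noteq> 0 \<and> pgl A \<in> S} \<inter> {A. det A \<noteq> 0 \<and> pgl A \<in> T})"
    unfolding open_pgl2_def by (rule openin_Int)
  also have "{A. det A \<noteq> 0 \<and> pgl A \<in> S} \<inter> {A. det A \<noteq> 0 \<and> pgl A \<in> T} =
      {A. det A \<noteq> 0 \<and> pgl A \<in> S \<inter> T}"
    by blast
  finally show "open (S \<inter> T)"
    unfolding open_pgl2_def .
next
  let ?G = "top_of_set {A::'a^2^2. det A \<noteq> 0}"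
  fix K :: "'a pgl2 set set"
  assume "\<forall>S\<in>K. open S"
  then have "openin ?G (\<Union>S\<in>K. {A. det A \<noteq> 0 \<and> pgl A \<in> S})"
    unfolding open_pgl2_def by blast
  also have "(\<Union>S\<in>K. {A. det A \<noteq> 0 \<and> pgl A \<in> S}) = {A. det A \<noteq> 0 \<and> pgl A \<in> \<Union>K}"
    by blast
  finally show "open (\<Union>K)"
    unfolding open_pgl2_def .
qed

end

definition upper :: "'a::field \<Rightarrow> 'a \<Rightarrow> 'a pgl2" where
  "upper a b = pgl (vector [vector [a, b], vector [0, 1]])"

definition nbar :: "'a::field \<Rightarrow> 'a pgl2" where
  "nbar x = pgl (vector [vector [1, 0], vector [x, 1]])"


section \<open>Principal series and intertwining operators\<close>

text \<open>
  The normalised induction space: the factor comes from \<open>chi\<close> shifted by \<open>1/2\<close>.  As every element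
  of the Borel subgroup of PGL(2) is \<open>upper a b\<close> for unique \<open>a \<noteq> 0\<close> and \<open>b\<close>, the condition ranges
  over the whole subgroup.
\<close>

definition principal_series ::
    "'a::nonarch_local_field \<Rightarrow> ('a \<Rightarrow> complex) \<Rightarrow> complex \<Rightarrow> ('a pgl2 \<Rightarrow> complex) set" where
  "principal_series p chi s = {f. locally_constant f \<and>
     (\<forall>g a b. a \<noteq> 0 \<longrightarrow> f (g * upper a b) = inverse (quasi_char p chi (s + 1/2) a) * f g)}"

definition left_translate :: "'a::field pgl2 \<Rightarrow> ('a pgl2 \<Rightarrow> complex) \<Rightarrow> 'a pgl2 \<Rightarrow> complex" where
  "left_translate h f = (\<lambda>g. f (inverse h * g))"

definition map_mat2 :: "('f \<Rightarrow> 'e) \<Rightarrow> 'f^2^2 \<Rightarrow> 'e^2^2" where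
  "map_mat2 \<iota> A = (\<chi> i j. \<iota> (A $ i $ j))"

text \<open>
  Linear maps between the induction spaces, extended by zero to all functions so that they form
  a vector space under pointwise operations.  The subgroup PGL(2,F) acts through representatives
  in GL(2,F).
\<close>

definition intertwiners ::
    "('f::nonarch_local_field \<Rightarrow> 'e::nonarch_local_field) \<Rightarrow> 'e \<Rightarrow> 'f \<Rightarrow>
     ('e \<Rightarrow> complex) \<Rightarrow> complex \<Rightarrow> ('f \<Rightarrow> complex) \<Rightarrow> complex \<Rightarrow>
     (('e pgl2 \<Rightarrow> complex) \<Rightarrow> 'f pgl2 \<Rightarrow> complex) set" where
  "intertwiners \<iota> pE pF chi s eta t = {A.
     (\<forall>f \<in> principal_series pE chi s. A f \<in> principal_series pF eta t) \<and>
     (\<forall>f \<in> principal_series pE chi s. \<forall>f' \<in> principal_series pE chi s.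
        A (\<lambda>g. f g + f' g) = (\<lambda>g. A f g + A f' g)) \<and>
     (\<forall>c. \<forall>f \<in> principal_series pE chi s. A (\<lambda>g. c * f g) = (\<lambda>g. c * A f g)) \<and>
     (\<forall>h. det h \<noteq> 0 \<longrightarrow> (\<forall>f \<in> principal_series pE chi s.
        A (left_translate (pgl (map_mat2 \<iota> h)) f) = left_translate (pgl h) (A f))) \<and>
     (\<forall>f. f \<notin> principal_series pE chi s \<longrightarrow> A f = (\<lambda>g. 0))}"


section \<open>Distributions\<close>

definition test_fun :: "'a::topological_space set \<Rightarrow> ('a \<Rightarrow> complex) set" where
  "test_fun U = {\<phi>. locally_constant \<phi> \<and> compact (closure {x. \<phi> x \<noteq> 0}) \<and>
     closure {x. \<phi> x \<noteq> 0} \<subseteq> U}"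

text \<open>Linear functionals on the test functions, extended by zero to all functions.\<close>

definition distributions :: "(('a::topological_space \<Rightarrow> complex) \<Rightarrow> complex) set" where
  "distributions = {u.
     (\<forall>\<phi> \<in> test_fun UNIV. \<forall>\<psi> \<in> test_fun UNIV. u (\<lambda>x. \<phi> x + \<psi> x) = u \<phi> + u \<psi>) \<and>
     (\<forall>c. \<forall>\<phi> \<in> test_fun UNIV. u (\<lambda>x. c * \<phi> x) = c * u \<phi>) \<and>
     (\<forall>\<phi>. \<phi> \<notin> test_fun UNIV \<longrightarrow> u \<phi> = 0)}"

definition dirac :: "('a::{topological_space, zero} \<Rightarrow> complex) \<Rightarrow> complex" where
  "dirac \<phi> = (if \<phi> \<in> test_fun UNIV then \<phi> 0 else 0)"

definition invariant_distributions ::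
    "('f::nonarch_local_field \<Rightarrow> 'e::nonarch_local_field) \<Rightarrow> 'e \<Rightarrow> 'f \<Rightarrow>
     ('e \<Rightarrow> complex) \<Rightarrow> complex \<Rightarrow> ('f \<Rightarrow> complex) \<Rightarrow> complex \<Rightarrow>
     (('e \<Rightarrow> complex) \<Rightarrow> complex) set" where
  "invariant_distributions \<iota> pE pF chi s eta t = {u \<in> distributions.
     (\<forall>a. a \<noteq> 0 \<longrightarrow> (\<forall>\<phi> \<in> test_fun UNIV.
        of_real (inverse (absv (\<iota> a))) * u (\<lambda>x. \<phi> (inverse (\<iota> a) * x)) =
        quasi_char pE chi (s - 1/2) (\<iota> a) * inverse (quasi_char pF eta (t + 1/2) a) * u \<phi>)) \<and>
     (\<forall>b. b \<noteq> 0 \<longrightarrow> (\<forall>\<phi> \<in> test_fun (UNIV - {inverse (\<iota> b)}).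
        u (\<lambda>x. if 1 + \<iota> b * x = 0 then 0
               else of_real (inverse (absv (1 + \<iota> b * x) ^ 2)) * \<phi> (x / (1 + \<iota> b * x))) =
        u (\<lambda>x. inverse (quasi_char pE chi (s - 1/2) ((1 - \<iota> b * x) ^ 2)) * \<phi> x)))}"

text \<open>
  The function in the induction space that is supported in the open cell and whose restriction
  to the lower unipotent matrices is \<open>\<phi>\<close>, and the distribution attached to an intertwiner.
\<close>

definition cell_section ::
    "'a::nonarch_local_field \<Rightarrow> ('a \<Rightarrow> complex) \<Rightarrow> complex \<Rightarrow> ('a \<Rightarrow> complex) \<Rightarrow> 'a pgl2 \<Rightarrow> complex" where
  "cell_section p chi s \<phi> = (THE f. f \<in> principal_series p chi s \<and> (\<forall>x. f (nbar x) = \<phi> x) \<and>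
     (\<forall>g. g \<notin> {nbar x * upper a b |x a b. a \<noteq> 0} \<longrightarrow> f g = 0))"

definition intertwiner_kernel ::
    "'e::nonarch_local_field \<Rightarrow> ('e \<Rightarrow> complex) \<Rightarrow> complex \<Rightarrow>
     (('e pgl2 \<Rightarrow> complex) \<Rightarrow> 'f::nonarch_local_field pgl2 \<Rightarrow> complex) \<Rightarrow> ('e \<Rightarrow> complex) \<Rightarrow> complex" where
  "intertwiner_kernel p chi s A \<phi> =
     (if \<phi> \<in> test_fun UNIV then A (cell_section p chi s \<phi>) 1 else 0)"


section \<open>Quadratic extensions\<close>

definition unramified ::
    "('f::nonarch_local_field \<Rightarrow> 'e::nonarch_local_field) \<Rightarrow> bool" where
  "unramified \<iota> \<longleftrightarrow> (\<forall>p. uniformizer p \<longrightarrow> uniformizer (\<iota> p)) \<and>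
     residue_card TYPE('e) = residue_card TYPE('f) ^ 2"

text \<open>
  The extension is given by the embedding \<open>\<iota>\<close> of the small field and by a square root \<open>\<alpha>\<close> of the
  non-square \<open>d\<close>, normalised so that \<open>d\<close> is a unit or a uniformizer up to a unit, according to
  ramification.  The chosen uniformizers \<open>pE\<close> and \<open>pF\<close> are compatible: the character \<open>\<chi>\<^sub>s\<close> depends
  on \<open>pE\<close>, and only for compatible choices is \<open>\<chi>\<^sub>s(\<iota> pF) = |\<iota> pF|\<^sup>s\<close> for every \<open>chi\<close>, as the shape of
  the local factors \<open>lambda_plus\<close> and \<open>lambda_minus\<close> requires.
\<close>

locale quadratic_local_extension =
  fixes \<iota> :: "'f::nonarch_local_field \<Rightarrow> 'e::nonarch_local_field"
    and d :: 'f and \<alpha> :: 'e and pF :: 'f and pE :: 'e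
  assumes \<iota>_one: "\<iota> 1 = 1"
    and \<iota>_add: "\<iota> (x + y) = \<iota> x + \<iota> y"
    and \<iota>_mult: "\<iota> (x * y) = \<iota> x * \<iota> y"
    and \<iota>_continuous: "continuous_on UNIV \<iota>"
    and \<alpha>_notin: "\<alpha> \<notin> range \<iota>"
    and \<alpha>_square: "\<alpha> ^ 2 = \<iota> d"
    and d_nonzero: "d \<noteq> 0"
    and d_nonsquare: "\<nexists>c. d = c ^ 2"
    and generated: "\<exists>x\<^sub>1 x\<^sub>2. z = \<iota> x\<^sub>1 + \<iota> x\<^sub>2 * \<alpha>"
    and d_normalised: "unramified \<iota> \<and> d \<in> int_units \<or> \<not> unramified \<iota> \<and> uniformizer d"
    and uniformizer_F: "uniformizer pF"
    and uniformizer_E: "uniformizer pE"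
    and uniformizers_compatible: "if unramified \<iota> then pE = \<iota> pF else pE ^ 2 = \<iota> pF"

definition coord1 :: "('f::field \<Rightarrow> 'e::field) \<Rightarrow> 'e \<Rightarrow> 'e \<Rightarrow> 'f" where
  "coord1 \<iota> \<alpha> x = (THE x\<^sub>1. \<exists>x\<^sub>2. x = \<iota> x\<^sub>1 + \<iota> x\<^sub>2 * \<alpha>)"

definition coord2 :: "('f::field \<Rightarrow> 'e::field) \<Rightarrow> 'e \<Rightarrow> 'e \<Rightarrow> 'f" where
  "coord2 \<iota> \<alpha> x = (THE x\<^sub>2. \<exists>x\<^sub>1. x = \<iota> x\<^sub>1 + \<iota> x\<^sub>2 * \<alpha>)"


section \<open>The kernels\<close>

text \<open>The kernel is set to \<open>0\<close> on the null set \<open>range \<iota>\<close>, where it is not defined.\<close>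

definition kernel_fun ::
    "('f::nonarch_local_field \<Rightarrow> 'e::nonarch_local_field) \<Rightarrow> 'f \<Rightarrow> 'e \<Rightarrow> 'f \<Rightarrow> 'e \<Rightarrow>
     ('e \<Rightarrow> complex) \<Rightarrow> complex \<Rightarrow> ('f \<Rightarrow> complex) \<Rightarrow> complex \<Rightarrow> 'e \<Rightarrow> complex" where
  "kernel_fun \<iota> d \<alpha> pF pE chi s eta t x = (if x \<in> range \<iota> then 0 else
     (let x\<^sub>1 = coord1 \<iota> \<alpha> x; x\<^sub>2 = coord2 \<iota> \<alpha> x; y = x\<^sub>2 / (x\<^sub>1 ^ 2 - x\<^sub>2 ^ 2 * d)
      in quasi_char pE chi (s - 1/2) (x ^ 2) *
         (quasi_char pE chi (s - 1/2) (\<iota> y) * quasi_char pF eta (t + 1/2) y)))"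

definition lambda_plus ::
    "('f::nonarch_local_field \<Rightarrow> 'e::nonarch_local_field) \<Rightarrow>
     ('e \<Rightarrow> complex) \<Rightarrow> complex \<Rightarrow> ('f \<Rightarrow> complex) \<Rightarrow> complex \<Rightarrow> complex" where
  "lambda_plus \<iota> chi s eta t = (if \<forall>x\<in>int_units. chi (\<iota> x) * eta x = 1
     then 1 - of_nat (residue_card TYPE('f)) powr (- (2 * s + t + 1/2)) else 1)"

definition lambda_minus ::
    "('f::nonarch_local_field \<Rightarrow> 'e::nonarch_local_field) \<Rightarrow>
     ('e \<Rightarrow> complex) \<Rightarrow> complex \<Rightarrow> ('f \<Rightarrow> complex) \<Rightarrow> complex \<Rightarrow> complex" where
  "lambda_minus \<iota> chi s eta t = (if \<forall>x\<in>int_units. chi (\<iota> x) * inverse (eta x) = 1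
     then 1 - of_nat (residue_card TYPE('f)) powr (- (2 * s - t + 1/2)) else 1)"

definition holomorphic_C2 :: "(complex \<times> complex \<Rightarrow> complex) \<Rightarrow> bool" where
  "holomorphic_C2 h \<longleftrightarrow>
     (\<forall>w. \<exists>a b. (h has_derivative (\<lambda>(v\<^sub>1, v\<^sub>2). a * v\<^sub>1 + b * v\<^sub>2)) (at w))"

text \<open>
  The renormalised kernel: for each test function, the unique entire function on \<open>\<complex>\<^sup>2\<close> that agrees
  with \<open>\<lambda>\<^sub>+ \<lambda>\<^sub>- \<integral> K\<^sub>s\<^sub>,\<^sub>t \<phi> dx\<close> on the domain where \<open>K\<^sub>s\<^sub>,\<^sub>t\<close> is locally integrable.
\<close>

definition kernel_tilde ::
    "'e measure \<Rightarrow> ('f::nonarch_local_field \<Rightarrow> 'e::nonarch_local_field) \<Rightarrow> 'f \<Rightarrow> 'e \<Rightarrow> 'f \<Rightarrow> 'e \<Rightarrow>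
     ('e \<Rightarrow> complex) \<Rightarrow> complex \<Rightarrow> ('f \<Rightarrow> complex) \<Rightarrow> complex \<Rightarrow> ('e \<Rightarrow> complex) \<Rightarrow> complex" where
  "kernel_tilde M \<iota> d \<alpha> pF pE chi s eta t \<phi> = (if \<phi> \<in> test_fun UNIV then
     (THE h. holomorphic_C2 h \<and>
        (\<forall>s t. Re (2 * s + t + 1/2) > 0 \<and> Re (2 * s - t + 1/2) > 0 \<longrightarrow>
           h (s, t) = lambda_plus \<iota> chi s eta t * lambda_minus \<iota> chi s eta t *
             (LINT x|M. kernel_fun \<iota> d \<alpha> pF pE chi s eta t x * \<phi> x))) (s, t)
     else 0)"

definition kernel_tilde2 ::
    "'e measure \<Rightarrow> ('f::nonarch_local_field \<Rightarrow> 'e::nonarch_local_field) \<Rightarrow> 'f \<Rightarrow> 'e \<Rightarrow> 'f \<Rightarrow> 'e \<Rightarrow>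
     ('e \<Rightarrow> complex) \<Rightarrow> complex \<Rightarrow> ('f \<Rightarrow> complex) \<Rightarrow> complex \<Rightarrow> ('e \<Rightarrow> complex) \<Rightarrow> complex" where
  "kernel_tilde2 M \<iota> d \<alpha> pF pE chi s eta t \<phi> =
     Lim (at 0) (\<lambda>z. inverse (1 - of_nat (residue_card TYPE('f)) powr (- 2 * z)) *
       kernel_tilde M \<iota> d \<alpha> pF pE chi (s + z) eta t \<phi>)"


section \<open>The exceptional set\<close>

definition exceptional_points :: "bool \<Rightarrow> bool \<Rightarrow> real \<Rightarrow> real \<Rightarrow> (complex \<times> complex) set" where
  "exceptional_points unram chi2_trivial qE qF =
     (let PE = of_real (pi / ln qE) * \<i>; PF = of_real (pi / ln qF) * \<i> in
      if \<not> chi2_trivial \<and> unram then {(0, 1/2), (PE, 1/2 + PF)}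
      else if \<not> chi2_trivial \<and> \<not> unram then
        {(0, 1/2), (PE, 1/2), (PE / 2, 1/2 + PF), (3 * PE / 2, 1/2 + PF)}
      else if chi2_trivial \<and> unram then {(-1/2, -1/2), (-1/2 + PE, -1/2 + PF)}
      else {(-1/2, -1/2), (-1/2 + PE, -1/2), (PE / 2, 1/2 + PF), (3 * PE / 2, 1/2 + PF)})"

text \<open>The parameters \<open>s\<close> and \<open>t\<close> matter only up to the periods of \<open>\<chi>\<^sub>s\<close> and \<open>\<eta>\<^sub>t\<close>.\<close>

definition exceptional ::
    "('f::nonarch_local_field \<Rightarrow> 'e::nonarch_local_field) \<Rightarrow>
     ('e \<Rightarrow> complex) \<Rightarrow> complex \<Rightarrow> ('f \<Rightarrow> complex) \<Rightarrow> complex \<Rightarrow> bool" where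
  "exceptional \<iota> chi s eta t \<longleftrightarrow>
     (\<forall>x\<in>int_units. chi (\<iota> x) * eta x = 1) \<and>
     (\<forall>x\<in>int_units. chi (\<iota> x) * inverse (eta x) = 1) \<and>
     (let qE = real (residue_card TYPE('e)); qF = real (residue_card TYPE('f)) in
      \<exists>(s\<^sub>0, t\<^sub>0) \<in> exceptional_points (unramified \<iota>) (\<forall>x\<in>int_units. chi x ^ 2 = 1) qE qF.
        \<exists>m n :: int. s = s\<^sub>0 + of_int m * (of_real (2 * pi / ln qE) * \<i>) \<and>
                     t = t\<^sub>0 + of_int n * (of_real (2 * pi / ln qF) * \<i>))"

end

theory Submission
 imports Defs "HOL-Complex_Analysis.Conformal_Mappings"
begin

text \<open>
 In the coordinate \<open>w = 1/x\<close> an invariant distribution off \<open>0\<close> becomes a distribution on the whole of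
 \<open>E\<close> that is invariant under translation by \<open>F\<close> and homogeneous under \<open>F\<^sup>*\<close>.  For every parameter such
 distributions form a line, spanned by the analytic continuation of \<open>\<psi> \<mapsto> \<integral>\<psi>(w) \<sigma>(c2 w) dw\<close>, where
 \<open>c2\<close> is the \<open>F\<close>-linear coordinate that vanishes on \<open>F\<close>; the renormalised kernel corresponds to this
 generator.  Whether it extends across \<open>x = 0\<close> is decided by the integral \<open>S\<close> over one shell around \<open>0\<close>:
 the generator extends unless the character occurring in \<open>\<delta>\<close> is the critical one and \<open>S \<noteq> 0\<close>.  At the
 critical parameters \<open>S\<close> vanishes exactly on the exceptional set: by orthogonality of characters or a
 direct evaluation on one side, by inversion of a Radon transform over \<open>F\<close>-lines on the other.
 An intertwiner is recovered from its distribution by covering the projective line of \<open>E\<close> with the two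
 charts \<open>x\<close> and \<open>w\<close>, and the covariance of the distribution makes the gluing independent of the cut.
\<close>

section \<open>Valuations\<close>

text \<open>The natural normalisation of the generator fails: its density off F carries the inverse
  L-factor \<open>lam z\<close>, and at a zero of \<open>lam\<close> the density dies while a
  functional concentrated on F survives. Prescribing instead the value 1 on a fixed test function
  \<open>star\<close> gives \<open>vhat z\<close>, which is entire in z and nowhere zero. An
  invariant distribution is then a pair (A, C): its value on a ball around 0 and its coefficient of
  the generator. If the character occurring in \<delta> is trivial on units, homogeneity amounts to
  \<open>lam' s t * A = SS s t * C\<close>, where \<open>lam'\<close> is one minus the scaling
  factor at a uniformizer; otherwise it forces A = 0. The solutions form a plane exactly when both
  coefficients vanish. The renormalised kernel is a nonzero multiple of the pair (\<open>SS\<close>,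
  \<open>lam'\<close>), so it spans the solutions unless it is zero; along s + z the factor 1 -
  q^(-2z) is then exactly \<open>lam'\<close>, and dividing by it leaves a pair with C nonzero. In
  residue characteristic two \<alpha> need not generate the integers of an unramified extension.
  Estimates therefore use coordinates with respect to another element \<beta>, although the kernel
  is defined through \<alpha>.\<close>

lemma vnorm_zero [simp]: "vnorm (0::'a::nonarch_local_field) = 0" using dist_vnorm[of "0::'a" 0] by simp

lemma dist_zero_vnorm: "dist x 0 = vnorm (x::'a::nonarch_local_field)" using dist_vnorm[of x 0] by simp

lemma vnorm_eq_0 [simp]: "vnorm x = 0 \<longleftrightarrow> x = (0::'a::nonarch_local_field)" by (metis dist_zero_vnorm dist_eq_0_iff)

lemma vnorm_nonneg [simp]: "vnorm (x::'a::nonarch_local_field) \<ge> 0" by (metis dist_zero_vnorm zero_le_dist)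

lemma vnorm_pos_iff [simp]: "vnorm (x::'a::nonarch_local_field) > 0 \<longleftrightarrow> x ~= 0"
 by (metis vnorm_nonneg vnorm_eq_0 less_eq_real_def less_irrefl)

lemma vnorm_one [simp]: "vnorm (1::'a::nonarch_local_field) = 1" using vnorm_mult[of "1::'a" 1] by simp

lemma vnorm_minus [simp]: "vnorm (- x) = vnorm (x::'a::nonarch_local_field)"
 by (metis dist_commute dist_vnorm diff_0 diff_zero)

lemma vnorm_inverse: "vnorm (inverse x) = inverse (vnorm (x::'a::nonarch_local_field))"
proof (cases "x = 0")
 case False
 hence "vnorm x * vnorm (inverse x) = 1" by (simp flip: vnorm_mult)
 thus ?thesis using inverse_unique by metis
qed simp

lemma vnorm_divide: "vnorm (x / y) = vnorm x / vnorm (y::'a::nonarch_local_field)"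
 by (simp add: divide_inverse vnorm_mult vnorm_inverse)

lemma vnorm_power: "vnorm (x ^ n) = vnorm (x::'a::nonarch_local_field) ^ n" by (induction n) (simp_all add: vnorm_mult)

lemma vnorm_power_int: "vnorm (x powi n) = vnorm (x::'a::nonarch_local_field) powi n"
 by (auto simp: power_int_def vnorm_power vnorm_inverse)

lemma vnorm_diff_le: "vnorm (x - y) \<le> max (vnorm x) (vnorm (y::'a::nonarch_local_field))"
 using vnorm_ultrametric[of x "- y"] by simp

text \<open>By the ultrametric inequality the open unit ball is also closed, hence compact, so the
  absolute value attains a maximum on it. A maximiser generates the maximal ideal: discreteness of
  the valuation comes from local compactness.\<close>

lemma ex_uniformizer: "\<exists>p::'a::nonarch_local_field. uniformizer p"
proof -
 let ?B = "{x::'a. vnorm x < 1}"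
 have "open (- ?B)" unfolding open_dist proof
  fix x :: 'a assume "x \<in> - ?B"
  hence x: "\<not> vnorm x < 1" by simp
  have "y \<in> - ?B" if "dist y x < 1" for y using vnorm_diff_le[of y "y - x"] that x by (auto simp: dist_vnorm)
  thus "\<exists>e>0. \<forall>y. dist y x < e --> y \<in> - ?B" by (intro exI[of _ 1]) auto
 qed
 hence "compact ({x::'a. vnorm x \<le> 1} \<inter> ?B)" by (intro compact_Int_closed compact_unit_ball) (simp add: closed_def)
 moreover have "{x::'a. vnorm x \<le> 1} \<inter> ?B = ?B" by auto
 ultimately have "compact ?B" by simp
 moreover have "continuous_on ?B (%x. dist x 0)" by (intro continuous_intros)
 moreover have "0 \<in> ?B" by simp
 ultimately obtain p where p: "p \<in> ?B" "!!y. y \<in> ?B ==> dist y 0 \<le> dist p 0"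
  using continuous_attains_sup[of ?B "%x. dist x 0"] by (metis empty_iff)
 obtain x :: 'a where x: "x ~= 0" "vnorm x ~= 1" using vnorm_nontrivial by blast
 have "\<exists>y::'a. y ~= 0 & vnorm y < 1" proof (cases "vnorm x < 1")
  case False
  thus ?thesis using x by (intro exI[of _ "inverse x"]) (auto simp: vnorm_inverse inverse_less_1_iff)
 qed (use x in auto)
 then obtain y :: 'a where "y ~= 0" "vnorm y < 1" by blast
 hence p0: "p ~= 0" using p(2)[of y] by (auto simp: dist_zero_vnorm simp flip: not_less)
 have "?B = (*) p ` int_ring" proof
  show "?B \<subseteq> (*) p ` int_ring" proof
   fix z assume z: "z \<in> ?B"
   hence "vnorm z \<le> vnorm p" using p(2) by (simp add: dist_zero_vnorm)
   hence "z / p \<in> int_ring" using p0 by (simp add: int_ring_def vnorm_divide)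
   moreover have "z = p * (z / p)" using p0 by simp
   ultimately show "z \<in> (*) p ` int_ring" by blast
  qed
  show "(*) p ` int_ring \<subseteq> ?B" proof
   fix z assume "z \<in> (*) p ` int_ring"
   then obtain w where w: "z = p * w" "vnorm w \<le> 1" by (auto simp: int_ring_def)
   hence "vnorm z \<le> vnorm p * 1" unfolding w vnorm_mult by (intro mult_left_mono) auto
   thus "z \<in> ?B" using p(1) by auto
  qed
 qed
 thus ?thesis using p0 unfolding uniformizer_def by blast
qed

lemma uniformizer_vnorm:
 assumes "uniformizer (p::'a::nonarch_local_field)"
 shows "0 < vnorm p" "vnorm p < 1" "!!x::'a. vnorm x < 1 \<longleftrightarrow> vnorm x \<le> vnorm p"
proof -
 have p: "p ~= 0" and eq: "{x. vnorm x < 1} = (*) p ` int_ring" using assms by (auto simp: uniformizer_def)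
 show "0 < vnorm p" using p by simp
 have "p * 1 \<in> (*) p ` int_ring" by (intro imageI) (simp add: int_ring_def)
 thus 1: "vnorm p < 1" using eq by auto
 show "vnorm x < 1 \<longleftrightarrow> vnorm x \<le> vnorm p" for x :: 'a proof
  assume "vnorm x < 1"
  then obtain w where w: "x = p * w" "vnorm w \<le> 1" using eq by (auto simp: int_ring_def)
  have "vnorm x \<le> vnorm p * 1" unfolding w vnorm_mult by (intro mult_left_mono) (use w in auto)
  thus "vnorm x \<le> vnorm p" by simp
 qed (use 1 in auto)
qed

lemma uniformizer_vnorm_eq:
 assumes "uniformizer (p::'a::nonarch_local_field)" "uniformizer (p'::'a)" shows "vnorm p = vnorm p'"
 using uniformizer_vnorm(2)[OF assms(1)] uniformizer_vnorm(3)[OF assms(1), of p']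
  uniformizer_vnorm(2)[OF assms(2)] uniformizer_vnorm(3)[OF assms(2), of p] by linarith

lemma powi_less_iff:
 assumes "0 < (r::real)" "r < 1" shows "r powi m \<le> r powi n \<longleftrightarrow> n \<le> m"
proof -
 have less: "r powi b < r powi a" if "a < b" for a b proof -
  have "r powi b = r powi a * r ^ nat (b - a)"
   using power_int_add[of r a "b - a"] that assms by (simp add: power_int_def[of r "b - a"])
  moreover have "r ^ nat (b - a) < 1" using power_strict_decreasing[of 0 "nat (b - a)" r] that assms by simp
  ultimately show ?thesis using mult_strict_left_mono[of "r ^ nat (b - a)" 1 "r powi a"] assms by simp
 qed
 show ?thesis using less[of m n] less[of n m] by (cases m n rule: linorder_cases) auto
qed

lemma powi_inj:
 assumes "0 < (r::real)" "r < 1" "r powi m = r powi n" shows "m = n"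
 using powi_less_iff[OF assms(1,2), of m n] powi_less_iff[OF assms(1,2), of n m] assms(3) by simp

lemma ex_val:
 assumes "uniformizer (p::'a::nonarch_local_field)" "(x::'a) ~= 0" shows "\<exists>n. vnorm x = vnorm p powi n"
proof -
 define r where "r = vnorm p"
 have r: "0 < r" "r < 1" using uniformizer_vnorm[OF assms(1)] by (auto simp: r_def)
 define v where "v = vnorm x"
 have v: "0 < v" using assms by (simp add: v_def)
 \<comment> \<open>As \<open>r < 1\<close>, the floor of the logarithm to base \<open>r\<close>
   traps \<open>v\<close> between \<open>r powi (n + 1)\<close>, excluded, and
   \<open>r powi n\<close>. After division by the n-th power of \<open>p\<close> the absolute value
   lies in the gap above \<open>vnorm p\<close>, so it is 1.\<close>
 define n where "n = \<lfloor>log r v\<rfloor>"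
 have vr: "v = r powr log r v" using r v by simp
 have le: "v \<le> r powi n" proof -
  have "r powr log r v \<le> r powr of_int n" using r unfolding n_def by (intro powr_mono') auto
  thus ?thesis using vr r powr_real_of_int'[of r n] by simp
 qed
 have gt: "r powi (n + 1) < v" proof -
  have "r powr of_int (n + 1) < r powr log r v"
   using r unfolding n_def by (intro powr_less_mono') (auto simp: algebra_simps, linarith)
  thus ?thesis using vr r powr_real_of_int'[of r "n + 1"] by simp
 qed
 define z where "z = x * p powi (- n)"
 have z: "vnorm z = v / r powi n"
  by (simp add: z_def vnorm_mult v_def r_def vnorm_power_int power_int_minus divide_inverse vnorm_inverse)
 have rn: "r powi n > 0" using r by simp
 have "vnorm z > r" using gt rn r unfolding z by (simp add: field_simps power_int_add)
 moreover have "vnorm z \<le> 1" using le rn unfolding z by simp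
 ultimately have "vnorm z = 1" using uniformizer_vnorm(3)[OF assms(1), of z] by (simp add: r_def)
 hence "v = r powi n" using rn unfolding z by (simp add: field_simps)
 thus ?thesis unfolding v_def r_def by blast
qed

lemma val_eqI:
 assumes "uniformizer (p::'a::nonarch_local_field)" "vnorm (x::'a) = vnorm p powi n" shows "val x = n" unfolding val_def
proof (rule the_equality)
 show "\<exists>p::'a. uniformizer p & vnorm x = vnorm p powi n" using assms by blast
 fix m
 assume "\<exists>p'::'a. uniformizer p' & vnorm x = vnorm p' powi m"
 hence "vnorm x = vnorm p powi m" using uniformizer_vnorm_eq[OF assms(1)] by metis
 thus "m = n" using powi_inj assms uniformizer_vnorm[OF assms(1)] by metis
qed

lemma vnorm_val:
 assumes "uniformizer (p::'a::nonarch_local_field)" "(x::'a) ~= 0" shows "vnorm x = vnorm p powi val x"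
 using ex_val[OF assms] val_eqI[OF assms(1)] by metis

lemma val_mult: "x ~= 0 ==> y ~= 0 ==> val (x * y) = val x + val (y::'a::nonarch_local_field)"
proof -
 assume x: "x ~= 0" "y ~= 0"
 obtain p :: 'a where p: "uniformizer p" using ex_uniformizer by blast
 have "vnorm (x * y) = vnorm p powi (val x + val y)"
  using uniformizer_vnorm(1)[OF p] vnorm_val[OF p x(1)] vnorm_val[OF p x(2)] by (simp add: vnorm_mult power_int_add)
 thus ?thesis by (rule val_eqI[OF p])
qed

lemma vnorm_le_iff_val:
 assumes "(x::'a) ~= 0" "y ~= (0::'a::nonarch_local_field)"
 shows "vnorm x \<le> vnorm y \<longleftrightarrow> val y \<le> val x"
proof -
 obtain p :: 'a where p: "uniformizer p" using ex_uniformizer by blast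
 show ?thesis using vnorm_val[OF p assms(1)] vnorm_val[OF p assms(2)] powi_less_iff uniformizer_vnorm[OF p] by metis
qed

lemma val_one [simp]: "val (1::'a::nonarch_local_field) = 0" using val_mult[of 1 "1::'a"] by simp

lemma val_eq_0_iff: "x ~= 0 ==> val x = 0 \<longleftrightarrow> vnorm (x::'a::nonarch_local_field) = 1"
 using vnorm_le_iff_val[of x 1] vnorm_le_iff_val[of 1 x] by auto

lemma val_minus [simp]: "val (- x) = val (x::'a::nonarch_local_field)" by (simp add: val_def)

lemma val_inverse: "x ~= 0 ==> val (inverse x) = - val (x::'a::nonarch_local_field)"
 using val_mult[of x "inverse x"] by simp

lemma val_divide: "x ~= 0 ==> y ~= 0 ==> val (x / y) = val x - val (y::'a::nonarch_local_field)"
 by (simp add: divide_inverse val_mult val_inverse)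

lemma val_power: "x ~= 0 ==> val (x ^ n) = int n * val (x::'a::nonarch_local_field)"
 by (induction n) (simp_all add: val_mult algebra_simps)

lemma val_power_int: "x ~= 0 ==> val (x powi n) = n * val (x::'a::nonarch_local_field)"
 by (auto simp: power_int_def val_power val_inverse)

lemma val_uniformizer: "uniformizer (p::'a::nonarch_local_field) ==> val p = 1" by (rule val_eqI) auto

lemma uniformizer_nonzero: "uniformizer (p::'a::nonarch_local_field) ==> p ~= 0" by (simp add: uniformizer_def)

lemma uniformizer_iff_val: "uniformizer (p::'a::nonarch_local_field) \<longleftrightarrow> p ~= 0 & val p = 1"
proof
 assume "p ~= 0 & val p = 1"
 hence p: "p ~= 0" "val p = 1" by auto
 obtain p' :: 'a where p': "uniformizer p'" using ex_uniformizer by blast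
 hence eq: "vnorm p = vnorm p'" using vnorm_val[OF p' p(1)] p by simp
 have "(*) p ` int_ring = {x::'a. vnorm x \<le> vnorm p}" proof (intro equalityI subsetI)
  fix x :: 'a assume "x \<in> {x. vnorm x \<le> vnorm p}"
  hence "x = p * (x / p)" "x / p \<in> int_ring" using p by (auto simp: int_ring_def vnorm_divide)
  thus "x \<in> (*) p ` int_ring" by blast
 qed (use p in \<open>auto simp: int_ring_def vnorm_mult mult_left_le\<close>)
 thus "uniformizer p" using p uniformizer_vnorm(3)[OF p'] eq by (auto simp: uniformizer_def)
qed (auto simp: val_uniformizer uniformizer_nonzero)

text \<open>The fractional ideal of exponent n. Topology, periodicity and supports are all expressed
  through it, so that estimates need neither a real radius nor a chosen uniformizer.\<close>

definition pw :: "int => 'a::nonarch_local_field set" where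
 "pw n = {x. x = 0 \<or> n \<le> val x}"

lemma pw_vnorm: "uniformizer (p::'a::nonarch_local_field) ==> (pw n :: 'a set) = {x. vnorm x \<le> vnorm p powi n}"
proof -
 assume p: "uniformizer p"
 have "n \<le> val x \<longleftrightarrow> vnorm x \<le> vnorm p powi n" if "x ~= 0" for x :: 'a
  using vnorm_val[OF p that] powi_less_iff uniformizer_vnorm[OF p] by metis
 moreover have "vnorm p powi n \<ge> 0" using uniformizer_vnorm(1)[OF p] by simp
 ultimately have "x = 0 \<or> n \<le> val x \<longleftrightarrow> vnorm x \<le> vnorm p powi n" for x :: 'a by (cases "x = 0") auto
 thus ?thesis by (simp add: pw_def)
qed

lemma zero_in_pw [simp]: "0 \<in> pw n" by (simp add: pw_def)

lemma pw_minus [simp]: "- x \<in> pw n \<longleftrightarrow> x \<in> pw n" by (simp add: pw_def)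

lemma pw_add: "x \<in> pw n ==> y \<in> pw n ==> x + y \<in> pw n"
proof -
 assume xy: "x \<in> pw n" "y \<in> pw n"
 obtain p :: 'a where p: "uniformizer p" using ex_uniformizer by blast
 show ?thesis using xy vnorm_ultrametric[of x y] by (auto simp: pw_vnorm[OF p])
qed

lemma pw_diff: "x \<in> pw n ==> y \<in> pw n ==> x - y \<in> pw n" using pw_add[of x n "- y"] by simp

lemma pw_mult: "x \<in> pw m ==> y \<in> pw n ==> x * y \<in> pw (m + n)"
 by (cases "x = 0"; cases "y = 0") (auto simp: pw_def val_mult)

lemma pw_mono: "m \<le> n ==> x \<in> pw n ==> x \<in> pw m" by (auto simp: pw_def)

lemma pw_add_cancel: "y \<in> pw n ==> x + y \<in> pw n \<longleftrightarrow> x \<in> pw n" using pw_diff[of "x + y" n y] pw_add[of x n y] by auto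

lemma pw_diff_commute: "x - y \<in> pw n \<longleftrightarrow> y - x \<in> pw n" using pw_minus[of "x - y" n] by simp

lemma pw_diff_trans: "x - y \<in> pw n ==> y - z \<in> pw n ==> x - z \<in> pw n" using pw_add[of "x - y" n "y - z"] by simp

lemma pw_mult_iff: "a ~= 0 ==> a * x \<in> pw n \<longleftrightarrow> x \<in> pw (n - val a)" by (cases "x = 0") (auto simp: pw_def val_mult)

lemma int_ring_pw: "(int_ring :: 'a::nonarch_local_field set) = pw 0"
proof -
 have "vnorm x \<le> 1 \<longleftrightarrow> x = 0 \<or> 0 \<le> val x" for x :: 'a using vnorm_le_iff_val[of x 1] by (cases "x = 0") auto
 thus ?thesis by (auto simp: int_ring_def pw_def)
qed

lemma int_units_val: "int_units = {x::'a::nonarch_local_field. x ~= 0 & val x = 0}"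
proof -
 have "vnorm x = 1 \<longleftrightarrow> x ~= 0 & val x = 0" for x :: 'a using val_eq_0_iff[of x] by (cases "x = 0") auto
 thus ?thesis by (auto simp: int_units_def)
qed

lemma vnorm_less_one_pw: "vnorm (x::'a::nonarch_local_field) < 1 \<longleftrightarrow> x \<in> pw 1"
proof -
 obtain p :: 'a where p: "uniformizer p" using ex_uniformizer by blast
 show ?thesis using uniformizer_vnorm(3)[OF p] by (simp add: pw_vnorm[OF p])
qed

lemma val_congruent:
 assumes "x ~= 0" "x - y \<in> pw (val x + 1)" shows "y ~= 0" "val y = val (x::'a::nonarch_local_field)"
proof -
 have x: "x \<in> pw (val x)" "x \<notin> pw (val x + 1)" using assms by (auto simp: pw_def)
 have yx: "y - x \<in> pw (val x + 1)" using assms(2) by (simp add: pw_diff_commute)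
 have "y \<in> pw (val x)" using pw_add[OF x(1) pw_mono[OF _ yx]] by simp
 moreover have "y \<notin> pw (val x + 1)" using pw_add[OF assms(2), of y] x by auto
 ultimately show "y ~= 0" "val y = val x" by (auto simp: pw_def)
qed

lemma val_add_eq:
 assumes "x ~= 0" "y \<in> pw (val x + 1)" shows "x + y ~= 0" "val (x + y) = val (x::'a::nonarch_local_field)"
 using val_congruent[OF assms(1), of "x + y"] assms(2) by auto

lemma pw_nat_ex: "x ~= 0 ==> \<exists>n. x \<notin> pw n" by (intro exI[of _ "val x + 1"]) (simp add: pw_def)

lemma in_some_pw: "\<exists>n. x \<in> pw n" by (auto simp: pw_def)

text \<open>Representatives of \<open>pw n\<close> modulo \<open>pw k\<close>, meant for n \<le> k.
  Finite sums over them replace integrals of test functions.\<close>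

definition residue_reps :: "int => int => 'a::nonarch_local_field set => bool" where
 "residue_reps n k R \<longleftrightarrow> finite R & card R = residue_card TYPE('a) ^ nat (k - n) & R \<subseteq> pw n &
   (\<forall>x\<in>pw n. \<exists>!c. c \<in> R & x - c \<in> pw k)"

lemma compact_int_ring: "compact (int_ring :: 'a::nonarch_local_field set)"
 by (simp add: int_ring_def compact_unit_ball)

lemma ex_residue_reps_one: "\<exists>D::'a::nonarch_local_field set. residue_reps 0 1 D"
 and residue_card_ge_2: "residue_card TYPE('a::nonarch_local_field) \<ge> 2"
proof -
 define R :: "('a \<times> 'a) set" where
  "R = {(x, y). x \<in> int_ring & y \<in> int_ring & vnorm (x - y) < 1}"
 have q: "residue_card TYPE('a) = card ((int_ring::'a set) // R)" by (simp add: residue_card_def R_def)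
 have R: "equiv int_ring R" by (rule equivI)
   (auto simp: R_def refl_on_def sym_on_def trans_on_def vnorm_less_one_pw intro: pw_diff_trans
    simp: pw_diff_commute[of _ _ 1])
 have "\<exists>C\<subseteq>int_ring. finite C & (int_ring::'a set) \<subseteq> (\<Union>c\<in>C. {y. dist c y < 1})"
 proof (rule compactE_image[OF compact_int_ring, of int_ring "%c::'a. {y. dist c y < 1}"])
  show "open {y. dist c y < 1}" for c :: 'a using open_ball[of c 1] by (simp add: ball_def)
  show "(int_ring::'a set) \<subseteq> (\<Union>c\<in>int_ring. {y. dist c y < 1})" by force
 qed blast
 then obtain C :: "'a set" where C: "C \<subseteq> int_ring" "finite C" "int_ring \<subseteq> (\<Union>c\<in>C. {y. dist c y < 1})" by blast
 have "int_ring // R \<subseteq> (%c. R `` {c}) ` C" proof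
  fix X assume "X \<in> int_ring // R"
  then obtain y where y: "y \<in> int_ring" "X = R `` {y}" by (auto elim: quotientE)
  then obtain c where c: "c \<in> C" "dist c y < 1" using C by blast
  hence "(c, y) \<in> R" using y C by (auto simp: R_def dist_vnorm)
  thus "X \<in> (%c. R `` {c}) ` C" using equiv_class_eq[OF R] y c by blast
 qed
 hence fin: "finite (int_ring // R)" using C finite_subset by blast
 define r where "r X = (SOME x. x \<in> X)" for X :: "'a set"
 have r: "r X \<in> X" if "X \<in> int_ring // R" for X
  unfolding r_def using in_quotient_imp_non_empty[OF R that] by (simp add: some_in_eq)
 have sub: "r X \<in> int_ring" if "X \<in> int_ring // R" for X using r[OF that] in_quotient_imp_subset[OF R that] by blast
 have inj: "inj_on r (int_ring // R)" proof (rule inj_onI)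
  fix X Y assume *: "X \<in> int_ring // R" "Y \<in> int_ring // R" "r X = r Y"
  hence "r X \<in> X \<inter> Y" using r by (metis IntI)
  thus "X = Y" using quotient_disj[OF R *(1,2)] by auto
 qed
 have "\<exists>!c. c \<in> r ` (int_ring // R) & x - c \<in> pw 1" if x: "x \<in> pw 0" for x proof (rule ex_ex1I)
  have X: "R `` {x} \<in> int_ring // R" using x by (intro quotientI) (simp add: int_ring_pw)
  have "(x, r (R `` {x})) \<in> R" using r[OF X] by auto
  thus "\<exists>c. c \<in> r ` (int_ring // R) & x - c \<in> pw 1" using X by (auto simp: R_def vnorm_less_one_pw)
  fix c d assume c: "c \<in> r ` (int_ring // R) & x - c \<in> pw 1" and d: "d \<in> r ` (int_ring // R) & x - d \<in> pw 1"
  have cd: "(c, d) \<in> R"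
   using c d sub pw_diff_trans[of c x 1 d] by (auto simp: R_def vnorm_less_one_pw pw_diff_commute[of c])
  obtain X Y where XY: "X \<in> int_ring // R" "Y \<in> int_ring // R" "c = r X" "d = r Y" using c d by blast
  have "X = Y" using quotient_eqI[OF R XY(1,2) r[OF XY(1)] r[OF XY(2)]] cd XY by simp
  thus "c = d" using XY by simp
 qed
 hence "residue_reps 0 1 (r ` (int_ring // R))"
  using fin sub card_image[OF inj] by (auto simp: residue_reps_def q int_ring_pw)
 thus "\<exists>D::'a set. residue_reps 0 1 D" by blast
 have "R `` {0} ~= R `` {1}" proof
  assume "R `` {0} = R `` {1}"
  hence "(0, 1) \<in> R" using eq_equiv_class_iff[OF R, of 0 1] by (simp add: int_ring_def)
  thus False by (simp add: R_def)
 qed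
 hence "card {R `` {0}, R `` {1}} = 2" by simp
 moreover have "{R `` {0}, R `` {1}} \<subseteq> int_ring // R" by (auto intro!: quotientI simp: int_ring_def)
 ultimately show "residue_card TYPE('a) \<ge> 2" unfolding q using card_mono[OF fin] by metis
qed

text \<open>Digit expansion: one more power of the uniformizer is reached by the elements
  \<open>c + ?P * d\<close> with \<open>c\<close> an old representative and \<open>d\<close> a digit
  from \<open>D\<close>.\<close>

lemma ex_residue_reps:
 assumes "n \<le> k" shows "\<exists>R::'a::nonarch_local_field set. residue_reps n k R"
proof -
 obtain p :: 'a where p: "uniformizer p" using ex_uniformizer by blast
 have p0: "p ~= 0" "val p = 1" using p by (auto simp: uniformizer_iff_val)
 obtain D :: "'a set" where D: "residue_reps 0 1 D" using ex_residue_reps_one by blast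
 have "\<exists>R::'a set. residue_reps n (n + int m) R" for m proof (induction m)
  case 0
  have "residue_reps n (n + int 0) {0::'a}" by (auto simp: residue_reps_def)
  thus ?case by blast
 next
  case (Suc m)
  then obtain R :: "'a set" where R: "residue_reps n (n + int m) R" by blast
  let ?P = "p powi (n + int m)"
  have P: "?P ~= 0" "val ?P = n + int m" using p0 by (auto simp: val_power_int)
  define f where "f = (%(c, d). c + ?P * d)"
  have sub: "f (c, d) \<in> pw n" "f (c, d) - c \<in> pw (n + int m)" if "c \<in> R" "d \<in> D" for c d proof -
   have "d \<in> pw 0" "c \<in> pw n" using that R D by (auto simp: residue_reps_def)
   hence 1: "?P * d \<in> pw (n + int m)" by (simp add: pw_mult_iff P p0 val_power_int)
   thus "f (c, d) \<in> pw n" using \<open>c \<in> pw n\<close> pw_mono[OF _ 1, of n] by (auto simp: f_def intro: pw_add)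
   show "f (c, d) - c \<in> pw (n + int m)" using 1 by (simp add: f_def)
  qed
  have ex: "\<exists>e. e \<in> f ` (R \<times> D) & x - e \<in> pw (n + int (Suc m))" if x: "x \<in> pw n" for x proof -
   obtain c where c: "c \<in> R" "x - c \<in> pw (n + int m)" using R x by (auto simp: residue_reps_def)
   hence "(x - c) / ?P \<in> pw 0" using pw_mult_iff[of ?P "(x - c) / ?P" "n + int m"] P by simp
   then obtain d where d: "d \<in> D" "(x - c) / ?P - d \<in> pw 1" using D by (auto simp: residue_reps_def)
   have "x - f (c, d) = ?P * ((x - c) / ?P - d)" using P by (simp add: f_def field_simps)
   hence "x - f (c, d) \<in> pw (n + int (Suc m))" using d pw_mult_iff[of ?P "(x - c) / ?P - d" "n + int (Suc m)"] P by simp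
   thus ?thesis using c d by blast
  qed
  have uniq: "c = c' & d = d'"
   if cd: "c \<in> R" "d \<in> D" "c' \<in> R" "d' \<in> D" and f: "f (c, d) - f (c', d') \<in> pw (n + int (Suc m))" for c d c' d' proof -
   have "f (c, d) - c' \<in> pw (n + int m)" using pw_diff_trans[OF pw_mono[OF _ f, of "n + int m"] sub(2)] cd by simp
   hence 1: "c = c'" using R sub cd unfolding residue_reps_def by blast
   hence "?P * (d - d') \<in> pw (n + int (Suc m))" using f by (simp add: f_def algebra_simps)
   hence dd: "d - d' \<in> pw 1" using P by (simp add: pw_mult_iff)
   have d0: "d \<in> pw 0" "d' \<in> pw 0" "d - d \<in> pw 1" using D cd by (auto simp: residue_reps_def)
   hence "d = d'" using D dd cd unfolding residue_reps_def by blast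
   with 1 show ?thesis by simp
  qed
  have inj: "inj_on f (R \<times> D)" proof (rule inj_onI)
   fix u v assume uv: "u \<in> R \<times> D" "v \<in> R \<times> D" "f u = f v"
   hence "f (fst u, snd u) - f (fst v, snd v) \<in> pw (n + int (Suc m))" by simp
   hence "fst u = fst v & snd u = snd v" using uniq uv by (metis mem_Times_iff)
   thus "u = v" by (simp add: prod_eq_iff)
  qed
  have "card (f ` (R \<times> D)) = residue_card TYPE('a) ^ Suc m"
   using card_image[OF inj] R D by (simp add: residue_reps_def card_cartesian_product)
  moreover have "finite (f ` (R \<times> D))" "f ` (R \<times> D) \<subseteq> pw n" using R D sub by (auto simp: residue_reps_def)
  moreover have "\<exists>!e. e \<in> f ` (R \<times> D) & x - e \<in> pw (n + int (Suc m))" if x: "x \<in> pw n" for x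
  proof (rule ex_ex1I[OF ex[OF x]])
   fix e e' assume e: "e \<in> f ` (R \<times> D) & x - e \<in> pw (n + int (Suc m))"
    and e': "e' \<in> f ` (R \<times> D) & x - e' \<in> pw (n + int (Suc m))"
   hence "e - e' \<in> pw (n + int (Suc m))" using pw_diff_trans[of e x _ e'] by (simp add: pw_diff_commute)
   thus "e = e'" using e e' uniq by (auto simp: image_iff)
  qed
  ultimately have "residue_reps n (n + int (Suc m)) (f ` (R \<times> D))" by (simp add: residue_reps_def nat_add_distrib)
  thus ?case by blast
 qed
 from this[of "nat (k - n)"] show ?thesis using assms by simp
qed

section \<open>Topology and test functions\<close>

lemma open_pw_iff: "open U \<longleftrightarrow> (\<forall>x\<in>U. \<exists>n. \<forall>y. y - x \<in> pw n --> y \<in> (U::'a::nonarch_local_field set))"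
proof -
 obtain p :: 'a where p: "uniformizer p" using ex_uniformizer by blast
 let ?r = "vnorm p"
 have r: "0 < ?r" "?r < 1" using uniformizer_vnorm[OF p] by auto
 show ?thesis proof (intro iffI ballI)
  fix x assume U: "open U" and x: "x \<in> U"
  then obtain e where e: "e > 0" "!!y. dist y x < e ==> y \<in> U" unfolding open_dist by blast
  obtain n where "?r ^ n < e" using real_arch_pow_inv[OF e(1) r(2)] by blast
  hence "\<forall>y. y - x \<in> pw (int n) --> y \<in> U" using e(2) by (auto simp: pw_vnorm[OF p] dist_vnorm)
  thus "\<exists>n. \<forall>y. y - x \<in> pw n --> y \<in> U" by blast
 next
  assume H: "\<forall>x\<in>U. \<exists>n. \<forall>y. y - x \<in> pw n --> y \<in> U"
  show "open U" unfolding open_dist proof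
   fix x assume "x \<in> U"
   then obtain n where "\<forall>y. y - x \<in> pw n --> y \<in> U" using H by blast
   thus "\<exists>e>0. \<forall>y. dist y x < e --> y \<in> U"
    using r by (intro exI[of _ "?r powi n"]) (auto simp: pw_vnorm[OF p] dist_vnorm)
  qed
 qed
qed

lemma open_coset [simp]: "open {x. x - c \<in> pw n}" unfolding open_pw_iff by (auto intro: pw_diff_trans)

lemma open_pw [simp]: "open (pw n)" using open_coset[of 0 n] by simp

lemma closed_coset [simp]: "closed {x. x - c \<in> pw n}" unfolding closed_def open_pw_iff
 by (intro ballI exI[of _ n]) (auto simp: pw_diff_commute dest: pw_diff_trans)

lemma closed_pw [simp]: "closed (pw n)" using closed_coset[of 0 n] by simp

lemma continuous_mult_left: "continuous_on S ((*) (a::'a::nonarch_local_field))"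
proof -
 have "continuous_on UNIV ((*) a)" unfolding continuous_on_open_vimage[OF open_UNIV] Int_UNIV_right proof safe
  fix B :: "'a set" assume "open B"
  show "open ((*) a -` B)" proof (cases "a = 0")
   case False
   show ?thesis unfolding open_pw_iff proof
    fix x assume "x \<in> (*) a -` B"
    then obtain n where n: "!!y. y - a * x \<in> pw n ==> y \<in> B" using \<open>open B\<close> unfolding open_pw_iff by auto
    have "a * y \<in> B" if "y - x \<in> pw (n - val a)" for y
     using that by (intro n) (simp flip: right_diff_distrib add: pw_mult_iff False)
    thus "\<exists>n. \<forall>y. y - x \<in> pw n --> y \<in> (*) a -` B" by (intro exI[of _ "n - val a"]) auto
   qed
  qed (auto simp: vimage_def)
 qed
 thus ?thesis using continuous_on_subset by blast
qed

lemma compact_pw: "compact (pw n :: 'a::nonarch_local_field set)"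
proof -
 obtain p :: 'a where p: "uniformizer p" using ex_uniformizer by blast
 let ?P = "p powi n"
 have P: "?P ~= 0" "val ?P = n" using p by (auto simp: uniformizer_iff_val val_power_int)
 have "(*) ?P ` int_ring = (pw n :: 'a set)" proof (intro equalityI subsetI)
  fix x :: 'a assume "x \<in> pw n"
  hence "x = ?P * (x / ?P)" "x / ?P \<in> int_ring" using P pw_mult_iff[of ?P "x / ?P" n] by (auto simp: int_ring_pw)
  thus "x \<in> (*) ?P ` int_ring" by blast
 qed (use P in \<open>auto simp: int_ring_pw pw_mult_iff\<close>)
 thus ?thesis using compact_continuous_image[OF continuous_mult_left compact_int_ring, of ?P] by simp
qed

lemma locally_constant_pw:
 "locally_constant f \<longleftrightarrow> (\<forall>x. \<exists>n. \<forall>y. y - x \<in> pw n --> f y = f (x::'a::nonarch_local_field))"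
proof safe
 fix x assume "locally_constant f"
 then obtain U where U: "open U" "x \<in> U" "f constant_on U" unfolding locally_constant_def by blast
 then obtain n where "\<forall>y. y - x \<in> pw n --> y \<in> U" unfolding open_pw_iff by blast
 thus "\<exists>n. \<forall>y. y - x \<in> pw n --> f y = f x" using U unfolding constant_on_def by metis
next
 assume H: "\<forall>x. \<exists>n. \<forall>y. y - x \<in> pw n --> f y = f x"
 show "locally_constant f" unfolding locally_constant_def proof
  fix x
  obtain n where n: "\<forall>y. y - x \<in> pw n --> f y = f x" using H by blast
  have "f constant_on {y. y - x \<in> pw n}" unfolding constant_on_def using n by blast
  thus "\<exists>U. open U & x \<in> U & f constant_on U" using open_coset[of x n] by (intro exI[of _ "{y. y - x \<in> pw n}"]) simp
 qed
qed

definition periodic :: "int => ('a::nonarch_local_field => 'b) => bool" where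
 "periodic n f \<longleftrightarrow> (\<forall>x y. y - x \<in> pw n --> f y = f x)"

definition supported :: "int => ('a::nonarch_local_field => complex) => bool" where
 "supported m f \<longleftrightarrow> (\<forall>x. x \<notin> pw m --> f x = 0)"

lemma periodicD: "periodic n f ==> y - x \<in> pw n ==> f y = f x" by (simp add: periodic_def)

lemma periodic_mono: "periodic n f ==> n \<le> m ==> periodic m f" unfolding periodic_def using pw_mono by blast

lemma supported_mono: "supported n f ==> m \<le> n ==> supported m f" unfolding supported_def using pw_mono by blast

abbreviation TF :: "('a::nonarch_local_field => complex) set" where "TF \<equiv> test_fun UNIV"
abbreviation TF0 :: "('a::nonarch_local_field => complex) set" where "TF0 \<equiv> test_fun (- {0})"

text \<open>Finitely many balls of constancy cover the compact support, so one radius serves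
  everywhere. Test functions thereby become finite combinations of ball indicators
  (\<open>test_fun_decompose\<close>), the form in which functionals are evaluated.\<close>

lemma test_fun_UNIV_iff:
 "\<phi> \<in> TF \<longleftrightarrow> (\<exists>n m. periodic n \<phi> & supported m (\<phi>::'a::nonarch_local_field => complex))"
proof
 assume \<phi>: "\<phi> \<in> TF"
 define K where "K = closure {x. \<phi> x ~= 0}"
 have K: "compact K" "!!x. x \<notin> K ==> \<phi> x = 0"
  using \<phi> closure_subset[of "{x. \<phi> x ~= 0}"] by (auto simp: test_fun_def K_def)
 obtain n where n: "!!x y. y - x \<in> pw (n x) ==> \<phi> y = \<phi> x"
  using \<phi> unfolding test_fun_def locally_constant_pw by simp metis
 obtain C where C: "C \<subseteq> K" "finite C" "K \<subseteq> (\<Union>c\<in>C. {x. x - c \<in> pw (n c)})"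
  by (rule compactE_image[OF K(1), of K "%c. {x. x - c \<in> pw (n c)}"]) force+
 define N where "N = Max (insert 0 (n ` C))"
 have N: "n c \<le> N" if "c \<in> C" for c using that C(2) by (simp add: N_def)
 have *: "\<phi> y = \<phi> x" if "x \<in> K" "y - x \<in> pw N" for x y proof -
  obtain c where c: "c \<in> C" "x - c \<in> pw (n c)" using C \<open>x \<in> K\<close> by blast
  have "y - c \<in> pw (n c)" using pw_diff_trans[OF pw_mono[OF N[OF c(1)] that(2)] c(2)] .
  thus ?thesis using n c by metis
 qed
 have "periodic N \<phi>" unfolding periodic_def proof (intro allI impI)
  fix x y :: 'a assume xy: "y - x \<in> pw N"
  hence yx: "x - y \<in> pw N" by (simp add: pw_diff_commute)
  show "\<phi> y = \<phi> x" using *[OF _ xy] *[OF _ yx] K(2) by metis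
 qed
 moreover have "\<exists>m. supported m \<phi>" proof -
  obtain M where M: "!!x. x \<in> C ==> x \<in> pw (M x)" using in_some_pw by metis
  define m where "m = Min (insert 0 (M ` C \<union> n ` C))"
  have m: "m \<le> M c" "m \<le> n c" if "c \<in> C" for c using that C(2) by (auto simp: m_def)
  have "x \<in> pw m" if "x \<in> K" for x proof -
   obtain c where c: "c \<in> C" "x - c \<in> pw (n c)" using C \<open>x \<in> K\<close> by blast
   thus ?thesis using pw_add[OF pw_mono[OF m(2)] pw_mono[OF m(1)]] c M by (metis diff_add_cancel)
  qed
  thus ?thesis using K(2) unfolding supported_def by blast
 qed
 ultimately show "\<exists>n m. periodic n \<phi> & supported m \<phi>" by blast
next
 assume "\<exists>n m. periodic n \<phi> & supported m \<phi>"
 then obtain n m where nm: "periodic n \<phi>" "supported m \<phi>" by blast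
 have "locally_constant \<phi>" unfolding locally_constant_pw using nm periodicD by blast
 moreover have "closure {x. \<phi> x ~= 0} \<subseteq> pw m"
  by (rule closure_minimal) (use nm in \<open>auto simp: supported_def\<close>)
 hence "pw m \<inter> closure {x. \<phi> x ~= 0} = closure {x. \<phi> x ~= 0}" by blast
 hence "compact (closure {x. \<phi> x ~= 0})"
  using compact_Int_closed[OF compact_pw[of m], of "closure {x. \<phi> x ~= 0}"] by simp
 ultimately show "\<phi> \<in> TF" unfolding test_fun_def by simp
qed

lemma test_funI:
 assumes "locally_constant \<phi>" "supported m (\<phi>::'a::nonarch_local_field => complex)" shows "\<phi> \<in> TF"
proof -
 have "closure {x. \<phi> x ~= 0} \<subseteq> pw m" by (rule closure_minimal) (use assms in \<open>auto simp: supported_def\<close>)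
 hence "pw m \<inter> closure {x. \<phi> x ~= 0} = closure {x. \<phi> x ~= 0}" by blast
 hence "compact (closure {x. \<phi> x ~= 0})"
  using compact_Int_closed[OF compact_pw[of m], of "closure {x. \<phi> x ~= 0}"] by simp
 thus ?thesis using assms unfolding test_fun_def by simp
qed

lemma test_funE:
 assumes "\<phi> \<in> TF" obtains n m where "periodic n \<phi>" "supported m (\<phi>::'a::nonarch_local_field => complex)"
 using assms unfolding test_fun_UNIV_iff by blast

text \<open>For a test function the set of points with nonzero value is already closed, so the
  closure in \<open>test_fun\<close> reduces to pointwise vanishing off \<open>U\<close>.\<close>

lemma test_fun_iff:
 "\<phi> \<in> test_fun U \<longleftrightarrow> \<phi> \<in> TF & (\<forall>x. x \<notin> U --> \<phi> (x::'a::nonarch_local_field) = 0)"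
proof -
 have "closure {x. \<phi> x ~= 0} = {x. \<phi> x ~= 0}" if tf: "\<phi> \<in> TF" proof -
  obtain n m where nm: "periodic n \<phi>" "supported m \<phi>" using tf by (rule test_funE)
  have "open (- {x. \<phi> x ~= 0})" unfolding open_pw_iff using periodicD[OF nm(1)] by (intro ballI exI[of _ n]) auto
  thus ?thesis by (simp add: closed_def)
 qed
 thus ?thesis by (auto simp: test_fun_def)
qed

lemma test_fun_subset: "\<phi> \<in> test_fun U ==> U \<subseteq> V ==> \<phi> \<in> test_fun (V::'a::nonarch_local_field set)"
 by (subst test_fun_iff, drule test_fun_iff[THEN iffD1]) auto

lemma locally_constantE:
 assumes "locally_constant f" obtains n where "!!y. y - x \<in> pw n ==> f y = f (x::'a::nonarch_local_field)"
 using assms unfolding locally_constant_pw by blast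

lemma test_fun_locally_constant: "\<phi> \<in> test_fun U ==> locally_constant (\<phi>::'a::nonarch_local_field => complex)"
 by (simp add: test_fun_def)

lemma test_fun_cong_supp:
 assumes "\<phi> \<in> test_fun (U::'a::nonarch_local_field set)"
  and "!!x. \<exists>n. \<forall>y. y - x \<in> pw n --> \<psi> y = \<psi> x" "!!x. \<phi> x = 0 ==> \<psi> x = 0" shows "\<psi> \<in> test_fun U"
proof -
 obtain n m where nm: "periodic n \<phi>" "supported m \<phi>" using assms(1) test_fun_iff[of \<phi> U] test_funE by blast
 have "\<psi> \<in> TF" proof (rule test_funI[of _ m])
  show "locally_constant \<psi>" unfolding locally_constant_pw using assms(2) by blast
  show "supported m \<psi>" using assms(3) nm(2) unfolding supported_def by blast
 qed
 thus ?thesis using assms(1,3) test_fun_iff[of \<psi> U] test_fun_iff[of \<phi> U] by simp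
qed

lemma test_fun_mult:
 assumes "\<phi> \<in> test_fun (U::'a::nonarch_local_field set)"
  and g: "!!x. \<phi> x ~= 0 ==> \<exists>n. \<forall>y. y - x \<in> pw n --> g y = g x" shows "(%x. g x * \<phi> x) \<in> test_fun U"
proof (rule test_fun_cong_supp[OF assms(1)])
 fix x
 obtain n where n: "!!y. y - x \<in> pw n ==> \<phi> y = \<phi> x"
  using locally_constantE[OF test_fun_locally_constant[OF assms(1)], of x] by blast
 show "\<exists>n. \<forall>y. y - x \<in> pw n --> g y * \<phi> y = g x * \<phi> x" proof (cases "\<phi> x = 0")
  case True
  hence "\<forall>y. y - x \<in> pw n --> g y * \<phi> y = g x * \<phi> x" using n by (metis mult_zero_right)
  thus ?thesis by blast
 next
  case False
  then obtain m where m: "!!y. y - x \<in> pw m ==> g y = g x" using g by blast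
  have "g y * \<phi> y = g x * \<phi> x" if "y - x \<in> pw (max n m)" for y using n[of y] m[of y] pw_mono[OF _ that] by simp
  thus ?thesis by blast
 qed
qed auto

lemma test_fun_cmult: "\<phi> \<in> test_fun U ==> (%x. c * \<phi> x) \<in> test_fun (U::'a::nonarch_local_field set)"
 by (rule test_fun_mult) auto

lemma test_fun_add:
 assumes "\<phi> \<in> test_fun (U::'a::nonarch_local_field set)" "\<psi> \<in> test_fun U"
 shows "(%x. \<phi> x + \<psi> x) \<in> test_fun U"
proof -
 obtain n m where nm: "periodic n \<phi>" "supported m \<phi>" using assms(1) test_fun_iff[of \<phi> U] test_funE by blast
 obtain n' m' where nm': "periodic n' \<psi>" "supported m' \<psi>" using assms(2) test_fun_iff[of \<psi> U] test_funE by blast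
 have "periodic (max n n') (%x. \<phi> x + \<psi> x)"
  using periodic_mono[OF nm(1), of "max n n'"] periodic_mono[OF nm'(1), of "max n n'"] unfolding periodic_def by simp
 moreover have "supported (min m m') (%x. \<phi> x + \<psi> x)"
  using supported_mono[OF nm(2), of "min m m'"] supported_mono[OF nm'(2), of "min m m'"] unfolding supported_def by simp
 ultimately show ?thesis
  using assms test_fun_iff[of "%x. \<phi> x + \<psi> x" U] test_fun_iff[of \<phi> U] test_fun_iff[of \<psi> U]
   test_fun_UNIV_iff[of "%x. \<phi> x + \<psi> x"] by auto
qed

lemma test_fun_zero: "(%x. 0) \<in> test_fun (U::'a::nonarch_local_field set)"
 by (subst test_fun_iff, subst test_fun_UNIV_iff) (auto simp: periodic_def supported_def)

lemma test_fun_diff: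
 assumes "\<phi> \<in> test_fun (U::'a::nonarch_local_field set)" "\<psi> \<in> test_fun U"
 shows "(%x. \<phi> x - \<psi> x) \<in> test_fun U" using test_fun_add[OF assms(1) test_fun_cmult[OF assms(2), of "-1"]] by simp

lemma test_fun_sum:
 assumes "!!i. i \<in> I ==> \<phi> i \<in> test_fun (U::'a::nonarch_local_field set)"
 shows "(%x. \<Sum>i\<in>I. \<phi> i x) \<in> test_fun U" using assms
 by (induction I rule: infinite_finite_induct) (auto simp: test_fun_zero test_fun_add)

definition ball_ind :: "'a::nonarch_local_field => int => 'a => complex" where
 "ball_ind c n x = (if x - c \<in> pw n then 1 else 0)"

lemma periodic_ball_ind: "periodic n (ball_ind c n)" unfolding periodic_def ball_ind_def
proof (intro allI impI)
 fix x y :: 'a assume xy: "y - x \<in> pw n"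
 have "y - c \<in> pw n \<longleftrightarrow> x - c \<in> pw n" using pw_add_cancel[OF xy, of "x - c"] by (simp add: algebra_simps)
 thus "(if y - c \<in> pw n then 1 else 0) = (if x - c \<in> pw n then 1 else (0::complex))" by simp
qed

lemma test_fun_ball_ind_UNIV: "ball_ind c n \<in> test_fun (UNIV::'a::nonarch_local_field set)"
proof -
 obtain m where m: "c \<in> pw m" using in_some_pw by blast
 have "supported (min m n) (ball_ind c n)" unfolding supported_def ball_ind_def
  using pw_add[of "_ - c" "min m n" c] pw_mono[OF _ m, of "min m n"] pw_mono[of "min m n" n] by auto
 thus ?thesis using periodic_ball_ind test_fun_UNIV_iff by blast
qed

lemma test_fun_decompose:
 assumes "periodic n \<phi>" "supported m \<phi>" "residue_reps m n R"
 shows "\<phi> = (%x. \<Sum>c\<in>R. \<phi> c * ball_ind c n x)"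
proof
 fix x
 show "\<phi> x = (\<Sum>c\<in>R. \<phi> c * ball_ind c n x)" proof (cases "x \<in> pw m")
  case True
  then obtain c where c: "c \<in> R" "x - c \<in> pw n" "!!d. d \<in> R ==> x - d \<in> pw n ==> d = c"
   using assms(3) unfolding residue_reps_def by blast
  have "(\<Sum>d\<in>R. \<phi> d * ball_ind d n x) = (\<Sum>d\<in>R. if d = c then \<phi> c else 0)" proof (intro sum.cong refl)
   fix d assume "d \<in> R"
   hence "d ~= c ==> x - d \<notin> pw n" using c(3) by blast
   thus "\<phi> d * ball_ind d n x = (if d = c then \<phi> c else 0)" using c(2) by (cases "d = c") (simp_all add: ball_ind_def)
  qed
  also have "\<dots> = \<phi> c" using c(1) assms(3) by (simp add: residue_reps_def)
  also have "\<dots> = \<phi> x" by (rule periodicD[OF assms(1) c(2), symmetric])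
  finally show ?thesis by (rule sym)
 next
  case False
  have "\<phi> c * ball_ind c n x = 0" if "c \<in> R" for c proof (cases "x - c \<in> pw n")
   case True
   thus ?thesis using periodicD[OF assms(1) True] False assms(2) by (simp add: supported_def)
  qed (simp add: ball_ind_def)
  hence "(\<Sum>c\<in>R. \<phi> c * ball_ind c n x) = 0" by (intro sum.neutral) blast
  thus ?thesis using False assms(2) by (simp add: supported_def)
 qed
qed

definition linear_on_tf :: "'a::nonarch_local_field set => (('a => complex) => complex) => bool" where
 "linear_on_tf U u \<longleftrightarrow> (\<forall>\<phi>\<in>test_fun U. \<forall>\<psi>\<in>test_fun U. u (%x. \<phi> x + \<psi> x) = u \<phi> + u \<psi>) &
   (\<forall>c. \<forall>\<phi>\<in>test_fun U. u (%x. c * \<phi> x) = c * u \<phi>)"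

lemma linear_on_tf_add:
 "linear_on_tf U u ==> \<phi> \<in> test_fun U ==> \<psi> \<in> test_fun U ==> u (%x. \<phi> x + \<psi> x) = u \<phi> + u \<psi>"
 by (simp add: linear_on_tf_def)

lemma linear_on_tf_cmult:
 "linear_on_tf U u ==> \<phi> \<in> test_fun U ==> u (%x. c * \<phi> x) = c * u \<phi>" by (simp add: linear_on_tf_def)

lemma linear_on_tf_zero: "linear_on_tf U u ==> u (%x. 0) = 0"
 using linear_on_tf_cmult[OF _ test_fun_zero, of U u 0] by simp

lemma linear_on_tf_diff:
 assumes "linear_on_tf U u" "\<phi> \<in> test_fun U" "\<psi> \<in> test_fun U" shows "u (%x. \<phi> x - \<psi> x) = u \<phi> - u \<psi>"
 using linear_on_tf_add[OF assms(1,2) test_fun_cmult[OF assms(3), of "-1"]]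
  linear_on_tf_cmult[OF assms(1,3), of "-1"] by simp

lemma linear_on_tf_sum:
 assumes "linear_on_tf U u" "!!i. i \<in> I ==> \<phi> i \<in> test_fun U"
 shows "u (%x. \<Sum>i\<in>I. \<phi> i x) = (\<Sum>i\<in>I. u (\<phi> i))" using assms(2) by (induction I rule: infinite_finite_induct)
  (auto simp: linear_on_tf_zero[OF assms(1)] linear_on_tf_add[OF assms(1)] test_fun_sum)

section \<open>Characters\<close>

text \<open>Complex numbers have no small multiplicative subgroups: squaring multiplies the distance
  to 1 by the distance to -1, which stays at least 3/2 here, so the distances of the powers
  \<open>z ^ (2 ^ j)\<close> to 1 would grow without bound.\<close>

lemma near_one_powers_trivial:
 fixes z :: complex
 assumes "!!k. norm (z ^ k - 1) < 1/2" shows "z = 1"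
proof (rule ccontr)
 assume "z ~= 1"
 define w where "w j = norm (z ^ (2 ^ j) - 1)" for j
 have step: "w (Suc j) \<ge> (3/2) * w j" for j proof -
  have "z ^ (2 ^ Suc j) - 1 = (z ^ (2 ^ j) - 1) * ((z ^ (2 ^ j) - 1) + 2)"
   by (simp add: power_mult algebra_simps power2_eq_square mult_2 power_add)
  hence "w (Suc j) = w j * norm ((z ^ (2 ^ j) - 1) + 2)" unfolding w_def by (metis norm_mult)
  moreover have "norm ((z ^ (2 ^ j) - 1) + 2) \<ge> 3/2" proof -
   have "norm (2::complex) \<le> norm ((z ^ (2 ^ j) - 1) + 2) + norm (z ^ (2 ^ j) - 1)"
    by (metis add_diff_cancel_left' norm_triangle_ineq4 add.commute)
   thus ?thesis using assms[of "2 ^ j"] by simp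
  qed
  ultimately show ?thesis
   using mult_left_mono[of "3/2" "norm ((z ^ (2 ^ j) - 1) + 2)" "w j"] by (simp add: w_def mult.commute)
 qed
 have "w j \<ge> (3/2) ^ j * w 0" for j proof (induction j)
  case (Suc j)
  thus ?case using step[of j] by simp
 qed simp
 moreover have "w j < 1/2" for j using assms by (simp add: w_def)
 moreover have "w 0 > 0" using \<open>z ~= 1\<close> by (simp add: w_def)
 moreover obtain j where "(1/2) / w 0 < (3/2) ^ j" using real_arch_pow[of "3/2" "(1/2) / w 0"] by auto
 ultimately show False by (metis divide_less_eq le_less_trans less_asym)
qed

lemma one_plus_pw:
 assumes "x \<in> pw n" "n \<ge> 1" shows "1 + x ~= 0" "val (1 + x) = 0" "1 + x \<in> int_units"
 using val_add_eq[of "1" x] pw_mono[OF assms(2,1)] by (auto simp: int_units_val)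

lemma one_plus_pw_power:
 assumes "x \<in> pw n" "n \<ge> 1" shows "(1 + x) ^ k - 1 \<in> pw n"
proof (induction k)
 case (Suc k)
 have "(1 + x) ^ Suc k - 1 = ((1 + x) ^ k - 1) + (1 + x) ^ k * x" by (simp add: algebra_simps)
 moreover have "(1 + x) ^ k \<in> pw 0" using one_plus_pw[OF assms] by (simp add: pw_def val_power)
 ultimately show ?case
  using pw_add[OF Suc, of "(1 + x) ^ k * x"] pw_mult[of "(1 + x) ^ k" 0 x n] assms(1) by (simp add: algebra_simps)
qed simp

lemma unit_character_power:
 assumes "unit_character chi" "x \<in> int_units" shows "chi (x ^ k) = chi x ^ k"
proof (induction k)
 case 0
 thus ?case using assms by (simp add: unit_character_def)
next
 case (Suc k)
 have "x ^ k \<in> int_units" using assms(2) by (simp add: int_units_def vnorm_power)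
 thus ?case using Suc assms by (simp add: unit_character_def)
qed

text \<open>The elements \<open>1 + x\<close> with \<open>x\<close> in \<open>pw n\<close> are
  stable under powers, so by continuity all powers of their images stay in a small disc around 1,
  and \<open>near_one_powers_trivial\<close> applies.\<close>

lemma unit_character_trivial_near_one:
 assumes "unit_character (chi :: 'a::nonarch_local_field => complex)"
 obtains n where "n \<ge> 1" "!!x. x \<in> pw n ==> chi (1 + x) = 1"
proof -
 have 1: "1 \<in> (int_units :: 'a set)" "chi 1 = 1" using assms by (auto simp: int_units_def unit_character_def)
 have "continuous_on int_units chi" using assms by (simp add: unit_character_def)
 hence "\<exists>U. open U & 1 \<in> U & (\<forall>y\<in>int_units. y \<in> U --> chi y \<in> ball 1 (1/2))"
  unfolding continuous_on_topological using 1 open_ball[of "1::complex" "1/2"] by (metis centre_in_ball half_gt_zero zero_less_one)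
 then obtain U where U: "open U" "1 \<in> U" "!!y. y \<in> int_units ==> y \<in> U ==> chi y \<in> ball 1 (1/2)" by blast
 obtain n0 where n0: "!!y. y - 1 \<in> pw n0 ==> y \<in> U" using U(1,2) unfolding open_pw_iff by blast
 define n where "n = max 1 n0"
 have "chi (1 + x) = 1" if x: "x \<in> pw n" for x proof (rule near_one_powers_trivial)
  fix k
  have "(1 + x) ^ k - 1 \<in> pw n" using one_plus_pw_power[OF x] by (simp add: n_def)
  hence "(1 + x) ^ k \<in> U" using n0[of "(1 + x) ^ k"] pw_mono[of n0 n "(1 + x) ^ k - 1"] by (simp add: n_def)
  moreover have u: "1 + x \<in> int_units" using one_plus_pw[OF x] by (simp add: n_def)
  moreover have "(1 + x) ^ k \<in> int_units" using u by (simp add: int_units_def vnorm_power)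
  ultimately have "chi ((1 + x) ^ k) \<in> ball 1 (1/2)" using U by blast
  thus "norm (chi (1 + x) ^ k - 1) < 1/2"
   unfolding unit_character_power[OF assms u] by (simp add: dist_norm norm_minus_commute)
 qed
 thus thesis using that[of n] by (simp add: n_def)
qed

lemma compact_int_units: "compact (int_units :: 'a::nonarch_local_field set)"
proof -
 have "int_units = (int_ring :: 'a set) \<inter> - pw 1" by (auto simp: int_units_val int_ring_pw pw_def)
 thus ?thesis using compact_Int_closed[OF compact_int_ring, of "- pw 1"] by (metis closed_Compl open_pw)
qed

text \<open>The unit group is compact, so \<open>chi\<close> is bounded on it; powers of
  \<open>x\<close> and of its inverse then exclude every absolute value other than 1.\<close>

lemma unit_character_norm:
 assumes "unit_character (chi :: 'a::nonarch_local_field => complex)" "x \<in> int_units" shows "norm (chi x) = 1"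
proof -
 have "compact (chi ` int_units)"
  using assms(1) compact_int_units by (intro compact_continuous_image) (auto simp: unit_character_def)
 then obtain B where B: "!!x. x \<in> int_units ==> norm (chi x) \<le> B"
  using compact_imp_bounded bounded_iff by (metis imageI)
 have le: "norm (chi x) \<le> 1" if x: "x \<in> int_units" for x proof (rule ccontr)
  assume "\<not> norm (chi x) \<le> 1"
  then obtain k where "B < norm (chi x) ^ k" using real_arch_pow[of "norm (chi x)" B] by auto
  moreover have "x ^ k \<in> int_units" using x by (simp add: int_units_def vnorm_power)
  ultimately show False using B[of "x ^ k"] unit_character_power[OF assms(1) x] by (simp add: norm_power)
 qed
 have i: "inverse x \<in> int_units" "x ~= 0" using assms(2) by (auto simp: int_units_def vnorm_inverse)
 hence "chi x * chi (inverse x) = 1" using assms by (metis right_inverse unit_character_def)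
 hence "norm (chi x) * norm (chi (inverse x)) = 1" by (metis norm_mult norm_one)
 thus ?thesis using le[OF assms(2)] le[OF i(1)] by (smt (verit) mult_left_le norm_ge_zero)
qed

lemma unit_character_mult:
 "unit_character chi ==> x \<in> int_units ==> y \<in> int_units ==> chi (x * y) = chi x * chi y"
 by (simp add: unit_character_def)

lemma unit_character_one: "unit_character chi ==> chi 1 = 1" by (simp add: unit_character_def)

text \<open>The angular component, that is, the unit part of \<open>x\<close> relative to the
  uniformizer \<open>p\<close>.\<close>

definition ang :: "'a::nonarch_local_field => 'a => 'a" where
 "ang p x = p powi (- val x) * x"

lemma ang_unit: "uniformizer p ==> x ~= 0 ==> ang p x \<in> int_units"
 by (simp add: ang_def int_units_val uniformizer_iff_val val_mult val_power_int)

lemma ang_mult: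
 assumes "uniformizer p" "x ~= 0" "y ~= 0" shows "ang p (x * y) = ang p x * ang p y"
 using assms uniformizer_nonzero[OF assms(1)] by (simp add: ang_def val_mult power_int_diff power_int_minus divide_inverse)

lemma ang_of_unit: "x \<in> int_units ==> ang p x = x" by (simp add: ang_def int_units_val)

lemma ang_uniformizer: "uniformizer p ==> ang p p = 1"
 using uniformizer_nonzero[of p] by (simp add: ang_def val_uniformizer power_int_minus)

abbreviation qr :: "'a::nonarch_local_field itself => real" where
 "qr T \<equiv> real (residue_card T)"

lemma qr_gt_1: "qr TYPE('a::nonarch_local_field) > 1" using residue_card_ge_2[where 'a='a] by simp

lemma qr_pos: "qr TYPE('a::nonarch_local_field) > 0" using qr_gt_1[where 'a='a] by simp

lemma ln_qr_pos: "ln (qr TYPE('a::nonarch_local_field)) > 0" using qr_gt_1[where 'a='a] by simp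

text \<open>The number q^(-s), written as an exponential so that integer powers, holomorphy in s and
  periods are immediate.\<close>

definition qexp :: "'a::nonarch_local_field itself => complex => complex" where
 "qexp T s = exp (- (s * of_real (ln (qr T))))"

lemma qexp_nonzero [simp]: "qexp T s ~= 0" by (simp add: qexp_def)

lemma qexp_add: "qexp T (s + t) = qexp T s * qexp T t"
 by (simp add: qexp_def ring_distribs exp_add exp_diff exp_minus divide_inverse)

lemma qexp_zero [simp]: "qexp T 0 = 1" by (simp add: qexp_def)

lemma qexp_minus: "qexp T (- s) = inverse (qexp T s)" by (simp add: qexp_def exp_minus)

lemma qexp_diff: "qexp T (s - t) = qexp T s / qexp T t"
 using qexp_add[of T s "- t"] by (simp add: qexp_minus divide_inverse)

lemma exp_powi: "exp (z::complex) powi n = exp (of_int n * z)"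
proof (cases "n \<ge> 0")
 case True
 thus ?thesis by (simp add: power_int_def flip: exp_of_nat_mult)
next
 case False
 thus ?thesis by (simp add: power_int_def exp_minus[symmetric] flip: exp_of_nat_mult)
qed

lemma qexp_powi: "qexp T s powi n = qexp T (of_int n * s)" by (simp add: qexp_def exp_powi algebra_simps)

lemma qexp_of_int: "qexp TYPE('a::nonarch_local_field) (of_int n) = of_real (qr TYPE('a) powi (- n))"
proof -
 have "qexp TYPE('a) 1 = of_real (inverse (qr TYPE('a)))"
  using qr_pos[where 'a='a] exp_of_real[of "ln (qr TYPE('a))"] by (simp add: qexp_def exp_minus)
 hence "qexp TYPE('a) 1 powi n = of_real (inverse (qr TYPE('a)) powi n)" by simp
 thus ?thesis using qexp_powi[of "TYPE('a)" 1 n] by (simp add: power_int_minus power_int_inverse)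
qed

lemma norm_qexp: "norm (qexp TYPE('a::nonarch_local_field) s) = qr TYPE('a) powr (- Re s)"
 using qr_pos[where 'a='a] by (simp add: qexp_def powr_def)

lemma qexp_powr: "of_nat (residue_card TYPE('a::nonarch_local_field)) powr (- s) = qexp TYPE('a) s"
proof -
 have "Ln (of_nat (residue_card TYPE('a))) = of_real (ln (qr TYPE('a)))"
  using qr_pos[where 'a='a] by (metis Ln_of_real of_real_of_nat_eq)
 thus ?thesis using qr_pos[where 'a='a] by (simp add: powr_def qexp_def)
qed

lemma absv_pos: "x ~= 0 ==> absv (x::'a::nonarch_local_field) > 0" using qr_pos[where 'a='a] by (simp add: absv_def)

lemma absv_zero [simp]: "absv 0 = 0" by (simp add: absv_def)

lemma absv_mult: "absv (x * y) = absv x * absv (y::'a::nonarch_local_field)"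
 using qr_pos[where 'a='a] by (auto simp: absv_def val_mult power_int_add[symmetric] power_int_diff power_int_minus divide_inverse)

lemma absv_powr: 
 assumes "x ~= 0" shows "of_real (absv (x::'a::nonarch_local_field)) powr s = qexp TYPE('a) s powi val x"
proof -
 have "absv x = qr TYPE('a) powr of_int (- val x)"
  using assms qr_pos[where 'a='a] powr_real_of_int'[of "qr TYPE('a)" "- val x"] by (simp add: absv_def)
 hence "ln (absv x) = - (of_int (val x) * ln (qr TYPE('a)))" using qr_pos[where 'a='a] by (simp add: ln_powr)
 moreover have "Ln (of_real (absv x)) = of_real (ln (absv x))" using absv_pos[OF assms] by (rule Ln_of_real)
 moreover have "complex_of_real (absv x) ~= 0" using absv_pos[OF assms] by simp
 ultimately show ?thesis by (simp add: powr_def qexp_def exp_powi algebra_simps)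
qed

lemma quasi_char_eq:
 "x ~= 0 ==> quasi_char p chi s (x::'a::nonarch_local_field) = chi (ang p x) * qexp TYPE('a) s powi val x"
 by (simp add: quasi_char_def ang_def absv_powr)

lemma quasi_char_zero [simp]: "quasi_char p chi s 0 = 0" by (simp add: quasi_char_def)

lemma unit_character_nonzero:
 "unit_character chi ==> x \<in> int_units ==> chi (x::'a::nonarch_local_field) ~= 0"
 using unit_character_norm[of chi x] by auto

lemma quasi_char_nonzero:
 "unit_character chi ==> uniformizer p ==> x ~= 0 ==> quasi_char p chi s (x::'a::nonarch_local_field) ~= 0"
 by (simp add: quasi_char_eq unit_character_nonzero ang_unit)

lemma quasi_char_mult:
 assumes "unit_character chi" "uniformizer p"
 shows "quasi_char p chi s (x * y) = quasi_char p chi s x * quasi_char p chi s (y::'a::nonarch_local_field)"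
proof (cases "x = 0 \<or> y = 0")
 case False
 thus ?thesis using assms by (simp add: quasi_char_eq ang_mult val_mult power_int_add unit_character_mult ang_unit)
qed auto

lemma quasi_char_one: "unit_character chi ==> quasi_char p chi s (1::'a::nonarch_local_field) = 1"
 by (simp add: quasi_char_eq ang_def unit_character_one)

lemma quasi_char_inverse:
 assumes "unit_character chi" "uniformizer p"
 shows "quasi_char p chi s (inverse x) = inverse (quasi_char p chi s (x::'a::nonarch_local_field))"
proof (cases "x = 0")
 case False
 hence "quasi_char p chi s x * quasi_char p chi s (inverse x) = 1"
  using quasi_char_mult[OF assms, of s x "inverse x"] quasi_char_one[OF assms(1)] by simp
 thus ?thesis using inverse_unique by metis
qed simp

lemma quasi_char_divide:
 assumes "unit_character chi" "uniformizer p"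
 shows "quasi_char p chi s (x / y) = quasi_char p chi s x / quasi_char p chi s (y::'a::nonarch_local_field)"
 by (simp add: divide_inverse quasi_char_mult[OF assms] quasi_char_inverse[OF assms])

lemma quasi_char_power:
 assumes "unit_character chi" "uniformizer p"
 shows "quasi_char p chi s (x ^ n) = quasi_char p chi s (x::'a::nonarch_local_field) ^ n"
 by (induction n) (simp_all add: quasi_char_mult[OF assms] quasi_char_one[OF assms(1)])

lemma quasi_char_add:
 "quasi_char p chi (s + t) x = quasi_char p chi s x * qexp TYPE('a) t powi val (x::'a::nonarch_local_field)"
 by (cases "x = 0") (simp_all add: quasi_char_eq qexp_add power_int_mult_distrib)

lemma quasi_char_unit: "x \<in> int_units ==> quasi_char p chi s (x::'a::nonarch_local_field) = chi x"
 using ang_of_unit[of x p] by (simp add: quasi_char_eq int_units_val)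

lemma norm_quasi_char:
 assumes "unit_character chi" "uniformizer p" "x ~= 0"
 shows "norm (quasi_char p chi s x) = absv (x::'a::nonarch_local_field) powr Re s"
proof -
 have "absv x powr Re s = norm (of_real (absv x) powr s)" using absv_pos[OF assms(3)] by (simp add: norm_powr_real_powr)
 thus ?thesis using unit_character_norm[OF assms(1) ang_unit[OF assms(2,3)]]
  by (simp add: quasi_char_def ang_def norm_mult)
qed

text \<open>The radius depends on a conductor exponent of \<open>chi\<close> and on
  \<open>val x\<close>, but not on s. This uniformity lets a test function multiplied by
  quasi-characters be expanded over one partition for all s at once.\<close>

lemma quasi_char_congruent:
 assumes "uniformizer p" "unit_character chi" and n: "n \<ge> 1" "!!h. h \<in> pw n ==> chi (1 + h) = 1"
  and x: "x ~= 0" "y - x \<in> pw (val x + n)"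
 shows "quasi_char p chi s y = quasi_char p chi s (x::'a::nonarch_local_field)"
proof -
 define h where "h = (y - x) / x"
 have h: "h \<in> pw n" using x pw_mult_iff[of x h "val x + n"] by (simp add: h_def)
 have y: "y = x * (1 + h)" using x by (simp add: h_def field_simps)
 have "quasi_char p chi s (1 + h) = 1" using quasi_char_unit[OF one_plus_pw(3)[OF h n(1)]] n(2)[OF h] by simp
 thus ?thesis unfolding y quasi_char_mult[OF assms(2,1)] by simp
qed

lemma quasi_char_locally_constant:
 assumes "uniformizer p" "unit_character chi" "x ~= (0::'a::nonarch_local_field)"
 shows "\<exists>n. \<forall>y. y - x \<in> pw n --> y ~= 0 & val y = val x & (\<forall>s. quasi_char p chi s y = quasi_char p chi s x)"
proof -
 obtain n where n: "n \<ge> 1" "!!h. h \<in> pw n ==> chi (1 + h) = 1"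
  using unit_character_trivial_near_one[OF assms(2)] by blast
 have "y ~= 0 & val y = val x & (\<forall>s. quasi_char p chi s y = quasi_char p chi s x)"
  if y: "y - x \<in> pw (val x + n)" for y proof -
  have "x - y \<in> pw (val x + 1)" using pw_mono[OF _ y, of "val x + 1"] n(1) by (simp add: pw_diff_commute)
  thus ?thesis using quasi_char_congruent[OF assms(1,2) n assms(3) y] val_congruent[OF assms(3), of y] by blast
 qed
 thus ?thesis by blast
qed

section \<open>Haar measure\<close>

lemma normalized_haarD:
 assumes "normalized_haar (M::'a::nonarch_local_field measure)"
 shows "sets M = sets borel" "space M = UNIV" "distr M borel ((+) a) = M" "emeasure M (pw 0) = 1"
 using assms sets_eq_imp_space_eq[of M borel] by (auto simp: normalized_haar_def int_ring_pw)

lemma haar_borel_measurable: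
 "normalized_haar M ==> f \<in> borel_measurable borel ==> f \<in> borel_measurable M"
 using measurable_cong_sets[OF normalized_haarD(1) refl, of M] by metis

text \<open>Translations and dilations both satisfy the hypothesis, which says that \<open>T\<close>
  shifts all levels by \<open>r\<close>; they are treated together here and in
  \<open>distr_similarity\<close>.\<close>

lemma similarity_measurable:
 assumes "!!x y n. T x - T y \<in> pw (n + r) \<longleftrightarrow> x - y \<in> pw n"
 shows "(T :: 'a => 'a) \<in> borel_measurable (borel :: 'a::nonarch_local_field measure)"
proof -
 have "continuous_on UNIV T" unfolding continuous_on_open_vimage[OF open_UNIV] Int_UNIV_right proof safe
  fix B :: "'a set" assume B: "open B"
  show "open (T -` B)" unfolding open_pw_iff proof
   fix x assume "x \<in> T -` B"
   then obtain n where n: "!!y. y - T x \<in> pw n ==> y \<in> B" using B unfolding open_pw_iff by auto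
   have "T y \<in> B" if "y - x \<in> pw (n - r)" for y using n[of "T y"] assms[of y x "n - r"] that by simp
   thus "\<exists>n. \<forall>y. y - x \<in> pw n --> y \<in> T -` B" by blast
  qed
 qed
 thus ?thesis by (rule borel_measurable_continuous_onI)
qed

lemma coset_borel [measurable]: "{x. x - c \<in> pw n} \<in> sets (borel :: 'a::nonarch_local_field measure)"
 by (rule borel_open) simp

lemma pw_borel [measurable]: "pw n \<in> sets (borel :: 'a::nonarch_local_field measure)" by (rule borel_open) simp

lemma emeasure_coset_translate:
 assumes "normalized_haar (M::'a::nonarch_local_field measure)"
 shows "emeasure M {x. x - c \<in> pw n} = emeasure M (pw n)"
proof -
 note M = normalized_haarD[OF assms]
 have meas: "(+) c \<in> borel_measurable M"
  by (rule haar_borel_measurable[OF assms similarity_measurable[of "(+) c" 0]]) simp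
 have "emeasure M {x. x - c \<in> pw n} = emeasure (distr M borel ((+) c)) {x. x - c \<in> pw n}" using M(3) by simp
 also have "\<dots> = emeasure M ((+) c -` {x. x - c \<in> pw n} \<inter> space M)" by (rule emeasure_distr[OF meas]) measurable
 also have "(+) c -` {x. x - c \<in> pw n} \<inter> space M = pw n" using M(2) by auto
 finally show ?thesis .
qed

lemma emeasure_pw_subdivide:
 assumes "normalized_haar (M::'a::nonarch_local_field measure)" "n \<le> k"
 shows "emeasure M (pw n) = of_nat (residue_card TYPE('a) ^ nat (k - n)) * emeasure M (pw k)"
proof -
 note M = normalized_haarD[OF assms(1)]
 obtain R :: "'a set" where R: "residue_reps n k R" using ex_residue_reps[OF assms(2)] by blast
 have un: "(pw n :: 'a set) = (\<Union>c\<in>R. {x. x - c \<in> pw k})" proof (intro equalityI subsetI)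
  fix x :: 'a assume "x \<in> pw n"
  thus "x \<in> (\<Union>c\<in>R. {x. x - c \<in> pw k})" using R unfolding residue_reps_def by blast
 next
  fix x :: 'a assume "x \<in> (\<Union>c\<in>R. {x. x - c \<in> pw k})"
  then obtain c where c: "c \<in> R" "x - c \<in> pw k" by blast
  thus "x \<in> pw n" using pw_add[OF pw_mono[OF assms(2) c(2)], of c] R by (auto simp: residue_reps_def)
 qed
 have disj: "disjoint_family_on (%c. {x. x - c \<in> pw k}) R" unfolding disjoint_family_on_def proof (intro ballI impI)
  fix c d assume cd: "c \<in> R" "d \<in> R" "c ~= d"
  have "c = d" if x: "x - c \<in> pw k" "x - d \<in> pw k" for x proof -
   have "x \<in> pw n" using un x cd by blast
   thus ?thesis using R cd x unfolding residue_reps_def by blast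
  qed
  thus "{x. x - c \<in> pw k} \<inter> {x. x - d \<in> pw k} = {}" using cd by blast
 qed
 have "emeasure M (pw n) = (\<Sum>c\<in>R. emeasure M {x. x - c \<in> pw k})" unfolding un using R M(1) disj
  by (intro sum_emeasure[symmetric]) (auto simp: residue_reps_def)
 also have "\<dots> = (\<Sum>c\<in>R. emeasure M (pw k))" by (simp add: emeasure_coset_translate[OF assms(1)])
 also have "\<dots> = of_nat (card R) * emeasure M (pw k)" by simp
 finally show ?thesis using R by (simp add: residue_reps_def)
qed

lemma emeasure_pw:
 assumes "normalized_haar (M::'a::nonarch_local_field measure)"
 shows "emeasure M (pw n) = ennreal (qr TYPE('a) powi (- n))"
proof -
 note M = normalized_haarD[OF assms]
 note q = qr_pos[where 'a='a]
 show ?thesis proof (cases "n \<ge> 0")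
  case True
  have e: "(of_nat (residue_card TYPE('a) ^ nat n) :: ennreal) = ennreal (qr TYPE('a) ^ nat n)"
   by (metis ennreal_of_nat_eq_real_of_nat of_nat_power)
  have "ennreal (qr TYPE('a) ^ nat n) * emeasure M (pw n) = 1" using emeasure_pw_subdivide[OF assms True] M(4) e by simp
  hence "ennreal (inverse (qr TYPE('a) ^ nat n)) * (ennreal (qr TYPE('a) ^ nat n) * emeasure M (pw n)) =
    ennreal (inverse (qr TYPE('a) ^ nat n))" by simp
  moreover have "ennreal (inverse (qr TYPE('a) ^ nat n)) * ennreal (qr TYPE('a) ^ nat n) = 1"
   using q by (simp flip: ennreal_mult)
  ultimately have "emeasure M (pw n) = ennreal (inverse (qr TYPE('a) ^ nat n))" by (metis mult.assoc mult_1)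
  moreover have "qr TYPE('a) powi (- n) = inverse (qr TYPE('a) ^ nat n)"
   using True by (simp add: power_int_minus power_int_def[of _ n])
  ultimately show ?thesis by simp
 next
  case False
  hence "emeasure M (pw n) = of_nat (residue_card TYPE('a) ^ nat (- n))"
   using emeasure_pw_subdivide[OF assms, of n 0] M(4) by simp
  also have "\<dots> = ennreal (qr TYPE('a) ^ nat (- n))" by (metis ennreal_of_nat_eq_real_of_nat of_nat_power)
  also have "qr TYPE('a) ^ nat (- n) = qr TYPE('a) powi (- n)" using False by (simp add: power_int_def)
  finally show ?thesis .
 qed
qed

lemma emeasure_coset:
 assumes "normalized_haar (M::'a::nonarch_local_field measure)"
 shows "emeasure M {x. x - c \<in> pw n} = ennreal (qr TYPE('a) powi (- n))"
 using emeasure_coset_translate[OF assms] emeasure_pw[OF assms] by simp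

lemma powi_tendsto_zero:
 assumes "(r::real) > 1" "e > 0" shows "\<exists>n::int. r powi (- n) < e"
proof -
 obtain n where "(inverse r) ^ n < e" using real_arch_pow_inv[of e "inverse r"] assms inverse_less_1_iff[of r] by auto
 thus ?thesis by (intro exI[of _ "int n"]) (simp add: power_int_minus power_inverse)
qed

lemma emeasure_singleton_zero:
 assumes "normalized_haar (M::'a::nonarch_local_field measure)" shows "emeasure M {c} = 0"
proof (rule ccontr)
 assume ne: "emeasure M {c} ~= 0"
 have le: "emeasure M {c} \<le> ennreal (qr TYPE('a) powi (- n))" for n unfolding emeasure_coset[OF assms, of c, symmetric]
  using normalized_haarD(1)[OF assms] by (intro emeasure_mono) auto
 hence "emeasure M {c} ~= \<infinity>" by (metis ennreal_neq_top infinity_ennreal_def top.extremum_uniqueI)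
 then obtain r where r: "emeasure M {c} = ennreal r" "r > 0"
  using ne by (metis ennreal_cases ennreal_0 infinity_ennreal_def less_eq_real_def)
 obtain n where "qr TYPE('a) powi (- n) < r" using powi_tendsto_zero[OF qr_gt_1[where 'a='a] r(2)] by blast
 moreover have "ennreal r \<le> ennreal (qr TYPE('a) powi (- n))" using le[of n] r(1) by simp
 ultimately show False using r qr_pos[where 'a='a] by (simp add: ennreal_le_iff)
qed

lemma coset_eq: "d - c \<in> pw n ==> {x. x - c \<in> pw n} = {x::'a::nonarch_local_field. x - d \<in> pw n}"
proof -
 assume dc: "d - c \<in> pw n"
 have "x - c \<in> pw n \<longleftrightarrow> x - d \<in> pw n" for x using pw_add_cancel[OF dc, of "x - d"] by simp
 thus ?thesis by simp
qed

lemma countable_cosets: "countable {{x::'a::nonarch_local_field. x - c \<in> pw n} | c n. True}"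
proof -
 obtain R :: "int => int => 'a set" where R: "!!m n. m \<le> n ==> residue_reps m n (R m n)"
  using ex_residue_reps[where 'a='a] by metis
 have "{{x::'a. x - c \<in> pw n} | c n. True} \<subseteq>
   (\<Union>n. \<Union>m\<in>{..n}. (%c. {x. x - c \<in> pw n}) ` R m n)" proof
  fix X assume "X \<in> {{x::'a. x - c \<in> pw n} | c n. True}"
  then obtain c n where X: "X = {x::'a. x - c \<in> pw n}" by blast
  obtain m0 where m0: "c \<in> pw m0" using in_some_pw by blast
  define m where "m = min m0 n"
  have "c \<in> pw m" "m \<le> n" using pw_mono[OF _ m0, of m] by (auto simp: m_def)
  then obtain d where d: "d \<in> R m n" "c - d \<in> pw n" using R unfolding residue_reps_def by blast
  hence "X = {x. x - d \<in> pw n}" using coset_eq[OF d(2)] X by simp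
  thus "X \<in> (\<Union>n. \<Union>m\<in>{..n}. (%c. {x. x - c \<in> pw n}) ` R m n)" using d \<open>m \<le> n\<close> by blast
 qed
 moreover have "countable (\<Union>n::int. \<Union>m\<in>{..n}. (%c. {x. x - c \<in> pw n}) ` R m n)"
 proof (intro countable_UN countableI_type)
  fix n m assume "m \<in> {..n::int}"
  hence "finite (R m n)" using R by (auto simp: residue_reps_def)
  thus "countable ((%c. {x. x - c \<in> pw n}) ` R m n)" by (intro countable_image countable_finite)
 qed
 ultimately show ?thesis by (rule countable_subset)
qed

text \<open>Balls containing \<open>0\<close> are avoided so that inversion can be treated on the generators.\<close>

lemma measure_eq_on_cosets:
 fixes M N :: "'a::nonarch_local_field measure"
 assumes sets: "sets M = sets borel" "sets N = sets borel"
  and eq: "!!c n. 0 \<notin> {x. x - c \<in> pw n} ==> emeasure M {x. x - c \<in> pw n} = emeasure N {x. x - c \<in> pw n}"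
  and fin: "!!c n. 0 \<notin> {x. x - c \<in> pw n} ==> emeasure M {x. x - c \<in> pw n} ~= \<infinity>"
  and zero: "emeasure M {0} = 0" "emeasure N {0} = 0" shows "M = N"
proof -
 define C where "C = {{x::'a. x - c \<in> pw n} | c n. 0 \<notin> {x. x - c \<in> pw n}}"
 \<comment> \<open>The point 0 lies in none of the balls of \<open>C\<close>. Adding
   \<open>{0}\<close>, on which both measures vanish, makes the generator cover the field.\<close>
 define E where "E = insert {} (insert {0} C)"
 have countable: "countable E"
  using countable_subset[OF _ countable_cosets[where 'a='a], of C] by (auto simp: C_def E_def)
 have borel: "X \<in> sets borel" if "X \<in> E" for X using that by (auto simp: E_def C_def)
 have gen: "sets borel = sigma_sets (UNIV::'a set) E" proof -
  have "sigma_sets UNIV {S::'a set. open S} = sigma_sets UNIV E" proof (rule sigma_sets_eqI)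
   fix U :: "'a set" assume "U \<in> {S. open S}"
   hence U: "open U" by simp
   have "U \<subseteq> \<Union>{X\<in>E. X \<subseteq> U}" proof
    fix x assume x: "x \<in> U"
    show "x \<in> \<Union>{X\<in>E. X \<subseteq> U}" proof (cases "x = 0")
     case True
     thus ?thesis using x by (auto simp: E_def)
    next
     case False
     obtain n where n: "!!y. y - x \<in> pw n ==> y \<in> U" using U x unfolding open_pw_iff by blast
     let ?k = "max n (val x + 1)"
     have "- x \<notin> pw ?k" using False by (simp add: pw_def)
     hence "{y. y - x \<in> pw ?k} \<in> E" by (auto simp: E_def C_def)
     moreover have "{y. y - x \<in> pw ?k} \<subseteq> U" using n pw_mono[of n ?k] by auto
     ultimately show ?thesis by (intro UnionI[of "{y. y - x \<in> pw ?k}"]) auto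
    qed
   qed
   hence "U = \<Union>{X\<in>E. X \<subseteq> U}" by blast
   moreover have "\<Union>{X\<in>E. X \<subseteq> U} \<in> sigma_sets UNIV E"
    using countable by (intro sigma_sets_UNION) (auto intro: countable_subset)
   ultimately show "U \<in> sigma_sets UNIV E" by simp
  next
   fix X assume X: "X \<in> E"
   show "X \<in> sigma_sets UNIV {S::'a set. open S}" proof (cases "X = {0}")
    case True
    have "UNIV - (- {0}) \<in> sigma_sets UNIV {S::'a set. open S}"
     by (intro sigma_sets.Compl sigma_sets.Basic) (auto simp: open_Compl)
    thus ?thesis using True by simp
   next
    case False
    thus ?thesis using X by (intro sigma_sets.Basic) (auto simp: E_def C_def)
   qed
  qed
  thus ?thesis by (simp add: borel_def)
 qed
 have stable: "Int_stable E" proof (rule Int_stableI)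
  have CC: "X \<inter> Y \<in> E" if XC: "X \<in> C" "Y \<in> C" for X Y proof -
   obtain c n d m where XY: "X = {x. x - c \<in> pw n}" "Y = {x. x - d \<in> pw m}" using XC unfolding C_def by blast
   show ?thesis proof (cases "X \<inter> Y = {}")
    case False
    then obtain z where z: "z - c \<in> pw n" "z - d \<in> pw m" using XY by blast
    have "X = {x. x - z \<in> pw n}" "Y = {x. x - z \<in> pw m}"
     using XY(1) coset_eq[OF z(1)] XY(2) coset_eq[OF z(2)] by (blast intro: trans)+
    moreover have "{x. x - z \<in> pw m} \<subseteq> {x. x - z \<in> pw n} \<or> {x. x - z \<in> pw n} \<subseteq> {x. x - z \<in> pw m}"
     using pw_mono[of n m] pw_mono[of m n] linear[of n m] by blast
    ultimately have "X \<inter> Y = X \<or> X \<inter> Y = Y" by blast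
    moreover have "X \<in> E" "Y \<in> E" using XC by (simp_all add: E_def)
    ultimately show ?thesis by metis
   qed (simp add: E_def)
  qed
  have C0: "{0} \<inter> X = {}" if "X \<in> C" for X using that by (auto simp: C_def)
  fix X Y assume XY: "X \<in> E" "Y \<in> E"
  hence "X = {} \<or> X = {0} \<or> X \<in> C" "Y = {} \<or> Y = {0} \<or> Y \<in> C" by (auto simp: E_def)
  thus "X \<inter> Y \<in> E" using CC[of X Y] C0[of X] C0[of Y] by (auto simp: E_def)
 qed
 have cover: "\<Union>E = UNIV" proof -
  have "x \<in> \<Union>E" for x proof (cases "x = 0")
   case False
   hence "- x \<notin> pw (val x + 1)" by (simp add: pw_def)
   hence "{y. y - x \<in> pw (val x + 1)} \<in> E" by (auto simp: E_def C_def)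
   thus ?thesis by (intro UnionI[of "{y. y - x \<in> pw (val x + 1)}"]) auto
  qed (auto simp: E_def)
  thus ?thesis by blast
 qed
 show ?thesis proof (rule measure_eqI_generator_eq_countable[of E UNIV M N E])
  show "emeasure M X = emeasure N X" if "X \<in> E" for X using that eq zero by (auto simp: E_def C_def)
  show "emeasure M X ~= \<infinity>" if "X \<in> E" for X using that fin zero by (auto simp: E_def C_def)
 qed (use gen stable cover countable sets in auto)
qed

lemma vimage_coset_similarity:
 assumes T: "!!x y n. T x - T y \<in> pw (n + r) \<longleftrightarrow> x - y \<in> pw n" and "surj T"
 obtains d where "T -` {x. x - c \<in> pw n} = {x::'a::nonarch_local_field. x - d \<in> pw (n - r)}" "T d = c"
proof -
 obtain d where d: "T d = c" using assms(2) by (metis surj_def)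
 have "T x - c \<in> pw n \<longleftrightarrow> x - d \<in> pw (n - r)" for x using T[of x d "n - r"] d by simp
 thus thesis using that[of d] d by (simp add: vimage_def)
qed

text \<open>The preimage of a ball is a ball whose level is lowered by \<open>r\<close>, so the two
  measures agree on balls.\<close>

lemma distr_similarity:
 assumes M: "normalized_haar (M::'a::nonarch_local_field measure)"
  and T: "!!x y n. T x - T y \<in> pw (n + r) \<longleftrightarrow> x - y \<in> pw n" and "surj T"
 shows "distr M borel T = scale_measure (ennreal (qr TYPE('a) powi r)) M"
proof -
 note q = qr_pos[where 'a='a]
 have meas: "T \<in> borel_measurable M" by (rule haar_borel_measurable[OF M similarity_measurable[OF T]])
 have sp: "space M = UNIV" "sets M = sets borel" using normalized_haarD[OF M] by auto
 have eq: "emeasure (distr M borel T) {x. x - c \<in> pw n} = ennreal (qr TYPE('a) powi r * qr TYPE('a) powi (- n))" for c n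
 proof -
  obtain d where d: "T -` {x. x - c \<in> pw n} = {x. x - d \<in> pw (n - r)}"
   using vimage_coset_similarity[OF T assms(3)] by metis
  have "emeasure (distr M borel T) {x. x - c \<in> pw n} = emeasure M (T -` {x. x - c \<in> pw n} \<inter> space M)"
   by (rule emeasure_distr[OF meas]) measurable
  also have "\<dots> = ennreal (qr TYPE('a) powi (- (n - r)))" unfolding d sp Int_UNIV_right by (rule emeasure_coset[OF M])
  also have "qr TYPE('a) powi (- (n - r)) = qr TYPE('a) powi r * qr TYPE('a) powi (- n)"
   using q by (simp flip: power_int_add)
  finally show ?thesis .
 qed
 show ?thesis proof (rule measure_eq_on_cosets)
  fix c :: 'a and n
  show "emeasure (distr M borel T) {x. x - c \<in> pw n} =
    emeasure (scale_measure (ennreal (qr TYPE('a) powi r)) M) {x. x - c \<in> pw n}"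
   unfolding eq by (simp add: emeasure_coset[OF M] ennreal_mult)
  show "emeasure (distr M borel T) {x. x - c \<in> pw n} ~= \<infinity>" unfolding eq by simp
 next
  obtain d where d: "T d = 0" using assms(3) by (metis surj_def)
  have inj: "x = y" if "T x = T y" for x y using T[of x y] that pw_nat_ex[of "x - y"] by auto
  have "T -` {0} = {d}" using d inj by auto
  hence "emeasure (distr M borel T) {0} = emeasure M {d}"
   using emeasure_distr[OF meas, of "{0}"] sp by (simp add: borel_closed)
  thus "emeasure (distr M borel T) {0} = 0" by (simp add: emeasure_singleton_zero[OF M])
 qed (simp_all add: sp emeasure_singleton_zero[OF M])
qed

lemma integral_scale_measure':
 fixes f :: "'a => complex"
 assumes "f \<in> borel_measurable M" "r \<ge> 0"
 shows "integral\<^sup>L (scale_measure (ennreal r) M) f = of_real r * integral\<^sup>L M f"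
proof -
 have "scale_measure (ennreal r) M = density M (%_. ennreal r)"
  by (intro measure_eqI) (auto simp: emeasure_density nn_integral_cmult_indicator)
 thus ?thesis using integral_density[of f M "%_. r"] assms by (simp add: scaleR_conv_of_real)
qed

lemma integral_similarity:
 fixes f :: "'a::nonarch_local_field => complex"
 assumes M: "normalized_haar M"
  and T: "!!x y n. T x - T y \<in> pw (n + r) \<longleftrightarrow> x - y \<in> pw n" and "surj T" and f: "f \<in> borel_measurable borel"
 shows "(LINT x|M. f (T x)) = of_real (qr TYPE('a) powi r) * integral\<^sup>L M f"
proof -
 have sp: "space M = UNIV" "sets M = sets borel" using normalized_haarD[OF M] by auto
 have meas: "T \<in> borel_measurable M" by (rule haar_borel_measurable[OF M similarity_measurable[OF T]])
 note fM = haar_borel_measurable[OF M f]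
 have "(LINT x|M. f (T x)) = integral\<^sup>L (distr M borel T) f" using integral_distr[OF meas f] by simp
 also have "\<dots> = of_real (qr TYPE('a) powi r) * integral\<^sup>L M f" unfolding distr_similarity[OF M T assms(3)]
  using fM qr_pos[where 'a='a] by (intro integral_scale_measure') auto
 finally show ?thesis .
qed

lemma integral_translate:
 fixes f :: "'a::nonarch_local_field => complex"
 assumes "normalized_haar M" "f \<in> borel_measurable borel" shows "(LINT x|M. f (x + c)) = integral\<^sup>L M f"
 using integral_similarity[OF assms(1), of "%x. x + c" 0 f] assms(2) by (simp add: surj_plus_right)

lemma integral_scale:
 fixes f :: "'a::nonarch_local_field => complex"
 assumes "normalized_haar M" "f \<in> borel_measurable borel" "a ~= 0"
 shows "(LINT x|M. f (a * x)) = of_real (inverse (absv a)) * integral\<^sup>L M f"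
proof -
 have s: "surj ((*) a)" by (rule surjI[of _ "%x. x / a"]) (use assms(3) in simp)
 have "(LINT x|M. f (a * x)) = of_real (qr TYPE('a) powi val a) * integral\<^sup>L M f" using assms(3)
  by (intro integral_similarity[OF assms(1) _ s assms(2)]) (simp flip: right_diff_distrib add: pw_mult_iff)
 also have "qr TYPE('a) powi val a = inverse (absv a)" using assms(3) by (simp add: absv_def power_int_minus)
 finally show ?thesis .
qed

lemma measurable_locally_constant_on:
 fixes f :: "'a::nonarch_local_field => 'b::topological_space"
 assumes A: "closed A" and f: "!!x. x \<notin> A ==> \<exists>n. \<forall>y. y - x \<in> pw n --> f y = f x" and z: "!!x. x \<in> A ==> f x = z"
 shows "f \<in> borel_measurable borel"
proof -
 have "continuous_on (- A) f" unfolding continuous_on_topological proof (intro ballI allI impI)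
  fix x B assume x: "x \<in> - A" "open B" "f x \<in> B"
  obtain n where n: "!!y. y - x \<in> pw n ==> f y = f x" using f x by blast
  show "\<exists>U. open U & x \<in> U & (\<forall>y\<in>- A. y \<in> U --> f y \<in> B)"
   using x n by (intro exI[of _ "{y. y - x \<in> pw n}"]) (metis (mono_tags, lifting) diff_self mem_Collect_eq open_coset zero_in_pw)
 qed
 hence "(%x. if x \<in> A then z else f x) \<in> borel_measurable borel"
  using A by (intro borel_measurable_continuous_on_if) auto
 moreover have "(%x. if x \<in> A then z else f x) = f" using z by auto
 ultimately show ?thesis by simp
qed

lemma measurable_test_fun: "\<phi> \<in> test_fun U ==> \<phi> \<in> borel_measurable (borel::'a::nonarch_local_field measure)"
proof (rule measurable_locally_constant_on[of "{}"])
 assume "\<phi> \<in> test_fun U"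
 thus "\<exists>n. \<forall>y. y - x \<in> pw n --> \<phi> y = \<phi> x" for x using test_fun_locally_constant unfolding locally_constant_pw by blast
qed auto

lemma ball_ind_indicator: "ball_ind c n = indicator {x. x - c \<in> pw n}"
 by (auto simp: ball_ind_def indicator_def fun_eq_iff)

lemma integral_ball_ind:
 assumes M: "normalized_haar (M::'a::nonarch_local_field measure)"
 shows "integrable M (ball_ind c n)" "integral\<^sup>L M (ball_ind c n) = of_real (qr TYPE('a) powi (- n))"
proof -
 have s: "{x. x - c \<in> pw n} \<in> sets M" "emeasure M {x. x - c \<in> pw n} < \<infinity>"
  using normalized_haarD(1)[OF M] by (auto simp: emeasure_coset[OF M])
 show "integrable M (ball_ind c n)" using integrable_of_real[OF integrable_real_indicator[OF s], where 'a=complex]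
  by (simp add: ball_ind_indicator of_real_indicator)
 have "integral\<^sup>L M (%x. of_real (indicator {x. x - c \<in> pw n} x) :: complex) = of_real (measure M {x. x - c \<in> pw n})"
  using has_bochner_integral_integral_eq[OF has_bochner_integral_real_indicator[OF s]]
  by (simp only: integral_complex_of_real)
 thus "integral\<^sup>L M (ball_ind c n) = of_real (qr TYPE('a) powi (- n))"
  using qr_pos[where 'a='a] by (simp add: ball_ind_indicator measure_def emeasure_coset[OF M] of_real_indicator cong: Bochner_Integration.integral_cong)
qed

lemma integrable_test_fun:
 assumes M: "normalized_haar (M::'a::nonarch_local_field measure)" and "\<phi> \<in> test_fun U" shows "integrable M \<phi>"
proof -
 obtain n m where nm: "periodic n \<phi>" "supported m \<phi>" using assms(2) test_fun_iff[of \<phi> U] test_funE by blast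
 have nm': "supported (min m n) \<phi>" by (rule supported_mono[OF nm(2)]) simp
 obtain R :: "'a set" where R: "residue_reps (min m n) n R" using ex_residue_reps[of "min m n" n] by auto
 show ?thesis by (subst test_fun_decompose[OF nm(1) nm' R])
   (intro Bochner_Integration.integrable_sum Bochner_Integration.integrable_mult_right impI integral_ball_ind(1)[OF M])
qed

lemma inverse_near:
 assumes x: "x ~= 0" and y: "y - x \<in> pw (val x + 1)" shows "y ~= 0" "val y = val (x::'a::nonarch_local_field)"
  "inverse y - inverse x \<in> pw n \<longleftrightarrow> y - x \<in> pw (n + 2 * val x)"
proof -
  have "x - y \<in> pw (val x + 1)" using y by (simp add: pw_diff_commute)
  thus y0: "y ~= 0" "val y = val x" using val_congruent[OF x, of y] by blast+
  have "inverse y - inverse x = (- inverse x * inverse y) * (y - x)" using x y0 by (simp add: field_simps)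
  thus "inverse y - inverse x \<in> pw n \<longleftrightarrow> y - x \<in> pw (n + 2 * val x)"
   using x y0 pw_mult_iff[of "- inverse x * inverse y" "y - x" n] val_minus[of "inverse x * inverse y"]
   by (simp add: val_mult val_inverse)
qed

lemma inverse_measurable: "inverse \<in> borel_measurable (borel::'a::nonarch_local_field measure)"
proof -
  have "continuous_on (- {0::'a}) inverse" unfolding continuous_on_topological proof (intro ballI allI impI)
   fix x :: 'a and B assume x: "x \<in> - {0}" "open B" "inverse x \<in> B"
   obtain n where n: "!!y. y - inverse x \<in> pw n ==> y \<in> B" using x unfolding open_pw_iff by blast
   let ?k = "max (val x + 1) (n + 2 * val x)"
   have "inverse y \<in> B" if "y - x \<in> pw ?k" for y
    using n[of "inverse y"] inverse_near(3)[of x y n] pw_mono[OF _ that] x by simp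
   hence "open {y. y - x \<in> pw ?k} & x \<in> {y. y - x \<in> pw ?k} &
     (\<forall>y\<in>- {0}. y \<in> {y. y - x \<in> pw ?k} --> inverse y \<in> B)" using open_coset[of x ?k] by (simp del: max.bounded_iff)
   thus "\<exists>U. open U & x \<in> U & (\<forall>y\<in>- {0}. y \<in> U --> inverse y \<in> B)" by blast
  qed
  hence "(%x. if x \<in> {0} then 0 else inverse x) \<in> borel_measurable (borel::'a measure)"
   by (intro borel_measurable_continuous_on_if) auto
  moreover have "(%x. if x \<in> {0} then 0 else inverse x) = (inverse :: 'a => 'a)" by auto
  ultimately show ?thesis by simp
qed

lemma absv_measurable: "absv \<in> borel_measurable (borel::'a::nonarch_local_field measure)"
proof (rule measurable_locally_constant_on[of "{0}"])
 fix x :: 'a assume x: "x \<notin> {0}"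
 have "absv y = absv x" if "y - x \<in> pw (val x + 1)" for y using inverse_near(1,2)[OF _ that] x by (simp add: absv_def)
 thus "\<exists>n. \<forall>y. y - x \<in> pw n --> absv y = absv x" by blast
qed auto

text \<open>A ball of level n around \<open>c\<close> that avoids 0 has as preimage the ball of
  level n - 2 val c around 1/c. The density is constant there and makes up for the change of level.
  This is the Jacobian of w = 1/x.\<close>

lemma distr_inverse:
 assumes M: "normalized_haar (M::'a::nonarch_local_field measure)"
 shows "distr (density M (%w. ennreal (inverse (absv w ^ 2)))) borel inverse = M"
proof -
 let ?N = "density M (%w::'a. ennreal (inverse (absv w ^ 2)))"
 note q = qr_pos[where 'a='a]
 have sp: "space M = UNIV" "sets M = sets borel" using normalized_haarD[OF M] by auto
 have inv_N: "inverse \<in> borel_measurable ?N" using haar_borel_measurable[OF M inverse_measurable] by simp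
 have absv_meas: "(%w::'a. ennreal (inverse (absv w ^ 2))) \<in> borel_measurable M"
  using haar_borel_measurable[OF M absv_measurable] by measurable
 have eq: "emeasure (distr ?N borel inverse) {x. x - c \<in> pw n} = ennreal (qr TYPE('a) powi (- n))"
  if c: "0 \<notin> {x. x - c \<in> pw n}" for c n proof -
  have c0: "c ~= 0" "val c < n" using c by (auto simp: pw_def)
  have i0: "inverse c ~= 0" "val (inverse c) = - val c" using c0 by (auto simp: val_inverse)
  let ?k = "n - 2 * val c"
  have k1: "val (inverse c) + 1 \<le> ?k" using c0 i0 by simp
  have pre: "inverse -` {x. x - c \<in> pw n} = {w. w - inverse c \<in> pw ?k}" proof (intro set_eqI iffI)
   fix w assume "w \<in> inverse -` {x. x - c \<in> pw n}"
   hence w: "inverse w - c \<in> pw n" by simp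
   have "inverse (inverse w) - inverse c \<in> pw ?k"
    using inverse_near(3)[of c "inverse w" ?k] c0 pw_mono[OF _ w, of "val c + 1"] w by simp
   thus "w \<in> {w. w - inverse c \<in> pw ?k}" by simp
  next
   fix w assume "w \<in> {w. w - inverse c \<in> pw ?k}"
   hence w: "w - inverse c \<in> pw ?k" by simp
   have "inverse w - inverse (inverse c) \<in> pw n" using inverse_near(3)[of "inverse c" w n] i0 pw_mono[OF k1 w] w by simp
   thus "w \<in> inverse -` {x. x - c \<in> pw n}" by simp
  qed
  have "emeasure (distr ?N borel inverse) {x. x - c \<in> pw n} = emeasure ?N {w. w - inverse c \<in> pw ?k}"
   using emeasure_distr[OF inv_N, of "{x. x - c \<in> pw n}"] pre sp by simp
  also have "\<dots> = (\<integral>\<^sup>+ w. ennreal (inverse (absv w ^ 2)) * indicator {w. w - inverse c \<in> pw ?k} w \<partial>M)"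
   using absv_meas sp by (intro emeasure_density) auto
  also have "\<dots> = (\<integral>\<^sup>+ w. ennreal (qr TYPE('a) powi (- (2 * val c))) * indicator {w. w - inverse c \<in> pw ?k} w \<partial>M)"
  proof (rule nn_integral_cong)
   fix w
   show "ennreal (inverse (absv w ^ 2)) * indicator {w. w - inverse c \<in> pw ?k} w =
     ennreal (qr TYPE('a) powi (- (2 * val c))) * indicator {w. w - inverse c \<in> pw ?k} w"
   proof (cases "w - inverse c \<in> pw ?k")
    case True
    hence "w ~= 0" "val w = - val c" using inverse_near(1,2)[OF i0(1) pw_mono[OF k1 True]] i0 by auto
    hence "inverse (absv w ^ 2) = qr TYPE('a) powi (- (2 * val c))"
     using q by (simp add: absv_def power2_eq_square power_int_minus flip: power_int_add)
    thus ?thesis by simp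
   qed simp
  qed
  also have "\<dots> = ennreal (qr TYPE('a) powi (- (2 * val c))) * ennreal (qr TYPE('a) powi (- ?k))"
   using sp by (subst nn_integral_cmult_indicator) (auto simp: emeasure_coset[OF M])
  also have "\<dots> = ennreal (qr TYPE('a) powi (- (2 * val c)) * qr TYPE('a) powi (- ?k))"
   using q by (simp add: ennreal_mult)
  also have "qr TYPE('a) powi (- (2 * val c)) * qr TYPE('a) powi (- ?k) = qr TYPE('a) powi (- n)"
   using q by (simp flip: power_int_add)
  finally show ?thesis .
 qed
 show ?thesis proof (rule measure_eq_on_cosets)
  fix c :: 'a and n assume c: "0 \<notin> {x. x - c \<in> pw n}"
  show "emeasure (distr ?N borel inverse) {x. x - c \<in> pw n} = emeasure M {x. x - c \<in> pw n}"
   using eq[OF c] emeasure_coset[OF M] by simp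
  show "emeasure (distr ?N borel inverse) {x. x - c \<in> pw n} ~= \<infinity>" using eq[OF c] by simp
 next
  have "inverse -` {0} = {0::'a}" by auto
  hence "emeasure (distr ?N borel inverse) {0} = emeasure ?N {0}"
   using emeasure_distr[OF inv_N, of "{0}"] sp by (simp add: borel_closed)
  also have "\<dots> = (\<integral>\<^sup>+ w. ennreal (inverse (absv w ^ 2)) * indicator {0} w \<partial>M)"
   using absv_meas sp by (intro emeasure_density) (auto simp: borel_closed)
  \<comment> \<open>At \<open>w = 0\<close> the density is \<open>inverse 0 = 0\<close>.\<close>
  also have "\<dots> = (\<integral>\<^sup>+ w. 0 \<partial>M)" by (intro nn_integral_cong) (auto simp: indicator_def)
  finally show "emeasure (distr ?N borel inverse) {0} = 0" by simp
 qed (simp_all add: sp emeasure_singleton_zero[OF M])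
qed

lemma inversion_density:
 fixes f :: "'a::nonarch_local_field => complex"
 assumes M: "normalized_haar M" and f: "f \<in> borel_measurable borel"
 shows integrable_inversion: "integrable M f \<longleftrightarrow> integrable M (%w. of_real (inverse (absv w ^ 2)) * f (inverse w))"
  and integral_inversion: "integral\<^sup>L M f = (LINT w|M. of_real (inverse (absv w ^ 2)) * f (inverse w))"
proof -
 let ?N = "density M (%w::'a. ennreal (inverse (absv w ^ 2)))"
 have inv_N: "inverse \<in> borel_measurable ?N" using haar_borel_measurable[OF M inverse_measurable] by simp
 have g: "(%w. inverse (absv w ^ 2)) \<in> borel_measurable M"
  using haar_borel_measurable[OF M absv_measurable] by measurable
 have fi: "(%w. f (inverse w)) \<in> borel_measurable M"
  using haar_borel_measurable[OF M measurable_compose[OF inverse_measurable f]] .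
 have "integrable M f \<longleftrightarrow> integrable ?N (%w. f (inverse w))"
  using integrable_distr_eq[OF inv_N f] by (simp add: distr_inverse[OF M])
 thus "integrable M f \<longleftrightarrow> integrable M (%w. of_real (inverse (absv w ^ 2)) * f (inverse w))"
  using integrable_density[OF fi g] by (simp add: scaleR_conv_of_real)
 have "integral\<^sup>L M f = integral\<^sup>L ?N (%w. f (inverse w))"
  using integral_distr[OF inv_N f] by (simp add: distr_inverse[OF M])
 thus "integral\<^sup>L M f = (LINT w|M. of_real (inverse (absv w ^ 2)) * f (inverse w))"
  using integral_density[OF fi g] by (simp add: scaleR_conv_of_real)
qed

section \<open>Quadratic extensions and lattices\<close>

text \<open>Sending each element to the representative of its class matches any two systems. A
  residue cardinality can thus be read off from a system obtained in another field.\<close>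

lemma residue_system_card:
 fixes R :: "'a::nonarch_local_field set"
 assumes R: "R \<subseteq> pw n" "\<forall>x\<in>pw n. \<exists>!c. c \<in> R & x - c \<in> pw k" and "n \<le> k"
 shows "card R = residue_card TYPE('a) ^ nat (k - n)"
proof -
 obtain S :: "'a set" where S: "residue_reps n k S" using ex_residue_reps[OF assms(3)] by blast
 hence S': "S \<subseteq> pw n" "\<forall>x\<in>pw n. \<exists>!c. c \<in> S & x - c \<in> pw k" by (auto simp: residue_reps_def)
 have "\<exists>f. \<forall>x\<in>pw n. f x \<in> S & x - f x \<in> pw k" using S'(2) by (intro bchoice) blast
 then obtain f where f: "!!x. x \<in> pw n ==> f x \<in> S" "!!x. x \<in> pw n ==> x - f x \<in> pw k" by blast
 have "bij_betw f R S" unfolding bij_betw_def proof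
  show "inj_on f R" proof (rule inj_onI)
   fix x y assume xy: "x \<in> R" "y \<in> R" "f x = f y"
   have "x - y \<in> pw k" using pw_diff_trans[OF f(2)[of x], of y] f(2)[of y] xy R(1) by (auto simp: pw_diff_commute)
   moreover have "y - y \<in> pw k" "x - x \<in> pw k" "x \<in> pw n" using xy R(1) by auto
   ultimately show "x = y" using R(2) xy by blast
  qed
  show "f ` R = S" proof (intro equalityI subsetI)
   fix s assume s: "s \<in> S"
   then obtain c where c: "c \<in> R" "s - c \<in> pw k" using R(2) S'(1) by blast
   have "s - f c \<in> pw k" "s - s \<in> pw k" using pw_diff_trans[OF c(2) f(2)] c R(1) by auto
   hence "f c = s" using S'(2) s S'(1) f(1)[of c] c R(1) by blast
   thus "s \<in> f ` R" using c by blast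
  qed (use f R(1) in blast)
 qed
 hence "card R = card S" by (rule bij_betw_same_card)
 thus ?thesis using S by (simp add: residue_reps_def)
qed

lemma continuous_pwI:
 fixes f :: "'a::nonarch_local_field => 'b::nonarch_local_field"
 assumes "!!n x. \<exists>m. \<forall>y. y - x \<in> pw m --> f y - f x \<in> pw n" shows "continuous_on UNIV f"
 unfolding continuous_on_open_vimage[OF open_UNIV] Int_UNIV_right
proof safe
 fix B :: "'b set" assume B: "open B"
 show "open (f -` B)" unfolding open_pw_iff proof
  fix x assume "x \<in> f -` B"
  then obtain n where n: "!!y. y - f x \<in> pw n ==> y \<in> B" using B unfolding open_pw_iff by auto
  obtain m where "\<forall>y. y - x \<in> pw m --> f y - f x \<in> pw n" using assms by blast
  thus "\<exists>n. \<forall>y. y - x \<in> pw n --> y \<in> f -` B" using n by blast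
 qed
qed

locale field_embedding =
 fixes J :: "'f::nonarch_local_field => 'e::nonarch_local_field"
 assumes emb_one: "J 1 = 1" and emb_add: "J (x + y) = J x + J y" and emb_mult: "J (x * y) = J x * J y"
begin

lemma emb_zero [simp]: "J 0 = 0" using emb_add[of 0 0] by (metis add_0 add_cancel_right_right)

lemma emb_minus: "J (- x) = - J x" using emb_add[of x "- x"] by (simp add: eq_neg_iff_add_eq_0 add.commute)

lemma emb_diff: "J (x - y) = J x - J y" using emb_add[of x "- y"] by (simp add: emb_minus)

lemma emb_eq_0_iff [simp]: "J x = 0 \<longleftrightarrow> x = 0"
proof
 assume "J x = 0"
 thus "x = 0" using emb_mult[of x "inverse x"] emb_one by (cases "x = 0") auto
qed simp

lemma emb_eq_iff [simp]: "J x = J y \<longleftrightarrow> x = y" using emb_eq_0_iff[of "x - y"] by (simp only: emb_diff right_minus_eq)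

lemma emb_inverse: "J (inverse x) = inverse (J x)"
proof (cases "x = 0")
 case False
 hence "J x * J (inverse x) = 1" using emb_mult[of x "inverse x"] emb_one by simp
 thus ?thesis using inverse_unique by metis
qed simp

lemma emb_divide: "J (x / y) = J x / J y" by (simp add: divide_inverse emb_mult emb_inverse)

lemma emb_power: "J (x ^ n) = J x ^ n" by (induction n) (simp_all add: emb_one emb_mult)

lemma emb_power_int: "J (x powi n) = J x powi n" by (simp add: power_int_def emb_power emb_inverse)

end

text \<open>What the analysis uses of the extension, in one form for both types: \<open>e\<close> is
  the ramification index, \<open>card_ext\<close> is the equation ef = 2, and \<open>lattice\<close>
  says that the integers of E are spanned by 1 and \<beta> over those of F.\<close>

locale lattice_extension = field_embedding J
 for J :: "'f::nonarch_local_field => 'e::nonarch_local_field" +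
 fixes \<beta> :: 'e and e :: int
 assumes e_pos: "e > 0" and val_emb: "x ~= 0 ==> val (J x) = e * val x"
  and card_ext: "qr TYPE('e) powi e = qr TYPE('f) ^ 2" and spanned: "\<exists>x y. z = J x + J y * \<beta>"
  and lattice: "J x + J y * \<beta> \<in> pw (e * k) \<longleftrightarrow> x \<in> pw k & y \<in> pw k"
begin

lemma basis_zero: "J x + J y * \<beta> = 0 \<longleftrightarrow> x = 0 & y = 0"
proof
 assume *: "J x + J y * \<beta> = 0"
 have "x \<in> pw k & y \<in> pw k" for k using lattice[of x y k] * by simp
 thus "x = 0 & y = 0" using pw_nat_ex by blast
qed simp

lemma basis_inj: "J x + J y * \<beta> = J x' + J y' * \<beta> \<longleftrightarrow> x = x' & y = y'"
 using basis_zero[of "x - x'" "y - y'"] by (auto simp: emb_diff algebra_simps)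

text \<open>Coordinates with respect to \<beta>; the functions \<open>coord1\<close> and
  \<open>coord2\<close> in the kernel refer to \<alpha>.\<close>

definition c1 :: "'e => 'f" where "c1 z = (THE x. \<exists>y. z = J x + J y * \<beta>)"
definition c2 :: "'e => 'f" where "c2 z = (THE y. \<exists>x. z = J x + J y * \<beta>)"

lemma c1_basis [simp]: "c1 (J x + J y * \<beta>) = x" unfolding c1_def by (rule the_equality) (auto simp: basis_inj)

lemma c2_basis [simp]: "c2 (J x + J y * \<beta>) = y" unfolding c2_def by (rule the_equality) (auto simp: basis_inj)

lemma decompose: "z = J (c1 z) + J (c2 z) * \<beta>" using spanned[of z] by auto

lemma coords_eqI: "z = J x + J y * \<beta> ==> c1 z = x & c2 z = y" by simp

lemma coords_eq_iff: "z = w \<longleftrightarrow> c1 z = c1 w & c2 z = c2 w" using decompose by metis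

lemma c_add: "c1 (z + w) = c1 z + c1 w" "c2 (z + w) = c2 z + c2 w"
proof -
 obtain x y x' y' where zw: "z = J x + J y * \<beta>" "w = J x' + J y' * \<beta>" using spanned by metis
 hence "z + w = J (x + x') + J (y + y') * \<beta>" by (simp add: emb_add algebra_simps)
 thus "c1 (z + w) = c1 z + c1 w" "c2 (z + w) = c2 z + c2 w" using coords_eqI zw by metis+
qed

lemma c_smult: "c1 (J a * z) = a * c1 z" "c2 (J a * z) = a * c2 z"
proof -
 obtain x y where z: "z = J x + J y * \<beta>" using spanned by metis
 hence "J a * z = J (a * x) + J (a * y) * \<beta>" by (simp add: emb_mult algebra_simps)
 thus "c1 (J a * z) = a * c1 z" "c2 (J a * z) = a * c2 z" using coords_eqI z by metis+
qed

lemma c_emb [simp]: "c1 (J x) = x" "c2 (J x) = 0" using coords_eqI[of "J x" x 0] by auto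

lemma c_beta [simp]: "c1 \<beta> = 0" "c2 \<beta> = 1" using coords_eqI[of \<beta> 0 1] by (auto simp: emb_one)

lemma c_zero [simp]: "c1 0 = 0" "c2 0 = 0" using c_emb[of 0] by auto

lemma c_minus: "c1 (- z) = - c1 z" "c2 (- z) = - c2 z"
 using c_add[of z "- z"] by (auto simp: eq_neg_iff_add_eq_0 add.commute)

lemma c_diff: "c1 (z - w) = c1 z - c1 w" "c2 (z - w) = c2 z - c2 w" using c_add[of z "- w"] by (simp_all add: c_minus)

lemma pw_coords: "z \<in> pw (e * k) \<longleftrightarrow> c1 z \<in> pw k & c2 z \<in> pw k" by (metis decompose lattice)

lemma c2_eq_0_iff: "c2 z = 0 \<longleftrightarrow> z \<in> range J"
proof
 assume "c2 z = 0"
 hence "z = J (c1 z)" by (metis decompose add.right_neutral emb_zero mult_zero_left)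
 thus "z \<in> range J" by blast
qed auto

lemma pw_emb: "J x \<in> pw (e * k) \<longleftrightarrow> x \<in> pw k" by (simp add: pw_coords)

lemma continuous_c1: "continuous_on UNIV c1" and continuous_c2: "continuous_on UNIV c2"
proof -
 have "\<forall>y. y - x \<in> pw (e * n) --> c1 y - c1 x \<in> pw n" "\<forall>y. y - x \<in> pw (e * n) --> c2 y - c2 x \<in> pw n" for x n
  by (auto simp: pw_coords c_diff)
 thus "continuous_on UNIV c1" "continuous_on UNIV c2" by (blast intro: continuous_pwI)+
qed

lemma measurable_c1: "c1 \<in> borel_measurable borel" and measurable_c2: "c2 \<in> borel_measurable borel"
 using continuous_c1 continuous_c2 by (auto intro: borel_measurable_continuous_onI)

lemma closed_range_emb: "closed (range J)"
proof -
 have "range J = c2 -` {0}" using c2_eq_0_iff by auto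
 moreover have "closed (c2 -` {0})" using continuous_on_closed_vimage[of UNIV c2] continuous_c2 by auto
 ultimately show ?thesis by simp
qed

lemma qE_pow: "qr TYPE('e) powi (e * n) = qr TYPE('f) powi (2 * n)"
proof -
 have "qr TYPE('e) powi (e * n) = (qr TYPE('e) powi e) powi n" by (simp add: power_int_mult)
 thus ?thesis by (simp add: card_ext power_int_mult)
qed

lemma absv_emb: "absv (J x) = absv x ^ 2"
proof (cases "x = 0")
 case False
 have "absv (J x) = qr TYPE('e) powi (e * (- val x))" using False by (simp add: absv_def val_emb)
 also have "\<dots> = qr TYPE('f) powi (2 * (- val x))" by (rule qE_pow)
 also have "\<dots> = absv x ^ 2"
  using False power_int_mult[of "qr TYPE('f)" "- val x" 2] by (simp add: absv_def mult.commute)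
 finally show ?thesis .
qed simp

lemma qexp_ext: "qexp TYPE('e) s powi e = qexp TYPE('f) (2 * s)"
proof -
 have "ln (qr TYPE('e) powi e) = real_of_int e * ln (qr TYPE('e))"
  using qr_pos[where 'a='e] powr_real_of_int'[of "qr TYPE('e)" e] ln_powr[of "qr TYPE('e)" "of_int e"] by simp
 hence "real_of_int e * ln (qr TYPE('e)) = 2 * ln (qr TYPE('f))"
  using card_ext qr_pos[where 'a='f] by (simp add: ln_realpow)
 hence "of_int e * complex_of_real (ln (qr TYPE('e))) = 2 * complex_of_real (ln (qr TYPE('f)))"
  by (metis of_real_mult of_real_numeral of_real_of_int_eq)
 hence F: "of_int e * s * complex_of_real (ln (qr TYPE('e))) = 2 * s * complex_of_real (ln (qr TYPE('f)))"
  by (metis mult.assoc mult.commute)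
 show ?thesis by (simp only: qexp_powi) (simp only: qexp_def F)
qed

text \<open>The longer side is cut into q^(b - a) pieces of the length of the shorter one, which
  leaves translates of \<open>pw (e * b)\<close>, each of measure q^(-2b).\<close>

lemma emeasure_box:
 assumes M: "normalized_haar (M::'e measure)" and ab: "a \<le> b"
 shows "emeasure M {w. c1 w \<in> pw a & c2 w \<in> pw b} = ennreal (qr TYPE('f) powi (- a - b))"
  and "emeasure M {w. c1 w \<in> pw b & c2 w \<in> pw a} = ennreal (qr TYPE('f) powi (- a - b))"
proof -
 obtain R :: "'f set" where R: "residue_reps a b R" using ex_residue_reps[OF ab] by blast
 note q = qr_pos[where 'a='f]
 have sM: "sets M = sets borel" by (rule normalized_haarD(1)[OF M])
 have *: "emeasure M (\<Union>c\<in>R. {w. w - f c \<in> pw (e * b)}) = ennreal (qr TYPE('f) powi (- a - b))"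
  if f: "!!c d. f c - f d \<in> pw (e * b) ==> c - d \<in> pw b" for f :: "'f => 'e" proof -
  have "disjoint_family_on (%c. {w. w - f c \<in> pw (e * b)}) R" unfolding disjoint_family_on_def proof (intro ballI impI)
   fix c d assume cd: "c \<in> R" "d \<in> R" "c ~= d"
   have "False" if w: "w - f c \<in> pw (e * b)" "w - f d \<in> pw (e * b)" for w proof -
    have "f c - f d \<in> pw (e * b)" using pw_diff_trans[of "f c" w _ "f d"] w by (simp add: pw_diff_commute)
    hence "c - d \<in> pw b" "c - c \<in> pw b" "c \<in> pw a" using f cd R by (auto simp: residue_reps_def)
    thus False using R cd unfolding residue_reps_def by blast
   qed
   thus "{w. w - f c \<in> pw (e * b)} \<inter> {w. w - f d \<in> pw (e * b)} = {}" by blast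
  qed
  hence "emeasure M (\<Union>c\<in>R. {w. w - f c \<in> pw (e * b)}) = (\<Sum>c\<in>R. emeasure M {w. w - f c \<in> pw (e * b)})"
   using R sM by (intro sum_emeasure[symmetric]) (auto simp: residue_reps_def)
  also have "\<dots> = of_nat (card R) * ennreal (qr TYPE('f) powi (- 2 * b))"
   using qE_pow[of "- b"] by (simp add: emeasure_coset[OF M])
  also have "\<dots> = ennreal (qr TYPE('f) ^ nat (b - a)) * ennreal (qr TYPE('f) powi (- 2 * b))"
   using R by (simp add: residue_reps_def ennreal_of_nat_eq_real_of_nat)
  also have "qr TYPE('f) ^ nat (b - a) = qr TYPE('f) powi (b - a)" using ab by (simp add: power_int_def)
  also have "ennreal (qr TYPE('f) powi (b - a)) * ennreal (qr TYPE('f) powi (- 2 * b)) = ennreal (qr TYPE('f) powi (b - a) * qr TYPE('f) powi (- 2 * b))"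
   using q by (intro ennreal_mult[symmetric]) auto
  also have "qr TYPE('f) powi (b - a) * qr TYPE('f) powi (- 2 * b) = qr TYPE('f) powi (- a - b)"
   using q by (subst power_int_add[symmetric]) (simp_all add: algebra_simps)
  finally show ?thesis .
 qed
 have sub: "x \<in> pw a \<longleftrightarrow> (\<exists>c\<in>R. x - c \<in> pw b)" for x proof
  assume "\<exists>c\<in>R. x - c \<in> pw b"
  then obtain c where c: "c \<in> R" "x - c \<in> pw b" by blast
  thus "x \<in> pw a" using pw_add[OF pw_mono[OF ab c(2)], of c] R by (auto simp: residue_reps_def)
 qed (use R in \<open>auto simp: residue_reps_def\<close>)
 have 1: "{w. c1 w \<in> pw a & c2 w \<in> pw b} = (\<Union>c\<in>R. {w. w - J c \<in> pw (e * b)})" by (auto simp: pw_coords c_diff sub)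
 have 2: "{w. c1 w \<in> pw b & c2 w \<in> pw a} = (\<Union>c\<in>R. {w. w - J c * \<beta> \<in> pw (e * b)})"
  by (auto simp: pw_coords c_diff sub c_smult)
 show "emeasure M {w. c1 w \<in> pw a & c2 w \<in> pw b} = ennreal (qr TYPE('f) powi (- a - b))"
  unfolding 1 by (rule *) (simp add: pw_coords c_diff)
 show "emeasure M {w. c1 w \<in> pw b & c2 w \<in> pw a} = ennreal (qr TYPE('f) powi (- a - b))"
  unfolding 2 by (rule *) (simp add: pw_coords c_diff c_smult)
qed

definition strip :: "'f => int => 'e set" where
 "strip y k = {w. c2 w - y \<in> pw k}"

lemma strip_borel: "strip y k \<in> sets borel"
proof -
 have "c2 -` {x. x - y \<in> pw k} \<inter> space borel \<in> sets borel" by (rule measurable_sets[OF measurable_c2]) measurable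
 thus ?thesis by (simp add: strip_def vimage_def)
qed

end

lemma val_not_divisible:
 assumes "x ~= 0" "y ~= 0" "val x ~= val (y::'a::nonarch_local_field)"
 shows "x + y \<in> pw n \<longleftrightarrow> x \<in> pw n & y \<in> pw n"
proof (cases "val x < val y")
 case True
 hence "x + y ~= 0" "val (x + y) = val x" using val_add_eq[OF assms(1), of y] by (auto simp: pw_def)
 thus ?thesis using True assms by (auto simp: pw_def)
next
 case False
 hence "y + x ~= 0" "val (y + x) = val y" using val_add_eq[OF assms(2), of x] assms by (auto simp: pw_def)
 thus ?thesis using False assms by (auto simp: pw_def add.commute)
qed

section \<open>Integral bases for the ramified and the unramified extension\<close>

context quadratic_local_extension
begin

sublocale field_embedding \<iota> by unfold_locales (rule \<iota>_one \<iota>_add \<iota>_mult)+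

text \<open>Continuity of the embedding keeps the image of the compact unit group bounded, and an
  element whose powers are all bounded has absolute value at most 1. The inverse supplies the
  opposite bound.\<close>

lemma emb_unit: 
 assumes "x \<in> int_units" shows "\<iota> x \<in> int_units"
proof -
 have "compact (\<iota> ` int_units)"
  using \<iota>_continuous continuous_on_subset compact_int_units by (intro compact_continuous_image) auto
 then obtain B where B: "!!y. y \<in> int_units ==> dist 0 (\<iota> y) \<le> B"
  using compact_imp_bounded bounded_any_center[of "\<iota> ` int_units" 0] by auto
 have le: "vnorm (\<iota> y) \<le> 1" if y: "y \<in> int_units" for y proof (rule ccontr)
  assume "\<not> vnorm (\<iota> y) \<le> 1"
  then obtain k where "B < vnorm (\<iota> y) ^ k" using real_arch_pow[of "vnorm (\<iota> y)" B] by auto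
  moreover have "y ^ k \<in> int_units" using y by (simp add: int_units_def vnorm_power)
  ultimately show False using B[of "y ^ k"] dist_zero_vnorm[of "\<iota> (y ^ k)"]
   by (simp add: dist_commute emb_power vnorm_power)
 qed
 have "inverse x \<in> int_units" using assms by (simp add: int_units_def vnorm_inverse)
 hence "inverse (vnorm (\<iota> x)) \<le> 1" using le[of "inverse x"] by (simp add: emb_inverse vnorm_inverse)
 moreover have "x ~= 0" using assms by (auto simp: int_units_def)
 hence "vnorm (\<iota> x) > 0" by simp
 ultimately show ?thesis using le[OF assms] by (auto simp: int_units_def inverse_le_1_iff)
qed

definition ram :: int where "ram = (if unramified \<iota> then 1 else 2)"

lemma val_emb_uniformizer: "\<iota> pF ~= 0" "val (\<iota> pF) = ram"
proof -
 have p: "pE ~= 0" "val pE = 1" "pF ~= 0" using uniformizer_E uniformizer_F by (auto simp: uniformizer_iff_val)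
 thus "\<iota> pF ~= 0" by simp
 show "val (\<iota> pF) = ram" using p uniformizers_compatible val_power[OF p(1), of 2]
  by (auto simp: ram_def split: if_splits)
qed

lemma val_emb_ram: 
 assumes "x ~= 0" shows "val (\<iota> x) = ram * val x"
proof -
 have p: "pF ~= 0" "val pF = 1" using uniformizer_F by (auto simp: uniformizer_iff_val)
 define u where "u = ang pF x"
 have u: "u \<in> int_units" "u ~= 0" using ang_unit[OF uniformizer_F assms] by (auto simp: u_def int_units_val)
 have x: "x = pF powi val x * u" using p by (simp add: u_def ang_def power_int_minus)
 have "\<iota> u \<in> int_units" by (rule emb_unit[OF u(1)])
 hence "val (\<iota> u) = 0" by (simp add: int_units_val)
 have "val (\<iota> x) = val (\<iota> pF powi val x * \<iota> u)" by (subst x) (simp only: emb_mult emb_power_int)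
 also have "\<dots> = val x * ram"
  using u p \<open>val (\<iota> u) = 0\<close> by (simp add: val_mult val_power_int val_emb_uniformizer)
 finally show ?thesis by simp
qed

text \<open>\<alpha> has valuation one while elements of F have even valuation, so the two terms of
  \<open>\<iota> x + \<iota> y * \<alpha>\<close> cannot cancel. For an integer the second term lies
  in the maximal ideal, hence the residue fields agree.\<close>

lemma ramified_lattice:
 assumes "\<not> unramified \<iota>"
 shows "lattice_extension \<iota> \<alpha> 2" "val \<alpha> = 1" "\<alpha> ~= 0" "residue_card TYPE('e) = residue_card TYPE('f)"
proof -
 have ram: "ram = 2" using assms by (simp add: ram_def)
 have d: "d ~= 0" "val d = 1" using d_normalised assms by (auto simp: uniformizer_iff_val)
 show a0: "\<alpha> ~= 0" using \<alpha>_square d by auto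
 have "val (\<alpha> ^ 2) = 2" unfolding \<alpha>_square using d ram by (simp add: val_emb_ram)
 thus a1: "val \<alpha> = 1" using a0 by (simp add: val_power)
 have split: "\<iota> x + \<iota> y * \<alpha> \<in> pw n \<longleftrightarrow> \<iota> x \<in> pw n & \<iota> y * \<alpha> \<in> pw n" for x y n proof (cases "x = 0 \<or> y = 0")
  case False
  hence "val (\<iota> x) = 2 * val x" "val (\<iota> y * \<alpha>) = 2 * val y + 1" using a0 a1 ram by (simp_all add: val_emb_ram val_mult)
  hence "val (\<iota> x) ~= val (\<iota> y * \<alpha>)" by presburger
  thus ?thesis using False a0 by (intro val_not_divisible) auto
 qed auto
 have in1: "\<iota> x \<in> pw (2 * k) \<longleftrightarrow> x \<in> pw k" for x k by (cases "x = 0") (auto simp: pw_def val_emb_ram ram)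
 have in2: "\<iota> y * \<alpha> \<in> pw (2 * k) \<longleftrightarrow> y \<in> pw k" for y k
  using a0 a1 by (cases "y = 0") (auto simp: pw_def val_emb_ram ram val_mult)
 obtain R :: "'f set" where R: "residue_reps 0 1 R" using ex_residue_reps_one by blast
 have R': "R \<subseteq> pw 0" "!!x. x \<in> pw 0 ==> \<exists>!c. c \<in> R & x - c \<in> pw 1" using R by (auto simp: residue_reps_def)
 have "card (\<iota> ` R) = residue_card TYPE('e) ^ nat (1 - 0)" proof (rule residue_system_card)
  show "\<iota> ` R \<subseteq> pw 0" using R'(1) in1[of _ 0] by auto
  show "\<forall>x\<in>pw 0. \<exists>!c. c \<in> \<iota> ` R & x - c \<in> pw 1" proof
   fix z :: 'e assume z: "z \<in> pw 0"
   obtain x y where xy: "z = \<iota> x + \<iota> y * \<alpha>" using generated by blast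
   have "\<iota> x \<in> pw 0" "\<iota> y * \<alpha> \<in> pw 0" using z split[of x y 0] xy by auto
   hence "x \<in> pw 0" "y \<in> pw 0" using in1[of x 0] in2[of y 0] by auto
   have y1: "\<iota> y * \<alpha> \<in> pw 1"
    using \<open>y \<in> pw 0\<close> a0 a1 by (cases "y = 0") (auto simp: pw_def val_emb_ram ram val_mult)
   have iff: "z - \<iota> c \<in> pw 1 \<longleftrightarrow> x - c \<in> pw 1" for c proof -
    have "z - \<iota> c = \<iota> (x - c) + \<iota> y * \<alpha>" by (simp add: xy emb_diff)
    hence "z - \<iota> c \<in> pw 1 \<longleftrightarrow> \<iota> (x - c) \<in> pw 1" using pw_add_cancel[OF y1] by simp
    also have "\<dots> \<longleftrightarrow> x - c \<in> pw 1" by (cases "x = c") (auto simp: pw_def val_emb_ram ram)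
    finally show ?thesis .
   qed
   show "\<exists>!c. c \<in> \<iota> ` R & z - c \<in> pw 1" using R'(2)[OF \<open>x \<in> pw 0\<close>] iff by (auto simp: image_iff)
  qed
 qed auto
 moreover have "card (\<iota> ` R) = card R" by (rule card_image) (simp add: inj_on_def)
 ultimately show q: "residue_card TYPE('e) = residue_card TYPE('f)" using R by (simp add: residue_reps_def)
 show "lattice_extension \<iota> \<alpha> 2" proof
  show "val (\<iota> x) = 2 * val x" if "x ~= 0" for x using val_emb_ram[OF that] ram by simp
  show "qr TYPE('e) powi 2 = qr TYPE('f) ^ 2" by (simp add: q)
  show "\<exists>x y. z = \<iota> x + \<iota> y * \<alpha>" for z by (rule generated)
  show "\<iota> x + \<iota> y * \<alpha> \<in> pw (2 * k) \<longleftrightarrow> x \<in> pw k & y \<in> pw k" for x y k by (simp add: split in1 in2)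
 qed simp
qed

text \<open>If every integer of E were congruent to one of F, the residue fields would have equal
  size, against the definition of \<open>unramified\<close>. An integer \<beta> with residue outside
  the smaller field makes every \<open>\<beta> + \<iota> c\<close> with integral \<open>c\<close> a
  unit, which excludes cancellation.\<close>

lemma unramified_lattice:
 assumes "unramified \<iota>" obtains \<beta> where "lattice_extension \<iota> \<beta> 1"
proof -
 have ram: "ram = 1" using assms by (simp add: ram_def)
 have q: "residue_card TYPE('e) = residue_card TYPE('f) ^ 2" using assms by (simp add: unramified_def)
 have in1: "\<iota> x \<in> pw k \<longleftrightarrow> x \<in> pw k" for x k by (cases "x = 0") (auto simp: pw_def val_emb_ram ram)
 have "\<exists>\<beta>. \<beta> \<in> pw 0 & (\<forall>c\<in>pw 0. \<beta> + \<iota> c \<notin> pw 1)" proof (rule ccontr)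
  assume H: "\<not> ?thesis"
  obtain R :: "'f set" where R: "residue_reps 0 1 R" using ex_residue_reps_one by blast
  have R': "R \<subseteq> pw 0" "!!x. x \<in> pw 0 ==> \<exists>!c. c \<in> R & x - c \<in> pw 1" using R by (auto simp: residue_reps_def)
  have "card (\<iota> ` R) = residue_card TYPE('e) ^ nat (1 - 0)" proof (rule residue_system_card)
   show "\<iota> ` R \<subseteq> pw 0" using R'(1) in1 by auto
   show "\<forall>x\<in>pw 0. \<exists>!c. c \<in> \<iota> ` R & x - c \<in> pw 1" proof
    fix z :: 'e assume z: "z \<in> pw 0"
    then obtain c where c: "c \<in> pw 0" "z + \<iota> c \<in> pw 1" using H by blast
    have iff: "z - \<iota> c' \<in> pw 1 \<longleftrightarrow> (- c) - c' \<in> pw 1" for c' proof -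
     have "z - \<iota> c' = \<iota> ((- c) - c') + (z + \<iota> c)" by (simp add: emb_diff emb_minus)
     thus ?thesis using pw_add_cancel[OF c(2)] in1 by metis
    qed
    show "\<exists>!c. c \<in> \<iota> ` R & z - c \<in> pw 1" using R'(2)[of "- c"] c(1) iff by (auto simp: image_iff)
   qed
  qed auto
  moreover have "card (\<iota> ` R) = card R" by (rule card_image) (simp add: inj_on_def)
  ultimately have "residue_card TYPE('e) = residue_card TYPE('f)" using R by (simp add: residue_reps_def)
  thus False using q residue_card_ge_2[where 'a='f] by (simp add: power2_eq_square)
 qed
 then obtain \<beta> where b: "\<beta> \<in> pw 0" "!!c. c \<in> pw 0 ==> \<beta> + \<iota> c \<notin> pw 1" by blast
 have unit: "\<beta> + \<iota> c ~= 0 & val (\<beta> + \<iota> c) = 0" if "c \<in> pw 0" for c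
  using b(2)[OF that] pw_add[OF b(1), of "\<iota> c"] in1[of c 0] that by (auto simp: pw_def)
 have lat: "\<iota> x + \<iota> y * \<beta> \<in> pw k \<longleftrightarrow> x \<in> pw k & y \<in> pw k" for x y k proof (cases "y = 0")
  case False
  have eq: "\<iota> x + \<iota> y * \<beta> = \<iota> y * (\<beta> + \<iota> (x / y))" using False by (simp add: emb_divide field_simps)
  show ?thesis proof (cases "x / y \<in> pw 0")
   case True
   have "x \<in> pw (val y)" using True False pw_mult_iff[of y "x / y" "val y"] by simp
   hence "y \<in> pw k ==> x \<in> pw k" using False pw_mono by (auto simp: pw_def)
   moreover have "val (\<iota> y * (\<beta> + \<iota> (x / y))) = val y" "\<iota> y * (\<beta> + \<iota> (x / y)) ~= 0"
    using unit[OF True] False by (auto simp: val_mult val_emb_ram ram)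
   ultimately show ?thesis unfolding eq using False by (auto simp: pw_def)
  next
   case 2: False
   hence x0: "x ~= 0" "val x < val y" using False by (auto simp: pw_def val_divide)
   have "val (\<iota> (x / y) + \<beta>) = val (\<iota> (x / y))" "\<iota> (x / y) + \<beta> ~= 0"
    using val_add_eq[of "\<iota> (x / y)" \<beta>] pw_mono[OF _ b(1), of "val (\<iota> (x / y)) + 1"] 2 x0 False
    by (auto simp: val_emb_ram ram val_divide)
   hence "\<iota> y * (\<beta> + \<iota> (x / y)) ~= 0" "val (\<iota> y * (\<beta> + \<iota> (x / y))) = val x"
    using x0 False by (auto simp: val_mult val_emb_ram ram val_divide add.commute)
   thus ?thesis unfolding eq using x0 False by (auto simp: pw_def)
  qed
 qed (simp add: in1)
 have "\<beta> \<notin> range \<iota>" proof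
  assume "\<beta> \<in> range \<iota>"
  then obtain c where "\<beta> = \<iota> c" by blast
  thus False using unit[of "- c"] b(1) in1[of c 0] by (simp add: emb_minus)
 qed
 have "lattice_extension \<iota> \<beta> 1" proof
  show "val (\<iota> x) = 1 * val x" if "x ~= 0" for x using val_emb_ram[OF that] ram by simp
  show "qr TYPE('e) powi 1 = qr TYPE('f) ^ 2" by (simp add: q)
  show "\<exists>x y. z = \<iota> x + \<iota> y * \<beta>" for z proof -
   obtain b1 b2 where bb: "\<beta> = \<iota> b1 + \<iota> b2 * \<alpha>" using generated by blast
   have b2: "b2 ~= 0" using bb \<open>\<beta> \<notin> range \<iota>\<close> by auto
   obtain z1 z2 where z: "z = \<iota> z1 + \<iota> z2 * \<alpha>" using generated by blast
   have "\<iota> (z2 / b2) * \<beta> = \<iota> (z2 * b1 / b2) + \<iota> z2 * \<alpha>" using b2 by (simp add: bb emb_divide emb_mult distrib_left)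
   hence "z = \<iota> (z1 - z2 * b1 / b2) + \<iota> (z2 / b2) * \<beta>" by (simp add: z emb_diff)
   thus ?thesis by blast
  qed
  show "\<iota> x + \<iota> y * \<beta> \<in> pw (1 * k) \<longleftrightarrow> x \<in> pw k & y \<in> pw k" for x y k using lat by simp
 qed simp
 thus thesis by (rule that)
qed

end

section \<open>Homogeneous distributions invariant under translation\<close>

lemma absv_inverse: "absv (inverse x) = inverse (absv (x::'a::nonarch_local_field))"
proof (cases "x = 0")
 case False
 have "absv x * absv (inverse x) = 1" using False by (simp flip: absv_mult) (simp add: absv_def)
 thus ?thesis using inverse_unique by metis
qed simp

lemma qr_powi_add: "qr TYPE('a::nonarch_local_field) powi (m + n) = qr TYPE('a) powi m * qr TYPE('a) powi n"
 using qr_pos[where 'a='a] by (simp add: power_int_add)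

lemma test_fun_shift:
 fixes \<psi> :: "'a::nonarch_local_field => complex"
 assumes "\<psi> \<in> TF" shows "(%w. \<psi> (w + b)) \<in> TF"
proof -
 obtain n m where nm: "periodic n \<psi>" "supported m \<psi>" using assms by (rule test_funE)
 obtain k where k: "b \<in> pw k" using in_some_pw by blast
 have "periodic n (%w. \<psi> (w + b))" unfolding periodic_def proof (intro allI impI)
  fix x y :: 'a assume "y - x \<in> pw n"
  thus "\<psi> (y + b) = \<psi> (x + b)" by (intro periodicD[OF nm(1)]) simp
 qed
 moreover have "supported (min m k) (%w. \<psi> (w + b))" unfolding supported_def proof (intro allI impI)
  fix x :: 'a assume x: "x \<notin> pw (min m k)"
  have "b \<in> pw (min m k)" using pw_mono[OF _ k] by simp
  hence "x + b \<notin> pw (min m k)" using x pw_add_cancel by blast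
  hence "x + b \<notin> pw m" using pw_mono[of "min m k" m] by auto
  thus "\<psi> (x + b) = 0" using nm(2) by (simp add: supported_def)
 qed
 ultimately show ?thesis using test_fun_UNIV_iff by blast
qed

lemma test_fun_scale:
 fixes \<psi> :: "'a::nonarch_local_field => complex"
 assumes "\<psi> \<in> TF" "a ~= 0" shows "(%w. \<psi> (a * w)) \<in> TF"
proof -
 obtain n m where nm: "periodic n \<psi>" "supported m \<psi>" using assms(1) by (rule test_funE)
 have "periodic (n - val a) (%w. \<psi> (a * w))" unfolding periodic_def proof (intro allI impI)
  fix x y :: 'a assume "y - x \<in> pw (n - val a)"
  hence "a * (y - x) \<in> pw n" using assms(2) by (simp add: pw_mult_iff)
  thus "\<psi> (a * y) = \<psi> (a * x)" by (intro periodicD[OF nm(1)]) (simp add: right_diff_distrib)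
 qed
 moreover have "supported (m - val a) (%w. \<psi> (a * w))" using nm(2) assms(2) by (simp add: supported_def pw_mult_iff)
 ultimately show ?thesis using test_fun_UNIV_iff by blast
qed

lemma ball_ind_split:
 assumes "residue_reps n k R" "n \<le> k" shows "ball_ind c n = (%x. \<Sum>h\<in>R. ball_ind (c + h) k x)"
proof
 fix x :: 'a
 show "ball_ind c n x = (\<Sum>h\<in>R. ball_ind (c + h) k x)" proof (cases "x - c \<in> pw n")
  case True
  then obtain h where h: "h \<in> R" "x - c - h \<in> pw k" "!!h'. h' \<in> R ==> x - c - h' \<in> pw k ==> h' = h"
   using assms unfolding residue_reps_def by blast
  have "(\<Sum>h\<in>R. ball_ind (c + h) k x) = (\<Sum>h'\<in>R. if h' = h then 1 else 0)" proof (intro sum.cong refl)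
   fix h' assume "h' \<in> R"
   hence "h' ~= h ==> x - c - h' \<notin> pw k" using h(3) by blast
   thus "ball_ind (c + h') k x = (if h' = h then 1 else 0)"
    using h(2) by (cases "h' = h") (simp_all add: ball_ind_def diff_diff_eq)
  qed
  also have "\<dots> = 1" using h(1) assms by (simp add: residue_reps_def)
  finally show ?thesis using True by (simp add: ball_ind_def)
 next
  case False
  show ?thesis proof (cases "\<exists>h\<in>R. x - (c + h) \<in> pw k")
   case True
   then obtain h where h: "h \<in> R" "x - c - h \<in> pw k" by (auto simp: diff_diff_eq)
   have "h \<in> pw n" using assms h by (auto simp: residue_reps_def)
   hence "x - c \<in> pw n" using pw_add[OF pw_mono[OF assms(2) h(2)] \<open>h \<in> pw n\<close>] by simp
   thus ?thesis using False by simp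
  next
   case 2: False
   hence "(\<Sum>h\<in>R. ball_ind (c + h) k x) = 0" by (intro sum.neutral) (simp add: ball_ind_def)
   thus ?thesis using False by (simp add: ball_ind_def)
  qed
 qed
qed

locale char_lattice = lattice_extension J \<beta> e
 for J :: "'f::nonarch_local_field => 'e::nonarch_local_field" and \<beta> e +
 fixes M :: "'e measure" and p :: 'f and sg :: "'f => complex"
 assumes M: "normalized_haar M" and p: "uniformizer p" and sg: "unit_character sg"
begin

abbreviation \<sigma> :: "complex => 'f => complex" where
 "\<sigma> z \<equiv> quasi_char p sg z"

text \<open>The space to which the density \<open>\<sigma> z (c2 w)\<close> belongs wherever it is
  locally integrable (\<open>inV_I\<close>): invariant under translation by F and homogeneous of the
  matching degree.\<close>

definition inV :: "complex => (('e => complex) => complex) => bool" where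
 "inV z v \<longleftrightarrow> linear_on_tf UNIV v &
   (\<forall>\<psi>\<in>TF. \<forall>b. v (%w. \<psi> (w + J b)) = v \<psi>) &
   (\<forall>\<psi>\<in>TF. \<forall>a. a ~= 0 -->
    v (%w. \<psi> (J a * w)) = of_real (inverse (absv (J a))) * inverse (\<sigma> z a) * v \<psi>)"

lemma inV_linear: "inV z v ==> linear_on_tf UNIV v"
 and inV_shift: "inV z v ==> \<psi> \<in> TF ==> v (%w. \<psi> (w + J b)) = v \<psi>"
 and inV_scale: "inV z v ==> \<psi> \<in> TF ==> a ~= 0 ==>
   v (%w. \<psi> (J a * w)) = of_real (inverse (absv (J a))) * inverse (\<sigma> z a) * v \<psi>" by (auto simp: inV_def)

text \<open>A conductor exponent of \<open>sg\<close>, kept at least 1 so that \<open>1 + h\<close>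
  is a unit.\<close>

definition N0 :: int where
 "N0 = (SOME n. n \<ge> 1 & (\<forall>h\<in>pw n. sg (1 + h) = 1))"

lemma N0: "N0 \<ge> 1" "!!h. h \<in> pw N0 ==> sg (1 + h) = 1"
proof -
 have "\<exists>n. n \<ge> 1 & (\<forall>h\<in>pw n. sg (1 + h) = 1)" using unit_character_trivial_near_one[OF sg] by metis
 hence "N0 \<ge> 1 & (\<forall>h\<in>pw N0. sg (1 + h) = 1)" unfolding N0_def by (rule someI_ex)
 thus "N0 \<ge> 1" "!!h. h \<in> pw N0 ==> sg (1 + h) = 1" by auto
qed

lemma sigma_near: "x ~= 0 ==> y - x \<in> pw (val x + N0) ==> \<sigma> z y = \<sigma> z x" using quasi_char_congruent[OF p sg N0] by blast

definition box :: "'e => int => 'e => complex" where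
 "box w k = ball_ind w (e * k)"

lemma box_eq: "box w k x = (if c1 x - c1 w \<in> pw k & c2 x - c2 w \<in> pw k then 1 else 0)"
 by (simp add: box_def ball_ind_def pw_coords c_diff)

lemma test_fun_box: "box w k \<in> TF" by (simp add: box_def test_fun_ball_ind_UNIV)

lemma inV_box_shift: "inV z v ==> v (box (w + J b) k) = v (box w k)"
proof -
 assume v: "inV z v"
 have "(%x. box w k (x + J (- b))) = box (w + J b) k" by (simp add: fun_eq_iff box_eq c_add algebra_simps)
 thus ?thesis using inV_shift[OF v test_fun_box, of w k "- b"] by simp
qed

lemma inV_box_scale:
 assumes v: "inV z v" and y: "y ~= 0"
 shows "v (box (J y * w) k) = of_real (absv (J y)) * \<sigma> z y * v (box w (k - val y))"
proof -
 have eq: "(%x. box w (k - val y) (J (inverse y) * x)) = box (J y * w) k" proof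
  fix x
  have "inverse y * a - b \<in> pw (k - val y) \<longleftrightarrow> a - y * b \<in> pw k" for a b proof -
   have "y * (inverse y * a - b) = a - y * b" using y by (simp add: right_diff_distrib)
   thus ?thesis using pw_mult_iff[OF y, of "inverse y * a - b" k] by simp
  qed
  thus "box w (k - val y) (J (inverse y) * x) = box (J y * w) k x" by (simp add: box_eq c_smult)
 qed
 have "absv (J (inverse y)) = inverse (absv (J y))" by (simp add: emb_inverse absv_inverse)
 thus ?thesis using inV_scale[OF v test_fun_box, of "inverse y" w "k - val y"] y
  by (simp add: eq quasi_char_inverse[OF sg p])
qed

lemma qq: "qr TYPE('e) powi (- (e * k)) = qr TYPE('f) powi (- 2 * k)" using qE_pow[of "- k"] by simp

text \<open>The ball splits into q^2 smaller ones centred at \<open>\<beta> + h\<close>, q being the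
  residue cardinality of F. Translation by \<open>J (c1 h)\<close> and dilation by
  \<open>1 + c2 h\<close>, on which \<open>sg\<close> is trivial, carry each of them to the one
  centred at \<beta>.\<close>

lemma inV_box_beta_step:
 assumes v: "inV z v" and k: "k \<ge> N0" shows "v (box \<beta> k) = of_real (qr TYPE('f) ^ 2) * v (box \<beta> (k + 1))"
proof -
 obtain R :: "'e set" where R: "residue_reps (e * k) (e * (k + 1)) R"
  using ex_residue_reps[of "e * k" "e * (k + 1)"] e_pos by auto
 have "v (box \<beta> k) = v (%x. \<Sum>h\<in>R. box (\<beta> + h) (k + 1) x)"
  unfolding box_def using ball_ind_split[OF R, of \<beta>] e_pos by simp
 also have "\<dots> = (\<Sum>h\<in>R. v (box (\<beta> + h) (k + 1)))" by (rule linear_on_tf_sum[OF inV_linear[OF v] test_fun_box])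
 also have "\<dots> = (\<Sum>h\<in>R. v (box \<beta> (k + 1)))" proof (intro sum.cong refl)
  fix h assume "h \<in> R"
  hence h: "c2 h \<in> pw k" using R by (auto simp: residue_reps_def pw_coords)
  define y where "y = 1 + c2 h"
  have y: "y ~= 0" "val y = 0" "y \<in> int_units"
   using one_plus_pw[of "c2 h" N0] pw_mono[OF k h] N0(1) by (auto simp: y_def)
  have "\<beta> + h = J y * \<beta> + J (c1 h)" by (simp add: coords_eq_iff c_add c_smult y_def)
  hence "v (box (\<beta> + h) (k + 1)) = v (box (J y * \<beta>) (k + 1))" using inV_box_shift[OF v] by simp
  also have "\<dots> = v (box \<beta> (k + 1))" proof -
   have "\<sigma> z y = 1" using quasi_char_unit[OF y(3)] N0(2)[OF pw_mono[OF k h]] by (simp add: y_def)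
   moreover have "absv y = 1" using y by (simp add: absv_def)
   ultimately show ?thesis using inV_box_scale[OF v y(1), of \<beta> "k + 1"] y(2) by (simp add: absv_emb)
  qed
  finally show "v (box (\<beta> + h) (k + 1)) = v (box \<beta> (k + 1))" .
 qed
 also have "\<dots> = of_nat (card R) * v (box \<beta> (k + 1))" by simp
 also have "of_nat (card R) = complex_of_real (qr TYPE('f) ^ 2)" proof -
  have "card R = residue_card TYPE('e) ^ nat e" using R e_pos by (simp add: residue_reps_def algebra_simps)
  hence "real (card R) = qr TYPE('e) powi e" using e_pos by (simp add: power_int_def)
  thus ?thesis using card_ext by (metis of_real_of_nat_eq)
 qed
 finally show ?thesis .
qed

text \<open>The density of \<open>v\<close> with respect to Haar measure at \<beta>, that is, on the
  line \<open>c2 = 1\<close>; by \<open>inV_box_beta\<close> every finer level gives the same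
  number.\<close>

definition mass :: "(('e => complex) => complex) => complex" where
 "mass v = of_real (qr TYPE('f) powi (2 * N0)) * v (box \<beta> N0)"

lemma inV_box_beta:
 assumes v: "inV z v" and k: "k \<ge> N0" shows "v (box \<beta> k) = of_real (qr TYPE('f) powi (- 2 * k)) * mass v"
proof -
 note q = qr_pos[where 'a='f]
 have "v (box \<beta> (N0 + int j)) = of_real (qr TYPE('f) powi (- 2 * (N0 + int j))) * mass v" for j proof (induction j)
  case 0
  have "complex_of_real (qr TYPE('f) powi (- 2 * N0)) * of_real (qr TYPE('f) powi (2 * N0)) = 1"
   using q by (simp flip: of_real_mult power_int_add)
  hence "complex_of_real (qr TYPE('f) powi (- 2 * N0)) * (of_real (qr TYPE('f) powi (2 * N0)) * v (box \<beta> N0)) = v (box \<beta> N0)"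
   by (simp only: mult.assoc[symmetric] mult_1)
  thus ?case by (simp only: mass_def of_nat_0 add_0_right)
 next
  case (Suc j)
  have "v (box \<beta> (N0 + int j)) = of_real (qr TYPE('f) ^ 2) * v (box \<beta> (N0 + int (Suc j)))"
   using inV_box_beta_step[OF v, of "N0 + int j"] by (simp add: algebra_simps)
  moreover have "qr TYPE('f) powi (- 2 * (N0 + int j)) = qr TYPE('f) ^ 2 * qr TYPE('f) powi (- 2 * (N0 + int (Suc j)))"
  proof -
   have "qr TYPE('f) ^ 2 = qr TYPE('f) powi 2" by simp
   thus ?thesis by (simp only: qr_powi_add[symmetric]) (simp add: algebra_simps)
  qed
  ultimately have "complex_of_real (qr TYPE('f) ^ 2) * v (box \<beta> (N0 + int (Suc j))) =
    of_real (qr TYPE('f) ^ 2) * (of_real (qr TYPE('f) powi (- 2 * (N0 + int (Suc j)))) * mass v)"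
   using Suc by (simp only: of_real_mult mult.assoc)
  moreover have "complex_of_real (qr TYPE('f) ^ 2) ~= 0" using q by simp
  ultimately show ?case using mult_left_cancel by blast
 qed
 from this[of "nat (k - N0)"] show ?thesis using k by simp
qed

text \<open>A point off F is \<open>J (c2 w) * \<beta>\<close> up to translation by F, so
  homogeneity transports the density from \<beta> to it.\<close>

lemma inV_box_off:
 assumes v: "inV z v" and y: "c2 w ~= 0" and k: "k \<ge> val (c2 w) + N0"
 shows "v (box w k) = of_real (qr TYPE('f) powi (- 2 * k)) * \<sigma> z (c2 w) * mass v"
proof -
 note q = qr_pos[where 'a='f]
 let ?y = "c2 w"
 have "w = J ?y * \<beta> + J (c1 w)" by (simp add: coords_eq_iff c_add c_smult)
 hence "v (box w k) = v (box (J ?y * \<beta>) k)" using inV_box_shift[OF v, of "J ?y * \<beta>" "c1 w" k] by simp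
 also have "\<dots> = of_real (absv ?y ^ 2) * \<sigma> z ?y * v (box \<beta> (k - val ?y))"
  using inV_box_scale[OF v y] by (simp add: absv_emb)
 also have "v (box \<beta> (k - val ?y)) = of_real (qr TYPE('f) powi (- 2 * (k - val ?y))) * mass v"
  using k by (intro inV_box_beta[OF v]) simp
 also have "of_real (absv ?y ^ 2) * \<sigma> z ?y * (of_real (qr TYPE('f) powi (- 2 * (k - val ?y))) * mass v) =
   complex_of_real (absv ?y ^ 2 * qr TYPE('f) powi (- 2 * (k - val ?y))) * \<sigma> z ?y * mass v" by simp
 also have "absv ?y ^ 2 * qr TYPE('f) powi (- 2 * (k - val ?y)) = qr TYPE('f) powi (- 2 * k)" proof -
  have "absv ?y ^ 2 = qr TYPE('f) powi (- val ?y * 2)"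
   using y power_int_mult[of "qr TYPE('f)" "- val ?y" 2] by (simp add: absv_def)
  thus ?thesis by (simp only: qr_powi_add[symmetric]) (simp add: algebra_simps)
 qed
 finally show ?thesis .
qed

definition I :: "complex => ('e => complex) => complex" where
 "I z \<psi> = (LINT w|M. \<psi> w * \<sigma> z (c2 w))"

lemma sigma_c2_locally_constant:
 assumes "c2 w ~= 0" shows "\<exists>n. \<forall>y. y - w \<in> pw n --> \<sigma> z (c2 y) = \<sigma> z (c2 w)"
proof -
 have "\<sigma> z (c2 y) = \<sigma> z (c2 w)" if "y - w \<in> pw (e * (val (c2 w) + N0))" for y
  using that assms by (intro sigma_near) (simp_all add: pw_coords c_diff)
 thus ?thesis by blast
qed

lemma measurable_sigma_c2: "(%w. \<sigma> z (c2 w)) \<in> borel_measurable borel"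
 by (rule measurable_locally_constant_on[OF closed_range_emb])
  (use sigma_c2_locally_constant c2_eq_0_iff in \<open>auto\<close>)

lemma box_sigma:
 assumes y: "c2 w ~= 0" and k: "k \<ge> val (c2 w) + N0"
 shows "box w k x * \<sigma> z (c2 x) = \<sigma> z (c2 w) * box w k x"
proof (cases "box w k x = 0")
 case False
 hence "c2 x - c2 w \<in> pw (val (c2 w) + N0)" using pw_mono[OF k] by (auto simp: box_eq split: if_splits)
 thus ?thesis using sigma_near[OF y, of "c2 x" z] by simp
qed simp

text \<open>Away from the subfield, every such functional is a multiple of the density \<open>\<sigma> z (c2 w)\<close>.\<close>

lemma off_expansion:
 assumes \<psi>: "\<psi> \<in> test_fun (- range J)"
 obtains R k where "finite R" "!!c. c \<in> R ==> \<psi> c ~= 0 ==> c2 c ~= 0 & k \<ge> val (c2 c) + N0"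
  "\<psi> = (%x. \<Sum>c\<in>R. \<psi> c * box c k x)"
proof -
 have U: "\<psi> \<in> TF" "!!x. \<psi> (J x) = 0" using \<psi> test_fun_iff[of \<psi> "- range J"] by auto
 obtain n m where nm: "periodic n \<psi>" "supported m \<psi>" using U(1) by (rule test_funE)
 define k0 where "k0 = max n 1"
 have k0: "e * k0 \<ge> n" "k0 \<ge> 1" using e_pos mult_mono[of 1 e k0 k0] by (auto simp: k0_def)
 \<comment> \<open>Where \<open>c2 c\<close> lies in \<open>pw k0\<close> the point is so close to F
   that \<open>\<psi>\<close> takes there one of its values on F, which are 0.\<close>
 have van: "c2 c ~= 0 & val (c2 c) < k0" if "\<psi> c ~= 0" for c proof (rule ccontr)
  assume "\<not> (c2 c ~= 0 & val (c2 c) < k0)"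
  hence "c2 c \<in> pw k0" by (auto simp: pw_def)
  hence "c - J (c1 c) \<in> pw (e * k0)" by (simp add: pw_coords c_diff)
  hence "\<psi> c = \<psi> (J (c1 c))" using periodicD[OF nm(1)] pw_mono[OF k0(1)] by blast
  thus False using that U(2) by simp
 qed
 define k where "k = k0 + N0"
 have k: "e * k \<ge> n" "e * k \<ge> min m n" proof -
  have "e * k0 \<le> e * k" using N0(1) e_pos by (intro mult_left_mono) (auto simp: k_def)
  thus "e * k \<ge> n" "e * k \<ge> min m n" using k0(1) by auto
 qed
 obtain R :: "'e set" where R: "residue_reps (min m n) (e * k) R" using ex_residue_reps[OF k(2)] by blast
 have "\<psi> = (%x. \<Sum>c\<in>R. \<psi> c * box c k x)" unfolding box_def
  by (rule test_fun_decompose[OF periodic_mono[OF nm(1) k(1)] supported_mono[OF nm(2)] R]) simp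
 moreover have "finite R" using R by (simp add: residue_reps_def)
 moreover have "c2 c ~= 0 & k \<ge> val (c2 c) + N0" if "\<psi> c ~= 0" for c using van[OF that] by (simp add: k_def)
 ultimately show thesis using that by blast
qed

lemma off_values:
 assumes \<psi>: "\<psi> \<in> test_fun (- range J)" and R: "finite R"
  "!!c. c \<in> R ==> \<psi> c ~= 0 ==> c2 c ~= 0 & k \<ge> val (c2 c) + N0"
  "\<psi> = (%x. \<Sum>c\<in>R. \<psi> c * box c k x)"
 shows "I z \<psi> = (\<Sum>c\<in>R. of_real (qr TYPE('f) powi (- 2 * k)) * \<psi> c * \<sigma> z (c2 c))"
  and "inV z v ==> v \<psi> = mass v * (\<Sum>c\<in>R. of_real (qr TYPE('f) powi (- 2 * k)) * \<psi> c * \<sigma> z (c2 c))"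
proof -
 have "I z \<psi> = (LINT w|M. (\<Sum>c\<in>R. \<psi> c * \<sigma> z (c2 c) * box c k w))" unfolding I_def
 proof (intro Bochner_Integration.integral_cong refl)
  fix w
  have "\<psi> w * \<sigma> z (c2 w) = (\<Sum>c\<in>R. \<psi> c * box c k w) * \<sigma> z (c2 w)" using R(3) by metis
  also have "\<dots> = (\<Sum>c\<in>R. \<psi> c * (box c k w * \<sigma> z (c2 w)))" by (simp add: sum_distrib_right mult.assoc)
  also have "\<dots> = (\<Sum>c\<in>R. \<psi> c * \<sigma> z (c2 c) * box c k w)" proof (intro sum.cong refl)
   fix c assume "c \<in> R"
   thus "\<psi> c * (box c k w * \<sigma> z (c2 w)) = \<psi> c * \<sigma> z (c2 c) * box c k w"
    using R(2)[of c] box_sigma[of c k w z] by (cases "\<psi> c = 0") auto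
  qed
  finally show "\<psi> w * \<sigma> z (c2 w) = (\<Sum>c\<in>R. \<psi> c * \<sigma> z (c2 c) * box c k w)" .
 qed
 also have "\<dots> = (\<Sum>c\<in>R. (LINT w|M. \<psi> c * \<sigma> z (c2 c) * box c k w))" by (rule Bochner_Integration.integral_sum)
   (auto simp: box_def intro!: Bochner_Integration.integrable_mult_right integral_ball_ind(1)[OF M])
 also have "\<dots> = (\<Sum>c\<in>R. of_real (qr TYPE('f) powi (- 2 * k)) * \<psi> c * \<sigma> z (c2 c))"
  unfolding box_def integral_mult_right_zero integral_ball_ind(2)[OF M] qq by (simp add: mult_ac)
 finally show "I z \<psi> = (\<Sum>c\<in>R. of_real (qr TYPE('f) powi (- 2 * k)) * \<psi> c * \<sigma> z (c2 c))" .
 assume v: "inV z v"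
 have "v \<psi> = v (%x. \<Sum>c\<in>R. \<psi> c * box c k x)" using R(3) by metis
 also have "\<dots> = (\<Sum>c\<in>R. v (%x. \<psi> c * box c k x))"
  by (rule linear_on_tf_sum[OF inV_linear[OF v]]) (rule test_fun_cmult[OF test_fun_box])
 also have "\<dots> = (\<Sum>c\<in>R. \<psi> c * v (box c k))" by (simp add: linear_on_tf_cmult[OF inV_linear[OF v] test_fun_box])
 also have "\<dots> = (\<Sum>c\<in>R. mass v * (of_real (qr TYPE('f) powi (- 2 * k)) * \<psi> c * \<sigma> z (c2 c)))" proof (intro sum.cong refl)
  fix c assume "c \<in> R"
  thus "\<psi> c * v (box c k) = mass v * (of_real (qr TYPE('f) powi (- 2 * k)) * \<psi> c * \<sigma> z (c2 c))"
   using R(2)[of c] inV_box_off[OF v, of c k] by (cases "\<psi> c = 0") auto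
 qed
 finally show "v \<psi> = mass v * (\<Sum>c\<in>R. of_real (qr TYPE('f) powi (- 2 * k)) * \<psi> c * \<sigma> z (c2 c))"
  by (simp add: sum_distrib_left)
qed

lemma inV_off: "\<psi> \<in> test_fun (- range J) ==> inV z v ==> v \<psi> = mass v * I z \<psi>"
proof -
 assume \<psi>: "\<psi> \<in> test_fun (- range J)" and v: "inV z v"
 obtain R k where R: "finite R" "!!c. c \<in> R ==> \<psi> c ~= 0 ==> c2 c ~= 0 & k \<ge> val (c2 c) + N0"
  "\<psi> = (%x. \<Sum>c\<in>R. \<psi> c * box c k x)" using off_expansion[OF \<psi>] by blast
 show ?thesis using off_values[OF \<psi> R] v by simp
qed

lemma holomorphic_sigma: "(%z. \<sigma> z y) holomorphic_on UNIV"
proof (cases "y = 0")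
 case False
 hence "(%z. \<sigma> z y) = (%z. sg (ang p y) * exp (of_int (val y) * - (z * of_real (ln (qr TYPE('f))))))"
  by (simp add: quasi_char_eq qexp_powi) (simp add: qexp_def algebra_simps)
 thus ?thesis by (auto intro!: holomorphic_intros)
qed auto

lemma holomorphic_I_off:
 assumes "\<psi> \<in> test_fun (- range J)" shows "(%z. I z \<psi>) holomorphic_on UNIV"
proof -
 obtain R k where R: "finite R" "!!c. c \<in> R ==> \<psi> c ~= 0 ==> c2 c ~= 0 & k \<ge> val (c2 c) + N0"
  "\<psi> = (%x. \<Sum>c\<in>R. \<psi> c * box c k x)" using off_expansion[OF assms] by blast
 have "(%z. I z \<psi>) = (%z. \<Sum>c\<in>R. of_real (qr TYPE('f) powi (- 2 * k)) * \<psi> c * \<sigma> z (c2 c))"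
  using off_values(1)[OF assms R] by (rule ext)
 moreover have "(%z. \<Sum>c\<in>R. of_real (qr TYPE('f) powi (- 2 * k)) * \<psi> c * \<sigma> z (c2 c)) holomorphic_on UNIV"
  by (intro holomorphic_on_sum holomorphic_on_mult holomorphic_on_const holomorphic_sigma)
 ultimately show ?thesis by (simp only:)
qed

definition triv :: bool where "triv \<longleftrightarrow> (\<forall>x\<in>int_units. sg x = 1)"

text \<open>The inverse L-factor \<open>lambda_plus\<close> in the variable z = 2s + t -
  1/2.\<close>

definition lam :: "complex => complex" where
 "lam z = (if triv then 1 - qexp TYPE('f) (z + 1) else 1)"

lemma sigma_triv: "triv ==> x ~= 0 ==> \<sigma> z x = qexp TYPE('f) z powi val x"
 using ang_unit[OF p] by (simp add: quasi_char_eq triv_def)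

lemma box_zero_nontriv:
 assumes v: "inV z v" and "\<not> triv" shows "v (box 0 k) = 0"
proof -
 obtain x where x: "x \<in> int_units" "sg x ~= 1" using assms(2) by (auto simp: triv_def)
 hence "x ~= 0" "val x = 0" by (auto simp: int_units_val)
 hence "v (box 0 k) = sg x * v (box 0 k)" using inV_box_scale[OF v, of x 0 k] x quasi_char_unit[OF x(1), of p sg z]
  by (simp add: absv_emb) (simp add: absv_def)
 thus ?thesis using x by simp
qed

text \<open>Shrinking a ball around 0 by a uniformizer of F contributes q^(-2) from the volume and
  q^(-z) from the homogeneity.\<close>

definition rho :: "complex => complex" where "rho z = qexp TYPE('f) (z + 2)"

lemma box_zero_triv:
 assumes v: "inV z v" and "triv" shows "v (box 0 k) = rho z powi k * v (box 0 0)"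
proof -
 note q = qr_pos[where 'a='f]
 have p0: "p ~= 0" "val p = 1" using p by (auto simp: uniformizer_iff_val)
 let ?y = "p powi k"
 have y: "?y ~= 0" "val ?y = k" using p0 by (auto simp: val_power_int)
 have "v (box 0 k) = of_real (absv ?y ^ 2) * \<sigma> z ?y * v (box 0 0)"
  using inV_box_scale[OF v y(1), of 0 k] y by (simp add: absv_emb)
 also have "\<sigma> z ?y = qexp TYPE('f) z powi k" using sigma_triv[OF assms(2) y(1)] y by simp
 also have "complex_of_real (absv ?y ^ 2) = qexp TYPE('f) 2 powi k" proof -
  have "complex_of_real (absv ?y ^ 2) = of_real (qr TYPE('f) powi (- (2 * k)))"
   using y power_int_mult[of "qr TYPE('f)" "- k" 2] by (simp add: absv_def mult.commute)
  also have "\<dots> = qexp TYPE('f) (of_int (2 * k))" by (simp only: qexp_of_int)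
  also have "\<dots> = qexp TYPE('f) 2 powi k" by (simp add: qexp_powi mult.commute)
  finally show ?thesis .
 qed
 finally show ?thesis by (simp add: rho_def qexp_add power_int_mult_distrib mult_ac)
qed

definition near :: "int => 'e => complex" where
 "near k w = (if c2 w \<in> pw k then 1 else 0)"

lemma near_periodic: "y - x \<in> pw (e * k) ==> near k y = near k x"
proof -
 assume "y - x \<in> pw (e * k)"
 hence "c2 y - c2 x \<in> pw k" by (simp add: pw_coords c_diff)
 hence "c2 y \<in> pw k \<longleftrightarrow> c2 x \<in> pw k" using pw_add_cancel[of "c2 y - c2 x" k "c2 x"] by simp
 thus ?thesis by (simp add: near_def)
qed

lemma test_fun_near:
 "\<psi> \<in> test_fun U ==> (%w. near k w * \<psi> w) \<in> test_fun U" by (rule test_fun_mult) (use near_periodic in blast)+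

lemma test_fun_far:
 assumes "\<psi> \<in> TF" shows "(%w. (1 - near k w) * \<psi> w) \<in> test_fun (- range J)"
proof -
 have "(%w. (1 - near k w) * \<psi> w) \<in> TF" by (rule test_fun_mult[OF assms]) (use near_periodic in metis)
 thus ?thesis by (subst test_fun_iff) (auto simp: near_def)
qed

text \<open>Far from F the functional is its density; near F it is a multiple of its value on one
  ball around 0 (\<open>near_value\<close>). This splitting is what bounds the dimension of
  \<open>inV z\<close>.\<close>

lemma near_far:
 assumes v: "inV z v" and \<psi>: "\<psi> \<in> TF"
 shows "v \<psi> = v (%w. near k w * \<psi> w) + mass v * I z (%w. (1 - near k w) * \<psi> w)"
proof -
 have "v \<psi> = v (%w. near k w * \<psi> w + (1 - near k w) * \<psi> w)" by (simp add: algebra_simps)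
 also have "\<dots> = v (%w. near k w * \<psi> w) + v (%w. (1 - near k w) * \<psi> w)"
  by (rule linear_on_tf_add[OF inV_linear[OF v] test_fun_near[OF \<psi>] test_fun_subset[OF test_fun_far[OF \<psi>]]]) simp
 finally show ?thesis using inV_off[OF test_fun_far[OF \<psi>] v] by simp
qed

text \<open>At level k the function depends only on \<open>c1\<close> inside the strip, so the strip
  decomposes into translates of \<open>box 0 k\<close> along F, and \<open>v\<close> takes the same
  value on all of them.\<close>

lemma near_value:
 assumes v: "inV z v" and \<psi>: "periodic (e * k) \<psi>" "supported (e * m) \<psi>" and R: "residue_reps m k R"
 shows "v (%w. near k w * \<psi> w) = (\<Sum>b\<in>R. \<psi> (J b)) * v (box 0 k)"
proof -
 have eq: "(%w. near k w * \<psi> w) = (%w. \<Sum>b\<in>R. \<psi> (J b) * box (J b) k w)" proof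
  fix w
  show "near k w * \<psi> w = (\<Sum>b\<in>R. \<psi> (J b) * box (J b) k w)" proof (cases "c2 w \<in> pw k")
   case False
   hence "(\<Sum>b\<in>R. \<psi> (J b) * box (J b) k w) = 0" by (intro sum.neutral) (simp add: box_eq)
   thus ?thesis using False by (simp add: near_def)
  next
   case True
   have "periodic k (%x. \<psi> (J x))" unfolding periodic_def proof (intro allI impI)
    fix x y :: 'f assume "y - x \<in> pw k"
    thus "\<psi> (J y) = \<psi> (J x)" by (intro periodicD[OF \<psi>(1)]) (simp add: pw_emb flip: emb_diff)
   qed
   moreover have "supported m (%x. \<psi> (J x))" using \<psi>(2) by (simp add: supported_def pw_emb)
   ultimately have "(%x. \<psi> (J x)) = (%x. \<Sum>b\<in>R. \<psi> (J b) * ball_ind b k x)" using R by (rule test_fun_decompose)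
   hence "\<psi> (J (c1 w)) = (\<Sum>b\<in>R. \<psi> (J b) * ball_ind b k (c1 w))" by meson
   also have "\<dots> = (\<Sum>b\<in>R. \<psi> (J b) * box (J b) k w)" using True by (simp add: box_eq ball_ind_def)
   also have "\<psi> (J (c1 w)) = \<psi> w" using True by (intro periodicD[OF \<psi>(1)]) (simp add: pw_coords c_diff)
   finally show ?thesis using True by (simp add: near_def)
  qed
 qed
 have "v (%w. near k w * \<psi> w) = (\<Sum>b\<in>R. v (%w. \<psi> (J b) * box (J b) k w))"
  unfolding eq by (rule linear_on_tf_sum[OF inV_linear[OF v]]) (rule test_fun_cmult[OF test_fun_box])
 also have "\<dots> = (\<Sum>b\<in>R. \<psi> (J b) * v (box (J b) k))" by (simp add: linear_on_tf_cmult[OF inV_linear[OF v] test_fun_box])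
 also have "\<dots> = (\<Sum>b\<in>R. \<psi> (J b) * v (box 0 k))" using inV_box_shift[OF v, of 0] by simp
 finally show ?thesis by (simp add: sum_distrib_right)
qed

end

section \<open>Convergence and analytic continuation of the generator\<close>

context char_lattice
begin

lemma norm_sigma: "y ~= 0 ==> norm (\<sigma> z y) = qr TYPE('f) powr (- (of_int (val y) * Re z))"
proof -
 assume y: "y ~= 0"
 have "absv y = qr TYPE('f) powr of_int (- val y)"
  using y qr_pos[where 'a='f] powr_real_of_int'[of "qr TYPE('f)" "- val y"] by (simp add: absv_def)
 thus ?thesis using norm_quasi_char[OF sg p y] by (simp add: powr_powr)
qed

lemma box_borel: "{w. c1 w \<in> pw k & c2 w \<in> pw l} \<in> sets borel"
proof -
 have "c1 -` pw k \<inter> space borel \<in> sets borel" "c2 -` pw l \<inter> space borel \<in> sets borel"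
  by (rule measurable_sets[OF measurable_c1] measurable_sets[OF measurable_c2]; measurable)+
 moreover have "{w. c1 w \<in> pw k & c2 w \<in> pw l} = (c1 -` pw k \<inter> space borel) \<inter> (c2 -` pw l \<inter> space borel)" by auto
 ultimately show ?thesis using sets.Int by metis
qed

text \<open>On the shell where \<open>c2\<close> has valuation m + n the density has constant
  absolute value, and the shell volumes bound the integral by a geometric series of ratio q^(-(Re z
  + 1)).\<close>

lemma nn_integral_box_sigma:
 assumes z: "Re z > - 1"
 shows "(\<integral>\<^sup>+ w. ennreal (norm (box 0 m w * \<sigma> z (c2 w))) \<partial>M) < \<infinity>"
proof -
 note q = qr_pos[where 'a='f]
 have sp: "space M = UNIV" "sets M = sets borel" using normalized_haarD[OF M] by auto
 define A where "A n = {w. c1 w \<in> pw m & c2 w \<in> pw (m + int n)} - {w. c2 w \<in> pw (m + int n + 1)}" for n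
 define r where "r n = qr TYPE('f) powr (- (of_int (m + int n) * Re z))" for n
 note meas1 = box_borel
 have meas2: "{w. c2 w \<in> pw l} \<in> sets borel" for l
  using measurable_sets[OF measurable_c2 pw_borel[of l]] by (simp add: vimage_def)
 have A: "A n \<in> sets M" for n unfolding A_def sp using meas1 meas2 by blast
 have eq: "ennreal (norm (box 0 m w * \<sigma> z (c2 w))) = (\<Sum>n. ennreal (r n) * indicator (A n) w)" for w
 proof (cases "box 0 m w = 0 \<or> c2 w = 0")
  case True
  hence "w \<notin> A n" for n using pw_mono[of m "m + int n" "c2 w"] by (auto simp: A_def box_eq split: if_splits)
  thus ?thesis using True by auto
 next
  case False
  hence w: "c1 w \<in> pw m" "c2 w \<in> pw m" "c2 w ~= 0" "box 0 m w = 1" by (auto simp: box_eq split: if_splits)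
  define n0 where "n0 = nat (val (c2 w) - m)"
  have n0: "val (c2 w) = m + int n0" using w by (auto simp: n0_def pw_def)
  have "w \<in> A n \<longleftrightarrow> n = n0" for n using w n0 by (auto simp: A_def pw_def)
  hence "(%n. ennreal (r n) * indicator (A n) w) = (%n. if n = n0 then ennreal (r n0) else 0)"
   by (auto simp: fun_eq_iff)
  hence "(\<Sum>n. ennreal (r n) * indicator (A n) w) = ennreal (r n0)"
   using sums_unique[OF sums_If_finite_set[of "{n0}" "%_. ennreal (r n0)"]] by simp
  thus ?thesis using w norm_sigma[OF w(3)] n0 by (simp add: r_def)
 qed
 have "(\<integral>\<^sup>+ w. ennreal (norm (box 0 m w * \<sigma> z (c2 w))) \<partial>M) = (\<Sum>n. \<integral>\<^sup>+ w. ennreal (r n) * indicator (A n) w \<partial>M)"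
  unfolding eq using A by (intro nn_integral_suminf) auto
 also have "\<dots> = (\<Sum>n. ennreal (r n) * emeasure M (A n))" using A by (simp add: nn_integral_cmult_indicator)
 also have "\<dots> \<le> (\<Sum>n. ennreal (qr TYPE('f) powr (- of_int m * Re z - 2 * of_int m) * (qr TYPE('f) powr (- (Re z + 1))) ^ n))"
 proof (rule suminf_le)
  fix n
  have "emeasure M (A n) \<le> emeasure M {w. c1 w \<in> pw m & c2 w \<in> pw (m + int n)}"
   unfolding A_def using meas1 sp by (intro emeasure_mono) auto
  also have "\<dots> = ennreal (qr TYPE('f) powi (- m - (m + int n)))" by (intro emeasure_box(1)[OF M]) simp
  finally have "ennreal (r n) * emeasure M (A n) \<le> ennreal (r n) * ennreal (qr TYPE('f) powi (- m - (m + int n)))"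
   by (intro mult_left_mono) auto
  also have "\<dots> = ennreal (r n * qr TYPE('f) powi (- m - (m + int n)))" using q by (simp add: r_def flip: ennreal_mult)
  also have "r n * qr TYPE('f) powi (- m - (m + int n)) =
    qr TYPE('f) powr (- of_int m * Re z - 2 * of_int m) * (qr TYPE('f) powr (- (Re z + 1))) ^ n" proof -
   have "qr TYPE('f) powi (- m - (m + int n)) = qr TYPE('f) powr (of_int (- m - (m + int n)))"
    using q powr_real_of_int' by (metis less_imp_le less_irrefl)
   moreover have "(qr TYPE('f) powr (- (Re z + 1))) ^ n = qr TYPE('f) powr (- (Re z + 1) * of_nat n)"
    using q by (simp add: powr_powr flip: powr_realpow)
   ultimately show ?thesis unfolding r_def by (simp only: powr_add[symmetric]) (simp add: algebra_simps)
  qed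
  finally show "ennreal (r n) * emeasure M (A n) \<le>
    ennreal (qr TYPE('f) powr (- of_int m * Re z - 2 * of_int m) * (qr TYPE('f) powr (- (Re z + 1))) ^ n)" .
 qed auto
 also have "\<dots> < \<infinity>" proof -
  have "qr TYPE('f) powr (- (Re z + 1)) < 1" using z qr_gt_1[where 'a='f] by (simp add: powr_less_one)
  hence "(%n. qr TYPE('f) powr (- of_int m * Re z - 2 * of_int m) * (qr TYPE('f) powr (- (Re z + 1))) ^ n) sums
    (qr TYPE('f) powr (- of_int m * Re z - 2 * of_int m) * (1 / (1 - qr TYPE('f) powr (- (Re z + 1)))))"
   by (intro sums_mult geometric_sums) simp
  thus ?thesis by (subst suminf_ennreal_eq) auto
 qed
 finally show ?thesis .
qed

lemma bounded_test_fun: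
 assumes "\<psi> \<in> test_fun (UNIV :: 'e set)" obtains B m where "!!w. norm (\<psi> w) \<le> B * norm (box 0 m w)"
proof -
 obtain n m where nm: "periodic n \<psi>" "supported m \<psi>" using assms by (rule test_funE)
 have ms: "supported (min m n) \<psi>" by (rule supported_mono[OF nm(2)]) simp
 obtain R :: "'e set" where R: "residue_reps (min m n) n R" using ex_residue_reps[of "min m n" n] by auto
 define m' where "m' = min m 0"
 have "e * m' \<le> m" proof -
  have "e * m' \<le> 1 * m'" using e_pos by (intro mult_right_mono_neg) (auto simp: m'_def)
  thus ?thesis by (simp add: m'_def)
 qed
 define B where "B = (\<Sum>c\<in>R. norm (\<psi> c))"
 have "norm (\<psi> w) \<le> B" for w proof -
  have "\<psi> w = (\<Sum>c\<in>R. \<psi> c * ball_ind c n w)" using test_fun_decompose[OF nm(1) ms R] by meson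
  also have "norm \<dots> \<le> (\<Sum>c\<in>R. norm (\<psi> c * ball_ind c n w))" by (rule norm_sum)
  also have "\<dots> \<le> B" unfolding B_def by (intro sum_mono) (simp add: ball_ind_def)
  finally show ?thesis .
 qed
 moreover have "\<psi> w = 0" if "box 0 m' w = 0" for w proof -
  have "w \<notin> pw (e * m')" using that by (auto simp: box_eq pw_coords)
  hence "w \<notin> pw m" using pw_mono[OF \<open>e * m' \<le> m\<close>] by blast
  thus ?thesis using nm(2) by (simp add: supported_def)
 qed
 ultimately have "norm (\<psi> w) \<le> B * norm (box 0 m' w)" for w
  by (cases "box 0 m' w = 0") (auto simp: box_eq split: if_splits)
 thus thesis by (rule that)
qed

lemma integrable_I:
 assumes z: "Re z > - 1" and \<psi>: "\<psi> \<in> TF" shows "integrable M (%w. \<psi> w * \<sigma> z (c2 w))"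
proof -
 obtain B m where B: "!!w. norm (\<psi> w) \<le> B * norm (box 0 m w)" using bounded_test_fun[OF \<psi>] by blast
 have meas: "(%w. \<phi> w * \<sigma> z (c2 w)) \<in> borel_measurable M" if "\<phi> \<in> TF" for \<phi>
  using haar_borel_measurable[OF M] measurable_test_fun[OF that] measurable_sigma_c2[of z]
  by (intro borel_measurable_times) blast+
 have "integrable M (%w. box 0 m w * \<sigma> z (c2 w))"
  using nn_integral_box_sigma[OF z] meas[OF test_fun_box] by (intro integrableI_bounded) auto
 hence "integrable M (%w. of_real B * (box 0 m w * \<sigma> z (c2 w)))" by (rule Bochner_Integration.integrable_mult_right)
 thus ?thesis proof (rule Bochner_Integration.integrable_bound[OF _ meas[OF \<psi>]])
  show "AE w in M. norm (\<psi> w * \<sigma> z (c2 w)) \<le> norm (of_real B * (box 0 m w * \<sigma> z (c2 w)))" proof (rule AE_I2)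
   fix w
   have "norm (\<psi> w) \<le> \<bar>B\<bar> * norm (box 0 m w)"
    using B[of w] abs_ge_self[of B] by (meson mult_right_mono norm_ge_zero order_trans)
   hence "norm (\<psi> w) * norm (\<sigma> z (c2 w)) \<le> \<bar>B\<bar> * norm (box 0 m w) * norm (\<sigma> z (c2 w))" by (rule mult_right_mono) simp
   thus "norm (\<psi> w * \<sigma> z (c2 w)) \<le> norm (of_real B * (box 0 m w * \<sigma> z (c2 w)))" by (simp add: norm_mult mult.assoc)
  qed
 qed
qed

lemma inV_I:
 assumes z: "Re z > - 1" shows "inV z (I z)" unfolding inV_def linear_on_tf_def
proof (intro conjI ballI allI impI)
 fix \<phi> \<psi> :: "'e => complex" assume "\<phi> \<in> TF" "\<psi> \<in> TF"
 thus "I z (%x. \<phi> x + \<psi> x) = I z \<phi> + I z \<psi>" using integrable_I[OF z] by (simp add: I_def distrib_right)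
next
 fix c and \<psi> :: "'e => complex"
 show "I z (%x. c * \<psi> x) = c * I z \<psi>" by (simp add: I_def mult.assoc)
next
 fix \<psi> :: "'e => complex" and b assume \<psi>: "\<psi> \<in> TF"
 have "(%w. \<psi> w * \<sigma> z (c2 w)) \<in> borel_measurable borel"
  using measurable_test_fun[OF \<psi>] measurable_sigma_c2 by measurable
 from integral_translate[OF M this, of "J b"]
 show "I z (%w. \<psi> (w + J b)) = I z \<psi>" by (simp add: I_def c_add)
next
 fix \<psi> :: "'e => complex" and a :: 'f assume \<psi>: "\<psi> \<in> TF" and a: "a ~= 0"
 have "(%w. \<psi> w * (inverse (\<sigma> z a) * \<sigma> z (c2 w))) \<in> borel_measurable borel"
  using measurable_test_fun[OF \<psi>] measurable_sigma_c2 by measurable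
 moreover have "inverse (\<sigma> z a) * \<sigma> z (a * y) = \<sigma> z y" for y
  using quasi_char_mult[OF sg p] quasi_char_nonzero[OF sg p a] by simp
 ultimately have "I z (%w. \<psi> (J a * w)) =
   of_real (inverse (absv (J a))) * (LINT w|M. \<psi> w * (inverse (\<sigma> z a) * \<sigma> z (c2 w)))"
  using integral_scale[OF M, of "%w. \<psi> w * (inverse (\<sigma> z a) * \<sigma> z (c2 w))" "J a"] a by (simp add: I_def c_smult)
 also have "(LINT w|M. \<psi> w * (inverse (\<sigma> z a) * \<sigma> z (c2 w))) = inverse (\<sigma> z a) * I z \<psi>" proof -
  have "(%w. \<psi> w * (inverse (\<sigma> z a) * \<sigma> z (c2 w))) = (%w. inverse (\<sigma> z a) * (\<psi> w * \<sigma> z (c2 w)))"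
   by (simp add: fun_eq_iff mult_ac)
  thus ?thesis unfolding I_def by simp
 qed
 finally show "I z (%w. \<psi> (J a * w)) = of_real (inverse (absv (J a))) * inverse (\<sigma> z a) * I z \<psi>" by simp
qed

lemma mass_I: "mass (I z) = 1"
proof -
 note q = qr_pos[where 'a='f]
 have "(%w. box \<beta> N0 w * \<sigma> z (c2 w)) = box \<beta> N0" proof
  fix w
  show "box \<beta> N0 w * \<sigma> z (c2 w) = box \<beta> N0 w" using box_sigma[of \<beta> N0 w z] by (simp add: quasi_char_one[OF sg])
 qed
 hence "I z (box \<beta> N0) = (LINT w|M. box \<beta> N0 w)" unfolding I_def by simp
 also have "\<dots> = of_real (qr TYPE('f) powi (- 2 * N0))" unfolding box_def integral_ball_ind(2)[OF M] qq ..
 finally have "mass (I z) = of_real (qr TYPE('f) powi (2 * N0) * qr TYPE('f) powi (- 2 * N0))" by (simp add: mass_def)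
 also have "qr TYPE('f) powi (2 * N0) * qr TYPE('f) powi (- 2 * N0) = 1" by (simp flip: qr_powi_add)
 finally show ?thesis by simp
qed

lemma periodic_box: "periodic (e * k) (box w k)" by (simp add: box_def periodic_ball_ind)

lemma measure_box_eq:
 assumes "a \<le> b" shows "measure M {w. c1 w \<in> pw a & c2 w \<in> pw b} = qr TYPE('f) powi (- a - b)"
 using emeasure_box(1)[OF M assms] qr_pos[where 'a='f] by (simp add: measure_def)

lemma integral_indicator_complex:
 assumes "A \<in> sets M" "emeasure M A < \<infinity>"
 shows "integrable M (%w. indicator A w :: complex)" "(LINT w|M. indicator A w :: complex) = of_real (measure M A)"
proof -
 have "integrable M (%w. complex_of_real (indicator A w))"
  by (rule integrable_of_real[OF integrable_real_indicator[OF assms]])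
 thus "integrable M (%w. indicator A w :: complex)" by (simp add: of_real_indicator)
 have "(LINT w|M. complex_of_real (indicator A w)) = of_real (measure M A)"
  using has_bochner_integral_integral_eq[OF has_bochner_integral_real_indicator[OF assms]]
  by (simp only: integral_complex_of_real)
 thus "(LINT w|M. indicator A w :: complex) = of_real (measure M A)" by (simp add: of_real_indicator)
qed

text \<open>Cut the unit ball by \<open>c2\<close>. The part with \<open>c2\<close> in
  \<open>pw 1\<close> consists of q translates of \<open>box 0 1\<close>, each worth
  \<open>rho z * v (box 0 0)\<close>; on the rest \<open>\<sigma> z\<close> is 1 and the volume is 1
  - 1/q. As q times \<open>rho z\<close> is q^(-(z + 1)), collecting the terms in
  \<open>v (box 0 0)\<close> produces \<open>lam z\<close>.\<close>

lemma box_zero_relation: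
 assumes v: "inV z v" and t: "triv" shows "lam z * v (box 0 0) = mass v * of_real (1 - inverse (qr TYPE('f)))"
proof -
 note q = qr_pos[where 'a='f]
 have sM: "sets M = sets borel" by (rule normalized_haarD(1)[OF M])
 obtain R :: "'f set" where R: "residue_reps 0 1 R" using ex_residue_reps_one by blast
 have per: "periodic (e * 1) (box 0 0)" "supported (e * 0) (box 0 0)"
  using periodic_mono[OF periodic_box[of 0 0], of "e * 1"] e_pos pw_coords[of _ 0] by (auto simp: supported_def box_eq)
 have "(\<Sum>b\<in>R. box 0 0 (J b)) = (\<Sum>b\<in>R. 1)" using R by (intro sum.cong) (auto simp: residue_reps_def box_eq)
 also have "\<dots> = of_nat (residue_card TYPE('f))" using R by (simp add: residue_reps_def)
 finally have near1: "v (%w. near 1 w * box 0 0 w) = of_nat (residue_card TYPE('f)) * (rho z * v (box 0 0))"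
  using near_value[OF v per R] box_zero_triv[OF v t, of 1] by simp
 have "I z (%w. (1 - near 1 w) * box 0 0 w) =
   (LINT w|M. indicator {w. c1 w \<in> pw 0 & c2 w \<in> pw 0} w - indicator {w. c1 w \<in> pw 0 & c2 w \<in> pw 1} w)" unfolding I_def
 proof (intro Bochner_Integration.integral_cong refl)
  fix w
  show "(1 - near 1 w) * box 0 0 w * \<sigma> z (c2 w) =
    indicator {w. c1 w \<in> pw 0 & c2 w \<in> pw 0} w - indicator {w. c1 w \<in> pw 0 & c2 w \<in> pw 1} w"
  proof (cases "c1 w \<in> pw 0 & c2 w \<in> pw 0 & c2 w \<notin> pw 1")
   case True
   hence "c2 w ~= 0" "val (c2 w) = 0" by (auto simp: pw_def)
   hence "\<sigma> z (c2 w) = 1" using sigma_triv[OF t, of "c2 w" z] by simp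
   thus ?thesis using True by (simp add: near_def box_eq)
  next
   case False
   thus ?thesis using pw_mono[of 0 1 "c2 w"] by (auto simp: near_def box_eq indicator_def)
  qed
 qed
 also have "\<dots> = of_real (measure M {w. c1 w \<in> pw 0 & c2 w \<in> pw 0}) - of_real (measure M {w. c1 w \<in> pw 0 & c2 w \<in> pw 1})"
 proof -
  have "emeasure M {w. c1 w \<in> pw 0 & c2 w \<in> pw k} < \<infinity>" if "k \<ge> 0" for k using emeasure_box(1)[OF M that] by simp
  thus ?thesis using box_borel sM
   by (subst Bochner_Integration.integral_diff) (simp_all add: integral_indicator_complex)
 qed
 also have "\<dots> = of_real (1 - inverse (qr TYPE('f)))"
  using measure_box_eq[of 0 0] measure_box_eq[of 0 1] by (simp add: power_int_minus)
 finally have "v (box 0 0) = of_nat (residue_card TYPE('f)) * (rho z * v (box 0 0)) + mass v * of_real (1 - inverse (qr TYPE('f)))"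
  using near_far[OF v test_fun_box, of 0 0 1] near1 by simp
 moreover have "of_nat (residue_card TYPE('f)) * rho z = qexp TYPE('f) (z + 1)" proof -
  have "qexp TYPE('f) (of_int (- 1)) = of_nat (residue_card TYPE('f))" by (simp only: qexp_of_int) simp
  hence "of_nat (residue_card TYPE('f)) * rho z = qexp TYPE('f) (- 1) * qexp TYPE('f) (z + 2)" by (simp add: rho_def)
  also have "\<dots> = qexp TYPE('f) (z + 1)" by (simp flip: qexp_add add: add.commute)
  finally show ?thesis .
 qed
 ultimately show ?thesis using t by (simp add: lam_def algebra_simps)
qed

text \<open>A test function on which no nonzero functional of \<open>inV z\<close> vanishes. For
  nontrivial \<open>sg\<close> the density at \<beta> detects them all; for trivial
  \<open>sg\<close> the density is lost at the zeros of \<open>lam\<close>, and a ball around 0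
  takes over.\<close>

definition star :: "'e => complex" where
 "star = (if triv then box 0 0 else box \<beta> N0)"

text \<open>The constant of \<open>star_mass\<close>, supplied by \<open>box_zero_relation\<close>
  in the trivial case and by \<open>inV_box_beta\<close> in the other.\<close>

definition kap :: real where
 "kap = (if triv then 1 - inverse (qr TYPE('f)) else qr TYPE('f) powi (- 2 * N0))"

lemma kap_nonzero: "kap ~= 0" using qr_gt_1[where 'a='f] by (auto simp: kap_def)

lemma test_fun_star: "star \<in> TF" by (simp add: star_def test_fun_box)

lemma star_mass: "inV z v ==> lam z * v star = of_real kap * mass v"
proof (cases triv)
 case True
 assume "inV z v"
 thus ?thesis using box_zero_relation[of z v] True by (simp add: star_def kap_def)
next
 case False
 assume "inV z v"
 thus ?thesis using inV_box_beta[of z v N0] False by (simp add: star_def kap_def lam_def)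
qed

lemma holomorphic_qexp [holomorphic_intros]:
 "f holomorphic_on A ==> (%z. qexp T (f z)) holomorphic_on A" unfolding qexp_def by (intro holomorphic_intros)

lemma holomorphic_lam: "lam holomorphic_on UNIV"
proof (cases triv)
 case True
 have "(%z. 1 - qexp TYPE('f) (z + 1)) holomorphic_on UNIV" by (intro holomorphic_intros)
 thus ?thesis using True by (simp add: lam_def[abs_def])
qed (simp add: lam_def[abs_def])

lemma ex_periodic_supported:
 assumes "\<psi> \<in> test_fun (UNIV :: 'e set)"
 obtains k m where "periodic (e * k) \<psi>" "supported (e * m) \<psi>" "m \<le> k" "k \<ge> k0"
proof -
 obtain n m where nm: "periodic n \<psi>" "supported m \<psi>" using assms by (rule test_funE)
 define k where "k = max (max n 1) k0"
 have "n \<le> e * k" proof -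
  have "n \<le> k" by (simp add: k_def)
  moreover have "1 * k \<le> e * k" using e_pos by (intro mult_right_mono) (simp_all add: k_def)
  ultimately show ?thesis by simp
 qed
 define m' where "m' = min m 0"
 have "e * m' \<le> m" proof -
  have "e * m' \<le> 1 * m'" using e_pos by (intro mult_right_mono_neg) (auto simp: m'_def)
  thus ?thesis by (simp add: m'_def)
 qed
 show thesis by (rule that[of k m'])
   (use periodic_mono[OF nm(1) \<open>n \<le> e * k\<close>] supported_mono[OF nm(2) \<open>e * m' \<le> m\<close>] in \<open>auto simp: k_def m'_def\<close>)
qed

text \<open>By \<open>near_far\<close>, \<open>near_value\<close> and \<open>star_mass\<close> both
  parts of \<open>v \<psi>\<close> are \<open>v star\<close> times a coefficient that is entire in z
  and the same for all \<open>v\<close>. In particular \<open>inV z\<close> has dimension at most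
  one.\<close>

lemma ex_value_function:
 assumes \<psi>: "\<psi> \<in> TF" shows "\<exists>P. P holomorphic_on UNIV & (\<forall>z v. inV z v --> v \<psi> = P z * v star)"
proof -
 obtain k m where km: "periodic (e * k) \<psi>" "supported (e * m) \<psi>" "m \<le> k"
  using ex_periodic_supported[OF \<psi>, of 0] by metis
 obtain R :: "'f set" where R: "residue_reps m k R" using ex_residue_reps[OF km(3)] by blast
 define P where "P = (%z. (\<Sum>b\<in>R. \<psi> (J b)) * (if triv then qexp TYPE('f) (of_int k * (z + 2)) else 0) +
   inverse (of_real kap) * lam z * I z (%w. (1 - near k w) * \<psi> w))"
 have "P holomorphic_on UNIV" proof -
  have "(%z. if triv then qexp TYPE('f) (of_int k * (z + 2)) else 0) holomorphic_on UNIV"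
   by (cases triv) (auto intro!: holomorphic_intros)
  thus ?thesis unfolding P_def
   by (intro holomorphic_intros holomorphic_lam holomorphic_I_off[OF test_fun_far[OF \<psi>]])
 qed
 moreover have "v \<psi> = P z * v star" if v: "inV z v" for z v proof -
  have m: "mass v = inverse (of_real kap) * lam z * v star" using star_mass[OF v] kap_nonzero by (simp add: field_simps)
  have "v (box 0 k) = (if triv then qexp TYPE('f) (of_int k * (z + 2)) else 0) * v star"
   using box_zero_triv[OF v, of k] box_zero_nontriv[OF v, of k] by (auto simp: star_def rho_def qexp_powi)
  thus ?thesis using near_far[OF v \<psi>, of k] near_value[OF v km(1,2) R] m by (simp add: P_def algebra_simps)
 qed
 ultimately show ?thesis by blast
qed

text \<open>The generator with value 1 on \<open>star\<close>. What is chosen for each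
  \<open>\<psi>\<close> is an entire function rather than a number for each z, so holomorphy comes
  with it; for Re z > -1 the value is pinned down by \<open>I z\<close>.\<close>

definition vhat :: "complex => ('e => complex) => complex" where
 "vhat z \<psi> = (if \<psi> \<in> TF then
   (SOME P. P holomorphic_on UNIV & (\<forall>z v. inV z v --> v \<psi> = P z * v star)) z else 0)"

lemma vhat_props:
 assumes \<psi>: "\<psi> \<in> TF" shows holomorphic_vhat: "(%z. vhat z \<psi>) holomorphic_on UNIV"
  and inV_vhat_eq: "inV z v ==> v \<psi> = vhat z \<psi> * v star"
proof -
 define P where "P = (SOME P. P holomorphic_on UNIV & (\<forall>z v. inV z v --> v \<psi> = P z * v star))"
 have "P holomorphic_on UNIV & (\<forall>z v. inV z v --> v \<psi> = P z * v star)"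
  unfolding P_def using ex_value_function[OF \<psi>] by (rule someI_ex)
 moreover have "vhat z \<psi> = P z" for z using \<psi> by (simp add: vhat_def P_def)
 ultimately show "(%z. vhat z \<psi>) holomorphic_on UNIV" "inV z v ==> v \<psi> = vhat z \<psi> * v star" by auto
qed

lemma entire_eqI:
 assumes "f holomorphic_on UNIV" "g holomorphic_on UNIV" "!!z. Re z > a ==> f z = g z" shows "f z = g z"
proof (rule analytic_continuation_open[where s = "{z. Re z > a}" and s' = UNIV and f = f and g = g])
 show "{z. Re z > a} ~= {}"
  using gt_ex[of a] by (metis (mono_tags, lifting) Re_complex_of_real empty_iff mem_Collect_eq)
 show "open {z. Re z > a}" by (rule open_halfspace_Re_gt)
qed (use assms in \<open>simp_all only: mem_Collect_eq open_UNIV connected_UNIV subset_UNIV UNIV_I\<close>)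

lemma I_star:
 assumes z: "Re z > - 1" shows "lam z * I z star = of_real kap" "I z star ~= 0"
proof -
 show *: "lam z * I z star = of_real kap" using star_mass[OF inV_I[OF z]] by (simp add: mass_I)
 thus "I z star ~= 0" using kap_nonzero by auto
qed

lemma vhat_I: 
 assumes "Re z > - 1" "\<psi> \<in> TF"
 shows "vhat z \<psi> = I z \<psi> / I z star" "lam z * I z \<psi> = of_real kap * vhat z \<psi>"
proof -
 have "I z \<psi> = vhat z \<psi> * I z star" by (rule inV_vhat_eq[OF assms(2) inV_I[OF assms(1)]])
 thus "vhat z \<psi> = I z \<psi> / I z star" "lam z * I z \<psi> = of_real kap * vhat z \<psi>"
  using I_star[OF assms(1)] by (simp_all add: mult.left_commute mult.commute)
qed

lemma vhat_star: "vhat z star = 1"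
proof (rule entire_eqI[of "%z. vhat z star" "%z. 1" "- 1"])
 show "vhat z star = 1" if "Re z > - 1" for z using vhat_I(1)[OF that test_fun_star] I_star(2)[OF that] by simp
qed (auto intro: holomorphic_vhat test_fun_star)

text \<open>Each identity holds for \<open>I z\<close> on Re z > -1 and continues because both sides
  are entire. With \<open>vhat_star\<close> this makes the space nonzero for every z.\<close>

lemma inV_vhat: "inV z (vhat z)" unfolding inV_def linear_on_tf_def
proof (intro conjI ballI allI impI)
 fix \<phi> \<psi> :: "'e => complex" assume t: "\<phi> \<in> TF" "\<psi> \<in> TF"
 show "vhat z (%x. \<phi> x + \<psi> x) = vhat z \<phi> + vhat z \<psi>"
 proof (rule entire_eqI[of "%z. vhat z (%x. \<phi> x + \<psi> x)" _ "- 1"])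
  show "vhat z (%x. \<phi> x + \<psi> x) = vhat z \<phi> + vhat z \<psi>" if z: "Re z > - 1" for z
   using t test_fun_add[OF t] linear_on_tf_add[OF inV_linear[OF inV_I[OF z]] t]
   by (simp add: vhat_I(1)[OF z] add_divide_distrib)
 qed (intro holomorphic_intros holomorphic_vhat test_fun_add t)+
next
 fix c and \<psi> :: "'e => complex" assume t: "\<psi> \<in> TF"
 show "vhat z (%x. c * \<psi> x) = c * vhat z \<psi>" proof (rule entire_eqI[of "%z. vhat z (%x. c * \<psi> x)" _ "- 1"])
  show "vhat z (%x. c * \<psi> x) = c * vhat z \<psi>" if z: "Re z > - 1" for z
   using t test_fun_cmult[OF t, of c] linear_on_tf_cmult[OF inV_linear[OF inV_I[OF z]] t] by (simp add: vhat_I(1)[OF z])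
 qed (intro holomorphic_intros holomorphic_vhat test_fun_cmult t)+
next
 fix \<psi> :: "'e => complex" and b assume t: "\<psi> \<in> TF"
 show "vhat z (%w. \<psi> (w + J b)) = vhat z \<psi>" proof (rule entire_eqI[of "%z. vhat z (%w. \<psi> (w + J b))" _ "- 1"])
  show "vhat z (%w. \<psi> (w + J b)) = vhat z \<psi>" if z: "Re z > - 1" for z
   using t test_fun_shift[OF t] inV_shift[OF inV_I[OF z] t] by (simp add: vhat_I(1)[OF z])
 qed (intro holomorphic_intros holomorphic_vhat test_fun_shift t)+
next
 fix \<psi> :: "'e => complex" and a :: 'f assume t: "\<psi> \<in> TF" and a: "a ~= 0"
 have t': "(%w. \<psi> (J a * w)) \<in> TF" using a by (intro test_fun_scale[OF t]) simp
 show "vhat z (%w. \<psi> (J a * w)) = of_real (inverse (absv (J a))) * inverse (\<sigma> z a) * vhat z \<psi>"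
 proof (rule entire_eqI[of "%z. vhat z (%w. \<psi> (J a * w))" _ "- 1"])
  show "vhat z (%w. \<psi> (J a * w)) = of_real (inverse (absv (J a))) * inverse (\<sigma> z a) * vhat z \<psi>" if z: "Re z > - 1" for z
   using t t' inV_scale[OF inV_I[OF z] t a] by (simp add: vhat_I(1)[OF z])
  show "(%z. of_real (inverse (absv (J a))) * inverse (\<sigma> z a) * vhat z \<psi>) holomorphic_on UNIV"
   using quasi_char_nonzero[OF sg p a] by (intro holomorphic_intros holomorphic_sigma holomorphic_vhat t) auto
 qed (intro holomorphic_vhat t')
qed

lemma mass_vhat: "of_real kap * mass (vhat z) = lam z" using star_mass[OF inV_vhat] by (simp add: vhat_star)

lemma vhat_off: "\<psi> \<in> test_fun (- range J) ==> of_real kap * vhat z \<psi> = lam z * I z \<psi>"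
 using inV_off[OF _ inV_vhat, of \<psi> z] mass_vhat[of z] by (simp flip: mult.assoc)

end

section \<open>Invariant distributions\<close>

lemma qexp_one_powi: "x ~= 0 ==> qexp TYPE('a) 1 powi val x = of_real (absv (x::'a::nonarch_local_field))"
 using qexp_of_int[of "val x", where 'a='a] by (simp add: qexp_powi absv_def)

lemma qexp_combine: "qexp T a * qexp T b * inverse (qexp T c) = qexp T (a + b - c)"
 by (simp add: qexp_diff qexp_add divide_inverse)

lemma quasi_char_product:
 "quasi_char p c1 s x * quasi_char p c2 t x = quasi_char p (%x. c1 x * c2 x) (s + t) (x::'a::nonarch_local_field)"
 by (cases "x = 0") (simp_all add: quasi_char_eq qexp_add power_int_mult_distrib mult_ac)

lemma test_fun_inversion:
 fixes \<phi> :: "'a::nonarch_local_field => complex"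
 assumes "\<phi> \<in> TF0" shows "(%w. \<phi> (inverse w)) \<in> TF0"
proof -
 have U: "\<phi> \<in> TF" "\<phi> 0 = 0" using assms test_fun_iff[of \<phi> "- {0}"] by auto
 obtain n m where nm: "periodic n \<phi>" "supported m \<phi>" using U(1) by (rule test_funE)
 have "(%w. \<phi> (inverse w)) \<in> TF" proof (rule test_funI[of _ "- n"])
  show "locally_constant (%w. \<phi> (inverse w))" unfolding locally_constant_pw proof
   fix x :: 'a
   show "\<exists>k. \<forall>y. y - x \<in> pw k --> \<phi> (inverse y) = \<phi> (inverse x)" proof (cases "x = 0")
    case True
    have "\<phi> (inverse y) = 0" if "y \<in> pw (1 - m)" for y proof (cases "y = 0")
     case False
     hence "inverse y \<notin> pw m" using that by (auto simp: pw_def val_inverse)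
     thus ?thesis using nm(2) by (simp add: supported_def)
    qed (simp add: U)
    thus ?thesis using True U(2) by (intro exI[of _ "1 - m"]) simp
   next
    case False
    let ?k = "max (val x + 1) (n + 2 * val x)"
    have "\<phi> (inverse y) = \<phi> (inverse x)" if y: "y - x \<in> pw ?k" for y proof -
     have "y - x \<in> pw (val x + 1)" "y - x \<in> pw (n + 2 * val x)" using pw_mono[OF _ y] by auto
     hence "inverse y - inverse x \<in> pw n" using inverse_near(3)[OF False] by blast
     thus ?thesis by (rule periodicD[OF nm(1)])
    qed
    thus ?thesis by blast
   qed
  qed
  show "supported (- n) (%w. \<phi> (inverse w))" unfolding supported_def proof (intro allI impI)
   fix w :: 'a assume "w \<notin> pw (- n)"
   hence "inverse w \<in> pw n" by (auto simp: pw_def val_inverse)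
   hence "\<phi> (inverse w) = \<phi> 0" using periodicD[OF nm(1), of "inverse w" 0] by simp
   thus "\<phi> (inverse w) = 0" using U by simp
  qed
 qed
 thus ?thesis using U by (subst test_fun_iff) auto
qed

text \<open>\<open>beta_ramified\<close> gives \<beta> valuation one in the ramified case, which
  controls the coordinates of elements of valuation one.\<close>

locale kernel_setting = quadratic_local_extension J d \<alpha> pF pE + lattice_extension J \<beta> e
 for J :: "'f::nonarch_local_field => 'e::nonarch_local_field" and d \<alpha> pF pE \<beta> e +
 fixes M :: "'e measure" and chi :: "'e => complex" and eta :: "'f => complex"
 assumes haar: "normalized_haar M" and chi: "unit_character chi" and eta: "unit_character eta"
  and e_ram: "e = ram" and beta_ramified: "\<not> unramified J ==> \<beta> = \<alpha>"
begin

lemma unit_character_restrict: "unit_character (%x. chi (J x))" unfolding unit_character_def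
proof (intro conjI ballI)
 have "continuous_on (J ` int_units) chi"
  by (rule continuous_on_subset[of int_units chi]) (use chi emb_unit in \<open>auto simp: unit_character_def\<close>)
 moreover have "continuous_on int_units J" using \<iota>_continuous continuous_on_subset by blast
 ultimately show "continuous_on int_units (%x. chi (J x))"
  using continuous_on_compose2[of "J ` int_units" chi int_units J] by blast
 show "chi (J 1) = 1" using chi by (simp add: emb_one unit_character_def)
 show "chi (J (x * y)) = chi (J x) * chi (J y)" if "x \<in> int_units" "y \<in> int_units" for x y
  using that emb_unit unit_character_mult[OF chi] by (simp add: emb_mult)
qed

definition sg :: "'f => complex" where "sg x = chi (J x) * eta x"

lemma unit_character_sg: "unit_character sg"
proof -
 have "continuous_on int_units (%x. chi (J x) * eta x)"
  using unit_character_restrict eta by (intro continuous_on_mult) (auto simp: unit_character_def)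
 thus ?thesis using unit_character_restrict eta unfolding unit_character_def sg_def by simp
qed

sublocale char_lattice J \<beta> e M pF sg using haar uniformizer_F unit_character_sg by unfold_locales

lemmas pF0 = uniformizer_nonzero[OF uniformizer_F]

lemma pE_powi_e: "pE powi e = J pF" using uniformizers_compatible by (auto simp: e_ram ram_def split: if_splits)

lemma ang_emb: "x ~= 0 ==> ang pE (J x) = J (ang pF x)"
proof -
 assume x: "x ~= 0"
 have "pE powi (- (e * val x)) = (pE powi e) powi (- val x)" by (simp flip: power_int_mult)
 thus ?thesis using x by (simp add: ang_def val_emb pE_powi_e emb_mult emb_power_int)
qed

lemma quasi_char_emb: "quasi_char pE chi s (J x) = quasi_char pF (%x. chi (J x)) (2 * s) x"
proof (cases "x = 0")
 case False
 have "qexp TYPE('e) s powi (e * val x) = qexp TYPE('f) (2 * s) powi val x" by (simp add: power_int_mult qexp_ext)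
 thus ?thesis using False by (simp add: quasi_char_eq ang_emb val_emb)
qed simp

text \<open>Restriction to F doubles the exponent (\<open>quasi_char_emb\<close>), so the product of
  the two quasi-characters has exponent 2(s - 1/2) + (t + 1/2).\<close>

definition zz :: "complex => complex => complex" where "zz s t = 2 * s + t - 1/2"

lemma sigma_product:
 "quasi_char pE chi (s - 1/2) (J y) * quasi_char pF eta (t + 1/2) y = quasi_char pF sg (zz s t) y"
 unfolding quasi_char_emb quasi_char_product sg_def[abs_def, symmetric]
 by (simp add: zz_def sg_def[abs_def] algebra_simps)

abbreviation mu :: "complex => 'e => complex" where "mu s \<equiv> quasi_char pE chi (s - 1/2)"
abbreviation nu :: "complex => 'f => complex" where "nu t \<equiv> quasi_char pF eta (t + 1/2)"

text \<open>By \<open>theta_mu\<close> this is the quasi-character with exponent s - 1/2 at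
  \<open>x ^ 2\<close> times the Jacobian factor \<open>absv x ^ 2\<close>: the weight acquired by
  test functions under inversion.\<close>

definition theta :: "complex => 'e => complex" where "theta s x = quasi_char pE chi (s + 1/2) x ^ 2"

lemma theta_mu: "theta s x = mu s x ^ 2 * of_real (absv x ^ 2)"
proof (cases "x = 0")
 case False
 have "quasi_char pE chi (s - 1/2 + 1) x = mu s x * qexp TYPE('e) 1 powi val x" by (rule quasi_char_add)
 thus ?thesis using qexp_one_powi[OF False] by (simp add: theta_def power_mult_distrib algebra_simps)
qed (simp add: theta_def)

lemma theta_zero [simp]: "theta s 0 = 0" by (simp add: theta_def)

lemma theta_nonzero: "x ~= 0 ==> theta s x ~= 0" using quasi_char_nonzero[OF chi uniformizer_E] by (simp add: theta_def)

lemma theta_mult: "theta s (x * y) = theta s x * theta s y"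
 by (simp add: theta_def quasi_char_mult[OF chi uniformizer_E] power_mult_distrib)

lemma theta_one [simp]: "theta s 1 = 1" by (simp add: theta_def quasi_char_one[OF chi])

lemma theta_inverse: "theta s (inverse x) = inverse (theta s x)"
 by (simp add: theta_def quasi_char_inverse[OF chi uniformizer_E] power_inverse)

lemma theta_divide: "theta s (x / y) = theta s x / theta s y" by (simp add: divide_inverse theta_mult theta_inverse)

lemma theta_locally_constant: "x ~= 0 ==> \<exists>n. \<forall>y. y - x \<in> pw n --> theta s y = theta s x"
 using quasi_char_locally_constant[OF uniformizer_E chi, of x] unfolding theta_def by metis

text \<open>Inversion of test functions vanishing at 0, with the weight that turns the invariance
  conditions into plain translation invariance and homogeneity. At 0 both operations give 0, because
  \<open>inverse 0 = 0\<close> and \<open>theta s 0 = 0\<close>.\<close>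

definition push :: "complex => ('e => complex) => 'e => complex" where
 "push s \<psi> x = \<psi> (inverse x) * theta s (inverse x)"

definition pull :: "complex => ('e => complex) => 'e => complex" where
 "pull s \<phi> w = \<phi> (inverse w) * inverse (theta s w)"

lemma test_fun_push_pull:
 assumes "\<phi> \<in> TF0" shows test_fun_push: "push s \<phi> \<in> TF0" and test_fun_pull: "pull s \<phi> \<in> TF0"
proof -
 note inv = test_fun_inversion[OF assms]
 have 0: "\<phi> (inverse x) ~= 0 ==> x ~= 0" for x using assms test_fun_iff[of \<phi> "- {0}"] by auto
 have "(%x. inverse (theta s x) * \<phi> (inverse x)) \<in> TF0"
  by (rule test_fun_mult[OF inv]) (use theta_locally_constant 0 in metis)
 thus "push s \<phi> \<in> TF0" "pull s \<phi> \<in> TF0"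
  by (simp_all add: push_def[abs_def] pull_def[abs_def] theta_inverse mult.commute)
qed

lemma push_pull: "\<phi> 0 = 0 ==> push s (pull s \<phi>) = \<phi>"
proof
 assume "\<phi> 0 = 0"
 thus "push s (pull s \<phi>) x = \<phi> x" for x
  using theta_nonzero[of "inverse x" s] by (cases "x = 0") (simp_all add: push_def pull_def)
qed

lemma pull_push: "\<psi> 0 = 0 ==> pull s (push s \<psi>) = \<psi>"
proof
 assume "\<psi> 0 = 0"
 thus "pull s (push s \<psi>) x = \<psi> x" for x using theta_nonzero[of x s] by (cases "x = 0") (simp_all add: push_def pull_def)
qed

abbreviation D :: "complex => complex => (('e => complex) => complex) set" where
 "D s t \<equiv> invariant_distributions J pE pF chi s eta t"

text \<open>The factor in the homogeneity condition once the Jacobian is moved to the right. For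
  \<delta> the left side is unchanged by dilation, so \<delta> is homogeneous exactly when this is 1
  for all nonzero \<open>a\<close>.\<close>

definition kfac :: "complex => complex => 'f => complex" where
 "kfac s t a = of_real (absv (J a)) * mu s (J a) * inverse (nu t a)"

text \<open>\<open>moved\<close> and \<open>twisted\<close> are the two sides of the unipotent
  condition, as operations on test functions.\<close>

definition moved :: "'f => ('e => complex) => 'e => complex" where
 "moved b \<phi> x = (if 1 + J b * x = 0 then 0
   else of_real (inverse (absv (1 + J b * x) ^ 2)) * \<phi> (x / (1 + J b * x)))"

definition twisted :: "complex => 'f => ('e => complex) => 'e => complex" where
 "twisted s b \<phi> x = inverse (mu s ((1 - J b * x) ^ 2)) * \<phi> x"

lemma distributions_iff: "u \<in> distributions \<longleftrightarrow> linear_on_tf UNIV u & (\<forall>\<phi>. \<phi> \<notin> TF --> u \<phi> = 0)"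
 by (simp add: distributions_def linear_on_tf_def)

lemma D_iff:
 "u \<in> D s t \<longleftrightarrow> linear_on_tf UNIV u & (\<forall>\<phi>. \<phi> \<notin> TF --> u \<phi> = 0) &
   (\<forall>a. a ~= 0 --> (\<forall>\<phi>\<in>TF. u (%x. \<phi> (inverse (J a) * x)) = kfac s t a * u \<phi>)) &
   (\<forall>b. b ~= 0 --> (\<forall>\<phi>\<in>test_fun (UNIV - {inverse (J b)}). u (moved b \<phi>) = u (twisted s b \<phi>)))"
proof -
 have eq: "(of_real (inverse (absv (J a))) * x = mu s (J a) * inverse (nu t a) * y) \<longleftrightarrow> (x = kfac s t a * y)"
  if "a ~= 0" for a and x y :: complex using that absv_pos[of "J a"] by (auto simp: kfac_def field_simps)
 show ?thesis
  unfolding invariant_distributions_def mem_Collect_eq distributions_iff moved_def[abs_def] twisted_def[abs_def]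
  using eq by (auto simp: distributions_iff)
qed

lemma kfac_mult: "kfac s t (a * b) = kfac s t a * kfac s t b"
 by (simp add: kfac_def emb_mult absv_mult quasi_char_mult[OF chi uniformizer_E] quasi_char_mult[OF eta uniformizer_F])

lemma sigma_mu_nu: "\<sigma> (zz s t) a = mu s (J a) * nu t a" by (simp add: sigma_product)

lemma kfac_sigma: "a ~= 0 ==>
 kfac s t a = theta s (J a) * of_real (inverse (absv (J a))) * inverse (\<sigma> (zz s t) a)"
 using absv_pos[of "J a"] quasi_char_nonzero[OF chi uniformizer_E, of "J a"]
 by (simp add: kfac_def theta_mu sigma_mu_nu field_simps power2_eq_square)

lemma test_fun_twisted:
 assumes "\<phi> \<in> test_fun (UNIV - {inverse (J b)})" "b ~= 0"
 shows "twisted s b \<phi> \<in> test_fun (UNIV - {inverse (J b)})" unfolding twisted_def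
proof (rule test_fun_mult[OF assms(1)])
 fix x assume "\<phi> x ~= 0"
 hence "x ~= inverse (J b)" using assms(1) test_fun_iff[of \<phi> "UNIV - {inverse (J b)}"] by auto
 hence nz: "1 - J b * x ~= 0" using assms(2) by (auto simp: field_simps)
 obtain n where n: "!!y. y - (1 - J b * x) \<in> pw n ==> mu s y = mu s (1 - J b * x)"
  using quasi_char_locally_constant[OF uniformizer_E chi nz] by blast
 have "mu s (1 - J b * y) = mu s (1 - J b * x)" if "y - x \<in> pw (n - val (J b))" for y proof (rule n)
  have "(1 - J b * y) - (1 - J b * x) = - (J b * (y - x))" by (simp add: algebra_simps)
  thus "(1 - J b * y) - (1 - J b * x) \<in> pw n" using that assms(2) by (simp add: pw_mult_iff del: minus_mult_right)
 qed
 hence "\<forall>y. y - x \<in> pw (n - val (J b)) -->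
   inverse (mu s ((1 - J b * y)\<^sup>2)) = inverse (mu s ((1 - J b * x)\<^sup>2))"
  unfolding quasi_char_power[OF chi uniformizer_E] by metis
 thus "\<exists>n. \<forall>y. y - x \<in> pw n --> inverse (mu s ((1 - J b * y)\<^sup>2)) = inverse (mu s ((1 - J b * x)\<^sup>2))" by blast
qed

text \<open>Under w = 1/x the map x/(1 + bx) becomes w + b, and the weights of \<open>moved\<close>
  and \<open>twisted\<close> cancel against those of \<open>pull\<close>. The unipotent condition is
  therefore invariance under translation by F.\<close>

lemma pull_shift:
 assumes "b ~= 0" "\<phi> 0 = 0" "\<phi> (inverse (J b)) = 0"
 shows "pull s (moved b \<phi>) = (%w. pull s (twisted s b \<phi>) (w + J b))"
proof
 fix w
 show "pull s (moved b \<phi>) w = pull s (twisted s b \<phi>) (w + J b)" proof (cases "w = 0 \<or> w + J b = 0")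
  case True
  thus ?thesis proof
   assume "w = 0"
   thus ?thesis using assms by (simp add: pull_def twisted_def)
  next
   assume "w + J b = 0"
   hence "1 + J b * inverse w = 0"
    using assms(1) by (metis add.right_neutral add_eq_0_iff emb_eq_0_iff mult_minus_left neg_eq_iff_add_eq_0 right_inverse)
   thus ?thesis using \<open>w + J b = 0\<close> assms by (simp add: pull_def moved_def twisted_def)
  qed
 next
  case False
  hence nz: "w ~= 0" "w + J b ~= 0" by auto
  have 1: "1 + J b * inverse w = (w + J b) / w" "1 - J b * inverse (w + J b) = w / (w + J b)"
   using nz by (simp_all add: field_simps)
  have 2: "inverse w / ((w + J b) / w) = inverse (w + J b)" using nz by (simp add: field_simps)
  have 3: "complex_of_real (absv ((w + J b) / w)) = of_real (absv (w + J b)) / of_real (absv w)"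
   by (simp add: divide_inverse absv_mult absv_inverse)
  show ?thesis using nz absv_pos[OF nz(1)] absv_pos[OF nz(2)] quasi_char_nonzero[OF chi uniformizer_E, of w]
    quasi_char_nonzero[OF chi uniformizer_E, of "w + J b"]
   by (simp add: pull_def moved_def twisted_def 1 2 3 theta_mu quasi_char_power[OF chi uniformizer_E]
     quasi_char_divide[OF chi uniformizer_E] field_simps)
 qed
qed

lemma test_fun_moved:
 assumes \<phi>: "\<phi> \<in> test_fun (UNIV - {inverse (J b)})" "\<phi> 0 = 0" and b: "b ~= 0" shows "moved b \<phi> \<in> TF0"
proof -
 have tw: "twisted s b \<phi> \<in> TF0" "\<phi> (inverse (J b)) = 0" for s
  using test_fun_twisted[OF \<phi>(1) b, of s] \<phi> test_fun_iff[of "twisted s b \<phi>" "- {0}"]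
   test_fun_iff[of "twisted s b \<phi>" "UNIV - {inverse (J b)}"] test_fun_iff[of \<phi> "UNIV - {inverse (J b)}"]
  by (auto simp: twisted_def)
 have "(%w. pull 0 (twisted 0 b \<phi>) (w + J b)) \<in> TF"
  by (intro test_fun_shift test_fun_subset[OF test_fun_pull[OF tw(1)]]) simp
 hence "pull 0 (moved b \<phi>) \<in> TF" using pull_shift[OF b \<phi>(2) tw(2)] by simp
 moreover have m0: "moved b \<phi> 0 = 0" using \<phi>(2) by (simp add: moved_def)
 hence "pull 0 (moved b \<phi>) 0 = 0" by (simp add: pull_def)
 ultimately have "pull 0 (moved b \<phi>) \<in> TF0" using test_fun_iff[of "pull 0 (moved b \<phi>)" "- {0}"] by auto
 from test_fun_push[OF this, of 0] show ?thesis by (simp add: push_pull m0)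
qed

text \<open>The functional on all of E in the coordinate w: a translation by F makes the test
  function vanish at w = 0, after which its inversion has compact support and \<open>u\<close>
  applies. The choice of \<open>b\<close> is harmless by
  \<open>push_shift_independent\<close>.\<close>

definition ext :: "complex => (('e => complex) => complex) => ('e => complex) => complex" where
 "ext s u \<psi> = u (push s (%w. \<psi> (w + J (SOME b. \<psi> (J b) = 0))))"

lemma ex_far: obtains b where "b ~= 0" "J b \<notin> pw m"
proof -
 have "val (pF powi (- (\<bar>m\<bar> + 1))) = - (\<bar>m\<bar> + 1)" "pF powi (- (\<bar>m\<bar> + 1)) ~= 0"
  using uniformizer_F by (auto simp: uniformizer_iff_val val_power_int)
 moreover have "e * - (\<bar>m\<bar> + 1) \<le> 1 * - (\<bar>m\<bar> + 1)" using e_pos by (intro mult_right_mono_neg) auto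
 ultimately show thesis by (intro that[of "pF powi (- (\<bar>m\<bar> + 1))"]) (auto simp: pw_def val_emb)
qed

lemma ex_common_zero:
 assumes "\<phi> \<in> TF" "\<psi> \<in> test_fun (UNIV :: 'e set)" obtains b where "\<phi> (J b) = 0" "\<psi> (J b) = 0"
proof -
 obtain n m where nm: "periodic n \<phi>" "supported m \<phi>" using assms(1) by (rule test_funE)
 obtain n' m' where nm': "periodic n' \<psi>" "supported m' \<psi>" using assms(2) by (rule test_funE)
 obtain b where "J b \<notin> pw (min m m')" using ex_far by metis
 thus thesis using that[of b] supported_mono[OF nm(2), of "min m m'"] supported_mono[OF nm'(2), of "min m m'"]
  by (auto simp: supported_def)
qed

text \<open>The consequences of membership in \<open>D\<close> from which \<open>ext\<close> is
  built. Homogeneity is asked only on test functions vanishing at 0, where multiples of \<delta> are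
  invisible.\<close>

definition covariant :: "complex => complex => (('e => complex) => complex) => bool" where
 "covariant s t u \<longleftrightarrow> linear_on_tf UNIV u &
   (\<forall>a. a ~= 0 --> (\<forall>\<phi>\<in>TF0. u (%x. \<phi> (inverse (J a) * x)) = kfac s t a * u \<phi>)) &
   (\<forall>b. b ~= 0 --> (\<forall>\<phi>\<in>test_fun (UNIV - {inverse (J b)}). u (moved b \<phi>) = u (twisted s b \<phi>)))"

lemma D_covariant: "u \<in> D s t ==> covariant s t u"
 unfolding D_iff covariant_def using test_fun_subset[of _ "- {0}" UNIV] by blast

text \<open>Undo the twist: if \<open>twisted s c \<phi>\<close> is the function pushed with shift
  \<open>b\<close>, then by \<open>pull_shift\<close> the function \<open>moved c \<phi>\<close> is
  the one pushed with shift \<open>b' = b + c\<close>, and the unipotent condition equates their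
  values.\<close>

lemma push_shift_independent:
 assumes u: "covariant s t u" and \<psi>: "\<psi> \<in> TF" and b: "\<psi> (J b) = 0" "\<psi> (J b') = 0"
 shows "u (push s (%w. \<psi> (w + J b))) = u (push s (%w. \<psi> (w + J b')))"
proof (cases "b = b'")
 case False
 define c where "c = b' - b"
 have c: "c ~= 0" "J b' = J c + J b" using False by (auto simp: c_def emb_diff)
 define \<psi>1 where "\<psi>1 = (%w. \<psi> (w + J b))"
 have t1: "\<psi>1 \<in> TF0" unfolding \<psi>1_def using test_fun_shift[OF \<psi>, of "J b"] b by (subst test_fun_iff) auto
 have p1: "push s \<psi>1 \<in> TF0" by (rule test_fun_push[OF t1])
 have z1: "push s \<psi>1 0 = 0" "push s \<psi>1 (inverse (J c)) = 0" using b c by (simp_all add: push_def \<psi>1_def)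
 define \<phi> where "\<phi> = (%x. mu s ((1 - J c * x) ^ 2) * push s \<psi>1 x)"
 have pU: "push s \<psi>1 \<in> test_fun (UNIV - {inverse (J c)})"
  using p1 z1 test_fun_iff[of "push s \<psi>1" "- {0}"] by (subst test_fun_iff) auto
 have \<phi>t: "\<phi> \<in> test_fun (UNIV - {inverse (J c)})" proof (rule test_fun_cong_supp[OF pU])
  have nzt: "twisted s c (push s \<psi>1) \<in> test_fun (UNIV - {inverse (J c)})" by (rule test_fun_twisted[OF pU c(1)])
  fix x
  obtain n where n: "!!y. y - x \<in> pw n ==> twisted s c (push s \<psi>1) y = twisted s c (push s \<psi>1) x"
   using locally_constantE[OF test_fun_locally_constant[OF nzt], of x] by blast
  obtain n' where n': "!!y. y - x \<in> pw n' ==> push s \<psi>1 y = push s \<psi>1 x"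
   using locally_constantE[OF test_fun_locally_constant[OF pU], of x] by blast
  have "\<phi> y = \<phi> x" if y: "y - x \<in> pw (max n n')" for y proof -
   have e1: "twisted s c (push s \<psi>1) y = twisted s c (push s \<psi>1) x" "push s \<psi>1 y = push s \<psi>1 x"
    using n[OF pw_mono[OF _ y]] n'[OF pw_mono[OF _ y]] by auto
   show ?thesis proof (cases "push s \<psi>1 x = 0")
    case False
    hence "inverse (mu s ((1 - J c * y) ^ 2)) = inverse (mu s ((1 - J c * x) ^ 2))" using e1 by (simp add: twisted_def)
    thus ?thesis using e1 by (simp add: \<phi>_def)
   qed (use e1 in \<open>simp add: \<phi>_def\<close>)
  qed
  thus "\<exists>n. \<forall>y. y - x \<in> pw n --> \<phi> y = \<phi> x" by blast
 qed (simp add: \<phi>_def)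
 have tw: "twisted s c \<phi> = push s \<psi>1" proof
  fix x
  show "twisted s c \<phi> x = push s \<psi>1 x" proof (cases "1 - J c * x = 0")
   case True
   hence "x = inverse (J c)" using c(1) by (simp add: field_simps)
   thus ?thesis using z1 by (simp add: twisted_def \<phi>_def)
  next
   case False
   hence "mu s ((1 - J c * x) ^ 2) ~= 0" using quasi_char_nonzero[OF chi uniformizer_E] by simp
   thus ?thesis by (simp add: twisted_def \<phi>_def)
  qed
 qed
 have \<phi>0: "\<phi> 0 = 0" "\<phi> (inverse (J c)) = 0" using z1 by (simp_all add: \<phi>_def)
 have "pull s (moved c \<phi>) = (%w. pull s (push s \<psi>1) (w + J c))" using pull_shift[OF c(1) \<phi>0] by (simp add: tw)
 also have "pull s (push s \<psi>1) = \<psi>1" using b by (intro pull_push) (simp add: \<psi>1_def)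
 finally have "push s (pull s (moved c \<phi>)) = push s (%w. \<psi> (w + J b'))" by (simp add: \<psi>1_def c(2) add.assoc)
 hence mv: "moved c \<phi> = push s (%w. \<psi> (w + J b'))" using \<phi>0 by (subst (asm) push_pull) (simp_all add: moved_def)
 have "u (moved c \<phi>) = u (twisted s c \<phi>)" using u \<phi>t c(1) unfolding covariant_def by blast
 thus ?thesis unfolding mv tw \<psi>1_def by simp
qed simp

lemma ext_eq:
 assumes "covariant s t u" "\<psi> \<in> TF" "\<psi> (J b) = 0" shows "ext s u \<psi> = u (push s (%w. \<psi> (w + J b)))"
proof -
 have "\<psi> (J (SOME b. \<psi> (J b) = 0)) = 0" using assms(3) by (rule someI)
 thus ?thesis unfolding ext_def by (rule push_shift_independent[OF assms(1,2) _ assms(3)])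
qed

lemma test_fun_shift0: "\<psi> \<in> TF ==> \<psi> (J b) = 0 ==> (%w. \<psi> (w + J b)) \<in> TF0"
 using test_fun_shift[of \<psi> "J b"] by (subst test_fun_iff) auto

text \<open>Each identity is checked after one translation that makes all functions involved vanish
  at 0. In the homogeneity \<open>kfac\<close> and the weight \<open>theta\<close> combine to the
  degree of \<open>\<sigma>\<close> (\<open>kfac_sigma\<close>).\<close>

lemma inV_ext:
 assumes u: "covariant s t u" shows "inV (zz s t) (ext s u)" unfolding inV_def linear_on_tf_def
proof (intro conjI ballI allI impI)
 have lin: "linear_on_tf UNIV u" using u by (simp add: covariant_def)
 have tU: "push s (%w. \<psi> (w + J b)) \<in> TF" if "\<psi> \<in> TF" "\<psi> (J b) = 0" for \<psi> b
  by (rule test_fun_subset[OF test_fun_push[OF test_fun_shift0[OF that]]]) simp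
 {
  fix \<phi> \<psi> :: "'e => complex" assume t: "\<phi> \<in> TF" "\<psi> \<in> TF"
  obtain b where b: "\<phi> (J b) = 0" "\<psi> (J b) = 0" using ex_common_zero[OF t] .
  have "push s (%w. \<phi> (w + J b) + \<psi> (w + J b)) =
    (%x. push s (%w. \<phi> (w + J b)) x + push s (%w. \<psi> (w + J b)) x)" by (simp add: push_def fun_eq_iff distrib_right)
  thus "ext s u (%x. \<phi> x + \<psi> x) = ext s u \<phi> + ext s u \<psi>"
   using ext_eq[OF u test_fun_add[OF t], of b] ext_eq[OF u t(1) b(1)] ext_eq[OF u t(2) b(2)] b
    linear_on_tf_add[OF lin tU[OF t(1) b(1)] tU[OF t(2) b(2)]] by simp
 next
  fix c and \<psi> :: "'e => complex" assume t: "\<psi> \<in> TF"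
  obtain b where b: "\<psi> (J b) = 0" using ex_common_zero[OF t t] .
  have "push s (%w. c * \<psi> (w + J b)) = (%x. c * push s (%w. \<psi> (w + J b)) x)" by (simp add: push_def fun_eq_iff)
  thus "ext s u (%x. c * \<psi> x) = c * ext s u \<psi>" using ext_eq[OF u test_fun_cmult[OF t, of c], of b] ext_eq[OF u t b] b
    linear_on_tf_cmult[OF lin tU[OF t b]] by simp
 next
  fix \<psi> :: "'e => complex" and c :: 'f assume t: "\<psi> \<in> TF"
  obtain b where b: "\<psi> (J b) = 0" using ex_common_zero[OF t t] .
  have "ext s u (%w. \<psi> (w + J c)) = u (push s (%w. \<psi> (w + J (b - c) + J c)))"
   using b by (intro ext_eq[OF u test_fun_shift[OF t]]) (simp add: emb_diff)
  thus "ext s u (%w. \<psi> (w + J c)) = ext s u \<psi>" using ext_eq[OF u t b] by (simp add: emb_diff algebra_simps)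
 next
  fix \<psi> :: "'e => complex" and a :: 'f assume t: "\<psi> \<in> TF" and a: "a ~= 0"
  obtain c where c: "\<psi> (J c) = 0" using ex_common_zero[OF t t] .
  define b where "b = c / a"
  have b: "J a * J b = J c" using a by (simp add: b_def flip: emb_mult)
  define \<psi>' where "\<psi>' = (%w. \<psi> (w + J c))"
  have "ext s u (%w. \<psi> (J a * w)) = u (push s (%w. \<psi> (J a * (w + J b))))"
   using a c b by (intro ext_eq[OF u test_fun_scale[OF t]]) simp_all
  also have "push s (%w. \<psi> (J a * (w + J b))) = (%x. inverse (theta s (J a)) * push s \<psi>' (inverse (J a) * x))"
   using a theta_nonzero[of "J a" s] by (simp add: push_def fun_eq_iff distrib_left b \<psi>'_def theta_mult)
  also have "u \<dots> = inverse (theta s (J a)) * u (%x. push s \<psi>' (inverse (J a) * x))"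
   using tU[OF t c] a unfolding \<psi>'_def by (intro linear_on_tf_cmult[OF lin] test_fun_scale) auto
  also have "u (%x. push s \<psi>' (inverse (J a) * x)) = kfac s t a * u (push s \<psi>')"
   using u a test_fun_push[OF test_fun_shift0[OF t c], of s] unfolding covariant_def \<psi>'_def by blast
  also have "u (push s \<psi>') = ext s u \<psi>" unfolding \<psi>'_def by (rule ext_eq[OF u t c, symmetric])
  finally show "ext s u (%w. \<psi> (J a * w)) = of_real (inverse (absv (J a))) * inverse (\<sigma> (zz s t) a) * ext s u \<psi>"
   using kfac_sigma[OF a, of s t] theta_nonzero[of "J a" s] a by simp
 }
qed

text \<open>Seen through \<open>pull\<close>, the restriction of \<open>u\<close> off 0 is
  translation invariant and homogeneous, hence a multiple of the generator, and \<open>star\<close>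
  reads off the multiple.\<close>

lemma covariant_off_zero:
 assumes u: "covariant s t u" and \<phi>: "\<phi> \<in> TF0" shows "u \<phi> = vhat (zz s t) (pull s \<phi>) * ext s u star"
proof -
 have \<phi>0: "\<phi> 0 = 0" using \<phi> test_fun_iff[of \<phi> "- {0}"] by auto
 have pt: "pull s \<phi> \<in> TF" by (rule test_fun_subset[OF test_fun_pull[OF \<phi>]]) simp
 have "ext s u (pull s \<phi>) = u (push s (%w. pull s \<phi> (w + J 0)))"
  using \<phi>0 by (intro ext_eq[OF u pt]) (simp add: pull_def)
 hence "ext s u (pull s \<phi>) = u \<phi>" using push_pull[of \<phi> s] \<phi>0 by simp
 thus ?thesis using inV_vhat_eq[OF pt inV_ext[OF u]] by simp
qed

text \<open>The radius is chosen so that \<open>om\<close> minus its dilate by \<open>pF\<close> is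
  the indicator of the valuations from 1 - e to 0 (\<open>shell\<close>), which inversion turns into
  the valuations from 0 to e - 1.\<close>

definition om :: "'e => complex" where "om = ball_ind 0 (1 - e)"

lemma test_fun_om: "om \<in> TF" by (simp add: om_def test_fun_ball_ind_UNIV)

lemma om_zero [simp]: "om 0 = 1" by (simp add: om_def ball_ind_def)

lemma om_scale: "a ~= 0 ==> om (inverse (J a) * x) = ball_ind 0 (1 - e + e * val a) x"
 by (simp add: om_def ball_ind_def pw_mult_iff val_inverse val_emb)

definition minus_om :: "('e => complex) => 'e => complex" where
 "minus_om \<phi> x = \<phi> x - \<phi> 0 * om x"

lemma test_fun_minus_om: "\<phi> \<in> TF ==> minus_om \<phi> \<in> TF0" unfolding minus_om_def
 by (subst test_fun_iff) (auto intro!: test_fun_diff test_fun_cmult test_fun_om)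

definition shell :: "'e => complex" where "shell x = ball_ind 0 (1 - e) x - ball_ind 0 1 x"

lemma test_fun_shell: "shell \<in> TF0" unfolding shell_def[abs_def]
 using test_fun_diff[OF test_fun_ball_ind_UNIV test_fun_ball_ind_UNIV, of 0 "1 - e" 0 1]
 by (subst test_fun_iff) (auto simp: ball_ind_def)

text \<open>The general shape of a distribution that is \<open>C\<close> times the generator off 0:
  \<open>om\<close> splits off the value at 0. The pair A = 1, C = 0 is \<delta>.\<close>

definition UU :: "complex => complex => complex => complex => ('e => complex) => complex" where
 "UU s t A C \<phi> = (if \<phi> \<in> TF then A * \<phi> 0 + C * vhat (zz s t) (pull s (minus_om \<phi>)) else 0)"

definition SS :: "complex => complex => complex" where
 "SS s t = vhat (zz s t) (pull s shell)"

definition triv' :: bool where "triv' \<longleftrightarrow> (\<forall>x\<in>int_units. chi (J x) * inverse (eta x) = 1)"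

definition lam' :: "complex => complex => complex" where
 "lam' s t = (if triv' then 1 - qexp TYPE('f) (2 * s - t + 1/2) else 1)"

text \<open>The constraint that homogeneity puts on the pair. If \<open>kfac\<close> is nontrivial
  on units, testing \<open>om\<close> with a unit forces A = 0. Otherwise testing it with
  \<open>pF\<close> leaves (1 - \<open>kfac s t pF\<close>) A on one side and C times the generator
  on \<open>shell\<close> on the other.\<close>

definition rel :: "complex => complex => complex => complex => bool" where
 "rel s t A C \<longleftrightarrow> (if triv' then lam' s t * A = SS s t * C else A = 0)"

lemma kfac_formula:
 assumes a: "a ~= 0"
 shows "kfac s t a = chi (J (ang pF a)) * inverse (eta (ang pF a)) * qexp TYPE('f) (2 * s - t + 1/2) powi val a"
proof -
 have "complex_of_real (absv (J a)) = (qexp TYPE('f) 1 * qexp TYPE('f) 1) powi val a"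
  unfolding power_int_mult_distrib qexp_one_powi[OF a] by (simp add: absv_emb power2_eq_square)
 also have "qexp TYPE('f) 1 * qexp TYPE('f) 1 = qexp TYPE('f) 2" by (simp flip: qexp_add)
 finally have 1: "complex_of_real (absv (J a)) = qexp TYPE('f) 2 powi val a" .
 have "qexp TYPE('f) 2 * qexp TYPE('f) (2 * (s - 1/2)) * inverse (qexp TYPE('f) (t + 1/2)) = qexp TYPE('f) (2 * s - t + 1/2)"
  unfolding qexp_combine by (simp add: algebra_simps)
 thus ?thesis unfolding kfac_def 1 quasi_char_emb quasi_char_eq[OF a]
  by (simp add: mult_ac flip: power_int_mult_distrib power_int_inverse)
qed

lemma kfac_unit: "a \<in> int_units ==> kfac s t a = chi (J a) * inverse (eta a)"
 using kfac_formula[of a s t] ang_of_unit[of a pF] by (simp add: int_units_val)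

lemma kfac_uniformizer: "kfac s t pF = qexp TYPE('f) (2 * s - t + 1/2)"
 using kfac_formula[OF pF0, of s t] ang_uniformizer[OF uniformizer_F] val_uniformizer[OF uniformizer_F]
  unit_character_one[OF chi] unit_character_one[OF eta] by (simp add: emb_one)

lemma om_uniformizer: "(%x. om (inverse (J pF) * x)) = ball_ind 0 1"
 using om_scale[OF pF0] val_uniformizer[OF uniformizer_F] by (simp add: fun_eq_iff)

lemma om_unit: "a \<in> int_units ==> (%x. om (inverse (J a) * x)) = om"
 using om_scale[of a] by (auto simp: fun_eq_iff int_units_val om_def)

lemma D_imp_UU:
 assumes u: "u \<in> D s t" shows "u = UU s t (u om) (ext s u star)" "rel s t (u om) (ext s u star)"
proof -
 note cov = D_covariant[OF u]
 have lin: "linear_on_tf UNIV u" and off: "!!\<phi>. \<phi> \<notin> TF ==> u \<phi> = 0"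
  and sc: "!!a \<phi>. a ~= 0 ==> \<phi> \<in> TF ==> u (%x. \<phi> (inverse (J a) * x)) = kfac s t a * u \<phi>" using u by (auto simp: D_iff)
 show "u = UU s t (u om) (ext s u star)" proof
  fix \<phi>
  show "u \<phi> = UU s t (u om) (ext s u star) \<phi>" proof (cases "\<phi> \<in> TF")
   case True
   have "u \<phi> = u (%x. \<phi> 0 * om x + minus_om \<phi> x)" by (simp add: minus_om_def)
   also have "\<dots> = \<phi> 0 * u om + u (minus_om \<phi>)" using test_fun_subset[OF test_fun_minus_om[OF True], of UNIV]
     linear_on_tf_add[OF lin test_fun_cmult[OF test_fun_om]] linear_on_tf_cmult[OF lin test_fun_om] by simp
   finally show ?thesis using covariant_off_zero[OF cov test_fun_minus_om[OF True]] True by (simp add: UU_def)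
  qed (simp add: UU_def off)
 qed
 show "rel s t (u om) (ext s u star)" proof (cases triv')
  case False
  then obtain a where a: "a \<in> int_units" "chi (J a) * inverse (eta a) ~= 1" by (auto simp: triv'_def)
  hence "u om = kfac s t a * u om" using sc[OF _ test_fun_om, of a] om_unit[OF a(1)] by (auto simp: int_units_val)
  thus ?thesis using a kfac_unit[OF a(1), of s t] False by (auto simp: rel_def)
 next
  case True
  have "u (ball_ind 0 1) = qexp TYPE('f) (2 * s - t + 1/2) * u om"
   using sc[OF pF0 test_fun_om] by (simp add: om_uniformizer kfac_uniformizer)
  moreover have "u shell = u om - u (ball_ind 0 1)"
   unfolding shell_def[abs_def] om_def by (intro linear_on_tf_diff[OF lin] test_fun_ball_ind_UNIV)
  ultimately show ?thesis
   using covariant_off_zero[OF cov test_fun_shell] True by (simp add: rel_def lam'_def SS_def algebra_simps)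
 qed
qed

lemma pull_linear:
 "pull s (%x. \<phi> x + \<psi> x) = (%w. pull s \<phi> w + pull s \<psi> w)"
 "pull s (%x. \<phi> x - \<psi> x) = (%w. pull s \<phi> w - pull s \<psi> w)"
 "pull s (%x. c * \<phi> x) = (%w. c * pull s \<phi> w)" by (simp_all add: pull_def fun_eq_iff algebra_simps)

definition W :: "complex => complex => ('e => complex) => complex" where
 "W s t \<phi> = vhat (zz s t) (pull s \<phi>)"

lemma test_fun_pull_UNIV: "\<phi> \<in> TF0 ==> pull s \<phi> \<in> TF" using test_fun_subset[OF test_fun_pull, of \<phi> UNIV] by simp

lemma W_linear: "linear_on_tf (- {0}) (W s t)" unfolding linear_on_tf_def W_def pull_linear
 using linear_on_tf_add[OF inV_linear[OF inV_vhat] test_fun_pull_UNIV test_fun_pull_UNIV]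
  linear_on_tf_cmult[OF inV_linear[OF inV_vhat] test_fun_pull_UNIV] by blast

lemma W_scale:
 assumes "a ~= 0" "\<phi> \<in> TF0" shows "W s t (%x. \<phi> (inverse (J a) * x)) = kfac s t a * W s t \<phi>"
proof -
 have "pull s (%x. \<phi> (inverse (J a) * x)) = (%w. theta s (J a) * pull s \<phi> (J a * w))"
  using assms(1) theta_nonzero[of "J a" s] by (simp add: pull_def fun_eq_iff theta_mult)
 hence "W s t (%x. \<phi> (inverse (J a) * x)) = theta s (J a) * vhat (zz s t) (%w. pull s \<phi> (J a * w))"
  using linear_on_tf_cmult[OF inV_linear[OF inV_vhat] test_fun_scale[OF test_fun_pull_UNIV[OF assms(2)]], of "J a"] assms(1)
  by (simp add: W_def)
 thus ?thesis using inV_scale[OF inV_vhat test_fun_pull_UNIV[OF assms(2)] assms(1)] kfac_sigma[OF assms(1)]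
  by (simp add: W_def)
qed

lemma W_moved:
 assumes "b ~= 0" "\<phi> \<in> test_fun (UNIV - {inverse (J b)})" "\<phi> 0 = 0"
 shows "W s t (moved b \<phi>) = W s t (twisted s b \<phi>)"
proof -
 have z: "\<phi> (inverse (J b)) = 0" using assms(2) test_fun_iff[of \<phi> "UNIV - {inverse (J b)}"] by auto
 have "twisted s b \<phi> \<in> TF0"
  using test_fun_twisted[OF assms(2,1), of s] assms(3) test_fun_iff[of "twisted s b \<phi>" "- {0}"]
   test_fun_iff[of "twisted s b \<phi>" "UNIV - {inverse (J b)}"] by (auto simp: twisted_def)
 thus ?thesis unfolding W_def pull_shift[OF assms(1,3) z] by (intro inV_shift[OF inV_vhat] test_fun_pull_UNIV)
qed

lemma minus_om_linear:
 "minus_om (%x. \<phi> x + \<psi> x) = (%x. minus_om \<phi> x + minus_om \<psi> x)"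
 "minus_om (%x. c * \<phi> x) = (%x. c * minus_om \<phi> x)" by (simp_all add: minus_om_def fun_eq_iff algebra_simps)

lemma minus_om_zero: "\<phi> 0 = 0 ==> minus_om \<phi> = \<phi>" by (simp add: minus_om_def fun_eq_iff)

lemma UU_eq: "\<phi> \<in> TF ==> UU s t A C \<phi> = A * \<phi> 0 + C * W s t (minus_om \<phi>)" by (simp add: UU_def W_def)

lemma UU_linear: "linear_on_tf UNIV (UU s t A C)" unfolding linear_on_tf_def
 using linear_on_tf_add[OF W_linear test_fun_minus_om test_fun_minus_om]
  linear_on_tf_cmult[OF W_linear test_fun_minus_om]
 by (auto simp: UU_eq test_fun_add test_fun_cmult minus_om_linear algebra_simps)

lemma UU_off_zero: "\<phi> \<in> TF0 ==> UU s t A C \<phi> = C * W s t \<phi>"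
proof -
 assume t: "\<phi> \<in> TF0"
 have "\<phi> 0 = 0" "\<phi> \<in> TF" using t test_fun_iff[of \<phi> "- {0}"] by auto
 thus ?thesis by (simp add: UU_eq minus_om_zero)
qed

lemma UU_om: "UU s t A C om = A"
proof -
 have "minus_om om = (%x. 0)" by (simp add: minus_om_def fun_eq_iff)
 thus ?thesis using linear_on_tf_zero[OF W_linear, of s t] by (simp add: UU_eq test_fun_om)
qed

lemma W_shell_nontriv:
 assumes "\<not> triv'" shows "W s t shell = 0"
proof -
 obtain y where y: "y \<in> int_units" "chi (J y) * inverse (eta y) ~= 1" using assms by (auto simp: triv'_def)
 have y0: "y ~= 0" using y by (simp add: int_units_val)
 have "(%x. shell (inverse (J y) * x)) = shell"
  using om_scale[OF y0] y y0 by (simp add: shell_def[abs_def] ball_ind_def pw_mult_iff val_inverse val_emb int_units_val)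
 hence "W s t shell = kfac s t y * W s t shell" using W_scale[OF y0 test_fun_shell, of s t] by simp
 thus ?thesis using y(2) by (simp add: kfac_unit[OF y(1)])
qed

text \<open>The relation expresses homogeneity at \<open>pF\<close> alone. Differences of successive
  dilates of \<open>om\<close> are dilates of \<open>shell\<close>, where the generator is
  homogeneous, so it propagates to all powers of \<open>pF\<close>; units either act trivially or A
  is 0.\<close>

lemma UU_om_scale:
 assumes rel: "rel s t A C" and a: "a ~= 0" shows "UU s t A C (%x. om (inverse (J a) * x)) = kfac s t a * A"
proof -
 define p where "p k = pF powi k" for k
 have p: "p k ~= 0" "val (p k) = k" "p (k + 1) = p k * pF" for k
  using pF0 val_uniformizer[OF uniformizer_F] by (simp_all add: p_def val_power_int power_int_add_1)
 define g where "g k = UU s t A C (%x. om (inverse (J (p k)) * x))" for k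
 have AC: "(1 - kfac s t pF) * A = C * W s t shell"
  using rel W_shell_nontriv by (cases triv') (simp_all add: rel_def lam'_def kfac_uniformizer SS_def W_def mult.commute)
 have step: "g k - g (k + 1) = kfac s t (p k) * A - kfac s t (p (k + 1)) * A" for k proof -
  have t: "(%x. om (inverse (J (p k)) * x)) \<in> TF" for k using p(1) by (intro test_fun_scale test_fun_om) simp
  have ts: "(%x. shell (inverse (J (p k)) * x)) \<in> TF0"
   using test_fun_scale[OF test_fun_subset[OF test_fun_shell, of UNIV], of "inverse (J (p k))"] p(1)
   by (subst test_fun_iff) (simp add: shell_def ball_ind_def)
  have "(%x. om (inverse (J (p k)) * x) - om (inverse (J (p (k + 1))) * x)) = (%x. shell (inverse (J (p k)) * x))" proof
   fix x
   have "ball_ind 0 n (inverse (J (p k)) * x) = ball_ind 0 (n + e * k) x" for n k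
    using p(1,2)[of k] by (simp add: ball_ind_def pw_mult_iff val_inverse val_emb)
   moreover have "1 - e + e * (k + 1) = 1 + e * k" by (simp add: algebra_simps)
   ultimately show "om (inverse (J (p k)) * x) - om (inverse (J (p (k + 1))) * x) = shell (inverse (J (p k)) * x)"
    by (simp only: om_def shell_def)
  qed
  hence "g k - g (k + 1) = UU s t A C (%x. shell (inverse (J (p k)) * x))"
   unfolding g_def using linear_on_tf_diff[OF UU_linear t t] by metis
  also have "\<dots> = kfac s t (p k) * (C * W s t shell)"
   unfolding UU_off_zero[OF ts] W_scale[OF p(1) test_fun_shell] by simp
  finally show ?thesis unfolding AC[symmetric] p(3) kfac_mult by (simp add: algebra_simps)
 qed
 have "g k = kfac s t (p k) * A" for k proof (induction k rule: int_induct[where k = 0])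
  case base
  have "kfac s t 1 = 1"
   by (simp add: kfac_formula ang_of_unit int_units_val emb_one unit_character_one[OF chi] unit_character_one[OF eta])
  thus ?case by (simp add: g_def p_def emb_one UU_om)
 next
  case (step1 i)
  thus ?case using step[of i] by simp
 next
  case (step2 i)
  thus ?case using step[of "i - 1"] by simp
 qed
 from this[of "val a"] have "UU s t A C (%x. om (inverse (J a) * x)) = kfac s t (p (val a)) * A"
  using om_scale[OF a] om_scale[OF p(1), of "val a"] p(2) by (simp add: g_def)
 moreover have "kfac s t a * A = kfac s t (p (val a)) * A" proof -
  have u: "ang pF a \<in> int_units" by (rule ang_unit[OF uniformizer_F a])
  have "a = p (val a) * ang pF a" using pF0 by (simp add: p_def ang_def power_int_minus)
  hence "kfac s t a = kfac s t (p (val a)) * kfac s t (ang pF a)" by (metis kfac_mult)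
  thus ?thesis using rel u by (cases triv') (auto simp: kfac_unit triv'_def rel_def)
 qed
 ultimately show ?thesis by (simp only:)
qed

lemma UU_scale_closed:
 assumes rel: "rel s t A C" and a: "a ~= 0" and \<phi>: "\<phi> \<in> TF"
 shows "UU s t A C (%x. \<phi> (inverse (J a) * x)) = kfac s t a * UU s t A C \<phi>"
proof -
 have scaled: "(%x. \<phi> (inverse (J a) * x)) \<in> TF" if "\<phi> \<in> TF" for \<phi> using that a by (intro test_fun_scale) auto
 note m = test_fun_minus_om[OF \<phi>]
 have mU: "minus_om \<phi> \<in> TF" using test_fun_subset[OF m, of UNIV] by simp
 have ms: "(%x. minus_om \<phi> (inverse (J a) * x)) \<in> TF0" using scaled[OF mU] m test_fun_iff[of "minus_om \<phi>" "- {0}"]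
   test_fun_iff[of "%x. minus_om \<phi> (inverse (J a) * x)" "- {0}"] by auto
 have "UU s t A C (%x. \<phi> (inverse (J a) * x)) =
   UU s t A C (%x. \<phi> 0 * om (inverse (J a) * x) + minus_om \<phi> (inverse (J a) * x))" by (simp add: minus_om_def)
 also have "\<dots> = \<phi> 0 * UU s t A C (%x. om (inverse (J a) * x)) + UU s t A C (%x. minus_om \<phi> (inverse (J a) * x))"
  using linear_on_tf_add[OF UU_linear test_fun_cmult[OF scaled[OF test_fun_om]] scaled[OF mU]]
   linear_on_tf_cmult[OF UU_linear scaled[OF test_fun_om]] by simp
 also have "UU s t A C (%x. minus_om \<phi> (inverse (J a) * x)) = kfac s t a * (C * W s t (minus_om \<phi>))"
  using UU_off_zero[OF ms] W_scale[OF a m] by simp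
 finally show ?thesis unfolding UU_om_scale[OF rel a] by (simp add: UU_eq[OF \<phi>] algebra_simps)
qed

text \<open>Only the value at 0 is new. A small ball \<open>B\<close> around 0 is fixed by both
  \<open>moved\<close> and \<open>twisted\<close>; subtracting \<open>\<phi> 0\<close> times it
  leaves a function vanishing at 0, which falls under the translation invariance of the
  generator.\<close>

lemma UU_moved:
 assumes b: "b ~= 0" and \<phi>: "\<phi> \<in> test_fun (UNIV - {inverse (J b)})"
 shows "UU s t A C (moved b \<phi>) = UU s t A C (twisted s b \<phi>)"
proof -
 obtain n0 where n0: "n0 \<ge> 1" "!!h. h \<in> pw n0 ==> chi (1 + h) = 1"
  using unit_character_trivial_near_one[OF chi] by metis
 define n where "n = max 1 (n0 - val (J b))"
 have small: "J b * x \<in> pw n0" "J b * x \<in> pw 1" if "x \<in> pw n" for x proof -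
  show "J b * x \<in> pw n0" using that b pw_mono[of "n0 - val (J b)" n x] by (simp add: pw_mult_iff n_def)
  thus "J b * x \<in> pw 1" using pw_mono[OF n0(1)] by blast
 qed
 define B :: "'e => complex" where "B = ball_ind 0 n"
 have tB: "B \<in> TF" by (simp add: B_def test_fun_ball_ind_UNIV)
 have Bb: "B (inverse (J b)) = 0" proof -
  have "inverse (J b) \<notin> pw n" proof
   assume "inverse (J b) \<in> pw n"
   hence "J b * inverse (J b) \<in> pw 1" by (rule small(2))
   thus False using b by (simp add: pw_def)
  qed
  thus ?thesis by (simp add: B_def ball_ind_def)
 qed
 have unitv: "absv (1 + J b * x) = 1" "val (1 + J b * x) = 0" "1 + J b * x ~= 0" if "x \<in> pw n" for x
  using one_plus_pw[OF small(2)[OF that]] by (simp_all add: absv_def)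
 have movB: "moved b B = B" proof
  fix x
  show "moved b B x = B x" proof (cases "1 + J b * x = 0")
   case True
   hence "x \<notin> pw n" using unitv(3) by blast
   thus ?thesis using True by (simp add: moved_def B_def ball_ind_def)
  next
   case False
   have iff: "x / (1 + J b * x) \<in> pw n \<longleftrightarrow> x \<in> pw n" proof
    assume y: "x / (1 + J b * x) \<in> pw n"
    define y' where "y' = x / (1 + J b * x)"
    have "1 - J b * y' = inverse (1 + J b * x)" using False by (simp add: y'_def field_simps)
    moreover have "val (1 + J b * (- y')) = 0" "1 + J b * (- y') ~= 0"
     using one_plus_pw[OF small(2)[of "- y'"]] y by (simp_all add: y'_def)
    ultimately have "val (inverse (1 + J b * x)) = 0" by simp
    hence "val (1 + J b * x) = 0" using False by (simp add: val_inverse)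
    thus "x \<in> pw n" using y False pw_mult_iff[of "1 + J b * x" "x / (1 + J b * x)" n] by simp
   next
    assume x: "x \<in> pw n"
    show "x / (1 + J b * x) \<in> pw n" using x unitv[OF x] pw_mult_iff[of "1 + J b * x" "x / (1 + J b * x)" n] by simp
   qed
   show ?thesis using False iff unitv(1)[of x] by (auto simp: moved_def B_def ball_ind_def)
  qed
 qed
 have twB: "twisted s b B = B" proof
  fix x
  show "twisted s b B x = B x" proof (cases "x \<in> pw n")
   case True
   have m: "- x \<in> pw n" using True by simp
   have "mu s (1 + J b * (- x)) = 1"
    using quasi_char_unit[OF one_plus_pw(3)[OF small(1)[OF m] n0(1)]] n0(2)[OF small(1)[OF m]] by simp
   thus ?thesis by (simp add: twisted_def quasi_char_power[OF chi uniformizer_E])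
  qed (simp add: twisted_def B_def ball_ind_def)
 qed
 define \<phi>' where "\<phi>' = (%x. \<phi> x - \<phi> 0 * B x)"
 have tBb: "B \<in> test_fun (UNIV - {inverse (J b)})" using tB Bb by (subst test_fun_iff) auto
 have t': "\<phi>' \<in> test_fun (UNIV - {inverse (J b)})"
  unfolding \<phi>'_def by (intro test_fun_diff \<phi> test_fun_cmult tBb)
 have z': "\<phi>' 0 = 0" by (simp add: \<phi>'_def B_def ball_ind_def)
 have tw': "twisted s b \<phi>' \<in> TF0"
  using test_fun_twisted[OF t' b, of s] z' test_fun_iff[of "twisted s b \<phi>'" "- {0}"]
   test_fun_iff[of "twisted s b \<phi>'" "UNIV - {inverse (J b)}"] by (auto simp: twisted_def)
 have mv': "moved b \<phi>' \<in> TF0" by (rule test_fun_moved[OF t' z' b])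
 have eq: "moved b \<phi> = (%x. \<phi> 0 * B x + moved b \<phi>' x)" "twisted s b \<phi> = (%x. \<phi> 0 * B x + twisted s b \<phi>' x)" proof -
  have "moved b \<phi> = (%x. \<phi> 0 * moved b B x + moved b \<phi>' x)"
   by (simp add: moved_def \<phi>'_def fun_eq_iff algebra_simps)
  thus "moved b \<phi> = (%x. \<phi> 0 * B x + moved b \<phi>' x)" by (simp add: movB)
  have "twisted s b \<phi> = (%x. \<phi> 0 * twisted s b B x + twisted s b \<phi>' x)"
   by (simp add: twisted_def \<phi>'_def fun_eq_iff algebra_simps)
  thus "twisted s b \<phi> = (%x. \<phi> 0 * B x + twisted s b \<phi>' x)" by (simp add: twB)
 qed
 have "UU s t A C (moved b \<phi>') = UU s t A C (twisted s b \<phi>')"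
  using UU_off_zero[OF mv'] UU_off_zero[OF tw'] W_moved[OF b t' z'] by simp
 thus ?thesis unfolding eq using linear_on_tf_add[OF UU_linear test_fun_cmult[OF tB] test_fun_subset[OF mv', of UNIV]]
   linear_on_tf_add[OF UU_linear test_fun_cmult[OF tB] test_fun_subset[OF tw', of UNIV]] by simp
qed

lemma UU_in_D: "rel s t A C ==> UU s t A C \<in> D s t"
 unfolding D_iff using UU_linear UU_scale_closed UU_moved by (auto simp: UU_def)

lemma D_eq: "D s t = {UU s t A C | A C. rel s t A C}" using D_imp_UU UU_in_D by blast

text \<open>\<open>om\<close> recovers A, and a pushed translate of \<open>star\<close>, on which
  the generator is 1, recovers C.\<close>

lemma UU_inject: "UU s t A C = UU s t A' C' \<longleftrightarrow> A = A' & C = C'"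
proof
 assume eq: "UU s t A C = UU s t A' C'"
 obtain b where b: "star (J b) = 0" using ex_common_zero[OF test_fun_star test_fun_star] .
 define \<phi> where "\<phi> = push s (%w. star (w + J b))"
 have t: "\<phi> \<in> TF0" unfolding \<phi>_def by (rule test_fun_push[OF test_fun_shift0[OF test_fun_star b]])
 have "pull s \<phi> = (%w. star (w + J b))" unfolding \<phi>_def using b by (intro pull_push) simp
 hence "W s t \<phi> = 1" using inV_shift[OF inV_vhat test_fun_star] by (simp add: W_def vhat_star)
 hence "C = C'" using UU_off_zero[OF t, of s t] fun_cong[OF eq, of \<phi>] by simp
 moreover have "A = A'" using UU_om[of s t] fun_cong[OF eq, of om] by simp
 ultimately show "A = A' & C = C'" by blast
qed simp

end

section \<open>The renormalised kernel\<close>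

lemma holomorphic_C2I:
 assumes "!!w. \<exists>a b. (h has_derivative (%v. a * fst v + b * snd v)) (at w)" shows "holomorphic_C2 h"
 using assms by (simp add: holomorphic_C2_def case_prod_unfold)

lemma holomorphic_C2D:
 assumes "holomorphic_C2 h" shows "\<exists>a b. (h has_derivative (%v. a * fst v + b * snd v)) (at w)"
 using assms unfolding holomorphic_C2_def case_prod_unfold by (rule spec)

lemma holomorphic_C2_const: "holomorphic_C2 (%w. c)" by (rule holomorphic_C2I, rule exI[of _ 0], rule exI[of _ 0]) simp

lemma holomorphic_C2_add:
 assumes "holomorphic_C2 f" "holomorphic_C2 g" shows "holomorphic_C2 (%w. f w + g w)"
proof (rule holomorphic_C2I)
 fix w
 obtain a b where f: "(f has_derivative (%v. a * fst v + b * snd v)) (at w)" using holomorphic_C2D[OF assms(1)] by blast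
 obtain a' b' where g: "(g has_derivative (%v. a' * fst v + b' * snd v)) (at w)"
  using holomorphic_C2D[OF assms(2)] by blast
 from has_derivative_add[OF f g]
 have "((%w. f w + g w) has_derivative (%v. (a + a') * fst v + (b + b') * snd v)) (at w)" by (simp add: algebra_simps)
 thus "\<exists>a b. ((%w. f w + g w) has_derivative (%v. a * fst v + b * snd v)) (at w)" by blast
qed

lemma holomorphic_C2_mult:
 assumes "holomorphic_C2 f" "holomorphic_C2 g" shows "holomorphic_C2 (%w. f w * g w)"
proof (rule holomorphic_C2I)
 fix w
 obtain a b where f: "(f has_derivative (%v. a * fst v + b * snd v)) (at w)" using holomorphic_C2D[OF assms(1)] by blast
 obtain a' b' where g: "(g has_derivative (%v. a' * fst v + b' * snd v)) (at w)"
  using holomorphic_C2D[OF assms(2)] by blast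
 from has_derivative_mult[OF f g]
 have "((%w. f w * g w) has_derivative (%v. (f w * a' + a * g w) * fst v + (f w * b' + b * g w) * snd v)) (at w)"
  by (simp add: algebra_simps)
 thus "\<exists>a b. ((%w. f w * g w) has_derivative (%v. a * fst v + b * snd v)) (at w)" by blast
qed

lemma holomorphic_C2_sum:
 "(!!i. i \<in> S ==> holomorphic_C2 (f i)) ==> holomorphic_C2 (%w. \<Sum>i\<in>S. f i w)"
 by (induction S rule: infinite_finite_induct) (auto intro: holomorphic_C2_const holomorphic_C2_add)

lemma holomorphic_C2_affine:
 assumes "f holomorphic_on UNIV" shows "holomorphic_C2 (%w. f (a * fst w + b * snd w + c))"
proof (rule holomorphic_C2I)
 fix w
 let ?l = "%w. a * fst w + b * snd w + c"
 have "(f has_field_derivative deriv f (?l w)) (at (?l w))" using assms by (simp add: holomorphic_derivI)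
 hence "(f has_derivative (*) (deriv f (?l w))) (at (?l w))" by (simp add: has_field_derivative_def)
 moreover have "(?l has_derivative (%v. a * fst v + b * snd v)) (at w)" by (auto intro!: derivative_eq_intros)
 ultimately have "((%w. f (?l w)) has_derivative (%v. deriv f (?l w) * (a * fst v + b * snd v))) (at w)"
  using has_derivative_compose by blast
 hence "((%w. f (?l w)) has_derivative (%v. (deriv f (?l w) * a) * fst v + (deriv f (?l w) * b) * snd v)) (at w)"
  by (simp add: algebra_simps)
 thus "\<exists>a' b'. ((%w. f (?l w)) has_derivative (%v. a' * fst v + b' * snd v)) (at w)" by blast
qed

lemma holomorphic_C2_line:
 assumes "holomorphic_C2 h" shows "(%x. h (s0 + x * s1, t0 + x * t1)) holomorphic_on UNIV" unfolding holomorphic_on_def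
proof
 fix x :: complex
 obtain a b where "(h has_derivative (%v. a * fst v + b * snd v)) (at (s0 + x * s1, t0 + x * t1))"
  using holomorphic_C2D[OF assms] by metis
 moreover have "((%x. (s0 + x * s1, t0 + x * t1)) has_derivative (%v. (v * s1, v * t1))) (at x)"
  by (auto intro!: derivative_eq_intros)
 ultimately have "((%x. h (s0 + x * s1, t0 + x * t1)) has_derivative (%v. a * fst (v * s1, v * t1) + b * snd (v * s1, v * t1))) (at x)"
  using has_derivative_compose by blast
 hence "((%x. h (s0 + x * s1, t0 + x * t1)) has_derivative (*) (a * s1 + b * t1)) (at x)"
  by (rule has_derivative_eq_rhs) (simp add: fun_eq_iff algebra_simps)
 hence "((%x. h (s0 + x * s1, t0 + x * t1)) has_field_derivative (a * s1 + b * t1)) (at x)"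
  by (simp add: has_field_derivative_def)
 thus "(%x. h (s0 + x * s1, t0 + x * t1)) field_differentiable at x within UNIV"
  by (auto simp: field_differentiable_def)
qed

text \<open>Restrict to the complex line through (0, 0) and \<open>w\<close>. The origin lies in the
  open domain of agreement thanks to the summand 1/2, so the identity theorem in one variable
  reaches the parameter 1.\<close>

lemma holomorphic_C2_eqI:
 assumes "holomorphic_C2 f" "holomorphic_C2 g"
  and eq: "!!s t. Re (2 * s + t + 1/2) > 0 & Re (2 * s - t + 1/2) > 0 ==> f (s, t) = g (s, t)" shows "f w = g w"
proof -
 define p where "p x = (0 + x * fst w, 0 + x * snd w)" for x :: complex
 define S where "S = {x. Re (2 * (x * fst w) + x * snd w + 1/2) > 0} \<inter> {x. Re (2 * (x * fst w) - x * snd w + 1/2) > 0}"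
 have "open {x. Re (2 * (x * fst w) + x * snd w + 1/2) > 0}" "open {x. Re (2 * (x * fst w) - x * snd w + 1/2) > 0}"
  by (intro open_Collect_less continuous_intros)+
 hence "open S" unfolding S_def by (rule open_Int)
 moreover have "0 \<in> S" by (simp add: S_def)
 moreover have "f (p x) = g (p x)" if "x \<in> S" for x using that unfolding p_def S_def by (intro eq) auto
 moreover have "(%x. f (p x)) holomorphic_on UNIV" "(%x. g (p x)) holomorphic_on UNIV"
  unfolding p_def by (rule holomorphic_C2_line[OF assms(1)] holomorphic_C2_line[OF assms(2)])+
 ultimately have "f (p 1) = g (p 1)" using analytic_continuation_open[of S UNIV "%x. f (p x)" "%x. g (p x)" 1] by blast
 thus ?thesis by (simp add: p_def)
qed

section \<open>The kernel in the coordinate w and its continuation\<close>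

context kernel_setting
begin

lemma alpha_zero_iff: "J x + J y * \<alpha> = 0 \<longleftrightarrow> x = 0 & y = 0"
proof
 assume z: "J x + J y * \<alpha> = 0"
 have "y = 0" proof (rule ccontr)
  assume "y ~= 0"
  hence "\<alpha> = J (- x / y)" using z by (simp add: emb_divide emb_minus field_simps add_eq_0_iff)
  thus False using \<alpha>_notin by blast
 qed
 thus "x = 0 & y = 0" using z by simp
qed simp

lemma alpha_inj: "J x + J y * \<alpha> = J x' + J y' * \<alpha> \<longleftrightarrow> x = x' & y = y'"
 using alpha_zero_iff[of "x - x'" "y - y'"] by (auto simp: emb_diff algebra_simps)

lemma coord_alpha [simp]: "coord1 J \<alpha> (J x + J y * \<alpha>) = x" "coord2 J \<alpha> (J x + J y * \<alpha>) = y"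
 unfolding coord1_def coord2_def by (rule the_equality; auto simp: alpha_inj)+

text \<open>Passing from the coordinate \<open>c2\<close> to the coordinate along \<alpha>
  multiplies by this number (\<open>coord2_c2\<close>), so it enters the kernel only through a
  constant value of \<open>\<sigma>\<close>.\<close>

definition b2 :: 'f where "b2 = coord2 J \<alpha> \<beta>"

lemma coord2_c2: "coord2 J \<alpha> w = b2 * c2 w"
proof -
 obtain x y where b: "\<beta> = J x + J y * \<alpha>" using generated by blast
 have "w = J (c1 w) + J (c2 w) * \<beta>" by (rule decompose)
 hence "w = J (c1 w + c2 w * x) + J (y * c2 w) * \<alpha>" by (simp add: b emb_add emb_mult algebra_simps)
 hence "coord2 J \<alpha> w = y * c2 w" by (metis coord_alpha(2))
 moreover have "b2 = y" using coord_alpha(2)[of x y] unfolding b[symmetric] b2_def .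
 ultimately show ?thesis by simp
qed

lemma b2_nonzero: "b2 ~= 0"
proof
 assume "b2 = 0"
 hence "coord2 J \<alpha> \<alpha> = 0" by (simp add: coord2_c2)
 moreover have "coord2 J \<alpha> (J 0 + J 1 * \<alpha>) = 1" by (rule coord_alpha)
 ultimately show False by (simp add: emb_one)
qed

abbreviation KK :: "complex => complex => 'e => complex" where
 "KK s t \<equiv> kernel_fun J d \<alpha> pF pE chi s eta t"

lemma range_emb_inverse: "inverse w \<in> range J \<longleftrightarrow> w \<in> range J"
proof -
 have "inverse w \<in> range J" if "w \<in> range J" for w using that by (auto simp flip: emb_inverse)
 thus ?thesis by (metis inverse_inverse_eq)
qed

text \<open>Under \<open>x = 1/w\<close> the invariant \<open>x\<^sub>2/(x\<^sub>1\<^sup>2 - x\<^sub>2\<^sup>2 d)\<close> becomes \<open>-w\<^sub>2\<close>.\<close>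

lemma kernel_inverse:
 "KK s t (inverse w) * of_real (inverse (absv w ^ 2)) = \<sigma> (zz s t) (- b2) * inverse (theta s w) * \<sigma> (zz s t) (c2 w)"
proof (cases "w \<in> range J")
 case True
 hence "c2 w = 0" using c2_eq_0_iff by blast
 thus ?thesis using True range_emb_inverse by (simp add: kernel_fun_def)
next
 case False
 hence w0: "w ~= 0" using emb_zero by (metis rangeI)
 obtain w1 w2 where w: "w = J w1 + J w2 * \<alpha>" using generated by blast
 define n where "n = w1 ^ 2 - w2 ^ 2 * d"
 \<comment> \<open>The conjugate of w gives the norm n, so 1/w has the \<alpha>-coordinates w1/n and
   -w2/n.\<close>
 have prod: "w * (J w1 + J (- w2) * \<alpha>) = J n"
  using \<alpha>_square by (simp add: w n_def emb_diff emb_mult emb_power emb_minus algebra_simps power2_eq_square)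
 have n0: "n ~= 0" proof
  assume "n = 0"
  hence "J w1 + J (- w2) * \<alpha> = 0" using prod w0 by simp
  hence "w1 = 0" "w2 = 0" using alpha_zero_iff[of w1 "- w2"] by auto
  thus False using w w0 by simp
 qed
 have "w * (J (w1 / n) + J (- w2 / n) * \<alpha>) =
   (w * (J w1 + J (- w2) * \<alpha>)) / J n"
  by (simp only: emb_divide times_divide_eq_left times_divide_eq_right flip: add_divide_distrib)
 hence "w * (J (w1 / n) + J (- w2 / n) * \<alpha>) = 1" unfolding prod using n0 by simp
 hence inv: "inverse w = J (w1 / n) + J (- w2 / n) * \<alpha>" by (rule inverse_unique)
 have "coord2 J \<alpha> (inverse w) / (coord1 J \<alpha> (inverse w) ^ 2 - coord2 J \<alpha> (inverse w) ^ 2 * d) = - w2" proof -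
  have "(w1 / n) ^ 2 - (- w2 / n) ^ 2 * d = n / n ^ 2" by (simp add: n_def power_divide diff_divide_distrib)
  hence "(- w2 / n) / ((w1 / n) ^ 2 - (- w2 / n) ^ 2 * d) = - w2" using n0 by (simp add: power2_eq_square)
  thus ?thesis by (simp only: inv coord_alpha)
 qed
 moreover have "w2 = b2 * c2 w" using coord2_c2[of w] w by simp
 ultimately have "KK s t (inverse w) = mu s ((inverse w) ^ 2) * (mu s (J (- b2 * c2 w)) * nu t (- b2 * c2 w))"
  using False range_emb_inverse by (simp add: kernel_fun_def Let_def)
 also have "mu s (J (- b2 * c2 w)) * nu t (- b2 * c2 w) = \<sigma> (zz s t) (- b2) * \<sigma> (zz s t) (c2 w)"
  unfolding sigma_product by (rule quasi_char_mult[OF unit_character_sg uniformizer_F])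
 also have "mu s ((inverse w) ^ 2) = inverse (mu s w ^ 2)"
  by (simp add: quasi_char_power[OF chi uniformizer_E] quasi_char_inverse[OF chi uniformizer_E] power_inverse)
 finally show ?thesis by (simp add: theta_mu mult_ac)
qed

lemma KK_eq: "KK s t x = \<sigma> (zz s t) (- b2) * inverse (theta s (inverse x)) * \<sigma> (zz s t) (c2 (inverse x)) * of_real (absv (inverse x) ^ 2)"
proof (cases "x = 0")
 case True
 thus ?thesis using range_eqI[of 0 J 0] by (simp add: kernel_fun_def)
next
 case False
 hence "absv (inverse x) ~= 0" using absv_pos[of "inverse x"] by simp
 thus ?thesis using kernel_inverse[of s t "inverse x"] by (simp add: field_simps)
qed

lemma measurable_theta: "theta s \<in> borel_measurable borel"
proof (rule measurable_locally_constant_on[of "{0}"])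
 fix x assume "x \<notin> {0::'e}"
 thus "\<exists>n. \<forall>y. y - x \<in> pw n --> theta s y = theta s x" using theta_locally_constant by simp
qed auto

lemma measurable_KK: "KK s t \<in> borel_measurable borel"
proof -
 have "(%w. \<sigma> (zz s t) (- b2) * inverse (theta s w) * \<sigma> (zz s t) (c2 w) * of_real (absv w ^ 2)) \<in> borel_measurable borel"
  using measurable_theta measurable_sigma_c2 absv_measurable by measurable
 from measurable_compose[OF inverse_measurable this] show ?thesis by (simp only: KK_eq[abs_def])
qed

lemma KK_integral:
 assumes \<phi>: "\<phi> \<in> borel_measurable borel"
 shows "(LINT x|M. KK s t x * \<phi> x) = \<sigma> (zz s t) (- b2) * I (zz s t) (pull s \<phi>)"
  and "integrable M (%x. KK s t x * \<phi> x) \<longleftrightarrow> integrable M (%w. pull s \<phi> w * \<sigma> (zz s t) (c2 w))"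
proof -
 have m: "(%x. KK s t x * \<phi> x) \<in> borel_measurable borel" using measurable_KK \<phi> by measurable
 have eq: "(%w. of_real (inverse (absv w ^ 2)) * (KK s t (inverse w) * \<phi> (inverse w))) =
   (%w. \<sigma> (zz s t) (- b2) * (pull s \<phi> w * \<sigma> (zz s t) (c2 w)))" proof
  fix w
  have "of_real (inverse (absv w ^ 2)) * (KK s t (inverse w) * \<phi> (inverse w)) =
    (KK s t (inverse w) * of_real (inverse (absv w ^ 2))) * \<phi> (inverse w)" by (simp only: mult_ac)
  thus "of_real (inverse (absv w ^ 2)) * (KK s t (inverse w) * \<phi> (inverse w)) =
    \<sigma> (zz s t) (- b2) * (pull s \<phi> w * \<sigma> (zz s t) (c2 w))" unfolding kernel_inverse by (simp add: pull_def mult_ac)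
 qed
 have nz: "\<sigma> (zz s t) (- b2) ~= 0" using quasi_char_nonzero[OF unit_character_sg uniformizer_F] b2_nonzero by simp
 show "(LINT x|M. KK s t x * \<phi> x) = \<sigma> (zz s t) (- b2) * I (zz s t) (pull s \<phi>)"
  unfolding integral_inversion[OF haar m] eq I_def by simp
 show "integrable M (%x. KK s t x * \<phi> x) \<longleftrightarrow> integrable M (%w. pull s \<phi> w * \<sigma> (zz s t) (c2 w))"
  unfolding integrable_inversion[OF haar m] eq
  using nz integrable_mult_right[of "inverse (\<sigma> (zz s t) (- b2))" M "%w. \<sigma> (zz s t) (- b2) * (pull s \<phi> w * \<sigma> (zz s t) (c2 w))"]
   integrable_mult_right[of "\<sigma> (zz s t) (- b2)" M "%w. pull s \<phi> w * \<sigma> (zz s t) (c2 w)"] by (auto simp flip: mult.assoc)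
qed

lemma KK_scale: "a ~= 0 ==> of_real (absv (J a)) * KK s t (J a * x) = kfac s t a * KK s t x"
proof -
 assume a: "a ~= 0"
 have 1: "c2 (inverse (J a * x)) = inverse a * c2 (inverse x)"
  using c_smult(2)[of "inverse a" "inverse x"] by (simp add: emb_inverse)
 have 2: "inverse (theta s (inverse (J a * x))) = theta s (J a) * inverse (theta s (inverse x))"
  by (simp add: theta_mult theta_inverse)
 have 3: "\<sigma> (zz s t) (inverse a * c2 (inverse x)) = inverse (\<sigma> (zz s t) a) * \<sigma> (zz s t) (c2 (inverse x))"
  by (simp add: quasi_char_mult[OF unit_character_sg uniformizer_F] quasi_char_inverse[OF unit_character_sg uniformizer_F])
 have 4: "complex_of_real (absv (inverse (J a * x)) ^ 2) = of_real (inverse (absv (J a))) ^ 2 * of_real (absv (inverse x) ^ 2)"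
  by (simp add: absv_mult absv_inverse power_mult_distrib)
 have 5: "complex_of_real (absv (J a)) * of_real (inverse (absv (J a))) ^ 2 = of_real (inverse (absv (J a)))"
  using absv_pos[of "J a"] a by (simp add: power2_eq_square)
 have "of_real (absv (J a)) * KK s t (J a * x) =
   \<sigma> (zz s t) (- b2) * (theta s (J a) * inverse (theta s (inverse x))) *
   (inverse (\<sigma> (zz s t) a) * \<sigma> (zz s t) (c2 (inverse x))) *
   ((of_real (absv (J a)) * of_real (inverse (absv (J a))) ^ 2) * of_real (absv (inverse x) ^ 2))"
  unfolding KK_eq[of s t "J a * x"] 1 2 3 4 by (simp only: mult_ac)
 thus ?thesis unfolding 5 kfac_sigma[OF a] KK_eq[of s t x] by (simp only: mult_ac)
qed

lemma zz_Re: "Re (2 * s + t + 1/2) > 0 \<longleftrightarrow> Re (zz s t) > - 1" by (simp add: zz_def) linarith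

lemma integrable_KK_off:
 assumes "Re (2 * s + t + 1/2) > 0" "\<phi> \<in> TF0" shows "integrable M (%x. KK s t x * \<phi> x)"
proof -
 have "Re (zz s t) > - 1" using assms(1) zz_Re by blast
 thus ?thesis using KK_integral(2)[OF measurable_test_fun[OF assms(2)]] integrable_I test_fun_pull_UNIV[OF assms(2)]
  by blast
qed

lemma norm_kfac_uniformizer: "norm (kfac s t pF) = qr TYPE('f) powr (- Re (2 * s - t + 1/2))"
 by (simp add: kfac_uniformizer norm_qexp)

lemma LINT_KK_scale:
 assumes "a ~= 0" "\<phi> \<in> borel_measurable borel"
 shows "(LINT x|M. KK s t x * \<phi> (inverse (J a) * x)) = kfac s t a * (LINT x|M. KK s t x * \<phi> x)"
proof -
 have ia: "J a ~= 0" using assms by simp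
 have mi: "(%x. inverse (J a) * x) \<in> borel_measurable borel"
  by (rule borel_measurable_continuous_onI[OF continuous_mult_left])
 have m: "(%x. KK s t x * \<phi> (inverse (J a) * x)) \<in> borel_measurable borel"
  using measurable_KK measurable_compose[OF mi assms(2)] by (intro borel_measurable_times)
 have "(LINT x|M. KK s t (J a * x) * \<phi> x) = of_real (inverse (absv (J a))) * (LINT x|M. KK s t x * \<phi> (inverse (J a) * x))"
  using integral_scale[OF haar m ia] ia by (simp flip: mult.assoc)
 hence "(LINT x|M. KK s t x * \<phi> (inverse (J a) * x)) = of_real (absv (J a)) * (LINT x|M. KK s t (J a * x) * \<phi> x)"
  using absv_pos[OF ia] by (simp add: field_simps)
 also have "\<dots> = (LINT x|M. (of_real (absv (J a)) * KK s t (J a * x)) * \<phi> x)" by (simp add: mult.assoc)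
 also have "\<dots> = kfac s t a * (LINT x|M. KK s t x * \<phi> x)" unfolding KK_scale[OF assms(1)] by (simp add: mult.assoc)
 finally show ?thesis .
qed

text \<open>Dilates of one shell, on which the kernel is integrable, exhaust the ball up to 0. Each
  dilation by \<open>pF\<close> multiplies the integral of the norm by |\<open>kfac s t pF\<close>|
  = q^(-Re(2s - t + 1/2)) < 1, so the contributions are summable.\<close>

lemma integrable_KK_om:
 assumes "Re (2 * s + t + 1/2) > 0" "Re (2 * s - t + 1/2) > 0" shows "integrable M (%x. KK s t x * om x)"
proof -
 define b where "b n x = ball_ind (0::'e) (1 - e + e * int n) x" for n x
 define f where "f n x = KK s t x * (b n x - b (Suc n) x)" for n x
 have step: "(%x. b (Suc n) x - b (Suc (Suc n)) x) = (%x. b n (inverse (J pF) * x) - b (Suc n) (inverse (J pF) * x))" for n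
 proof -
  have 1: "inverse (J pF) * x \<in> pw k \<longleftrightarrow> x \<in> pw (k + e)" for x k
   using pF0 by (simp add: pw_mult_iff val_inverse val_emb val_uniformizer[OF uniformizer_F])
  have 2: "1 - e + e * int (Suc n) = 1 - e + e * int n + e" for n by (simp add: algebra_simps)
  show ?thesis unfolding b_def ball_ind_def diff_0_right 1 2 ..
 qed
 have tf: "(%x. b n x - b (Suc n) x) \<in> TF0" for n proof -
  have "(%x. b n x - b (Suc n) x) \<in> TF" unfolding b_def by (intro test_fun_diff test_fun_ball_ind_UNIV)
  thus ?thesis by (subst test_fun_iff) (simp add: b_def ball_ind_def)
 qed
 have int_f: "integrable M (f n)" for n unfolding f_def by (rule integrable_KK_off[OF assms(1) tf])
 define r where "r = norm (kfac s t pF)"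
 have norm_step: "(LINT x|M. norm (f (Suc n) x)) = r * (LINT x|M. norm (f n x))" for n proof -
  have p: "J pF ~= 0" using pF0 by simp
  have "f (Suc n) \<in> borel_measurable borel"
   unfolding f_def using measurable_KK measurable_test_fun[OF tf] by (intro borel_measurable_times)
  hence m: "(%x. complex_of_real (norm (f (Suc n) x))) \<in> borel_measurable borel" by measurable
  have "norm (f (Suc n) (J pF * x)) = inverse (absv (J pF)) * (r * norm (f n x))" for x proof -
   have "b (Suc n) (J pF * x) - b (Suc (Suc n)) (J pF * x) = b n x - b (Suc n) x"
    using fun_cong[OF step[of n], of "J pF * x"] p by (simp flip: mult.assoc)
   hence "of_real (absv (J pF)) * f (Suc n) (J pF * x) = kfac s t pF * f n x"
    unfolding f_def using KK_scale[OF pF0, of s t x] by (simp flip: mult.assoc)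
   hence "norm (of_real (absv (J pF)) * f (Suc n) (J pF * x)) = norm (kfac s t pF * f n x)" by simp
   hence "absv (J pF) * norm (f (Suc n) (J pF * x)) = r * norm (f n x)"
    using absv_pos[OF p] by (simp add: norm_mult r_def)
   thus ?thesis using absv_pos[OF p] by (simp add: field_simps)
  qed
  hence "complex_of_real (inverse (absv (J pF)) * (r * (LINT x|M. norm (f n x)))) =
    of_real (inverse (absv (J pF))) * of_real (LINT x|M. norm (f (Suc n) x))" using integral_scale[OF haar m p] by simp
  thus ?thesis using absv_pos[OF p] unfolding of_real_mult[symmetric] of_real_eq_iff by (simp add: field_simps)
 qed
 have closed: "(%n. (LINT x|M. norm (f n x))) = (%n. r ^ n * (LINT x|M. norm (f 0 x)))" proof
  show "(LINT x|M. norm (f n x)) = r ^ n * (LINT x|M. norm (f 0 x))" for n by (induction n) (simp_all add: norm_step)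
 qed
 have "r < 1" unfolding r_def norm_kfac_uniformizer using assms(2) qr_gt_1[where 'a='f] by (simp add: powr_less_one)
 moreover have "r \<ge> 0" by (simp add: r_def)
 ultimately have summ: "summable (%n. (LINT x|M. norm (f n x)))"
  unfolding closed by (intro summable_mult2 summable_geometric) simp
 have ev: "\<exists>N. \<forall>n\<ge>N. b n x = 0" if "x ~= 0" for x proof -
  have "b n x = 0" if n: "n \<ge> nat (val x + e)" for n proof -
   have "val x + e \<le> int n" using n by simp
   also have "int n = 1 * int n" by simp
   also have "\<dots> \<le> e * int n" using e_pos by (intro mult_right_mono) auto
   finally show ?thesis using \<open>x ~= 0\<close> by (simp add: b_def ball_ind_def pw_def)
  qed
  thus ?thesis by blast
 qed
 have sums: "(%n. f n x) sums (KK s t x * om x)" for x proof (cases "x = 0")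
  case True
  have "0 \<in> range J" using range_eqI[of 0 J 0] by simp
  thus ?thesis using True by (simp add: f_def kernel_fun_def)
 next
  case False
  then obtain N where N: "!!n. n \<ge> N ==> b n x = 0" using ev by blast
  have "(%n. b n x) \<longlonglongrightarrow> 0" by (rule tendsto_eventually) (use N in \<open>auto simp: eventually_sequentially\<close>)
  from telescope_sums'[OF this] have "(%n. b n x - b (Suc n) x) sums om x" by (simp add: b_def om_def)
  thus ?thesis unfolding f_def by (rule sums_mult)
 qed
 have "summable (%n. norm (f n x))" for x proof (cases "x = 0")
  case True
  have "0 \<in> range J" using range_eqI[of 0 J 0] by simp
  thus ?thesis using True by (simp add: f_def kernel_fun_def)
 next
  case False
  then obtain N where N: "!!n. n \<ge> N ==> b n x = 0" using ev by blast
  show ?thesis by (rule summable_finite[of "{..<N}"]) (use N in \<open>auto simp: f_def\<close>)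
 qed
 hence "integrable M (%x. \<Sum>n. f n x)" using int_f summ by (intro integrable_suminf) auto
 thus ?thesis using sums_unique[OF sums] by simp
qed

text \<open>The nonvanishing factor between kernel and generator: \<open>kap\<close> stems from
  normalising on \<open>star\<close>, the other factor from \<open>b2\<close>.\<close>

definition kk :: "complex => complex => complex" where
 "kk s t = of_real kap * \<sigma> (zz s t) (- b2)"

lemma kk_nonzero: "kk s t ~= 0"
 using kap_nonzero quasi_char_nonzero[OF unit_character_sg uniformizer_F] b2_nonzero by (simp add: kk_def)

lemma lam_LINT_off:
 assumes "Re (2 * s + t + 1/2) > 0" "\<phi> \<in> TF0"
 shows "lam (zz s t) * (LINT x|M. KK s t x * \<phi> x) = kk s t * W s t \<phi>"
proof -
 have "Re (zz s t) > - 1" using assms(1) zz_Re by blast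
 hence "lam (zz s t) * I (zz s t) (pull s \<phi>) = of_real kap * W s t \<phi>"
  unfolding W_def by (rule vhat_I(2)) (rule test_fun_pull_UNIV[OF assms(2)])
 thus ?thesis unfolding KK_integral(1)[OF measurable_test_fun[OF assms(2)]] kk_def by (simp add: mult_ac)
qed

definition SS0 :: "complex => complex => complex" where
 "SS0 s t = (if triv' then SS s t else 0)"

text \<open>Integration against the kernel scales by \<open>kfac\<close>, so its value on
  \<open>om\<close> obeys the relation behind \<open>rel\<close>; the second L-factor enters
  here.\<close>

lemma lam_LINT_om:
 assumes "Re (2 * s + t + 1/2) > 0" "Re (2 * s - t + 1/2) > 0"
 shows "lam' s t * (lam (zz s t) * (LINT x|M. KK s t x * om x)) = kk s t * SS0 s t"
proof (cases triv')
 case False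
 then obtain a where a: "a \<in> int_units" "chi (J a) * inverse (eta a) ~= 1" by (auto simp: triv'_def)
 have "a ~= 0" using a by (simp add: int_units_val)
 hence "(LINT x|M. KK s t x * om x) = kfac s t a * (LINT x|M. KK s t x * om x)"
  using LINT_KK_scale[of a om s t] measurable_test_fun[OF test_fun_om] om_unit[OF a(1)] by metis
 hence "(LINT x|M. KK s t x * om x) = 0" using a kfac_unit[OF a(1), of s t] by simp
 thus ?thesis using False by (simp add: SS0_def)
next
 case True
 have "(LINT x|M. KK s t x * ball_ind 0 1 x) = kfac s t pF * (LINT x|M. KK s t x * om x)"
  using LINT_KK_scale[OF pF0 measurable_test_fun[OF test_fun_om], of s t] fun_cong[OF om_uniformizer] by simp
 moreover have "(LINT x|M. KK s t x * ball_ind 0 1 x) = (LINT x|M. KK s t x * om x - KK s t x * shell x)"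
  by (intro Bochner_Integration.integral_cong) (simp_all add: om_def shell_def algebra_simps)
 moreover have "\<dots> = (LINT x|M. KK s t x * om x) - (LINT x|M. KK s t x * shell x)"
  using integrable_KK_om[OF assms] integrable_KK_off[OF assms(1) test_fun_shell]
  by (rule Bochner_Integration.integral_diff)
 ultimately have "lam' s t * (LINT x|M. KK s t x * om x) = (LINT x|M. KK s t x * shell x)"
  using True by (simp add: lam'_def kfac_uniformizer algebra_simps)
 hence "lam (zz s t) * (lam' s t * (LINT x|M. KK s t x * om x)) = kk s t * W s t shell"
  using lam_LINT_off[OF assms(1) test_fun_shell] by simp
 thus ?thesis using True by (simp add: SS0_def SS_def W_def mult.left_commute)
qed

text \<open>The value at \<phi> of \<open>kk\<close> times the pair (\<open>SS0\<close>,
  \<open>lam'\<close>). No denominator is left, which makes it entire in both variables.\<close>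

definition hfun :: "('e => complex) => complex \<times> complex => complex" where
 "hfun \<phi> w = kk (fst w) (snd w) * (\<phi> 0 * SS0 (fst w) (snd w) + lam' (fst w) (snd w) * W (fst w) (snd w) (minus_om \<phi>))"

lemma lambda_plus_eq: "lambda_plus J chi s eta t = lam (zz s t)"
proof -
 have "zz s t + 1 = 2 * s + t + 1/2" by (simp add: zz_def)
 thus ?thesis using qexp_powr[of "2 * s + t + 1/2", where 'a='f] by (simp add: lambda_plus_def lam_def triv_def sg_def)
qed

lemma lambda_minus_eq: "lambda_minus J chi s eta t = lam' s t" using qexp_powr[of "2 * s - t + 1/2", where 'a='f]
 by (simp add: lambda_minus_def lam'_def triv'_def)

lemma hfun_integral:
 assumes re: "Re (2 * s + t + 1/2) > 0" "Re (2 * s - t + 1/2) > 0" and \<phi>: "\<phi> \<in> TF"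
 shows "hfun \<phi> (s, t) = lambda_plus J chi s eta t * lambda_minus J chi s eta t * (LINT x|M. KK s t x * \<phi> x)"
proof -
 have "(LINT x|M. KK s t x * \<phi> x) = (LINT x|M. \<phi> 0 * (KK s t x * om x) + KK s t x * minus_om \<phi> x)"
  by (intro Bochner_Integration.integral_cong) (simp_all add: minus_om_def algebra_simps)
 also have "\<dots> = \<phi> 0 * (LINT x|M. KK s t x * om x) + (LINT x|M. KK s t x * minus_om \<phi> x)"
  using integrable_KK_om[OF re] integrable_KK_off[OF re(1) test_fun_minus_om[OF \<phi>]]
  by (subst Bochner_Integration.integral_add) auto
 finally have "lam (zz s t) * lam' s t * (LINT x|M. KK s t x * \<phi> x) =
   \<phi> 0 * (lam' s t * (lam (zz s t) * (LINT x|M. KK s t x * om x))) +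
   lam' s t * (lam (zz s t) * (LINT x|M. KK s t x * minus_om \<phi> x))" by (simp add: algebra_simps)
 also have "\<dots> = hfun \<phi> (s, t)" unfolding lam_LINT_om[OF re] lam_LINT_off[OF re(1) test_fun_minus_om[OF \<phi>]]
  by (simp add: hfun_def algebra_simps)
 finally show ?thesis by (simp add: lambda_plus_eq lambda_minus_eq)
qed

text \<open>The function \<open>pull s \<phi>\<close> itself varies with s, but a bound for its
  support and a radius of constancy can be fixed. It is thus a finite sum over fixed balls with
  coefficients entire in s, and the generator on each ball is entire in
  \<open>zz s t\<close>.\<close>

lemma holomorphic_C2_W:
 assumes \<phi>: "\<phi> \<in> TF0" shows "holomorphic_C2 (%w. W (fst w) (snd w) \<phi>)"
proof -
 obtain n0 where n0: "n0 \<ge> 1" "!!h. h \<in> pw n0 ==> chi (1 + h) = 1"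
  using unit_character_trivial_near_one[OF chi] by blast
 obtain n m where nm: "periodic n (%w. \<phi> (inverse w))" "supported m (%w. \<phi> (inverse w))"
  using test_fun_subset[OF test_fun_inversion[OF \<phi>], of UNIV] test_funE by (metis subset_UNIV)
 have "\<phi> 0 = 0" using \<phi> test_fun_iff[of \<phi> "- {0}"] by auto
 hence "w \<notin> pw n" if "\<phi> (inverse w) ~= 0" for w using that periodicD[OF nm(1), of w 0] by auto
 hence big: "w ~= 0 & val w < n" if "\<phi> (inverse w) ~= 0" for w using that by (force simp: pw_def)
 define k where "k = max m (n + n0)"
 have near: "pull s \<phi> y = pull s \<phi> x" if y: "y - x \<in> pw k" and x: "\<phi> (inverse x) ~= 0" for s x y proof -
  have "y - x \<in> pw (val x + n0)" "y - x \<in> pw n" using y big[OF x] n0(1) by (auto simp: k_def elim!: pw_mono[rotated])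
  thus ?thesis
   using quasi_char_congruent[OF uniformizer_E chi n0, of x y "s + 1/2"] periodicD[OF nm(1), of y x] big[OF x]
   by (simp add: pull_def theta_def)
 qed
 have "periodic k (pull s \<phi>)" for s unfolding periodic_def proof (intro allI impI)
  fix x y :: 'e assume y: "y - x \<in> pw k"
  thus "pull s \<phi> y = pull s \<phi> x" using near[OF y] near[of x y] pw_diff_commute[of y x k]
   by (cases "\<phi> (inverse x) = 0"; cases "\<phi> (inverse y) = 0") (auto simp: pull_def)
 qed
 moreover have "supported m (pull s \<phi>)" for s using nm(2) by (simp add: supported_def pull_def)
 moreover obtain R :: "'e set" where R: "residue_reps m k R" using ex_residue_reps[of m k] by (auto simp: k_def)
 ultimately have pull_eq: "pull s \<phi> = (%w. \<Sum>c\<in>R. pull s \<phi> c * ball_ind c k w)" for s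
  using test_fun_decompose[of k "pull s \<phi>" m R] by blast
 have W_eq: "W s t \<phi> = (\<Sum>c\<in>R. pull s \<phi> c * vhat (zz s t) (ball_ind c k))" for s t unfolding W_def
  by (subst pull_eq, subst linear_on_tf_sum[OF inV_linear[OF inV_vhat]])
   (auto intro!: sum.cong test_fun_cmult test_fun_ball_ind_UNIV linear_on_tf_cmult[OF inV_linear[OF inV_vhat]])
 have h1: "holomorphic_C2 (%w. pull (fst w) \<phi> c)" for c proof (cases "c = 0")
  case False
  have "(%s. pull s \<phi> c) holomorphic_on UNIV" unfolding pull_def theta_def quasi_char_eq[OF False] qexp_powi
   using False chi ang_unit[OF uniformizer_E False] unit_character_nonzero[OF chi] by (intro holomorphic_intros) auto
  from holomorphic_C2_affine[OF this, of 1 0 0] show ?thesis by simp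
 qed (simp add: pull_def holomorphic_C2_const)
 have h2: "holomorphic_C2 (%w. vhat (zz (fst w) (snd w)) (ball_ind c k))" for c
  using holomorphic_C2_affine[OF holomorphic_vhat[OF test_fun_ball_ind_UNIV[of c k]], of 2 1 "- 1/2"] by (simp add: zz_def)
 show ?thesis unfolding W_eq by (intro holomorphic_C2_sum holomorphic_C2_mult h1 h2)
qed

lemma holomorphic_C2_SS: "holomorphic_C2 (%w. SS (fst w) (snd w))"
 using holomorphic_C2_W[OF test_fun_shell] by (simp add: SS_def W_def)

lemma holomorphic_C2_lam': "holomorphic_C2 (%w. lam' (fst w) (snd w))"
proof (cases triv')
 case True
 have "(%z. 1 - qexp TYPE('f) z) holomorphic_on UNIV" by (intro holomorphic_intros)
 from holomorphic_C2_affine[OF this, of 2 "- 1" "1/2"] show ?thesis using True by (simp add: lam'_def)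
qed (simp add: lam'_def holomorphic_C2_const)

lemma holomorphic_C2_kk: "holomorphic_C2 (%w. kk (fst w) (snd w))"
proof -
 have "holomorphic_C2 (%w. \<sigma> (zz (fst w) (snd w)) (- b2))"
  using holomorphic_C2_affine[OF holomorphic_sigma[of "- b2"], of 2 1 "- 1/2"] by (simp add: zz_def)
 thus ?thesis unfolding kk_def by (intro holomorphic_C2_mult holomorphic_C2_const)
qed

lemma holomorphic_C2_hfun:
 assumes "\<phi> \<in> TF" shows "holomorphic_C2 (hfun \<phi>)"
proof -
 have "holomorphic_C2 (%w. SS0 (fst w) (snd w))"
  using holomorphic_C2_SS holomorphic_C2_const by (cases triv') (auto simp: SS0_def)
 thus ?thesis unfolding hfun_def[abs_def]
  by (intro holomorphic_C2_mult holomorphic_C2_add holomorphic_C2_const holomorphic_C2_kk holomorphic_C2_lam'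
    holomorphic_C2_W test_fun_minus_om assms)
qed

abbreviation Kt :: "complex => complex => ('e => complex) => complex" where
 "Kt s t \<equiv> kernel_tilde M J d \<alpha> pF pE chi s eta t"

text \<open>\<open>hfun\<close> is entire and agrees with the renormalised integral where that
  converges, so it is the function singled out by \<open>THE\<close>.\<close>

lemma kernel_tilde_UU: "Kt s t = UU s t (kk s t * SS0 s t) (kk s t * lam' s t)"
proof
 fix \<phi>
 show "Kt s t \<phi> = UU s t (kk s t * SS0 s t) (kk s t * lam' s t) \<phi>" proof (cases "\<phi> \<in> TF")
  case True
  have "(THE h. holomorphic_C2 h &
    (\<forall>s t. Re (2 * s + t + 1/2) > 0 & Re (2 * s - t + 1/2) > 0 -->
      h (s, t) = lambda_plus J chi s eta t * lambda_minus J chi s eta t * (LINT x|M. KK s t x * \<phi> x))) = hfun \<phi>"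
  proof (rule the_equality)
   show "holomorphic_C2 (hfun \<phi>) & (\<forall>s t. Re (2 * s + t + 1/2) > 0 & Re (2 * s - t + 1/2) > 0 -->
      hfun \<phi> (s, t) = lambda_plus J chi s eta t * lambda_minus J chi s eta t * (LINT x|M. KK s t x * \<phi> x))"
    by (intro conjI allI impI holomorphic_C2_hfun True, elim conjE, rule hfun_integral[OF _ _ True])
   fix h
   assume h: "holomorphic_C2 h & (\<forall>s t. Re (2 * s + t + 1/2) > 0 & Re (2 * s - t + 1/2) > 0 -->
      h (s, t) = lambda_plus J chi s eta t * lambda_minus J chi s eta t * (LINT x|M. KK s t x * \<phi> x))"
   show "h = hfun \<phi>" proof
    fix w
    show "h w = hfun \<phi> w" proof (rule holomorphic_C2_eqI)
     fix s t :: complex assume re: "Re (2 * s + t + 1/2) > 0 & Re (2 * s - t + 1/2) > 0"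
     show "h (s, t) = hfun \<phi> (s, t)"
      using h[THEN conjunct2, rule_format, OF re] hfun_integral[OF re[THEN conjunct1] re[THEN conjunct2] True]
      by (rule trans[OF _ sym])
    qed (rule h[THEN conjunct1] holomorphic_C2_hfun[OF True])+
   qed
  qed
  hence "Kt s t \<phi> = hfun \<phi> (s, t)" using True by (simp add: kernel_tilde_def)
  thus ?thesis using True by (simp add: hfun_def UU_eq algebra_simps)
 qed (simp add: kernel_tilde_def UU_def)
qed

end

section \<open>Vanishing of the shell integral\<close>

definition ind :: "'a set => 'a => complex" where "ind T w = (if w \<in> T then 1 else 0)"

definition uniform_set :: "'a::nonarch_local_field set => bool" where
 "uniform_set T \<longleftrightarrow> (\<exists>n. \<forall>x y. y - x \<in> pw n --> (y \<in> T \<longleftrightarrow> x \<in> T))"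

lemma uniform_set_pw: "uniform_set (pw n)"
 unfolding uniform_set_def by (intro exI[of _ n]) (metis add_diff_cancel_left' diff_add_cancel pw_add pw_diff)

lemma uniform_set_Int_Diff:
 assumes "uniform_set S" "uniform_set (T::'a::nonarch_local_field set)"
 shows uniform_set_Int: "uniform_set (S \<inter> T)" and uniform_set_Diff: "uniform_set (S - T)"
proof -
 obtain n where n: "!!x y. y - x \<in> pw n ==> (y \<in> S \<longleftrightarrow> x \<in> S)" using assms(1) unfolding uniform_set_def by blast
 obtain m where m: "!!x y. y - x \<in> pw m ==> (y \<in> T \<longleftrightarrow> x \<in> T)" using assms(2) unfolding uniform_set_def by blast
 have *: "y - x \<in> pw (max n m) ==> y - x \<in> pw n & y - x \<in> pw m" for x y :: 'a
  using pw_mono[of n "max n m" "y - x"] pw_mono[of m "max n m" "y - x"] by simp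
 show "uniform_set (S \<inter> T)" "uniform_set (S - T)"
  unfolding uniform_set_def using n m * by (intro exI[of _ "max n m"]; blast)+
qed

lemma test_fun_ind:
 assumes "uniform_set T" "T \<subseteq> pw m" "T \<subseteq> U" shows "ind T \<in> test_fun (U::'a::nonarch_local_field set)"
proof -
 obtain n where "!!x y. y - x \<in> pw n ==> (y \<in> T \<longleftrightarrow> x \<in> T)" using assms(1) unfolding uniform_set_def by blast
 hence "periodic n (ind T)" unfolding periodic_def ind_def by metis
 moreover have "supported m (ind T)" using assms(2) by (auto simp: supported_def ind_def)
 ultimately have "ind T \<in> TF" using test_fun_UNIV_iff by blast
 thus ?thesis using assms(3) by (subst test_fun_iff) (auto simp: ind_def)
qed

lemma integral_affine:
 fixes f :: "'a::nonarch_local_field => complex"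
 assumes M: "normalized_haar M" and f: "f \<in> borel_measurable borel" and a: "a \<in> int_units"
 shows "(LINT x|M. f (a * x + b)) = integral\<^sup>L M f"
proof -
 have "a ~= 0" "absv a = 1" using a by (auto simp: int_units_val absv_def)
 moreover have "(%x. f (x + b)) \<in> borel_measurable borel" by (rule measurable_compose[OF _ f])
   (auto intro!: similarity_measurable[where r = 0])
 ultimately show ?thesis using integral_scale[OF M, of "%x. f (x + b)" a] integral_translate[OF M f, of b] by simp
qed

context kernel_setting
begin

abbreviation gg :: "complex => 'e => complex" where "gg s w \<equiv> inverse (theta s w)"

lemma gg_near: obtains n where "n \<ge> 1" "!!s h. h \<in> pw n ==> gg s (1 + h) = 1"
proof -
 obtain n where n: "n \<ge> 1" "!!x. x \<in> pw n ==> chi (1 + x) = 1" using unit_character_trivial_near_one[OF chi] by blast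
 show thesis proof (rule that[OF n(1)])
  show "gg s (1 + h) = 1" if "h \<in> pw n" for s h
   using n(2)[OF that] quasi_char_unit[OF one_plus_pw(3)[OF that n(1)]] by (simp add: theta_def)
 qed
qed

lemma theta_unit: "x \<in> int_units ==> theta s x = chi x ^ 2" by (simp add: theta_def quasi_char_unit)

lemma norm_gg_unit: "x \<in> int_units ==> norm (gg s x) = 1"
 using unit_character_norm[OF chi, of x] by (simp add: theta_unit norm_inverse norm_power)

text \<open>The generator on \<open>gg s\<close> cut to \<open>T\<close>. As \<open>pull\<close>
  multiplies by \<open>gg s\<close>, this is the shape in which \<open>SS\<close> appears after
  inversion.\<close>

definition V :: "complex => complex => 'e set => complex" where
 "V s t T = vhat (zz s t) (%w. gg s w * ind T w)"

lemma test_fun_gg: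
 assumes "ind T \<in> TF0" shows "(%w. gg s w * ind T w) \<in> TF0"
proof (rule test_fun_mult[OF assms])
 fix x :: 'e assume "ind T x ~= 0"
 hence "x ~= 0" using assms test_fun_iff[of "ind T" "- {0}"] by auto
 thus "\<exists>n. \<forall>y. y - x \<in> pw n --> gg s y = gg s x" using theta_locally_constant[of x s] by metis
qed

lemma test_fun_gg': "ind T \<in> TF0 ==> (%w. gg s w * ind T w) \<in> TF"
 using test_fun_subset[OF test_fun_gg, of T UNIV] by simp

lemma V_diff:
 assumes "ind S \<in> TF0" "ind T \<in> TF0" "T \<subseteq> S" shows "V s t (S - T) = V s t S - V s t T"
proof -
 have "(%w. gg s w * ind (S - T) w) = (%w. gg s w * ind S w - gg s w * ind T w)"
  using assms(3) by (auto simp: ind_def fun_eq_iff)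
 thus ?thesis
  unfolding V_def using linear_on_tf_diff[OF inV_linear[OF inV_vhat] test_fun_gg' test_fun_gg'] assms(1,2) by simp
qed

definition shells :: "'e set" where "shells = pw 0 - pw e"

lemma uniform_set_shells: "uniform_set shells" unfolding shells_def by (intro uniform_set_Diff uniform_set_pw)

lemma shells_sub: "shells \<subseteq> pw 0" "0 \<notin> shells" by (auto simp: shells_def)

lemma test_fun_shells: "ind shells \<in> TF0" using shells_sub by (intro test_fun_ind[OF uniform_set_shells]) auto

lemma SS_shells: "SS s t = V s t shells"
proof -
 have eq: "shell (inverse w) * gg s w = gg s w * ind shells w" for w proof (cases "w = 0")
  case False
  have "e > 0" by (rule e_pos)
  thus ?thesis using False by (auto simp: shell_def ball_ind_def ind_def shells_def pw_def val_inverse)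
 qed simp
 have "pull s shell = (%w. gg s w * ind shells w)" unfolding pull_def[abs_def] eq ..
 thus ?thesis unfolding SS_def V_def by (simp only:)
qed

text \<open>The parameters at which the dirac distribution satisfies the homogeneity condition.\<close>

definition critical :: "complex => complex => bool" where
 "critical s t \<longleftrightarrow> triv' & qexp TYPE('f) (2 * s - t + 1/2) = 1"

lemma critical_kfac: "critical s t ==> a ~= 0 ==> kfac s t a = 1"
 using ang_unit[OF uniformizer_F, of a] by (simp add: kfac_formula critical_def triv'_def)

lemma critical_vhat_scale:
 assumes "critical s t" "a ~= 0" "\<psi> \<in> TF"
 shows "vhat (zz s t) (%w. \<psi> (J a * w)) = gg s (J a) * vhat (zz s t) \<psi>"
proof -
 have "theta s (J a) * (of_real (inverse (absv (J a))) * inverse (\<sigma> (zz s t) a)) = 1"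
  using critical_kfac[OF assms(1,2)] kfac_sigma[OF assms(2), of s t] by (simp add: mult.assoc)
 hence "of_real (inverse (absv (J a))) * inverse (\<sigma> (zz s t) a) = gg s (J a)" by (rule inverse_unique[symmetric])
 thus ?thesis using inV_scale[OF inV_vhat assms(3,2), of "zz s t"] by simp
qed

text \<open>At critical parameters dilation by F multiplies the generator by
  \<open>gg s (J a)\<close>, and the factor \<open>gg s\<close> in the integrand compensates this
  exactly.\<close>

lemma critical_V_scale:
 assumes "critical s t" "a ~= 0" "ind T \<in> TF0" shows "V s t {w. J a * w \<in> T} = V s t T"
proof -
 let ?\<psi> = "%w. gg s w * ind T w"
 have "(%w. gg s w * ind {w. J a * w \<in> T} w) = (%w. theta s (J a) * ?\<psi> (J a * w))"
  using theta_nonzero[of "J a" s] assms(2) by (simp add: fun_eq_iff ind_def theta_mult)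
 hence "V s t {w. J a * w \<in> T} = vhat (zz s t) (%w. theta s (J a) * ?\<psi> (J a * w))" by (simp add: V_def)
 also have "\<dots> = theta s (J a) * vhat (zz s t) (%w. ?\<psi> (J a * w))"
  by (rule linear_on_tf_cmult[OF inV_linear[OF inV_vhat] test_fun_scale[OF test_fun_gg'[OF assms(3)]]]) (use assms(2) in simp)
 also have "\<dots> = V s t T" unfolding critical_vhat_scale[OF assms(1,2) test_fun_gg'[OF assms(3)]]
  using theta_nonzero[of "J a" s] assms(2) by (simp add: V_def)
 finally show ?thesis .
qed

lemma uniform_set_c2: "uniform_set {w. c2 w - y \<in> pw n}" unfolding uniform_set_def
proof (intro exI[of _ "e * n"] allI impI)
 fix x w :: 'e assume "w - x \<in> pw (e * n)"
 hence "c2 w - c2 x \<in> pw n" by (simp add: pw_coords c_diff)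
 thus "w \<in> {w. c2 w - y \<in> pw n} \<longleftrightarrow> x \<in> {w. c2 w - y \<in> pw n}" using pw_add_cancel[of "c2 w - c2 x" n "c2 x - y"] by simp
qed

lemma gg_orthogonal:
 assumes T: "ind T \<in> TF0" and a: "a \<in> int_units" "gg s a ~= 1" "!!w. a * w \<in> T \<longleftrightarrow> w \<in> T"
 shows "(LINT w|M. gg s w * ind T w) = 0"
proof -
 have "(LINT w|M. gg s w * ind T w) = (LINT w|M. gg s (a * w + 0) * ind T (a * w + 0))"
  using integral_affine[OF haar measurable_test_fun[OF test_fun_gg[OF T, of s]] a(1), of 0] by simp
 also have "\<dots> = (LINT w|M. gg s a * (gg s w * ind T w))"
  by (intro Bochner_Integration.integral_cong) (simp_all add: theta_mult ind_def a(3))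
 also have "\<dots> = gg s a * (LINT w|M. gg s w * ind T w)" by simp
 finally show ?thesis using a(2) by simp
qed

subsection \<open>The case of a nontrivial square\<close>

text \<open>The part inside a ball of a narrow strip around the line \<open>c2 = 1\<close>; dilation
  by F reduces strips around other lines off F to this one.\<close>

definition slab :: "int => int => 'e set" where
 "slab m j = {w. c2 w - 1 \<in> pw m & w \<in> pw (e * j)}"

lemma test_fun_slab:
 assumes "m \<ge> 1" shows "ind (slab m j) \<in> TF0"
proof -
 have "slab m j = {w. c2 w - 1 \<in> pw m} \<inter> pw (e * j)" by (auto simp: slab_def)
 moreover have "(- 1 :: 'f) \<notin> pw m" using assms by (auto simp: pw_def)
 ultimately show ?thesis by (simp only:) (intro test_fun_ind uniform_set_Int uniform_set_c2 uniform_set_pw, auto)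
qed

lemma unit_reps:
 assumes R: "residue_reps 0 m R" and m: "m \<ge> 1"
 shows "finite {u\<in>R. u \<notin> pw 1}" "{u\<in>R. u \<notin> pw (1::int)} ~= {}"
  and "!!x::'f. val x = 0 ==> x ~= 0 ==> \<exists>!u. u \<in> {u\<in>R. u \<notin> pw 1} & x - u \<in> pw m"
  and "!!u. u \<in> {u\<in>R. u \<notin> pw 1} ==> val u = 0 & u ~= 0"
proof -
 show "val u = 0 & u ~= 0" if "u \<in> {u\<in>R. u \<notin> pw 1}" for u proof -
  have "u \<in> pw 0" using that R unfolding residue_reps_def by blast
  thus ?thesis using that by (auto simp: pw_def)
 qed
 show "finite {u\<in>R. u \<notin> pw 1}" using R by (simp add: residue_reps_def)
 show ex: "\<exists>!u. u \<in> {u\<in>R. u \<notin> pw 1} & x - u \<in> pw m" if x: "val x = 0" "x ~= 0" for x :: 'f proof -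
  have "x \<in> pw 0" using x by (simp add: pw_def)
  hence "\<exists>!u. u \<in> R & x - u \<in> pw m" using R unfolding residue_reps_def by blast
  moreover have "u \<notin> pw 1" if "x - u \<in> pw m" for u proof
   assume "u \<in> pw 1"
   moreover have "x - u \<in> pw 1" using pw_mono[OF m that] .
   ultimately have "(x - u) + u \<in> pw 1" by (intro pw_add)
   thus False using x by (simp add: pw_def)
  qed
  ultimately show ?thesis by blast
 qed
 show "{u\<in>R. u \<notin> pw (1::int)} ~= {}" using ex[of 1] by auto
qed

text \<open>Nontrivial \<open>sg\<close> kills the contribution near F. The rest of
  \<open>shells\<close> is sorted by the valuation n of \<open>c2\<close> and its leading digits u;
  dilation turns each piece into a difference of two slabs independent of u. The sum over n
  telescopes, starting from an empty slab, and c counts the classes u.\<close>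

lemma SS_slab:
 assumes crit: "critical s t" and nt: "\<not> triv"
 obtains k0 where "!!k m. k \<ge> k0 ==> m \<ge> 1 ==> \<exists>c>0. SS s t = of_nat c * V s t (slab m (1 - int k))"
proof -
 let ?\<psi> = "%w. gg s w * ind shells w"
 have t: "?\<psi> \<in> TF" by (rule test_fun_gg'[OF test_fun_shells])
 obtain k1 m1 where km: "periodic (e * k1) ?\<psi>" "supported (e * m1) ?\<psi>" "m1 \<le> k1"
  using ex_periodic_supported[OF t] by metis
 show thesis proof (rule that[of "nat k1"])
  fix k :: nat and m :: int assume k: "k \<ge> nat k1" and m: "m \<ge> 1"
  have "periodic (e * int k) ?\<psi>" using e_pos k by (intro periodic_mono[OF km(1)] mult_left_mono) auto
  moreover obtain R where R: "residue_reps m1 (int k) (R :: 'f set)"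
   using ex_residue_reps[of m1 "int k"] km(3) k by fastforce
  ultimately have near0: "vhat (zz s t) (%w. near (int k) w * ?\<psi> w) = 0"
   using near_value[OF inV_vhat[of "zz s t"] _ km(2) R] box_zero_nontriv[OF inV_vhat nt] by simp
  obtain R' :: "'f set" where R': "residue_reps 0 m R'" using ex_residue_reps[of 0 m] m by auto
  define U where "U = {u\<in>R'. u \<notin> pw (1::int)}"
  note U = unit_reps[OF R' m, folded U_def]
  have Uunit: "val u = 0" "u ~= 0" if "u \<in> U" for u using U(4)[OF that] by auto
  define P where "P n u = {w \<in> shells. c2 w - pF powi int n * u \<in> pw (int n + m)}" for n u
  have tP: "ind (P n u) \<in> TF0" for n u proof -
   have "P n u = shells \<inter> {w. c2 w - pF powi int n * u \<in> pw (int n + m)}" by (auto simp: P_def)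
   thus ?thesis
    using shells_sub by (simp only:) (intro test_fun_ind[where m = 0] uniform_set_Int uniform_set_c2 uniform_set_shells; auto)
  qed
  have vp: "val (pF powi n) = n" "pF powi n ~= 0" for n
   using pF0 val_uniformizer[OF uniformizer_F] by (simp_all add: val_power_int)
  have P_iff: "w \<in> P n u \<longleftrightarrow> w \<in> shells & c2 w ~= 0 & val (c2 w) = int n & c2 w / pF powi int n - u \<in> pw m"
   if u: "u \<in> U" for w n u proof -
   let ?p = "pF powi int n"
   have "c2 w - ?p * u = ?p * (c2 w / ?p - u)" using vp(2)[of "int n"] by (simp add: field_simps)
   hence 1: "c2 w - ?p * u \<in> pw (int n + m) \<longleftrightarrow> c2 w / ?p - u \<in> pw m" using vp[of "int n"] by (simp add: pw_mult_iff)
   moreover have "c2 w ~= 0 & val (c2 w) = int n" if "c2 w - ?p * u \<in> pw (int n + m)" proof -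
    have nz: "?p * u ~= 0" "val (?p * u) = int n" using Uunit[OF u] vp[of "int n"] by (simp_all add: val_mult)
    have "?p * u - c2 w \<in> pw (val (?p * u) + 1)"
     using pw_mono[of "int n + 1" "int n + m", OF _ that] m unfolding nz(2) by (simp add: pw_diff_commute)
    thus ?thesis using val_congruent[OF nz(1), of "c2 w"] nz(2) by simp
   qed
   ultimately show ?thesis unfolding P_def by blast
  qed
  have split: "(1 - near (int k) w) * ind shells w = (\<Sum>n<k. \<Sum>u\<in>U. ind (P n u) w)" for w
  proof (cases "w \<in> shells & c2 w \<notin> pw (int k)")
   case False
   have "ind (P n u) w = 0" if "n < k" "u \<in> U" for n u
    using False that P_iff[OF that(2), of w n] by (auto simp: ind_def pw_def)
   thus ?thesis using False by (auto simp: ind_def near_def)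
  next
   case True
   hence c: "c2 w ~= 0" "val (c2 w) < int k" by (auto simp: pw_def)
   have "w \<in> pw (e * 0)" using True by (auto simp: shells_def)
   hence "val (c2 w) \<ge> 0" using c unfolding pw_coords by (simp add: pw_def)
   then obtain n0 where n0: "val (c2 w) = int n0" "n0 < k" using c by (metis nonneg_int_cases of_nat_less_iff)
   have "val (c2 w / pF powi int n0) = 0" "c2 w / pF powi int n0 ~= 0"
    using c vp[of "int n0"] n0 by (simp_all add: val_divide)
   from U(3)[OF this] obtain u0 where u0: "u0 \<in> U" "c2 w / pF powi int n0 - u0 \<in> pw m"
    "!!u. u \<in> U ==> c2 w / pF powi int n0 - u \<in> pw m ==> u = u0" by blast
   have "ind (P n u) w = (if n = n0 & u = u0 then 1 else 0)" if "u \<in> U" for n u proof (cases "n = n0 & u = u0")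
    case True
    thus ?thesis
     using P_iff[OF that, of w n] n0 u0(2) \<open>w \<in> shells & c2 w \<notin> pw (int k)\<close> c(1) by (simp add: ind_def)
   next
    case False
    have "w \<notin> P n u" proof
     assume "w \<in> P n u"
     hence "int n = int n0" "c2 w / pF powi int n - u \<in> pw m" using P_iff[OF that, of w n] n0 by auto
     thus False using False u0(3)[OF that] by simp
    qed
    thus ?thesis using False by (simp add: ind_def)
   qed
   hence "(\<Sum>n<k. \<Sum>u\<in>U. ind (P n u) w) = (\<Sum>n<k. \<Sum>u\<in>U. if n = n0 & u = u0 then 1 else 0)" by (intro sum.cong refl) auto
   also have "\<dots> = (\<Sum>n<k. if n = n0 then 1 else 0)" using U(1) u0(1) by (intro sum.cong refl) auto
   also have "\<dots> = 1" using n0(2) by simp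
   finally show ?thesis using True by (simp add: ind_def near_def)
  qed
  have V_P: "V s t (P n u) = V s t (slab m (- int n)) - V s t (slab m (1 - int n))" if u: "u \<in> U" for n u proof -
   define a where "a = pF powi int n * u"
   have a: "a ~= 0" "val a = int n" using Uunit[OF u] vp[of "int n"] by (simp_all add: val_mult a_def)
   have "J a * w \<in> P n u \<longleftrightarrow> w \<in> slab m (- int n) - slab m (1 - int n)" for w proof -
    have "J a * w \<in> shells \<longleftrightarrow> w \<in> pw (e * - int n) - pw (e * (1 - int n))" proof -
     have "J a * w \<in> pw k \<longleftrightarrow> w \<in> pw (k - e * int n)" for k using a by (simp add: pw_mult_iff val_emb)
     moreover have "e - e * int n = e * (1 - int n)" "0 - e * int n = e * - int n" by (simp_all add: algebra_simps)
     ultimately show ?thesis unfolding shells_def by (simp only: Diff_iff)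
    qed
    moreover have "c2 (J a * w) - a = a * (c2 w - 1)" unfolding c_smult by (simp add: algebra_simps)
    hence "c2 (J a * w) - a \<in> pw (int n + m) \<longleftrightarrow> c2 w - 1 \<in> pw m" using a by (simp add: pw_mult_iff)
    ultimately show ?thesis unfolding P_def slab_def a_def by blast
   qed
   hence "{w. J a * w \<in> P n u} = slab m (- int n) - slab m (1 - int n)" by blast
   moreover have "slab m (1 - int n) \<subseteq> slab m (- int n)" proof -
    have "e * - int n \<le> e * (1 - int n)" using e_pos by (intro mult_left_mono) auto
    thus ?thesis unfolding slab_def using pw_mono by blast
   qed
   ultimately show ?thesis
    using critical_V_scale[OF crit a(1) tP[of n u]] V_diff[OF test_fun_slab[OF m] test_fun_slab[OF m]] by simp
  qed
  have "slab m 1 = {}" proof -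
   have "c2 w - 1 \<notin> pw m" if "w \<in> pw (e * 1)" for w proof
    assume "c2 w - 1 \<in> pw m"
    hence "c2 w - 1 \<in> pw 1" by (rule pw_mono[OF m])
    moreover have "c2 w \<in> pw 1" using that unfolding pw_coords by simp
    ultimately have "c2 w - (c2 w - 1) \<in> pw 1" using pw_diff by blast
    thus False by (simp add: pw_def)
   qed
   thus ?thesis by (auto simp: slab_def)
  qed
  hence slab1: "V s t (slab m 1) = 0" using linear_on_tf_zero[OF inV_linear[OF inV_vhat]] by (simp add: V_def ind_def)
  have "SS s t = vhat (zz s t) (%w. (1 - near (int k) w) * ?\<psi> w)"
   using linear_on_tf_add[OF inV_linear[OF inV_vhat] test_fun_near[OF t] test_fun_subset[OF test_fun_far[OF t]], of "zz s t" "int k" "int k"]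
    near0 by (simp add: SS_shells V_def algebra_simps)
  also have "(%w. (1 - near (int k) w) * ?\<psi> w) = (%w. \<Sum>n<k. \<Sum>u\<in>U. gg s w * ind (P n u) w)" proof
   fix w
   have "(1 - near (int k) w) * ?\<psi> w = gg s w * ((1 - near (int k) w) * ind shells w)" by (simp only: mult_ac)
   thus "(1 - near (int k) w) * ?\<psi> w = (\<Sum>n<k. \<Sum>u\<in>U. gg s w * ind (P n u) w)"
    unfolding split by (simp add: sum_distrib_left)
  qed
  also have "vhat (zz s t) \<dots> = (\<Sum>n<k. \<Sum>u\<in>U. V s t (P n u))" unfolding V_def
   by (subst linear_on_tf_sum[OF inV_linear[OF inV_vhat]], intro test_fun_sum test_fun_gg' tP)
    (intro sum.cong refl linear_on_tf_sum[OF inV_linear[OF inV_vhat]] test_fun_gg' tP)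
  also have "\<dots> = of_nat (card U) * (\<Sum>n<k. V s t (slab m (- int n)) - V s t (slab m (1 - int n)))"
   using V_P by (simp add: sum_distrib_left)
  also have "(\<Sum>n<k. V s t (slab m (- int n)) - V s t (slab m (1 - int n))) = V s t (slab m (1 - int k))"
   using sum_lessThan_telescope[of "%n. V s t (slab m (1 - int n))" k] slab1 by (simp add: algebra_simps)
  finally show "\<exists>c>0. SS s t = of_nat c * V s t (slab m (1 - int k))"
   using U(1,2) by (intro exI[of _ "card U"]) (simp add: card_gt_0_iff)
 qed
qed

text \<open>If \<open>SS\<close> vanishes, so do the slabs and their dilates T around lines
  \<open>c2 = c\<close>. Such a T is a union of boxes along the line, on each of which
  \<open>gg s\<close> is constant and the generator has one common value, nonzero because
  \<open>lam\<close> is 1. What remains is a discrete integral of \<open>gg s\<close> over the line;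
  the bound \<open>k0\<close> is the same for all lines.\<close>

lemma line_sum_zero:
 assumes crit: "critical s t" and nt: "\<not> triv" and S0: "SS s t = 0" obtains k0 :: int where "k0 \<ge> 0"
  "!!w R n Q. c2 w ~= 0 ==> c1 w \<in> pw (- R) ==> R + val (c2 w) \<ge> k0 ==> n \<ge> val (c2 w) + k0 ==>
    residue_reps (- R) n Q ==> (\<Sum>v\<in>Q. gg s (J v + w)) = 0"
proof -
 obtain K where K: "!!k m. k \<ge> K ==> m \<ge> 1 ==> \<exists>c>0. SS s t = of_nat c * V s t (slab m (1 - int k))"
  using SS_slab[OF crit nt] by metis
 obtain n0 where n0: "n0 \<ge> 1" "!!s h. h \<in> pw n0 ==> gg s (1 + h) = 1" using gg_near by metis
 define k0 where "k0 = max (int K) (max (n0 + 1) N0)"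
 have k0: "k0 \<ge> int K" "k0 \<ge> n0 + 1" "k0 \<ge> N0" by (simp_all add: k0_def)
 show thesis proof (rule that[of k0])
  show "k0 \<ge> 0" using k0 by simp
  fix w :: 'e and R n :: int and Q :: "'f set"
  assume c0: "c2 w ~= 0" and w1: "c1 w \<in> pw (- R)" and R: "R + val (c2 w) \<ge> k0"
   and n: "n \<ge> val (c2 w) + k0" and Q: "residue_reps (- R) n Q"
  define c where "c = c2 w"
  have c: "c ~= 0" using c0 by (simp add: c_def)
  define T where "T = {y. c2 y - c \<in> pw n} \<inter> pw (e * - R)"
  have "0 \<notin> T" using c n k0 n0(1) by (auto simp: T_def pw_def c_def)
  hence tT: "ind T \<in> TF0" unfolding T_def by (intro test_fun_ind uniform_set_Int uniform_set_c2 uniform_set_pw) auto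
  have "V s t T = V s t {y. J c * y \<in> T}" using critical_V_scale[OF crit c tT] by simp
  also have "{y. J c * y \<in> T} = slab (n - val c) (1 - int (nat (R + val c + 1)))" proof -
   have "c2 (J c * y) - c = c * (c2 y - 1)" for y unfolding c_smult by (simp add: algebra_simps)
   moreover have "e * - R - e * val c = e * (1 - int (nat (R + val c + 1)))"
    using R k0 n0(1) by (simp add: c_def algebra_simps)
   ultimately show ?thesis using c by (auto simp: T_def slab_def pw_mult_iff val_emb)
  qed
  finally have "V s t T = V s t (slab (n - val c) (1 - int (nat (R + val c + 1))))" .
  moreover have "nat (R + val c + 1) \<ge> K" "n - val c \<ge> 1" using R n k0 n0(1) by (simp_all add: c_def)
  ultimately have V0: "V s t T = 0" using K[of "nat (R + val c + 1)" "n - val c"] S0 by auto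
  have const: "gg s y = gg s x" if x: "c2 x = c" and y: "y - x \<in> pw (e * n)" for x y proof -
   have "x \<notin> pw (e * (val c + 1))" using c x unfolding pw_coords by (simp add: pw_def)
   hence x0: "x ~= 0" "val x < e * (val c + 1)" by (auto simp: pw_def)
   have "1 * n0 \<le> e * n0" using e_pos n0(1) by (intro mult_right_mono) auto
   moreover have "e * (val c + 1 + n0) \<le> e * n" using e_pos n k0 by (intro mult_left_mono) (auto simp: c_def)
   ultimately have "n0 + val x \<le> e * n" using x0(2) by (simp add: algebra_simps)
   hence "x * ((y - x) / x) \<in> pw (n0 + val x)" using pw_mono[OF _ y] x0(1) by simp
   hence "(y - x) / x \<in> pw n0" using x0(1) by (subst (asm) pw_mult_iff) auto
   hence "gg s (1 + (y - x) / x) = 1" by (rule n0(2))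
   moreover have "x * (1 + (y - x) / x) = y" using x0(1) by (simp add: field_simps)
   ultimately show ?thesis using theta_mult[of s x "1 + (y - x) / x"] by simp
  qed
  have wT: "x \<in> pw (e * - R) \<longleftrightarrow> c1 x \<in> pw (- R)" if "c2 x - c \<in> pw n" for x proof -
   have "c \<in> pw (- R)" "- R \<le> n" using R n k0 n0(1) by (auto simp: c_def pw_def)
   hence "c2 x \<in> pw (- R)" using pw_add[of "c2 x - c" "- R" c] pw_mono[OF _ that] by simp
   thus ?thesis unfolding pw_coords by simp
  qed
  have "(%y. gg s y * ind T y) = (%y. \<Sum>v\<in>Q. gg s (J v + w) * box (J v + w) n y)" proof
   fix y
   have box: "box (J v + w) n y = (if (c1 y - c1 w) - v \<in> pw n & c2 y - c \<in> pw n then 1 else 0)" for v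
    by (simp add: box_eq c_add c_def algebra_simps)
   show "gg s y * ind T y = (\<Sum>v\<in>Q. gg s (J v + w) * box (J v + w) n y)" proof (cases "y \<in> T")
    case True
    hence yT: "c2 y - c \<in> pw n" "c1 y - c1 w \<in> pw (- R)" using wT[of y] w1 by (auto simp: T_def intro: pw_diff)
    then obtain v0 where v0: "v0 \<in> Q" "(c1 y - c1 w) - v0 \<in> pw n"
     "!!v. v \<in> Q ==> (c1 y - c1 w) - v \<in> pw n ==> v = v0" using Q unfolding residue_reps_def by metis
    have "y - (J v0 + w) \<in> pw (e * n)"
     using v0(2) yT(1) unfolding pw_coords by (simp add: c_diff c_add c_def algebra_simps)
    hence gy: "gg s y = gg s (J v0 + w)" by (intro const) (simp add: c_add c_def)
    have "(\<Sum>v\<in>Q. gg s (J v + w) * box (J v + w) n y) = (\<Sum>v\<in>Q. if v = v0 then gg s (J v0 + w) else 0)"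
    proof (rule sum.cong[OF refl])
     fix v assume "v \<in> Q"
     show "gg s (J v + w) * box (J v + w) n y = (if v = v0 then gg s (J v0 + w) else 0)" proof (cases "v = v0")
      case True
      thus ?thesis using v0(2) yT(1) by (simp only: box) simp
     next
      case False
      hence "\<not> (c1 y - c1 w) - v \<in> pw n" using v0(3)[OF \<open>v \<in> Q\<close>] by blast
      thus ?thesis using False by (simp only: box) simp
     qed
    qed
    also have "\<dots> = gg s y" using Q v0(1) gy by (simp add: residue_reps_def)
    finally show ?thesis using True by (simp add: ind_def)
   next
    case False
    have "box (J v + w) n y = 0" if v: "v \<in> Q" for v proof (rule ccontr)
     assume "\<not> ?thesis"
     hence b: "(c1 y - c1 w) - v \<in> pw n" "c2 y - c \<in> pw n" by (auto simp: box split: if_splits)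
     have "v \<in> pw (- R)" "- R \<le> n" using v Q R n k0 n0(1) by (auto simp: residue_reps_def c_def)
     hence "((c1 y - c1 w) - v) + v + c1 w \<in> pw (- R)" using b(1) w1 by (intro pw_add) (auto intro: pw_mono)
     thus False using False b(2) wT[OF b(2)] by (simp add: T_def)
    qed
    thus ?thesis using False by (simp add: ind_def)
   qed
  qed
  hence "V s t T = vhat (zz s t) (%y. \<Sum>v\<in>Q. gg s (J v + w) * box (J v + w) n y)" by (simp add: V_def)
  also have "\<dots> = (\<Sum>v\<in>Q. gg s (J v + w) * vhat (zz s t) (box (w + J v) n))"
   using linear_on_tf_sum[OF inV_linear[OF inV_vhat], of Q "%v y. gg s (J v + w) * box (J v + w) n y" "zz s t"]
    linear_on_tf_cmult[OF inV_linear[OF inV_vhat] test_fun_box] test_fun_cmult[OF test_fun_box]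
   by (simp add: add.commute)
  also have "\<dots> = (\<Sum>v\<in>Q. gg s (J v + w)) * vhat (zz s t) (box w n)"
   unfolding inV_box_shift[OF inV_vhat] by (simp add: sum_distrib_right)
  finally have "(\<Sum>v\<in>Q. gg s (J v + w)) * vhat (zz s t) (box w n) = 0" using V0 by simp
  moreover have "vhat (zz s t) (box w n) ~= 0" proof -
   have "mass (vhat (zz s t)) ~= 0" using mass_vhat[of "zz s t"] nt by (auto simp: lam_def)
   moreover have "n \<ge> val (c2 w) + N0" using n k0(3) by simp
   ultimately show ?thesis using inV_box_off[OF inV_vhat c0, of n "zz s t"] qr_pos[where 'a='f]
     quasi_char_nonzero[OF unit_character_sg uniformizer_F c0] by simp
  qed
  ultimately show "(\<Sum>v\<in>Q. gg s (J v + w)) = 0" by simp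
 qed
qed

text \<open>Since 1 + vx = x(v + 1/x), lines through 1 in direction x become F-lines through 1/x,
  for which uniform bounds are required. If \<open>c2 (inverse x)\<close> were too small, then 1/x,
  and with it x, would be too close to F.\<close>

lemma c2_inverse_bounds:
 assumes x: "x \<in> pw 0" "c2 x \<notin> pw N" and N: "N \<ge> 1"
 shows "c2 (inverse x) ~= 0" "val (c2 (inverse x)) < N" "- N \<le> val (c2 (inverse x))" "c1 (inverse x) \<in> pw (- N)"
proof -
 have x0: "x ~= 0" using x(2) by auto
 have "x \<notin> pw (e * N)" using x(2) unfolding pw_coords by simp
 hence "inverse x \<in> pw (e * - N)" using x0 by (auto simp: pw_def val_inverse)
 hence low: "c1 (inverse x) \<in> pw (- N)" "c2 (inverse x) \<in> pw (- N)" using pw_coords[of "inverse x" "- N"] by simp_all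
 define a b where "a = c1 (inverse x)" and "b = c2 (inverse x)"
 have "b \<notin> pw N" proof
  assume b: "b \<in> pw N"
  have \<beta>0: "\<beta> \<in> pw (e * 0)" unfolding pw_coords by (simp add: pw_def)
  have "inverse x = J a + J b * \<beta>" unfolding a_def b_def by (rule decompose)
  hence "x * (J a + J b * \<beta>) = 1" using x0 by (metis right_inverse)
  hence eq: "J a * x = J 1 + J (- b) * (x * \<beta>)" by (simp add: emb_one emb_minus algebra_simps)
  have "J (- b) * (x * \<beta>) \<in> pw (e * N + (0 + 0))" using b x(1) \<beta>0 by (intro pw_mult) (simp_all add: pw_emb)
  moreover have "1 * 1 \<le> e * N" using e_pos N by (intro mult_mono) auto
  ultimately have "J (- b) * (x * \<beta>) \<in> pw 1" using pw_mono[of 1 "e * N"] by simp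
  note one = one_plus_pw[OF this, folded emb_one]
  have "a ~= 0" "val (J a * x) = 0" using one(1,2) eq by (auto simp: emb_one)
  hence "e * val a = - val x" using x0 by (simp add: val_mult val_emb)
  moreover have "val x \<ge> 0" using x(1) x0 by (simp add: pw_def)
  ultimately have "\<not> e * val a > 0" by simp
  hence va: "val a \<le> 0" using e_pos by (simp add: zero_less_mult_iff)
  have "a * c2 x = - b * c2 (x * \<beta>)" using arg_cong[OF eq, of c2] unfolding c_add c_smult by simp
  moreover have "c2 (x * \<beta>) \<in> pw 0" using pw_mult[OF x(1) \<beta>0] pw_coords[of "x * \<beta>" 0] by simp
  hence "- b * c2 (x * \<beta>) \<in> pw (N + 0)" using b by (intro pw_mult) simp_all
  ultimately have "c2 x \<in> pw (N - val a)" using \<open>a ~= 0\<close> by (simp flip: pw_mult_iff)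
  thus False using x(2) pw_mono[of N "N - val a" "c2 x"] va by simp
 qed
 thus "c2 (inverse x) ~= 0" "val (c2 (inverse x)) < N" "- N \<le> val (c2 (inverse x))" "c1 (inverse x) \<in> pw (- N)"
  using low by (auto simp: b_def pw_def)
qed

text \<open>The map x -> ax + b preserves \<open>T\<close> and Haar measure and multiplies 1 + vx by
  a, hence the integral equals itself times \<open>gg s a\<close>.\<close>

lemma affine_vanishing:
 assumes a: "a \<in> int_units" "gg s a ~= 1" "J v * b = a - 1" and T: "T \<in> sets borel"
  and inv: "!!x. a * x + b \<in> T \<longleftrightarrow> x \<in> T" shows "(LINT x|M. ind T x * gg s (1 + J v * x)) = 0"
proof -
 have "(%x. 1 + J v * x) \<in> borel_measurable borel" proof (cases "v = 0")
  case False
  thus ?thesis by (intro similarity_measurable[where r = "val (J v)"])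
    (simp add: pw_mult_iff flip: right_diff_distrib)
 qed simp
 hence "(%x. theta s (1 + J v * x)) \<in> borel_measurable borel" by (rule measurable_compose[OF _ measurable_theta])
 moreover have "ind T = indicator T" by (auto simp: ind_def indicator_def fun_eq_iff)
 ultimately have m: "(%x. ind T x * gg s (1 + J v * x)) \<in> borel_measurable borel" using T by simp
 have "1 + J v * (a * x + b) = a * (1 + J v * x)" for x using a(3) by (simp add: algebra_simps)
 hence "(%x. ind T (a * x + b) * gg s (1 + J v * (a * x + b))) =
   (%x. gg s a * (ind T x * gg s (1 + J v * x)))" by (simp add: fun_eq_iff ind_def inv theta_mult)
 hence "(LINT x|M. ind T x * gg s (1 + J v * x)) = gg s a * (LINT x|M. ind T x * gg s (1 + J v * x))"
  using integral_affine[OF haar m a(1), of b] by simp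
 thus ?thesis using a(2) by simp
qed

lemma residue_reps_sub:
 assumes Q: "residue_reps r n (Q :: 'f set)" and f: "r \<le> f" "f \<le> n"
 shows "card {v\<in>Q. v \<in> pw f} = residue_card TYPE('f) ^ nat (n - f)"
proof (rule residue_system_card[OF _ _ f(2)])
 show "\<forall>x\<in>pw f. \<exists>!c. c \<in> {v \<in> Q. v \<in> pw f} & x - c \<in> pw n" proof
  fix x :: 'f assume x: "x \<in> pw f"
  hence "\<exists>!c. c \<in> Q & x - c \<in> pw n" using Q pw_mono[OF f(1)] unfolding residue_reps_def by blast
  moreover have "c \<in> pw f" if "x - c \<in> pw n" for c using pw_diff[OF x pw_mono[OF f(2) that]] by simp
  ultimately show "\<exists>!c. c \<in> {v \<in> Q. v \<in> pw f} & x - c \<in> pw n" by blast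
 qed
qed auto

text \<open>Radon inversion at the point \<open>1\<close>: if \<open>SS s t\<close> vanishes, then so do all integrals of \<open>gg s\<close> over
 affine \<open>F\<close>-lines missing \<open>0\<close>.  Averaging them over the lines \<open>{1 + v x}\<close> whose directions \<open>x\<close> stay
 away from \<open>F\<close> leaves only the neighbourhood of \<open>1\<close> where \<open>gg s\<close> is \<open>1\<close>, up to an error that is
 negligible when directions arbitrarily close to \<open>F\<close> are admitted.\<close>

lemma SS_nonzero:
 assumes crit: "critical s t" and nt: "\<not> triv" shows "SS s t ~= 0"
proof
 assume "SS s t = 0"
 then obtain k0 :: int where k0: "k0 \<ge> 0"
  and line: "!!w R n Q. c2 w ~= 0 ==> c1 w \<in> pw (- R) ==> R + val (c2 w) \<ge> k0 ==> n \<ge> val (c2 w) + k0 ==>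
    residue_reps (- R) n Q ==> (\<Sum>v\<in>Q. gg s (J v + w)) = 0" using line_sum_zero[OF crit nt] by blast
 \<comment> \<open>The least \<open>j\<close> with this property is the conductor exponent of
   \<open>gg s\<close> at 1, counted in powers of the uniformizer of F.\<close>
 define P where "P j \<longleftrightarrow> j \<ge> (1::nat) & (\<forall>h\<in>pw (e * int j). gg s (1 + h) = 1)" for j
 define f where "f = (LEAST j. P j)"
 obtain n0 where n0: "n0 \<ge> 1" "!!s h. h \<in> pw n0 ==> gg s (1 + h) = 1" using gg_near by metis
 have "1 * n0 \<le> e * n0" using e_pos n0(1) by (intro mult_right_mono) auto
 hence "P (nat n0)" using n0 pw_mono[of n0 "e * n0"] by (auto simp: P_def)
 hence Pf: "P f" unfolding f_def by (rule LeastI)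
 have f: "f \<ge> 1" "!!h. h \<in> pw (e * int f) ==> gg s (1 + h) = 1" using Pf by (auto simp: P_def)
 have nontriv: "\<exists>h\<in>pw (e * j). gg s (1 + h) ~= 1" if "1 \<le> j" "j < int f" for j proof -
  have "\<not> P (nat j)" using not_less_Least[of "nat j" P] that unfolding f_def by simp
  thus ?thesis using that by (auto simp: P_def)
 qed
 \<comment> \<open>The strip removed around F has measure q^(-N), and \<open>D\<close> below is q^(f
   - 1) times as large as \<open>C\<close>; this choice of \<open>N\<close> makes the error q^(-2)
   relative to the main term. \<open>R\<close> and \<open>n\<close> are large enough for the line
   sums at all x in \<open>G\<close>.\<close>
 define N where "N = int f + 1"
 define R where "R = 2 * N + k0"
 define n where "n = N + k0 + int f + 1"
 obtain Q :: "'f set" where Q: "residue_reps (- R) n Q"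
  using ex_residue_reps[of "- R" n] k0 by (auto simp: R_def n_def N_def)
 define G where "G = pw 0 - {w. c2 w - 0 \<in> pw N}"
 define B where "B = pw 0 \<inter> {w. c2 w - 0 \<in> pw N}"
 have uG: "uniform_set G" "uniform_set B"
  unfolding G_def B_def by (intro uniform_set_Diff uniform_set_Int uniform_set_c2 uniform_set_pw)+
 have tG: "ind G \<in> TF" "ind B \<in> TF" "ind (pw 0 :: 'e set) \<in> TF"
  by (intro test_fun_ind[of _ 0] uG uniform_set_pw; auto simp: G_def B_def)+
 have tH: "(%x. gg s (1 + J v * x) * ind T x) \<in> TF"
  if T: "ind T \<in> TF" and nz: "!!x. x \<in> T ==> 1 + J v * x ~= 0" for v T proof (rule test_fun_mult[OF T])
  fix x :: 'e assume "ind T x ~= 0"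
  hence "1 + J v * x ~= 0" using nz by (auto simp: ind_def split: if_splits)
  then obtain m where m: "!!y. y - (1 + J v * x) \<in> pw m ==> theta s y = theta s (1 + J v * x)"
   using theta_locally_constant by metis
  show "\<exists>m. \<forall>y. y - x \<in> pw m --> gg s (1 + J v * y) = gg s (1 + J v * x)" proof (cases "v = 0")
   case False
   have "gg s (1 + J v * y) = gg s (1 + J v * x)" if "y - x \<in> pw (m - val (J v))" for y proof -
    have "J v * (y - x) \<in> pw m" using that False by (simp add: pw_mult_iff)
    thus ?thesis using m[of "1 + J v * y"] by (simp add: algebra_simps)
   qed
   thus ?thesis by blast
  qed simp
 qed
 have nzG: "1 + J v * x ~= 0" if "x \<in> G" for v x proof
  assume "1 + J v * x = 0"
  hence "c2 (J 1 + J v * x) = 0" by (simp add: emb_one)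
  hence "v * c2 x = 0" unfolding c_add c_smult by simp
  thus False using that \<open>1 + J v * x = 0\<close> by (auto simp: G_def)
 qed
 \<comment> \<open>Interchanging the sum over v with the integral over x turns the total into line
   sums, which vanish. The single terms are estimated next according to the size of v.\<close>
 define H where "H v = (LINT x|M. gg s (1 + J v * x) * ind G x)" for v
 have "(\<Sum>v\<in>Q. H v) = (LINT x|M. (\<Sum>v\<in>Q. gg s (1 + J v * x) * ind G x))" unfolding H_def
  by (rule Bochner_Integration.integral_sum[symmetric]) (rule integrable_test_fun[OF haar tH[OF tG(1) nzG]])
 also have "(%x. \<Sum>v\<in>Q. gg s (1 + J v * x) * ind G x) = (%x. 0)" proof
  fix x
  show "(\<Sum>v\<in>Q. gg s (1 + J v * x) * ind G x) = 0" proof (cases "x \<in> G")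
   case True
   hence x: "x \<in> pw 0" "c2 x \<notin> pw N" "N \<ge> 1" by (auto simp: G_def N_def)
   note b = c2_inverse_bounds[OF x]
   have "c1 (inverse x) \<in> pw (- R)" using pw_mono[OF _ b(4), of "- R"] k0 x(3) by (simp add: R_def)
   hence sum0: "(\<Sum>v\<in>Q. gg s (J v + inverse x)) = 0"
    using b k0 x(3) by (intro line[OF _ _ _ _ Q]) (simp_all add: R_def n_def)
   have "x ~= 0" using x(2) by auto
   hence "1 + J v * x = x * (J v + inverse x)" for v by (simp add: algebra_simps)
   thus ?thesis using sum0 by (simp add: theta_mult flip: sum_distrib_left sum_distrib_right)
  qed (simp add: ind_def)
 qed
 finally have sum0: "(\<Sum>v\<in>Q. H v) = 0" by simp
 have borel: "G \<in> sets borel" "B \<in> sets borel" "(pw 0 :: 'e set) \<in> sets borel" proof -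
  have "{w. c2 w - 0 \<in> pw N} = strip 0 N" by (simp add: strip_def)
  thus "G \<in> sets borel" "B \<in> sets borel" "(pw 0 :: 'e set) \<in> sets borel"
   unfolding G_def B_def using strip_borel[of 0 N] by auto
 qed
 have measB: "measure M B = qr TYPE('f) powi (- N)" proof -
  have "B = {w. c1 w \<in> pw 0 & c2 w \<in> pw N}" using pw_coords[of _ 0] pw_mono[of 0 N] by (auto simp: B_def N_def)
  thus ?thesis using measure_box_eq[of 0 N] by (simp add: N_def)
 qed
 have intB: "(LINT x|M. ind B x) = of_real (qr TYPE('f) powi (- N))" proof -
  have "ind B = indicator B" by (auto simp: ind_def indicator_def fun_eq_iff)
  moreover have "emeasure M B \<le> emeasure M (pw 0)"
   using borel haar by (intro emeasure_mono) (auto simp: B_def normalized_haarD)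
  hence "emeasure M B < \<infinity>" using normalized_haarD(4)[OF haar] by (simp add: order_le_less_trans)
  ultimately show ?thesis using integral_indicator_complex(2)[of B] borel normalized_haarD(1)[OF haar] measB by simp
 qed
 have diff: "gg s (1 + J v * x) * ind G x = ind (pw 0) x * gg s (1 + J v * x) - gg s (1 + J v * x) * ind B x" for v x
  by (auto simp: ind_def G_def B_def)
 \<comment> \<open>For such v the value of \<open>gg s\<close> at 1 + vx is 1, and the measure of
   \<open>G\<close> remains: the main term.\<close>
 have HC: "H v = of_real (1 - qr TYPE('f) powi (- N))" if v: "v \<in> pw (int f)" for v proof -
  have "gg s (1 + J v * x) * ind G x = ball_ind 0 0 x - ind B x" for x proof (cases "x \<in> pw 0")
   case True
   have "J v * x \<in> pw (e * int f + 0)" using v True by (intro pw_mult) (simp_all add: pw_emb)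
   thus ?thesis using f(2)[of "J v * x"] True by (simp add: ind_def G_def B_def ball_ind_def)
  qed (simp add: ind_def G_def B_def ball_ind_def)
  thus ?thesis using integral_ball_ind[OF haar, of 0 0] integrable_test_fun[OF haar tG(2)] intB by (simp add: H_def)
 qed
 \<comment> \<open>For large v a unit u of F with \<open>sg u\<close> different from 1 yields an
   affine symmetry of \<open>G\<close> itself.\<close>
 have H0: "H v = 0" if v: "v \<notin> pw 1" for v proof -
  have v0: "v ~= 0" "val v \<le> 0" using v by (auto simp: pw_def)
  obtain u where u: "u \<in> int_units" "sg u ~= 1" using nt by (auto simp: triv_def)
  have iu: "J u \<in> int_units" "val u = 0" "u ~= 0" using emb_unit[OF u(1)] u(1) by (auto simp: int_units_val)
  have "chi (J u) = eta u"
   using crit u(1) unit_character_nonzero[OF eta u(1)] by (auto simp: critical_def triv'_def field_simps)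
  hence "theta s (J u) = sg u" by (simp add: theta_unit[OF iu(1)] sg_def power2_eq_square)
  hence gu: "gg s (J u) ~= 1" using u(2) by simp
  have "u - 1 \<in> pw 0" using iu by (intro pw_diff) (auto simp: pw_def)
  hence "v * ((u - 1) / v) \<in> pw 0" using v0 by simp
  hence "(u - 1) / v \<in> pw (0 - val v)" unfolding pw_mult_iff[OF v0(1)] .
  hence b: "(u - 1) / v \<in> pw 0" using v0(2) pw_mono[of 0 "0 - val v"] by simp
  hence b': "J ((u - 1) / v) \<in> pw 0" using pw_emb[of _ 0] by simp
  have "(LINT x|M. ind G x * gg s (1 + J v * x)) = 0" proof (rule affine_vanishing[OF iu(1) gu _ borel(1)])
   show "J v * J ((u - 1) / v) = J u - 1" using v0(1) by (simp add: emb_diff emb_one flip: emb_mult)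
   fix x
   have "J u * x + J ((u - 1) / v) \<in> pw 0 \<longleftrightarrow> x \<in> pw 0" using iu b' by (simp add: pw_add_cancel pw_mult_iff val_emb)
   moreover have "c2 (J u * x + J ((u - 1) / v)) = u * c2 x" by (simp add: c_add c_smult)
   ultimately show "J u * x + J ((u - 1) / v) \<in> G \<longleftrightarrow> x \<in> G" using iu by (simp add: G_def pw_mult_iff)
  qed
  thus ?thesis by (simp add: H_def mult.commute)
 qed
 \<comment> \<open>For intermediate v the symmetry comes from an element of E and preserves only
   \<open>pw 0\<close>; the error is the integral over the removed strip \<open>B\<close>, where
   \<open>gg s\<close> has absolute value 1.\<close>
 have HB: "norm (H v) \<le> qr TYPE('f) powi (- N)" if v: "v \<in> pw 1" "v \<notin> pw (int f)" for v proof -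
  have v0: "v ~= 0" "1 \<le> val v" "val v < int f" using v by (auto simp: pw_def)
  then obtain h where h: "h \<in> pw (e * val v)" "gg s (1 + h) ~= 1" using nontriv by blast
  have ev: "1 \<le> e * val v" using e_pos v0(2) mult_mono[of 1 e 1 "val v"] by simp
  have a: "1 + h \<in> int_units" by (rule one_plus_pw(3)[OF pw_mono[OF ev h(1)]]) simp
  have "J v * (h / J v) \<in> pw (e * val v)" using v0(1) h(1) by simp
  hence b: "h / J v \<in> pw 0" using v0(1) by (subst (asm) pw_mult_iff) (simp_all add: val_emb)
  have zero: "(LINT x|M. ind (pw 0) x * gg s (1 + J v * x)) = 0" proof (rule affine_vanishing[OF a h(2) _ borel(3)])
   show "J v * (h / J v) = 1 + h - 1" using v0(1) by simp
   fix x :: 'e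
   show "(1 + h) * x + h / J v \<in> pw 0 \<longleftrightarrow> x \<in> pw 0" using a b by (simp add: pw_add_cancel pw_mult_iff int_units_val)
  qed
  have unit: "1 + J v * x \<in> int_units" if "x \<in> pw 0" for x proof -
   have "J v * x \<in> pw (e * val v + 0)" using v0 that by (intro pw_mult) (simp_all add: val_emb pw_def)
   thus ?thesis using one_plus_pw(3)[OF pw_mono[OF ev, of "J v * x"]] by simp
  qed
  have nz: "1 + J v * x ~= 0" if "x \<in> pw 0" for x using unit[OF that] by (auto simp: int_units_val)
  have i1: "integrable M (%x. gg s (1 + J v * x) * ind B x)"
   using nz by (intro integrable_test_fun[OF haar tH[OF tG(2)]]) (auto simp: B_def)
  have i2: "integrable M (%x. ind (pw 0) x * gg s (1 + J v * x))"
   using integrable_test_fun[OF haar tH[OF tG(3) nz]] by (simp add: mult.commute)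
  have "H v = - (LINT x|M. gg s (1 + J v * x) * ind B x)"
   unfolding H_def diff using zero by (subst Bochner_Integration.integral_diff[OF i2 i1]) simp
  hence "norm (H v) \<le> (LINT x|M. norm (gg s (1 + J v * x) * ind B x))"
   using integral_norm_bound[of M "%x. gg s (1 + J v * x) * ind B x"] by simp
  also have "(%x. norm (gg s (1 + J v * x) * ind B x)) = indicator B" proof
   fix x
   show "norm (gg s (1 + J v * x) * ind B x) = indicator B x"
    using norm_gg_unit[OF unit, of x s] by (auto simp: ind_def B_def norm_mult indicator_def)
  qed
  also have "(LINT x|M. indicator B x) = measure M B" using normalized_haarD(2)[OF haar] by simp
  finally show ?thesis using measB by simp
 qed
 define q where "q = qr TYPE('f)"
 define C D where "C = {v\<in>Q. v \<in> pw (int f)}" and "D = {v\<in>Q. v \<in> pw 1}"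
 have fin: "finite Q" using Q by (simp add: residue_reps_def)
 have cards: "real (card C) = q ^ nat (n - int f)" "real (card D) = q ^ nat (n - 1)"
  using residue_reps_sub[OF Q, of "int f"] residue_reps_sub[OF Q, of 1] k0 f(1)
  by (simp_all add: C_def D_def q_def R_def n_def N_def)
 have CD: "C \<subseteq> D" using pw_mono[of 1 "int f"] f(1) by (auto simp: C_def D_def)
 have "(\<Sum>v\<in>Q. H v) = (\<Sum>v\<in>D. H v)" by (rule sum.mono_neutral_right[OF fin]) (auto simp: D_def H0)
 also have "\<dots> = (\<Sum>v\<in>D - C. H v) + (\<Sum>v\<in>C. H v)" using CD fin by (intro sum.subset_diff) (auto simp: D_def)
 also have "(\<Sum>v\<in>C. H v) = of_real (real (card C) * (1 - q powi (- N)))" using HC by (simp add: C_def q_def)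
 finally have "norm (\<Sum>v\<in>D - C. H v) = norm (complex_of_real (real (card C) * (1 - q powi (- N))))"
  using sum0 by (metis add_eq_0_iff norm_minus_cancel)
 hence "real (card C) * (1 - q powi (- N)) \<le> norm (\<Sum>v\<in>D - C. H v)" by (simp only: norm_of_real abs_ge_self)
 also have "\<dots> \<le> (\<Sum>v\<in>D - C. q powi (- N))" by (rule sum_norm_le) (use HB in \<open>auto simp: C_def D_def q_def\<close>)
 also have "\<dots> \<le> real (card D) * q powi (- N)" using card_mono[of D "D - C"] fin qr_pos[where 'a='f]
  by (auto simp: D_def q_def intro!: mult_right_mono)
 finally have ineq: "q ^ nat (n - int f) * (1 - q powi (- N)) \<le> q ^ nat (n - 1) * q powi (- N)" unfolding cards .
 have q2: "q \<ge> 2" using residue_card_ge_2[where 'a='f] by (simp add: q_def)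
 have "nat (n - 1) = nat (n - int f) + (f - 1)" using k0 f(1) by (simp add: n_def N_def)
 hence "q ^ nat (n - 1) * q powi (- N) = q ^ nat (n - int f) * (q ^ (f - 1) * q powi (- N))" by (simp add: power_add)
 with ineq have "q ^ nat (n - int f) * (1 - q powi (- N)) \<le> q ^ nat (n - int f) * (q ^ (f - 1) * q powi (- N))" by simp
 hence "1 - q powi (- N) \<le> q ^ (f - 1) * q powi (- N)" using q2 by (simp add: mult_le_cancel_left_pos)
 moreover have 1: "q powi (- N) = inverse (q ^ (f + 1))" proof -
  have "N = int (f + 1)" by (simp add: N_def)
  thus ?thesis by (simp only: power_int_minus power_int_of_nat)
 qed
 moreover have 2: "q ^ (f + 1) = q ^ (f - 1) * q ^ 2" using f(1) by (simp flip: power_add)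
 moreover have 3: "q ^ (f - 1) * inverse (q ^ (f - 1) * q ^ 2) = inverse (q ^ 2)" using q2 by simp
 ultimately have "1 - inverse (q ^ (f - 1) * q ^ 2) \<le> inverse (q ^ 2)" by (simp only: 1 2 3)
 moreover have "q ^ 2 \<ge> 4" using power_mono[OF q2, of 2] by simp
 moreover have "q ^ (f - 1) * q ^ 2 \<ge> 1 * 4" using q2 \<open>q ^ 2 \<ge> 4\<close> by (intro mult_mono) auto
 ultimately have "1 - 1/4 \<le> (1/4 :: real)"
  using le_imp_inverse_le[of 4 "q ^ 2"] le_imp_inverse_le[of 4 "q ^ (f - 1) * q ^ 2"] by simp
 thus False by simp
qed

end

section \<open>Periods and the lattices of exceptional parameters\<close>

lemma qexp_eq_1_iff:
 "qexp TYPE('a::nonarch_local_field) x = 1 \<longleftrightarrow>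
   (\<exists>n::int. x = of_int n * (of_real (2 * pi / ln (qr TYPE('a))) * \<i>))"
proof -
 let ?l = "ln (qr TYPE('a))"
 have l: "?l > 0" by (rule ln_qr_pos)
 have "qexp TYPE('a) x = 1 \<longleftrightarrow> Re x = 0 & (\<exists>n::int. - (Im x * ?l) = of_int (2 * n) * pi)"
  using l by (simp add: qexp_def exp_eq_1)
 also have "\<dots> \<longleftrightarrow> (\<exists>n::int. Re x = 0 & Im x = of_int n * (2 * pi / ?l))" proof -
  have "- (Im x * ?l) = of_int (2 * n) * pi \<longleftrightarrow> Im x = of_int (- n) * (2 * pi / ?l)" for n :: int
   using l by (auto simp: field_simps)
  thus ?thesis by (metis minus_minus)
 qed
 also have "\<dots> \<longleftrightarrow> (\<exists>n::int. x = of_int n * (of_real (2 * pi / ?l) * \<i>))" by (simp add: complex_eq_iff)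
 finally show ?thesis .
qed

lemma qexp_half_period:
 "qexp TYPE('a::nonarch_local_field) (of_real (2 * pi / ln (qr TYPE('a))) * \<i> / 2) = - 1"
proof -
 have "of_real (2 * pi / ln (qr TYPE('a))) * \<i> / 2 * of_real (ln (qr TYPE('a))) = complex_of_real pi * \<i>"
  using ln_qr_pos[where 'a='a] by (simp add: field_simps)
 thus ?thesis by (simp add: qexp_def exp_minus)
qed

text \<open>Adding the equations makes 4x an integral multiple of \<omega>, whose parity separates
  the two families. In the application \<omega> is the period of q^(-s) over F.\<close>

lemma half_lattice_iff:
 fixes x y \<omega> :: complex
 shows "(\<exists>a b::int. 2 * x - y = of_int a * \<omega> & 2 * x + y = of_int b * \<omega>) \<longleftrightarrow>
   (\<exists>m n::int. x = of_int m * (\<omega> / 2) & y = of_int n * \<omega>) \<or>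
   (\<exists>m n::int. x = \<omega> / 4 + of_int m * (\<omega> / 2) & y = \<omega> / 2 + of_int n * \<omega>)"
  (is "?L \<longleftrightarrow> ?A \<or> ?B")
proof
 assume ?L
 then obtain a b :: int where ab: "2 * x - y = of_int a * \<omega>" "2 * x + y = of_int b * \<omega>" by blast
 have x: "x = of_int (a + b) * \<omega> / 4" proof -
  have "4 * x = (2 * x - y) + (2 * x + y)" by simp
  thus ?thesis unfolding ab by (simp add: field_simps)
 qed
 have y: "y = 2 * x - of_int a * \<omega>" using ab(1) by (simp add: algebra_simps)
 consider m where "a + b = 2 * m" | m where "a + b = 2 * m + 1" by (metis oddE evenE)
 thus "?A \<or> ?B" proof cases
  case 1
  have "x = of_int m * (\<omega> / 2)" unfolding x 1 by (simp add: field_simps)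
  moreover from this have "y = of_int (m - a) * \<omega>" unfolding y by (simp add: field_simps)
  ultimately show ?thesis by blast
 next
  case 2
  have "x = \<omega> / 4 + of_int m * (\<omega> / 2)" unfolding x 2 by (simp add: field_simps)
  moreover from this have "y = \<omega> / 2 + of_int (m - a) * \<omega>" unfolding y by (simp add: field_simps)
  ultimately show ?thesis by blast
 qed
next
 assume "?A \<or> ?B"
 thus ?L proof
  assume ?A
  then obtain m n :: int where "x = of_int m * (\<omega> / 2)" "y = of_int n * \<omega>" by blast
  thus ?L by (intro exI[of _ "m - n"] exI[of _ "m + n"]) (simp add: algebra_simps)
 next
  assume ?B
  then obtain m n :: int where "x = \<omega> / 4 + of_int m * (\<omega> / 2)" "y = \<omega> / 2 + of_int n * \<omega>" by blast
  thus ?L by (intro exI[of _ "m - n"] exI[of _ "m + n + 1"]) (simp add: algebra_simps)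
 qed
qed

lemma quarter_lattice_iff:
 fixes x y \<omega> :: complex
 shows "(\<exists>a b::int. 2 * x - y = of_int a * \<omega> & 2 * x + y = of_int b * \<omega>) \<longleftrightarrow>
   (\<exists>m n::int. x = of_int m * \<omega> & y = of_int n * \<omega>) \<or>
   (\<exists>m n::int. x = \<omega> / 2 + of_int m * \<omega> & y = of_int n * \<omega>) \<or>
   (\<exists>m n::int. x = \<omega> / 4 + of_int m * \<omega> & y = \<omega> / 2 + of_int n * \<omega>) \<or>
   (\<exists>m n::int. x = 3 * \<omega> / 4 + of_int m * \<omega> & y = \<omega> / 2 + of_int n * \<omega>)"
proof -
 have par: "(\<exists>m::int. P m) \<longleftrightarrow> (\<exists>m. P (2 * m)) \<or> (\<exists>m. P (2 * m + 1))" for P by (metis oddE evenE)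
 have 1: "(\<exists>m::int. x = of_int m * (\<omega> / 2)) \<longleftrightarrow> (\<exists>m::int. x = of_int m * \<omega>) \<or> (\<exists>m::int. x = \<omega> / 2 + of_int m * \<omega>)"
  by (subst par) (simp add: algebra_simps)
 have 2: "(\<exists>m::int. x = \<omega> / 4 + of_int m * (\<omega> / 2)) \<longleftrightarrow>
   (\<exists>m::int. x = \<omega> / 4 + of_int m * \<omega>) \<or> (\<exists>m::int. x = 3 * \<omega> / 4 + of_int m * \<omega>)"
  by (subst par) (simp add: algebra_simps)
 show ?thesis unfolding half_lattice_iff using 1 2 by blast
qed

lemma double_lattice_iff:
 fixes x y \<omega> :: complex
 shows "(\<exists>a c::int. 2 * x - y = of_int a * \<omega> & 2 * x = of_int c * \<omega>) \<longleftrightarrow>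
   (\<exists>m n::int. x = of_int m * \<omega> & y = of_int n * \<omega>) \<or>
   (\<exists>m n::int. x = \<omega> / 2 + of_int m * \<omega> & y = of_int n * \<omega>)"
proof -
 have 1: "(\<exists>a::int. 2 * x - y = of_int a * \<omega>) \<longleftrightarrow> (\<exists>n::int. y = of_int n * \<omega>)" if "2 * x = of_int c * \<omega>" for c :: int
 proof -
  have "2 * x - y = of_int a * \<omega> \<longleftrightarrow> y = of_int (c - a) * \<omega>" for a unfolding that by (auto simp: algebra_simps)
  thus ?thesis by (metis diff_diff_eq2 add_diff_cancel_left')
 qed
 have 2: "(\<exists>c::int. 2 * x = of_int c * \<omega>) \<longleftrightarrow> (\<exists>m::int. x = of_int m * \<omega>) \<or> (\<exists>m::int. x = \<omega> / 2 + of_int m * \<omega>)" proof -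
  have "(\<exists>c::int. 2 * x = of_int c * \<omega>) \<longleftrightarrow>
    (\<exists>m::int. 2 * x = of_int (2 * m) * \<omega>) \<or> (\<exists>m::int. 2 * x = of_int (2 * m + 1) * \<omega>)" by (metis oddE evenE)
  also have "\<dots> \<longleftrightarrow> (\<exists>m::int. x = of_int m * \<omega>) \<or> (\<exists>m::int. x = \<omega> / 2 + of_int m * \<omega>)" by (auto simp: field_simps)
  finally show ?thesis .
 qed
 show ?thesis using 1 2 by blast
qed

section \<open>Evaluation of the shell integral for trivial \<open>sg\<close>\<close>

context kernel_setting
begin

text \<open>The unit group of the order O_F + pF^n O_E. This filtration of the units of E measures
  their closeness to F.\<close>

definition RR :: "nat => 'e set" where "RR n = (pw 0 - pw 1) \<inter> {w. c2 w - 0 \<in> pw (int n)}"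

lemma units_pw: "(int_units :: 'a::nonarch_local_field set) = pw 0 - pw 1" by (auto simp: int_units_val pw_def)

lemma RR_0: "RR 0 = int_units" using pw_coords[of _ 0] by (auto simp: RR_def units_pw)

lemma RR_units: "RR n \<subseteq> int_units" by (auto simp: RR_def units_pw)

lemma test_fun_RR: "ind (RR n) \<in> TF0"
 unfolding RR_def by (intro test_fun_ind[of _ 0] uniform_set_Int uniform_set_Diff uniform_set_pw uniform_set_c2) auto

lemma unit_c1_iff:
 assumes "n \<ge> 1" "c2 w \<in> pw n" "w \<in> pw 0" shows "w \<in> pw 1 \<longleftrightarrow> c1 w \<in> pw 1"
proof -
 have \<beta>0: "\<beta> \<in> pw 0" using pw_coords[of \<beta> 0] by (simp add: pw_def)
 have en: "1 \<le> e * n" using e_pos assms(1) mult_mono[of 1 e 1 n] by simp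
 have "J (c2 w) * \<beta> \<in> pw (e * n + 0)" using assms(2) \<beta>0 by (intro pw_mult) (simp_all add: pw_emb)
 hence "J (c2 w) * \<beta> \<in> pw 1" using pw_mono[OF en] by simp
 hence "w \<in> pw 1 \<longleftrightarrow> J (c1 w) \<in> pw 1" using pw_add_cancel[of "J (c2 w) * \<beta>" 1 "J (c1 w)"] decompose[of w] by simp
 also have "\<dots> \<longleftrightarrow> c1 w \<in> pw 1" proof (cases "c1 w = 0")
  case False
  have "1 \<le> e * k \<longleftrightarrow> 1 \<le> k" for k unfolding int_one_le_iff_zero_less using e_pos by (simp add: zero_less_mult_iff)
  thus ?thesis using False by (simp add: pw_def val_emb)
 qed simp
 finally show ?thesis .
qed

text \<open>Everything rests on \<open>c2 (a * w) = c1 a * c2 w + c2 a * c2 (\<beta> * w)\<close>: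
  for positive n the second term is small and \<open>c1 a\<close> is a unit.\<close>

lemma RR_mult_iff:
 assumes a: "a \<in> RR n" shows "a * w \<in> RR n \<longleftrightarrow> w \<in> RR n"
proof -
 have au: "a ~= 0" "val a = 0" "c2 a \<in> pw (int n)" using a RR_units by (auto simp: int_units_val RR_def)
 have u: "a * w \<in> pw k \<longleftrightarrow> w \<in> pw k" for k using au by (simp add: pw_mult_iff)
 have "c2 (a * w) \<in> pw (int n) \<longleftrightarrow> c2 w \<in> pw (int n)" if w: "w \<in> pw 0" proof (cases n)
  case 0
  thus ?thesis using pw_coords[of "a * w" 0] pw_coords[of w 0] u[of 0] w by simp
 next
  case (Suc m)
  have \<beta>0: "\<beta> \<in> pw 0" using pw_coords[of \<beta> 0] by (simp add: pw_def)
  have "c2 (\<beta> * w) \<in> pw 0" using pw_mult[OF \<beta>0 w] pw_coords[of "\<beta> * w" 0] by simp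
  hence small: "c2 a * c2 (\<beta> * w) \<in> pw (int n)" using pw_mult[OF au(3)] by fastforce
  have a1: "a \<in> pw 0" "a \<notin> pw 1" using au by (auto simp: pw_def)
  hence "c1 a \<notin> pw 1" "c1 a \<in> pw 0" using unit_c1_iff[of "int n" a] au(3) Suc pw_coords[of a 0] by auto
  hence c1u: "c1 a ~= 0" "val (c1 a) = 0" by (auto simp: pw_def)
  have "a * w = J (c1 a) * w + J (c2 a) * (\<beta> * w)" using decompose[of a] by (metis distrib_right mult.assoc)
  hence "c2 (a * w) = c1 a * c2 w + c2 a * c2 (\<beta> * w)" by (simp only: c_add c_smult)
  thus ?thesis using pw_add_cancel[OF small, of "c1 a * c2 w"] c1u by (simp add: pw_mult_iff)
 qed
 thus ?thesis using u by (auto simp: RR_def)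
qed

definition JJ :: "complex => 'e set => complex" where "JJ s T = (LINT w|M. gg s w * ind T w)"

lemma V_off_range:
 assumes T: "ind T \<in> TF0" and tr: triv and c: "!!w. w \<in> T ==> c2 w ~= 0 & val (c2 w) = n"
 shows "of_real kap * V s t T = lam (zz s t) * qexp TYPE('f) (zz s t) powi n * JJ s T"
proof -
 have "w \<notin> T" if "w \<in> range J" for w using c[of w] c2_eq_0_iff that by blast
 hence "(%w. gg s w * ind T w) \<in> test_fun (- range J)"
  using test_fun_gg'[OF T, of s] by (subst test_fun_iff) (simp add: ind_def)
 hence "of_real kap * V s t T = lam (zz s t) * I (zz s t) (%w. gg s w * ind T w)" unfolding V_def by (rule vhat_off)
 also have "I (zz s t) (%w. gg s w * ind T w) = (LINT w|M. qexp TYPE('f) (zz s t) powi n * (gg s w * ind T w))"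
  unfolding I_def by (intro Bochner_Integration.integral_cong refl) (use c sigma_triv[OF tr] in \<open>auto simp: ind_def\<close>)
 finally show ?thesis by (simp add: JJ_def)
qed

text \<open>Between consecutive groups \<open>c2\<close> has valuation exactly n, so the generator
  is there an ordinary integral with \<open>\<sigma>\<close> constant.\<close>

lemma V_RR_step:
 assumes tr: triv shows "of_real kap * (V s t (RR n) - V s t (RR (Suc n))) =
  lam (zz s t) * qexp TYPE('f) (zz s t) ^ n * (JJ s (RR n) - JJ s (RR (Suc n)))"
proof -
 have sub: "RR (Suc n) \<subseteq> RR n" using pw_mono[of "int n" "int (Suc n)"] by (auto simp: RR_def)
 have t: "ind (RR n - RR (Suc n)) \<in> TF0" unfolding RR_def
  by (intro test_fun_ind[of _ 0] uniform_set_Int uniform_set_Diff uniform_set_pw uniform_set_c2) auto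
 have "c2 w ~= 0 & val (c2 w) = int n" if "w \<in> RR n - RR (Suc n)" for w using that by (auto simp: RR_def pw_def)
 from V_off_range[OF t tr this, of s t]
 have "of_real kap * V s t (RR n - RR (Suc n)) = lam (zz s t) * qexp TYPE('f) (zz s t) ^ n * JJ s (RR n - RR (Suc n))"
  by simp
 moreover have "JJ s (RR n - RR (Suc n)) = JJ s (RR n) - JJ s (RR (Suc n))" proof -
  have "(%w. gg s w * ind (RR n - RR (Suc n)) w) = (%w. gg s w * ind (RR n) w - gg s w * ind (RR (Suc n)) w)"
   using sub by (auto simp: ind_def fun_eq_iff)
  thus ?thesis unfolding JJ_def
   by (simp only:) (intro Bochner_Integration.integral_diff integrable_test_fun[OF haar test_fun_gg[OF test_fun_RR]])
 qed
 ultimately show ?thesis unfolding V_diff[OF test_fun_RR test_fun_RR sub] by simp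
qed

text \<open>With \<open>gg s\<close> equal to 1 the group is the unit part of a strip around F, and
  \<open>near_value\<close> counts unit classes of F modulo \<open>pw k\<close>, of which there are
  q^k - q^(k - 1).\<close>

lemma V_RR_trivial:
 assumes tr: triv and k: "k \<ge> 1" and g: "!!w. w \<in> RR k ==> gg s w = 1"
 shows "V s t (RR k) = of_real (qr TYPE('f) ^ k - qr TYPE('f) ^ (k - 1)) * rho (zz s t) ^ k"
proof -
 have ek: "1 \<le> e * int k" using e_pos k mult_mono[of 1 e 1 "int k"] by simp
 have per: "periodic (e * int k) (ind (pw 0 - pw 1 :: 'e set))" proof (rule periodic_mono[OF _ ek])
  show "periodic 1 (ind (pw 0 - pw 1 :: 'e set))" unfolding periodic_def proof (intro allI impI)
   fix x y :: 'e assume xy: "y - x \<in> pw 1"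
   have "y \<in> pw n \<longleftrightarrow> x \<in> pw n" if "n \<le> 1" for n using pw_add_cancel[OF pw_mono[OF that xy], of x] by simp
   thus "ind (pw 0 - pw 1) y = ind (pw 0 - pw 1) x" by (simp add: ind_def)
  qed
 qed
 have sup: "supported (e * 0) (ind (pw 0 - pw 1 :: 'e set))" by (simp add: supported_def ind_def)
 obtain R :: "'f set" where R: "residue_reps 0 (int k) R" using ex_residue_reps[of 0 "int k"] by auto
 have eq: "(%w. gg s w * ind (RR k) w) = (%w. near (int k) w * ind (pw 0 - pw 1) w)" proof
  fix w
  show "gg s w * ind (RR k) w = near (int k) w * ind (pw 0 - pw 1) w"
   using g[of w] by (auto simp: ind_def near_def RR_def)
 qed
 have "V s t (RR k) = (\<Sum>b\<in>R. ind (pw 0 - pw 1) (J b)) * vhat (zz s t) (box 0 (int k))"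
  unfolding V_def eq by (rule near_value[OF inV_vhat per sup R])
 also have "vhat (zz s t) (box 0 (int k)) = rho (zz s t) ^ k"
  using box_zero_triv[OF inV_vhat tr, of "zz s t" "int k"] vhat_star[of "zz s t"] tr by (simp add: star_def)
 also have "(\<Sum>b\<in>R. ind (pw 0 - pw 1) (J b)) = of_real (qr TYPE('f) ^ k - qr TYPE('f) ^ (k - 1))" proof -
  have fin: "finite R" "R \<subseteq> pw 0" "card R = residue_card TYPE('f) ^ k" using R by (simp_all add: residue_reps_def)
  have "ind (pw 0 - pw 1) (J b) = 1 - ind (pw 1) b" if "b \<in> R" for b proof -
   have b: "b \<in> pw 0" using that fin by blast
   hence "J b \<in> pw 0" using pw_emb[of b 0] by simp
   moreover from this have "J b \<in> pw 1 \<longleftrightarrow> b \<in> pw 1" using unit_c1_iff[of 1 "J b"] by simp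
   ultimately show ?thesis by (simp add: ind_def)
  qed
  hence "(\<Sum>b\<in>R. ind (pw 0 - pw 1) (J b)) = (\<Sum>b\<in>R. 1 - ind (pw 1) b)" by (intro sum.cong refl) auto
  also have "\<dots> = of_nat (card R) - (\<Sum>b\<in>R. ind (pw 1) b)" by (simp add: sum_subtractf)
  also have "(\<Sum>b\<in>R. ind (pw 1) b) = of_nat (card {b\<in>R. b \<in> pw 1})"
   using fin(1) by (simp add: ind_def sum.If_cases Int_def)
  also have "card {b\<in>R. b \<in> pw 1} = residue_card TYPE('f) ^ (k - 1)"
   using residue_reps_sub[OF R, of 1] k by (simp add: nat_diff_distrib)
  finally show ?thesis using fin(3) by simp
 qed
 finally show ?thesis .
qed

lemma JJ_trivial:
 assumes T: "T \<in> sets borel" "T \<subseteq> pw 0" and g: "!!w. w \<in> T ==> gg s w = c" shows "JJ s T = c * of_real (measure M T)"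
proof -
 have "(%w. gg s w * ind T w) = (%w. c * indicator T w)" using g by (auto simp: ind_def fun_eq_iff indicator_def)
 moreover have "emeasure M T \<le> emeasure M (pw 0)" using T haar by (intro emeasure_mono) (auto simp: normalized_haarD)
 hence "emeasure M T < \<infinity>" using normalized_haarD(4)[OF haar] by (simp add: order_le_less_trans)
 ultimately show ?thesis using integral_indicator_complex[of T] T(1) normalized_haarD(1)[OF haar] by (simp add: JJ_def)
qed

lemma borel_uniform_set: "uniform_set (T :: 'e set) ==> T \<in> sets borel"
proof -
 assume "uniform_set T"
 hence "open T" unfolding open_pw_iff uniform_set_def by blast
 thus ?thesis by simp
qed

lemma measure_pw: "measure M (pw n) = qr TYPE('e) powi (- n)"
 using emeasure_pw[OF haar, of n] by (simp add: measure_def)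

lemma measure_pw_Diff:
 assumes "m \<le> n" shows "measure M (pw m - pw n) = qr TYPE('e) powi (- m) - qr TYPE('e) powi (- n)"
 using measure_Diff[of M "pw m" "pw n"] emeasure_pw[OF haar, of m] pw_mono[OF assms] normalized_haarD(1)[OF haar]
 by (auto simp: measure_pw subset_iff)

lemma measure_RR:
 assumes n: "n \<ge> 1" shows "measure M (RR n) = (1 - inverse (qr TYPE('f))) * qr TYPE('f) powi (- int n)"
proof -
 let ?A = "{w. c1 w \<in> pw 0 & c2 w \<in> pw (int n)}" and ?B = "{w. c1 w \<in> pw 1 & c2 w \<in> pw (int n)}"
 have "RR n = ?A - ?B" proof -
  have "w \<in> RR n \<longleftrightarrow> w \<in> ?A - ?B" for w proof (cases "c2 w \<in> pw (int n)")
   case True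
   hence "c2 w \<in> pw 0" using pw_mono[of 0 "int n"] by simp
   hence "w \<in> pw 0 \<longleftrightarrow> c1 w \<in> pw 0" using pw_coords[of w 0] by simp
   thus ?thesis using True unit_c1_iff[of "int n" w] n by (auto simp: RR_def)
  qed (simp add: RR_def)
  thus ?thesis by blast
 qed
 moreover have "?B \<subseteq> ?A" using pw_mono[of 0 1] by auto
 moreover have "emeasure M ?A ~= \<infinity>" using emeasure_box(1)[OF haar, of 0 "int n"] by simp
 ultimately have "measure M (RR n) = measure M ?A - measure M ?B"
  using measure_Diff[of M ?A ?B] box_borel normalized_haarD(1)[OF haar] by simp
 also have "\<dots> = qr TYPE('f) powi (- int n) - qr TYPE('f) powi (- 1 - int n)"
  using measure_box_eq[of 0 "int n"] measure_box_eq[of 1 "int n"] n by simp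
 also have "qr TYPE('f) powi (- 1 - int n) = inverse (qr TYPE('f)) * qr TYPE('f) powi (- int n)"
  using qr_powi_add[of "- 1" "- int n", where 'a='f] by (simp add: power_int_minus)
 finally show ?thesis by (simp add: algebra_simps)
qed

lemma JJ_orthogonal:
 "ind T \<in> TF0 ==> a \<in> int_units ==> gg s a ~= 1 ==> (!!w. a * w \<in> T \<longleftrightarrow> w \<in> T) ==> JJ s T = 0"
 unfolding JJ_def by (rule gg_orthogonal)

lemma triv_gg_emb:
 assumes "critical s t" triv "x \<in> int_units" shows "gg s (J x) = 1"
proof -
 have "chi (J x) = eta x" "chi (J x) * eta x = 1"
  using assms unit_character_nonzero[OF eta assms(3)] by (auto simp: critical_def triv'_def triv_def sg_def field_simps)
 thus ?thesis by (simp add: theta_unit[OF emb_unit[OF assms(3)]] power2_eq_square)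
qed

text \<open>The elements of valuation one; they belong to \<open>shells\<close> only in the ramified
  case, and there \<open>c2\<close> is a unit on them.\<close>

definition E1 :: "'e set" where "E1 = pw 1 - pw 2"

lemma test_fun_E1: "ind E1 \<in> TF0" unfolding E1_def by (intro test_fun_ind[of _ 1] uniform_set_Diff uniform_set_pw) auto

lemma ramified_facts:
 assumes "\<not> unramified J" shows "e = 2" "!!w. w \<in> E1 ==> c2 w ~= 0 & val (c2 w) = 0" "qr TYPE('e) = qr TYPE('f)"
proof -
 show e2: "e = 2" using assms by (simp add: e_ram ram_def)
 show "qr TYPE('e) = qr TYPE('f)" using ramified_lattice(4)[OF assms] by simp
 fix w assume w: "w \<in> E1"
 hence "w \<in> pw 0" using pw_mono[of 0 1 w] by (auto simp: E1_def)
 hence c: "c1 w \<in> pw 0" "c2 w \<in> pw 0" using pw_coords[of w 0] by auto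
 have "\<beta> \<in> pw 1" using beta_ramified[OF assms] ramified_lattice(2)[OF assms] by (simp add: pw_def)
 moreover have "J (c2 w) \<in> pw 0" using c(2) pw_emb[of "c2 w" 0] by simp
 ultimately have "J (c2 w) * \<beta> \<in> pw (0 + 1)" by (intro pw_mult)
 hence "J (c1 w) \<in> pw 1"
  using w pw_add_cancel[of "J (c2 w) * \<beta>" 1 "J (c1 w)"] decompose[of w] by (simp add: E1_def)
 hence "c1 w \<in> pw 1" by (cases "c1 w = 0") (auto simp: pw_def val_emb e2)
 moreover have "w \<notin> pw (e * 1)" using w by (simp add: E1_def e2)
 ultimately have "c2 w \<notin> pw 1" unfolding pw_coords by simp
 thus "c2 w ~= 0 & val (c2 w) = 0" using c(2) by (auto simp: pw_def)
qed

lemma V_shells: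
 "V s t shells = V s t (RR 0) + (if unramified J then 0 else V s t E1)"
proof (cases "unramified J")
 case True
 hence "e = 1" by (simp add: e_ram ram_def)
 hence "shells = RR 0" unfolding shells_def RR_0 units_pw by simp
 thus ?thesis using True by simp
next
 case False
 have "shells = pw 0 - pw 2" unfolding shells_def using ramified_facts(1)[OF False] by simp
 hence "shells - E1 = RR 0" "E1 \<subseteq> shells" using pw_mono[of 0 1] pw_mono[of 1 2] by (auto simp: RR_0 units_pw E1_def)
 thus ?thesis using V_diff[OF test_fun_shells test_fun_E1, of s t] False by simp
qed

lemma critical_zz:
 assumes "critical s t" shows "qexp TYPE('f) (zz s t) = qexp TYPE('f) (2 * s) ^ 2"
proof -
 have 1: "qexp TYPE('f) (zz s t) * qexp TYPE('f) (2 * s - t + 1/2) = qexp TYPE('f) (2 * s + 2 * s)"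
  by (simp add: zz_def flip: qexp_add)
 have 2: "qexp TYPE('f) (2 * s + 2 * s) = qexp TYPE('f) (2 * s) ^ 2" by (simp only: qexp_add power2_eq_square)
 show ?thesis using 1 2 assms[unfolded critical_def, THEN conjunct2] by (simp only: mult_1_right)
qed

definition chi2_trivial :: bool where "chi2_trivial \<longleftrightarrow> (\<forall>x\<in>int_units. chi x ^ 2 = 1)"

lemma qexp_nat: "qexp TYPE('f) (of_nat n) = of_real (inverse (qr TYPE('f) ^ n))"
 using qexp_of_int[of "int n", where 'a='f] by (simp add: power_int_minus)

lemma lam_rho_triv:
 assumes triv
 shows "lam z = 1 - qexp TYPE('f) z / of_real (qr TYPE('f))" "rho z = qexp TYPE('f) z / of_real (qr TYPE('f)) ^ 2"
  "kap = 1 - inverse (qr TYPE('f))" using qexp_nat[of 1] qexp_nat[of 2] assms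
 by (simp_all add: lam_def rho_def kap_def qexp_add divide_inverse)

text \<open>\<open>gg s\<close> is trivial on units of F and near 1, hence on some
  \<open>RR k\<close>; the least such k is positive as \<chi>^2 is nontrivial. For n < k
  orthogonality on the group \<open>RR n\<close> kills the integrals, so \<open>V\<close> agrees on
  \<open>RR 0\<close> and \<open>RR (k - 1)\<close>. The last step, computed by
  \<open>V_RR_trivial\<close>, leaves a nonzero multiple of X - 1.\<close>

lemma SS_zero_nontrivial:
 assumes crit: "critical s t" and tr: triv and nt: "\<not> chi2_trivial"
 shows "SS s t = 0 \<longleftrightarrow> qexp TYPE('f) (zz s t) = 1"
proof -
 define X where "X = qexp TYPE('f) (zz s t)"
 define q where "q = complex_of_real (qr TYPE('f))"
 have q: "q ~= 0" "q ~= 1" using qr_gt_1[where 'a='f] by (auto simp: q_def)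
 obtain u where u: "u \<in> int_units" "gg s u ~= 1" using nt theta_unit by (auto simp: chi2_trivial_def)
 define P where "P k \<longleftrightarrow> (\<forall>w\<in>RR k. gg s w = 1)" for k
 have "\<exists>k. P k" proof -
  obtain n0 where n0: "n0 \<ge> 1" "!!s h. h \<in> pw n0 ==> gg s (1 + h) = 1" using gg_near by metis
  have "gg s w = 1" if w: "w \<in> RR (nat n0)" for w proof -
   have \<beta>0: "\<beta> \<in> pw 0" using pw_coords[of \<beta> 0] by (simp add: pw_def)
   have w': "w \<in> pw 0" "w \<notin> pw 1" "c2 w \<in> pw n0" using w n0(1) by (auto simp: RR_def)
   hence "c1 w \<notin> pw 1" "c1 w \<in> pw 0" using unit_c1_iff[OF n0(1)] pw_coords[of w 0] by auto
   hence c: "c1 w ~= 0" "val (c1 w) = 0" "c1 w \<in> int_units" by (auto simp: pw_def int_units_val)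
   have "c1 w * (c2 w / c1 w) \<in> pw n0" using c w' by simp
   hence "c2 w / c1 w \<in> pw n0" using c by (subst (asm) pw_mult_iff) auto
   hence "J (c2 w / c1 w) * \<beta> \<in> pw (e * n0 + 0)" using \<beta>0 by (intro pw_mult) (simp_all add: pw_emb)
   moreover have "1 * n0 \<le> e * n0" using e_pos n0(1) by (intro mult_right_mono) auto
   ultimately have "gg s (1 + J (c2 w / c1 w) * \<beta>) = 1"
    using n0(2)[OF pw_mono[of n0 "e * n0" "J (c2 w / c1 w) * \<beta>"]] by simp
   moreover have "w = J (c1 w) * (1 + J (c2 w / c1 w) * \<beta>)"
    using decompose[of w] c(1) by (simp add: emb_divide distrib_left)
   ultimately show ?thesis
    using theta_mult[of s "J (c1 w)" "1 + J (c2 w / c1 w) * \<beta>"] triv_gg_emb[OF crit tr c(3)] by simp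
  qed
  thus ?thesis unfolding P_def by blast
 qed
 define k where "k = (LEAST k. P k)"
 have Pk: "P k" and least: "!!n. n < k ==> \<not> P n"
  using LeastI_ex[OF \<open>\<exists>k. P k\<close>] not_less_Least by (auto simp: k_def)
 have "\<not> P 0" using u RR_0 by (auto simp: P_def)
 then obtain m where k: "k = Suc m" using Pk by (cases k) auto
 have J0: "JJ s (RR n) = 0" if nk: "n < k" for n proof -
  obtain a where a: "a \<in> RR n" "gg s a ~= 1" using least[OF nk] by (auto simp: P_def)
  thus ?thesis using RR_units RR_mult_iff[OF a(1)] by (intro JJ_orthogonal[OF test_fun_RR _ a(2)]) auto
 qed
 have kap0: "complex_of_real kap ~= 0" using kap_nonzero by simp
 have Veq: "n \<le> m ==> V s t (RR n) = V s t (RR 0)" for n proof (induction n)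
  case (Suc n)
  thus ?case using V_RR_step[OF tr, of s t n] J0[of n] J0[of "Suc n"] k kap0 by simp
 qed simp
 have "V s t (RR 0) = V s t (RR m)" by (rule Veq[OF order_refl, symmetric])
 moreover have "of_real kap * (V s t (RR m) - V s t (RR k)) = lam (zz s t) * X ^ m * (0 - JJ s (RR k))"
  using V_RR_step[OF tr, of s t m] J0[of m] k by (simp add: X_def)
 moreover have "JJ s (RR k) = of_real kap * (1 / q ^ k)" proof -
  have b: "RR k \<in> sets borel" "RR k \<subseteq> pw 0"
   unfolding RR_def by (intro borel_uniform_set uniform_set_Int uniform_set_Diff uniform_set_pw uniform_set_c2) auto
  have "gg s w = 1" if "w \<in> RR k" for w using Pk that unfolding P_def by blast
  note J = JJ_trivial[OF b this]
  have "qr TYPE('f) powi (- int k) = inverse (qr TYPE('f) ^ k)" by (simp only: power_int_minus power_int_of_nat)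
  moreover have "k \<ge> 1" using k by simp
  ultimately show ?thesis using measure_RR[of k] J by (simp add: lam_rho_triv(3)[OF tr] q_def divide_inverse)
 qed
 moreover have "V s t (RR k) = (q ^ k - q ^ m) * (X / q ^ 2) ^ k" using V_RR_trivial[OF tr, of k s t] Pk k
  by (simp add: P_def lam_rho_triv(2)[OF tr] X_def q_def del: power_Suc)
 moreover have "lam (zz s t) = 1 - X / q" by (simp add: lam_rho_triv[OF tr] X_def q_def)
 ultimately have "of_real kap * (V s t (RR 0) - (q ^ k - q ^ m) * (X / q ^ 2) ^ k) = of_real kap * (- ((1 - X / q) * X ^ m * (1 / q ^ k)))"
  by simp
 hence "V s t (RR 0) - (q ^ k - q ^ m) * (X / q ^ 2) ^ k = - ((1 - X / q) * X ^ m * (1 / q ^ k))"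
  using kap0 by (subst (asm) mult_cancel_left) blast
 hence "V s t (RR 0) = (q ^ k - q ^ m) * (X / q ^ 2) ^ k - (1 - X / q) * X ^ m * (1 / q ^ k)"
  by (simp only: diff_eq_eq) simp
 also have "\<dots> = X ^ m / q ^ k * (X - 1)" proof -
  have 1: "(X / q ^ 2) ^ k = X * X ^ m / (q ^ k * q ^ k)"
   by (simp add: k power_divide power_mult_distrib power2_eq_square)
  have 2: "q ^ k - q ^ m = q ^ k * (1 - 1 / q)" using q by (simp add: k field_simps)
  have "Q * (1 - 1 / q) * (X * A / (Q * Q)) - (1 - X / q) * A * (1 / Q) = A / Q * (X - 1)" if "Q ~= 0" for A Q
   using that q by (simp add: field_simps)
  thus ?thesis unfolding 1 2 using q by simp
 qed
 finally have V0: "V s t (RR 0) = X ^ m / q ^ k * (X - 1)" .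
 have "V s t E1 = 0" if r: "\<not> unramified J" proof -
  have "JJ s E1 = 0" using u(1) by (intro JJ_orthogonal[OF test_fun_E1 u]) (simp add: E1_def pw_mult_iff int_units_val)
  thus ?thesis using V_off_range[OF test_fun_E1 tr ramified_facts(2)[OF r], of s t] kap0 by simp
 qed
 hence "SS s t = X ^ m / q ^ k * (X - 1)" using V_shells[of s t] V0 by (simp add: SS_shells)
 thus ?thesis using q by (simp add: X_def)
qed

text \<open>As \<open>gg s\<close> is 1 on units, one step of the filtration suffices. The result is
  1 - X/q^2 in the unramified case. In the ramified case valuation one adds a term, criticality
  gives X = Y^2 with Y = q^(-2s), and the sum factors as (1 + Y)(1 - Y/q)/Y.\<close>

lemma SS_zero_trivial:
 assumes crit: "critical s t" and tr: triv and c2: chi2_trivial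
 shows "SS s t = 0 \<longleftrightarrow> (if unramified J then qexp TYPE('f) (zz s t + 2) = 1
  else qexp TYPE('f) (2 * s) = - 1 \<or> qexp TYPE('f) (2 * s + 1) = 1)"
proof -
 define X where "X = qexp TYPE('f) (zz s t)"
 define Y where "Y = qexp TYPE('f) (2 * s)"
 define q where "q = complex_of_real (qr TYPE('f))"
 have q: "q ~= 0" "q ~= 1" using qr_gt_1[where 'a='f] by (auto simp: q_def)
 have Y0: "Y ~= 0" by (simp add: Y_def)
 have g: "gg s w = 1" if "w \<in> int_units" for w using c2 that by (simp add: theta_unit chi2_trivial_def)
 have b: "RR n \<in> sets borel" "RR n \<subseteq> pw 0" for n
  unfolding RR_def by (intro borel_uniform_set uniform_set_Int uniform_set_Diff uniform_set_pw uniform_set_c2) auto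
 have JJn: "JJ s (RR n) = of_real (measure M (RR n))" for n using JJ_trivial[OF b, of n s 1] g RR_units by auto
 have J0: "JJ s (RR 0) = 1 - 1 / of_real (qr TYPE('e))"
  using measure_pw_Diff[of 0 1] JJn[of 0] by (simp add: RR_0 units_pw power_int_minus divide_inverse)
 have kq: "complex_of_real kap = 1 - 1 / q" by (simp add: lam_rho_triv(3)[OF tr] q_def divide_inverse)
 have k0: "1 - 1 / q ~= 0" using q by simp
 have J1: "JJ s (RR 1) = (1 - 1 / q) / q" using measure_RR[of 1] by (simp add: JJn q_def power_int_minus divide_inverse)
 have V1: "V s t (RR 1) = (q - 1) * (X / q ^ 2)"
  using V_RR_trivial[OF tr, of 1 s t] g RR_units by (auto simp: lam_rho_triv(2)[OF tr] X_def q_def)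
 have l: "lam (zz s t) = 1 - X / q" by (simp add: lam_rho_triv[OF tr] X_def q_def)
 have st: "(1 - 1 / q) * (V s t (RR 0) - V s t (RR 1)) = (1 - X / q) * (JJ s (RR 0) - JJ s (RR 1))"
  using V_RR_step[OF tr, of s t 0] by (simp add: l kq)
 show ?thesis proof (cases "unramified J")
  case True
  have "qr TYPE('e) = qr TYPE('f) ^ 2" using True by (simp add: unramified_def)
  hence "JJ s (RR 0) = 1 - 1 / q ^ 2" using J0 by (simp add: q_def)
  hence "JJ s (RR 0) - JJ s (RR 1) = 1 - 1 / q" unfolding J1 using q by (simp add: field_simps power2_eq_square)
  hence "(1 - 1 / q) * (V s t (RR 0) - (q - 1) * (X / q ^ 2)) = (1 - 1 / q) * (1 - X / q)"
   using st unfolding V1 by (simp only: mult.commute)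
  hence "V s t (RR 0) - (q - 1) * (X / q ^ 2) = 1 - X / q" using k0 by (subst (asm) mult_cancel_left) blast
  hence "V s t (RR 0) = 1 - X / q + (q - 1) * (X / q ^ 2)" by (simp only: diff_eq_eq)
  also have "\<dots> = 1 - X / q ^ 2" using q by (simp add: field_simps power2_eq_square)
  finally have "SS s t = 1 - X / q ^ 2" using V_shells[of s t] True by (simp add: SS_shells)
  moreover have "qexp TYPE('f) (zz s t + 2) = X / q ^ 2"
   using qexp_nat[of 2] by (simp add: qexp_add X_def q_def divide_inverse)
  ultimately show ?thesis using True by auto
 next
  case False
  note ram = ramified_facts[OF False]
  have J0': "JJ s (RR 0) = 1 - 1 / q" using J0 ram(3) by (simp add: q_def)
  have gE: "gg s w = q / Y" if "w \<in> E1" for w proof -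
   have w: "w ~= 0" "val w = 1" using that by (auto simp: E1_def pw_def)
   have "theta s w = chi (ang pE w) ^ 2 * qexp TYPE('e) (s + 1/2) powi e"
    using w by (simp add: theta_def quasi_char_eq power_mult_distrib ram(1))
   also have "chi (ang pE w) ^ 2 = 1" using c2 ang_unit[OF uniformizer_E w(1)] by (simp add: chi2_trivial_def)
   also have "qexp TYPE('e) (s + 1/2) powi e = qexp TYPE('f) (2 * s + 1)" unfolding qexp_ext by (simp add: distrib_left)
   also have "\<dots> = Y / q" using qexp_nat[of 1] by (simp add: qexp_add Y_def q_def divide_inverse)
   finally show ?thesis by simp
  qed
  have bE: "E1 \<in> sets borel" "E1 \<subseteq> pw 0"
   using pw_mono[of 0 1] unfolding E1_def by (auto intro!: borel_uniform_set uniform_set_Diff uniform_set_pw)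
  have "JJ s E1 = q / Y * (1 / q - 1 / q ^ 2)" using JJ_trivial[OF bE gE] measure_pw_Diff[of 1 2] ram(3)
   by (simp add: E1_def q_def power_int_minus divide_inverse)
  hence "(1 - 1 / q) * V s t E1 = (1 - X / q) * (q / Y * (1 / q - 1 / q ^ 2))"
   using V_off_range[OF test_fun_E1 tr ram(2), of s t] by (simp add: l kq)
  also have "\<dots> = (1 - 1 / q) * ((1 - X / q) / Y)" using q Y0 by (simp add: field_simps power2_eq_square)
  finally have VE: "V s t E1 = (1 - X / q) / Y" using k0 by (subst (asm) mult_cancel_left) blast
  have "(1 - 1 / q) * (V s t (RR 0) - (q - 1) * (X / q ^ 2)) = (1 - 1 / q) * ((1 - X / q) * (1 - 1 / q))" proof -
   have "1 - 1 / q - (1 - 1 / q) / q = (1 - 1 / q) * (1 - 1 / q)" using q by (simp add: field_simps)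
   thus ?thesis using st unfolding V1 J1 J0' by (simp only: mult_ac)
  qed
  hence "V s t (RR 0) - (q - 1) * (X / q ^ 2) = (1 - X / q) * (1 - 1 / q)"
   using k0 by (subst (asm) mult_cancel_left) blast
  hence "SS s t = (1 - X / q) / Y + ((1 - X / q) * (1 - 1 / q) + (q - 1) * (X / q ^ 2))"
   using V_shells[of s t] False VE by (simp add: SS_shells algebra_simps)
  moreover have "X = Y ^ 2" using critical_zz[OF crit] by (simp add: X_def Y_def)
  ultimately have "SS s t = (1 - Y ^ 2 / q) / Y + ((1 - Y ^ 2 / q) * (1 - 1 / q) + (q - 1) * (Y ^ 2 / q ^ 2))" by simp
  also have "\<dots> = (1 + Y) * (1 - Y / q) / Y" using q Y0 by (simp add: field_simps power2_eq_square)
  finally have "SS s t = (1 + Y) * (1 - Y / q) / Y" .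
  hence "SS s t = 0 \<longleftrightarrow> Y = - 1 \<or> Y / q = 1" using Y0 by (auto simp: add_eq_0_iff)
  moreover have "qexp TYPE('f) (2 * s + 1) = Y / q"
   using qexp_nat[of 1] by (simp add: qexp_add Y_def q_def divide_inverse)
  ultimately show ?thesis using False by (simp add: Y_def)
 qed
qed

text \<open>For nontrivial \<open>sg\<close> neither side can hold, by \<open>SS_nonzero\<close>.
  Otherwise each case is a system of equations for q-powers, whose solutions modulo the periods
  \<omega> and \<open>\<omega>E\<close> are listed by the lattice lemmas.\<close>

lemma exceptional_iff: "exceptional J chi s eta t \<longleftrightarrow> critical s t & SS s t = 0"
proof (cases "triv & triv'")
 case False
 have "\<not> exceptional J chi s eta t" using False by (auto simp: exceptional_def triv_def triv'_def sg_def)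
 moreover have "\<not> (critical s t & SS s t = 0)" using False SS_nonzero[of s t] by (auto simp: critical_def)
 ultimately show ?thesis by blast
next
 case True
 define \<omega> where "\<omega> = complex_of_real (2 * pi / ln (qr TYPE('f))) * \<i>"
 define \<omega>E where "\<omega>E = complex_of_real (2 * pi / ln (qr TYPE('e))) * \<i>"
 have PE: "complex_of_real (pi / ln (qr TYPE('e))) * \<i> = \<omega>E / 2" "complex_of_real (pi / ln (qr TYPE('f))) * \<i> = \<omega> / 2"
  by (simp_all add: \<omega>E_def \<omega>_def)
 have \<omega>E: "\<omega>E = (if unramified J then \<omega> / 2 else \<omega>)" proof (cases "unramified J")
  case True
  hence "qr TYPE('e) = qr TYPE('f) ^ 2" by (simp add: unramified_def)
  hence "ln (qr TYPE('e)) = 2 * ln (qr TYPE('f))" using qr_pos[where 'a='f] by (simp add: ln_realpow)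
  thus ?thesis using True by (simp add: \<omega>E_def \<omega>_def)
 qed (simp add: \<omega>E_def \<omega>_def ramified_facts(3))
 have one: "qexp TYPE('f) x = 1 \<longleftrightarrow> (\<exists>n::int. x = of_int n * \<omega>)" for x unfolding \<omega>_def by (rule qexp_eq_1_iff)
 have crit: "critical s t \<longleftrightarrow> (\<exists>a::int. 2 * s - t + 1/2 = of_int a * \<omega>)" using True one by (simp add: critical_def)
 have tr: triv using True by simp
 have exc: "exceptional J chi s eta t \<longleftrightarrow>
   (\<exists>(s\<^sub>0, t\<^sub>0) \<in> exceptional_points (unramified J) chi2_trivial (qr TYPE('e)) (qr TYPE('f)).
    \<exists>m n :: int. s = s\<^sub>0 + of_int m * \<omega>E & t = t\<^sub>0 + of_int n * \<omega>)"
  using True by (simp add: exceptional_def triv_def triv'_def sg_def chi2_trivial_def \<omega>_def \<omega>E_def Let_def)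
 note pts = exceptional_points_def[of "unramified J" chi2_trivial "qr TYPE('e)" "qr TYPE('f)", unfolded Let_def PE]
 consider "unramified J" "\<not> chi2_trivial" | "\<not> unramified J" "\<not> chi2_trivial"
  | "unramified J" "chi2_trivial" | "\<not> unramified J" "chi2_trivial" by blast
 thus ?thesis proof cases
  case 1
  have "critical s t & SS s t = 0 \<longleftrightarrow> critical s t & qexp TYPE('f) (zz s t) = 1"
   using SS_zero_nontrivial[OF _ tr 1(2)] by blast
  also have "\<dots> \<longleftrightarrow> (\<exists>a b::int. 2 * s - (t - 1/2) = of_int a * \<omega> & 2 * s + (t - 1/2) = of_int b * \<omega>)"
   unfolding crit one by (auto simp: zz_def algebra_simps)
  also have "\<dots> \<longleftrightarrow> exceptional J chi s eta t"
   unfolding half_lattice_iff exc pts using 1 by (simp add: \<omega>E algebra_simps)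
  finally show ?thesis by blast
 next
  case 2
  have "critical s t & SS s t = 0 \<longleftrightarrow> critical s t & qexp TYPE('f) (zz s t) = 1"
   using SS_zero_nontrivial[OF _ tr 2(2)] by blast
  also have "\<dots> \<longleftrightarrow> (\<exists>a b::int. 2 * s - (t - 1/2) = of_int a * \<omega> & 2 * s + (t - 1/2) = of_int b * \<omega>)"
   unfolding crit one by (auto simp: zz_def algebra_simps)
  also have "\<dots> \<longleftrightarrow> exceptional J chi s eta t"
   unfolding quarter_lattice_iff exc pts using 2 by (simp add: \<omega>E algebra_simps)
  finally show ?thesis by blast
 next
  case 3
  have "critical s t & SS s t = 0 \<longleftrightarrow> critical s t & qexp TYPE('f) (zz s t + 2) = 1"
   using SS_zero_trivial[OF _ tr 3(2)] 3(1) by auto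
  also have "\<dots> \<longleftrightarrow> (\<exists>a b::int. 2 * (s + 1/2) - (t + 1/2) = of_int a * \<omega> & 2 * (s + 1/2) + (t + 1/2) = of_int b * \<omega>)"
   unfolding crit one by (auto simp: zz_def algebra_simps)
  also have "\<dots> \<longleftrightarrow> exceptional J chi s eta t"
   unfolding half_lattice_iff exc pts using 3 by (simp add: \<omega>E algebra_simps eq_diff_eq)
  finally show ?thesis by blast
 next
  case 4
  \<comment> \<open>The value -1 is attained at half a period, which makes this alternative a
    lattice condition as well.\<close>
  have half: "qexp TYPE('f) (2 * s) = - 1 \<longleftrightarrow> (\<exists>c::int. 2 * s - \<omega> / 2 = of_int c * \<omega>)" proof -
   have "qexp TYPE('f) (\<omega> / 2) = - 1" unfolding \<omega>_def by (rule qexp_half_period)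
   hence "qexp TYPE('f) (2 * s - \<omega> / 2) = - qexp TYPE('f) (2 * s)" by (simp add: qexp_diff)
   thus ?thesis unfolding one[symmetric] by (auto simp: minus_equation_iff)
  qed
  have "critical s t & SS s t = 0 \<longleftrightarrow>
    critical s t & (qexp TYPE('f) (2 * s) = - 1 \<or> qexp TYPE('f) (2 * s + 1) = 1)"
   using SS_zero_trivial[OF _ tr 4(2)] 4(1) by auto
  also have "\<dots> \<longleftrightarrow> (\<exists>a c::int. 2 * s - t + 1/2 = of_int a * \<omega> & 2 * s - \<omega> / 2 = of_int c * \<omega>) \<or>
    (\<exists>a c::int. 2 * s - t + 1/2 = of_int a * \<omega> & 2 * s + 1 = of_int c * \<omega>)" unfolding crit half one by blast
  also have "\<dots> \<longleftrightarrow>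
    (\<exists>a c::int. 2 * (s - \<omega> / 4) - (t - 1/2 - \<omega> / 2) = of_int a * \<omega> & 2 * (s - \<omega> / 4) = of_int c * \<omega>) \<or>
    (\<exists>a c::int. 2 * (s + 1/2) - (t + 1/2) = of_int a * \<omega> & 2 * (s + 1/2) = of_int c * \<omega>)" proof -
   have "2 * (s - \<omega> / 4) = 2 * s - \<omega> / 2" "2 * s - \<omega> / 2 - (t - 1/2 - \<omega> / 2) = 2 * s - t + 1/2"
    "2 * (s + 1/2) = 2 * s + 1" "2 * s + 1 - (t + 1/2) = 2 * s - t + 1/2" by (simp_all add: field_simps)
   thus ?thesis by (simp only:)
  qed
  also have "\<dots> \<longleftrightarrow> exceptional J chi s eta t" proof -
   have "s - \<omega> / 4 = \<omega> / 2 + of_int m * \<omega> \<longleftrightarrow> s = 3 * \<omega> / 4 + of_int m * \<omega>" for m proof -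
    have "\<omega> / 2 + of_int m * \<omega> + \<omega> / 4 = 3 * \<omega> / 4 + of_int m * \<omega>" by (simp add: field_simps)
    thus ?thesis by (simp only: diff_eq_eq)
   qed
   thus ?thesis unfolding double_lattice_iff exc pts using 4 by (auto simp: \<omega>E algebra_simps)
  qed
  finally show ?thesis by blast
 qed
qed

text \<open>At exceptional parameters \<open>SS (s + z) t\<close> and the denominator both vanish at \<open>z = 0\<close>.\<close>

lemma kernel_tilde2_UU:
 assumes exc: "exceptional J chi s eta t"
 obtains A where "kernel_tilde2 M J d \<alpha> pF pE chi s eta t = UU s t A (kk s t)"
proof -
 have crit: "critical s t" and S0: "SS s t = 0" and tr': triv' using exc exceptional_iff by (auto simp: critical_def)
 define D where "D z = 1 - qexp TYPE('f) (2 * z)" for z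
 have lamD: "lam' (s + z) t = D z" for z proof -
  have 1: "2 * (s + z) - t + 1/2 = (2 * s - t + 1/2) + 2 * z" by (simp add: algebra_simps)
  have "qexp TYPE('f) (2 * (s + z) - t + 1/2) = qexp TYPE('f) (2 * s - t + 1/2) * qexp TYPE('f) (2 * z)"
   unfolding 1 by (rule qexp_add)
  thus ?thesis using crit tr' by (simp only: lam'_def critical_def D_def if_True mult_1_left)
 qed
 have holD: "D holomorphic_on UNIV" unfolding D_def by (intro holomorphic_intros)
 \<comment> \<open>The derivative of \<open>D\<close> at 0. It is nonzero, so \<open>D\<close> has a
   simple zero there and the quotient of \<open>SS\<close> by \<open>D\<close> has a limit.\<close>
 define l where "l = complex_of_real (2 * ln (qr TYPE('f)))"
 have l: "l ~= 0" using ln_qr_pos[where 'a='f] by (simp add: l_def)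
 have dD: "(D has_field_derivative l) (at 0)" unfolding D_def qexp_def l_def by (auto intro!: derivative_eq_intros)
 have "(%z. SS (fst (s + z * 1, t + z * 0)) (snd (s + z * 1, t + z * 0))) holomorphic_on UNIV"
  by (rule holomorphic_C2_line[OF holomorphic_C2_SS])
 hence "(%z. SS (s + z) t) holomorphic_on UNIV" by simp
 hence "(%z. SS (s + z) t) field_differentiable at 0" by (simp add: holomorphic_on_def)
 then obtain S' where dS: "((%z. SS (s + z) t) has_field_derivative S') (at 0)" by (auto simp: field_differentiable_def)
 have limS: "((%z. SS (s + z) t / D z) \<longlongrightarrow> S' / l) (at 0)" proof -
  have "((%z. (SS (s + z) t / z) / (D z / z)) \<longlongrightarrow> S' / l) (at 0)"
   using dS dD l S0 by (intro tendsto_divide) (simp_all add: has_field_derivative_iff D_def)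
  thus ?thesis by (rule Lim_transform_eventually) (auto simp: eventually_at_filter)
 qed
 have nzD: "\<forall>\<^sub>F z in at 0. D z ~= 0" proof -
  have "((%z. D z / z) \<longlongrightarrow> l) (at 0)" using dD by (simp add: has_field_derivative_iff D_def)
  hence "\<forall>\<^sub>F z in at 0. D z / z ~= 0" using l by (rule tendsto_imp_eventually_ne)
  thus ?thesis by (rule eventually_mono) auto
 qed
 have cont: "((%z. h (s + z, t)) \<longlongrightarrow> h (s, t)) (at 0)" if "holomorphic_C2 h" for h proof -
  have "(%z. h (s + z * 1, t + z * 0)) holomorphic_on UNIV" by (rule holomorphic_C2_line[OF that])
  hence "isCont (%z. h (s + z, t)) 0"
   using holomorphic_on_imp_continuous_on continuous_on_eq_continuous_at[OF open_UNIV] by fastforce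
  thus ?thesis by (simp add: isCont_def)
 qed
 define A where "A = kk s t * (S' / l)"
 have "kernel_tilde2 M J d \<alpha> pF pE chi s eta t \<phi> = UU s t A (kk s t) \<phi>" for \<phi> proof -
  let ?F = "%z. inverse (1 - of_nat (residue_card TYPE('f)) powr (- 2 * z)) * Kt (s + z) t \<phi>"
  have "(?F \<longlongrightarrow> UU s t A (kk s t) \<phi>) (at 0)" proof (cases "\<phi> \<in> TF")
   case False
   hence "?F = (%z. 0)" "UU s t A (kk s t) \<phi> = 0" by (simp_all add: kernel_tilde_def UU_def)
   thus ?thesis by simp
  next
   case True
   have W: "((%z. W (s + z) t (minus_om \<phi>)) \<longlongrightarrow> W s t (minus_om \<phi>)) (at 0)"
    using cont[OF holomorphic_C2_W[OF test_fun_minus_om[OF True]]] by simp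
   have K: "((%z. kk (s + z) t) \<longlongrightarrow> kk s t) (at 0)" using cont[OF holomorphic_C2_kk] by simp
   have lim: "((%z. kk (s + z) t * (SS (s + z) t / D z) * \<phi> 0 + kk (s + z) t * W (s + z) t (minus_om \<phi>)) \<longlongrightarrow>
     kk s t * (S' / l) * \<phi> 0 + kk s t * W s t (minus_om \<phi>)) (at 0)" by (intro tendsto_intros K limS W)
   have "\<forall>\<^sub>F z in at 0. kk (s + z) t * (SS (s + z) t / D z) * \<phi> 0 + kk (s + z) t * W (s + z) t (minus_om \<phi>) = ?F z"
    using nzD proof (rule eventually_mono)
    fix z assume z: "D z ~= 0"
    have "1 - of_nat (residue_card TYPE('f)) powr (- 2 * z) = D z"
     using qexp_powr[of "2 * z", where 'a='f] by (simp add: D_def)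
    hence "?F z = inverse (D z) * (kk (s + z) t * SS (s + z) t * \<phi> 0 + kk (s + z) t * D z * W (s + z) t (minus_om \<phi>))"
     using True tr' by (simp add: kernel_tilde_UU UU_eq SS0_def lamD)
    thus "kk (s + z) t * (SS (s + z) t / D z) * \<phi> 0 + kk (s + z) t * W (s + z) t (minus_om \<phi>) = ?F z"
     using z by (simp add: field_simps)
   qed
   from Lim_transform_eventually[OF lim this] show ?thesis using True by (simp add: UU_eq A_def)
  qed
  thus ?thesis unfolding kernel_tilde2_def by (intro tendsto_Lim) auto
 qed
 thus thesis by (intro that) blast
qed

lemma dirac_UU: "dirac = UU s t 1 0" by (simp add: fun_eq_iff dirac_def UU_def)

lemma UU_combination: "a * UU s t A C \<phi> + b * UU s t A' C' \<phi> = UU s t (a * A + b * A') (a * C + b * C') \<phi>"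
 by (simp add: UU_def algebra_simps)

lemma UU_cmult: "c * UU s t A C \<phi> = UU s t (c * A) (c * C) \<phi>" by (simp add: UU_def algebra_simps)

text \<open>Outside the exceptional set (\<open>SS0\<close>, \<open>lam'\<close>) is a nonzero
  solution of \<open>rel\<close>, and the solutions form a line.\<close>

theorem D_generic:
 assumes "\<not> exceptional J chi s eta t" shows "D s t = {%\<phi>. c * Kt s t \<phi> | c. True}"
proof -
 have K: "(%\<phi>. c * Kt s t \<phi>) = UU s t (c * (kk s t * SS0 s t)) (c * (kk s t * lam' s t))" for c
  by (simp add: fun_eq_iff kernel_tilde_UU UU_cmult)
 have k: "kk s t ~= 0" by (rule kk_nonzero)
 have nd: "triv' ==> lam' s t = 0 ==> SS s t ~= 0" using assms exceptional_iff by (auto simp: critical_def lam'_def)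
 have "rel s t A C \<longleftrightarrow> (\<exists>c. A = c * (kk s t * SS0 s t) & C = c * (kk s t * lam' s t))" for A C proof (cases triv')
  case False
  thus ?thesis using k by (auto simp: rel_def SS0_def lam'_def intro!: exI[of _ "C / kk s t"])
 next
  case True
  show ?thesis proof
   assume r: "rel s t A C"
   show "\<exists>c. A = c * (kk s t * SS0 s t) & C = c * (kk s t * lam' s t)" proof (cases "lam' s t = 0")
    case l: True
    hence "C = 0" using r True nd by (simp add: rel_def)
    thus ?thesis using l True nd k by (intro exI[of _ "A / (kk s t * SS s t)"]) (simp add: SS0_def)
   next
    case l: False
    hence "A = SS s t * C / lam' s t" using r True by (simp add: rel_def field_simps)
    thus ?thesis using l True k by (intro exI[of _ "C / (kk s t * lam' s t)"]) (simp add: SS0_def)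
   qed
  next
   assume "\<exists>c. A = c * (kk s t * SS0 s t) & C = c * (kk s t * lam' s t)"
   thus "rel s t A C" using True by (auto simp: rel_def SS0_def)
  qed
 qed
 thus ?thesis unfolding D_eq K by auto
qed

text \<open>Here \<open>rel\<close> holds for every pair. The pairs (1, 0) of \<delta> and (A,
  \<open>kk s t\<close>) of the limit form a basis because \<open>kk s t\<close> is nonzero.\<close>

theorem D_exceptional:
 assumes exc: "exceptional J chi s eta t"
 defines "K' \<equiv> kernel_tilde2 M J d \<alpha> pF pE chi s eta t"
 shows "D s t = {%\<phi>. a * dirac \<phi> + b * K' \<phi> | a b. True}"
  and "(%\<phi>. a * dirac \<phi> + b * K' \<phi>) = (%\<phi>. 0) ==> a = 0 & b = 0"
proof -
 obtain A where A: "K' = UU s t A (kk s t)" using kernel_tilde2_UU[OF exc] unfolding K'_def by blast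
 have k: "kk s t ~= 0" by (rule kk_nonzero)
 have comb: "(%\<phi>. a * dirac \<phi> + b * K' \<phi>) = UU s t (a + b * A) (b * kk s t)" for a b
  unfolding A dirac_UU[of s t] UU_combination by simp
 have r: "rel s t A' C'" for A' C' using exc exceptional_iff by (auto simp: rel_def critical_def lam'_def)
 have ex: "\<exists>a b. A' = a + b * A & C' = b * kk s t" for A' C'
  using k by (intro exI[of _ "A' - C' / kk s t * A"] exI[of _ "C' / kk s t"]) simp
 show "D s t = {%\<phi>. a * dirac \<phi> + b * K' \<phi> | a b. True}" unfolding D_eq comb proof (intro equalityI subsetI)
  fix u assume "u \<in> {UU s t A C | A C. rel s t A C}"
  then obtain A' C' where u: "u = UU s t A' C'" by blast
  obtain a b where "A' = a + b * A" "C' = b * kk s t" using ex[of A' C'] by blast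
  thus "u \<in> {UU s t (a + b * A) (b * kk s t) | a b. True}" using u by blast
 next
  fix u assume "u \<in> {UU s t (a + b * A) (b * kk s t) | a b. True}"
  thus "u \<in> {UU s t A C | A C. rel s t A C}" using r by blast
 qed
 assume "(%\<phi>. a * dirac \<phi> + b * K' \<phi>) = (%\<phi>. 0)"
 moreover have "(%\<phi>. 0) = UU s t 0 0" by (simp add: fun_eq_iff UU_def)
 ultimately have "a + b * A = 0 & b * kk s t = 0" unfolding comb by (simp add: UU_inject)
 thus "a = 0 & b = 0" using k by auto
qed

end

section \<open>Principal series in coordinates\<close>

abbreviation mk2 :: "'a::zero => 'a => 'a => 'a => 'a^2^2" where
 "mk2 a b c d \<equiv> vector [vector [a, b], vector [c, d]]"

lemma mat2_eq_iff: "A = B \<longleftrightarrow> A$1$1 = B$1$1 & A$1$2 = B$1$2 & A$2$1 = B$2$1 & A$2$2 = (B::'a^2^2)$2$2"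
 by (auto simp: vec_eq_iff forall_2)

lemma mat2_mult:
 "(A ** B) $ i $ j = A$i$1 * B$1$j + A$i$2 * (B::('a::semiring_1)^2^2)$2$j" by (simp add: matrix_matrix_mult_def sum_2)

lemma mk2_eta: "A = mk2 (A$1$1) (A$1$2) (A$2$1) ((A::'a::zero^2^2)$2$2)" by (simp add: mat2_eq_iff)

lemma mk2_mult: "mk2 a b c d ** mk2 a' b' c' d' =
  mk2 (a * a' + b * c') (a * b' + b * d') (c * a' + d * c') (c * b' + d * (d'::'a::semiring_1))"
 by (simp add: mat2_eq_iff mat2_mult)

lemma det_mk2: "det (mk2 a b c d) = a * d - b * (c::'a::field)" by (simp add: det_2)

lemma scalar_mk2: "mat x ** mk2 a b c d = mk2 (x * a) (x * b) (x * c) (x * (d::'a::semiring_1))"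
 by (simp add: mat2_eq_iff mat_mult_nth)

lemma pgl_eq_iff:
 "det A ~= 0 ==> det B ~= 0 ==> pgl A = pgl B \<longleftrightarrow> (\<exists>c. c ~= 0 & B = mat c ** (A :: ('a::field)^2^2))"
 by transfer (simp add: pgl_rel_def)

lemma pgl_mult: "det A ~= 0 ==> det B ~= 0 ==> pgl A * pgl B = pgl (A ** (B :: ('a::field)^2^2))"
 by transfer (auto simp: det_mul intro: pgl_rel_refl)

lemma pgl_one: "(1 :: 'a::field pgl2) = pgl (mat 1)" by transfer (auto intro: pgl_rel_refl)

lemma pgl_cases: obtains A :: "('a::field)^2^2" where "det A ~= 0" "g = pgl A"
proof -
 have "\<exists>A :: 'a^2^2. det A ~= 0 & g = pgl A" proof transfer
  fix g :: "'a^2^2" assume "pgl_rel g g"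
  thus "\<exists>A. det A ~= 0 & pgl_rel g (if det A = 0 then mat 1 else A)"
   using pgl_rel_det[of g g] by (intro exI[of _ g]) simp
 qed
 thus thesis using that by blast
qed

lemma matrix_inv_both:
 assumes "det (A :: ('a::field)^2^2) ~= 0"
 shows "A ** matrix_inv A = mat 1" "matrix_inv A ** A = mat 1" "det (matrix_inv A) ~= 0"
proof -
 have "invertible A" using assms by (simp add: invertible_det_nz)
 thus "A ** matrix_inv A = mat 1" "matrix_inv A ** A = mat 1"
  using someI_ex[of "%A'. A ** A' = mat 1 & A' ** A = mat 1"] by (auto simp: invertible_def matrix_inv_def)
 show "det (matrix_inv A) ~= 0" using matrix_inv_mat_mult(2)[OF assms one_neq_zero] .
qed

lemma pgl_inverse: "det A ~= 0 ==> inverse (pgl A) = pgl (matrix_inv (A :: ('a::field)^2^2))"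
 by transfer (use matrix_inv_both in \<open>auto intro: pgl_rel_refl\<close>)

lemma pgl2_inverse: "inverse g * g = 1" "g * inverse g = (1 :: 'a::field pgl2)"
proof -
 obtain A :: "'a^2^2" where A: "det A ~= 0" "g = pgl A" by (rule pgl_cases)
 show "inverse g * g = 1" "g * inverse g = 1"
  using matrix_inv_both[OF A(1)] A by (simp_all add: pgl_inverse pgl_mult pgl_one)
qed

lemma pgl2_inverse_unique: "g * h = 1 ==> inverse (g :: 'a::field pgl2) = h"
 by (metis mult.assoc mult_1_left mult_1_right pgl2_inverse(1))

abbreviation mnear :: "int => ('a::nonarch_local_field)^2^2 => 'a^2^2 => bool" where
 "mnear m A B \<equiv> \<forall>i j. A$i$j - B$i$j \<in> pw m"

lemma mat2_bounded:
 fixes A :: "('a::nonarch_local_field)^2^2" obtains r where "!!i j. A$i$j \<in> pw r"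
proof -
 obtain a b c d where "A$1$1 \<in> pw a" "A$1$2 \<in> pw b" "A$2$1 \<in> pw c" "A$2$2 \<in> pw d" using in_some_pw by metis
 hence "\<forall>i j. A$i$j \<in> pw (min (min a b) (min c d))" unfolding forall_2 by (auto intro: pw_mono[rotated])
 thus thesis using that by blast
qed

lemma det_near:
 fixes A0 :: "('a::nonarch_local_field)^2^2"
 obtains m where "!!A. (!!i j. A$i$j - A0$i$j \<in> pw m) ==> det A - det A0 \<in> pw N"
proof -
 obtain r where r: "!!i j. A0$i$j \<in> pw r" using mat2_bounded by blast
 show thesis proof (rule that[of "max r (N - r)"])
  fix A assume A: "!!i j. A$i$j - A0$i$j \<in> pw (max r (N - r))"
  have Ar: "A$i$j \<in> pw r" for i j using pw_add[OF pw_mono[OF _ A[of i j], of r] r[of i j]] by simp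
  have prod: "A$i$j * A$k$l - A0$i$j * A0$k$l \<in> pw N" for i j k l proof -
   have "(A$i$j - A0$i$j) * A$k$l \<in> pw ((N - r) + r)" by (intro pw_mult Ar pw_mono[OF _ A]) simp
   moreover have "A0$i$j * (A$k$l - A0$k$l) \<in> pw (r + (N - r))" by (intro pw_mult r pw_mono[OF _ A]) simp
   ultimately have "(A$i$j - A0$i$j) * A$k$l + A0$i$j * (A$k$l - A0$k$l) \<in> pw N" by (intro pw_add) simp_all
   thus ?thesis by (simp add: algebra_simps)
  qed
  have "det A - det A0 = (A$1$1 * A$2$2 - A0$1$1 * A0$2$2) - (A$1$2 * A$2$1 - A0$1$2 * A0$2$1)" by (simp add: det_2)
  thus "det A - det A0 \<in> pw N" using pw_diff[OF prod prod] by simp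
 qed
qed

lemma open_mat2D:
 fixes S :: "(('a::nonarch_local_field)^2^2) set"
 assumes S: "open S" shows "\<forall>A0\<in>S. \<exists>m. \<forall>A. mnear m A A0 --> A \<in> S"
proof
 fix A0 assume "A0 \<in> S"
 then obtain U where U: "!!i. open (U i)" "!!i. A0$i \<in> U i" "!!A. (\<forall>i. A$i \<in> U i) ==> A \<in> S"
  using S unfolding open_vec_def by metis
 have "\<exists>V. (\<forall>j. open (V j) & A0$i$j \<in> V j) & (\<forall>y. (\<forall>j. y$j \<in> V j) --> y \<in> U i)" for i
  using U(1,2)[of i] unfolding open_vec_def by blast
 then obtain V where V: "!!i j. open (V i j)" "!!i j. A0$i$j \<in> V i j"
   "!!i y. (\<forall>j. y$j \<in> V i j) ==> y \<in> U i" by metis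
 have "\<exists>m. \<forall>y. y - A0$i$j \<in> pw m --> y \<in> V i j" for i j using V(1,2)[of i j] unfolding open_pw_iff by blast
 then obtain f where f: "!!i j y. y - A0$i$j \<in> pw (f i j) ==> y \<in> V i j" by metis
 define m where "m = Max {f i j | i j. True}"
 have "f i j \<le> m" for i j
  unfolding m_def by (rule Max_ge) (auto intro!: finite_image_set2[of "%_. True" "%_. True", simplified])
 thus "\<exists>m. \<forall>A. mnear m A A0 --> A \<in> S" using U(3) V(3) f pw_mono by (intro exI[of _ m]) blast
qed

lemma open_mat2I:
 fixes S :: "(('a::nonarch_local_field)^2^2) set"
 assumes *: "\<forall>A0\<in>S. \<exists>m. \<forall>A. mnear m A A0 --> A \<in> S" shows "open S"
proof (subst open_vec_def, rule ballI)
 fix A0 assume "A0 \<in> S"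
 then obtain m where m: "!!A. mnear m A A0 ==> A \<in> S" using * by blast
 have "open {y. \<forall>j. y$j - A0$i$j \<in> pw m}" for i unfolding open_vec_def proof
  fix y assume "y \<in> {y. \<forall>j. y$j - A0$i$j \<in> pw m}"
  thus "\<exists>V. (\<forall>j. open (V j) & y$j \<in> V j) & (\<forall>z. (\<forall>j. z$j \<in> V j) --> z \<in> {y. \<forall>j. y$j - A0$i$j \<in> pw m})"
   by (intro exI[of _ "%j. {z. z - A0$i$j \<in> pw m}"]) auto
 qed
 thus "\<exists>U. (\<forall>i. open (U i) & A0$i \<in> U i) & (\<forall>A. (\<forall>i. A$i \<in> U i) --> A \<in> S)"
  using m by (intro exI[of _ "%i. {y. \<forall>j. y$j - A0$i$j \<in> pw m}"]) auto
qed

lemma locally_constant_pgl2: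
 fixes F :: "'a::nonarch_local_field pgl2 => complex"
 shows "locally_constant F \<longleftrightarrow> (\<forall>A0. det A0 ~= 0 -->
  (\<exists>m. \<forall>A. mnear m A A0 --> det A ~= 0 & F (pgl A) = F (pgl A0)))"
proof
 assume lc: "locally_constant F"
 show "\<forall>A0. det A0 ~= 0 -->
  (\<exists>m. \<forall>A. mnear m A A0 --> det A ~= 0 & F (pgl A) = F (pgl A0))" proof (intro allI impI)
  fix A0 :: "'a^2^2" assume A0: "det A0 ~= 0"
  obtain U where U: "open U" "pgl A0 \<in> U" "F constant_on U" using lc unfolding locally_constant_def by blast
  then obtain T where T: "open T" "{A. det A ~= 0 & pgl A \<in> U} = {A. det A ~= 0} \<inter> T"
   unfolding open_pgl2_def openin_open by blast
  have "A0 \<in> T" using T(2) A0 U(2) by blast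
  then obtain m where m: "!!A. mnear m A A0 ==> A \<in> T" using open_mat2D[OF T(1)] by blast
  obtain m' where m': "!!A. (!!i j. A$i$j - A0$i$j \<in> pw m') ==> det A - det A0 \<in> pw (val (det A0) + 1)"
   using det_near[of A0] by blast
  show "\<exists>m. \<forall>A. mnear m A A0 --> det A ~= 0 & F (pgl A) = F (pgl A0)" proof (intro exI[of _ "max m m'"] allI impI)
   fix A :: "'a^2^2" assume A: "mnear (max m m') A A0"
   have 1: "A$i$j - A0$i$j \<in> pw m" "A$i$j - A0$i$j \<in> pw m'" for i j
    using A pw_mono[of m "max m m'" "A$i$j - A0$i$j"] pw_mono[of m' "max m m'" "A$i$j - A0$i$j"] by auto
   have "det A0 - det A \<in> pw (val (det A0) + 1)" using m'[OF 1(2)] pw_diff_commute by blast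
   hence d: "det A ~= 0" by (rule val_congruent(1)[OF A0])
   moreover have "A \<in> T" using m 1(1) by blast
   ultimately have "pgl A \<in> U" using T(2) by blast
   thus "det A ~= 0 & F (pgl A) = F (pgl A0)" using d U(2,3) unfolding constant_on_def by metis
  qed
 qed
next
 assume *: "\<forall>A0. det A0 ~= 0 -->
  (\<exists>m. \<forall>A. mnear m A A0 --> det A ~= 0 & F (pgl A) = F (pgl A0))"
 show "locally_constant F" unfolding locally_constant_def proof
  fix g :: "'a pgl2"
  let ?S = "{A. det A ~= 0 & pgl A \<in> {x. F x = F g}}"
  have "open ?S" proof (rule open_mat2I, rule ballI)
   fix A1 assume A1: "A1 \<in> ?S"
   then obtain m where m: "!!A. mnear m A A1 ==> det A ~= 0 & F (pgl A) = F (pgl A1)" using * by blast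
   have "A \<in> ?S" if "mnear m A A1" for A using m[OF that] A1 by simp
   thus "\<exists>m. \<forall>A. mnear m A A1 --> A \<in> ?S" by blast
  qed
  hence "open {x. F x = F g}" unfolding open_pgl2_def openin_open by (intro exI[of _ ?S]) auto
  thus "\<exists>U. open U & g \<in> U & F constant_on U" by (intro exI[of _ "{x. F x = F g}"]) (auto simp: constant_on_def)
 qed
qed

lemma upper_eq: "upper a b = pgl (mk2 a b 0 1)" and nbar_eq: "nbar x = pgl (mk2 1 0 x 1)"
 by (simp_all add: upper_def nbar_def)

text \<open>The second chart of the projective line, for matrices with nonzero lower left entry. Its
  origin \<open>wbar 0\<close> is the point at infinity missed by \<open>nbar\<close>.\<close>

definition wbar :: "'a::field => 'a pgl2" where "wbar y = pgl (mk2 y (- 1) 1 0)"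

lemma pgl_scale:
 fixes A :: "('a::field)^2^2"
 assumes "c ~= 0" "det A ~= 0" shows "pgl (mat c ** A) = pgl A"
proof -
 have "pgl A = pgl (mat c ** A)"
  using pgl_eq_iff[OF assms(2) det_mat_mult_nz[OF assms]] assms(1) by (auto intro: exI[of _ c])
 thus ?thesis by simp
qed

lemma pgl_nbar_decomp:
 assumes "a * d - b * c ~= 0" "a ~= (0::'a::field)"
 shows "pgl (mk2 a b c d) = nbar (c / a) * upper (a ^ 2 / (a * d - b * c)) (a * b / (a * d - b * c))"
proof -
 define \<delta> where "\<delta> = (a * d - b * c) / a"
 have \<delta>: "\<delta> ~= 0" "a ^ 2 / (a * d - b * c) = a / \<delta>" "a * b / (a * d - b * c) = b / \<delta>"
  using assms by (simp_all add: \<delta>_def power2_eq_square)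
 have "mat \<delta> ** mk2 (a / \<delta>) (b / \<delta>) (c / a * (a / \<delta>)) (c / a * (b / \<delta>) + 1) = mk2 a b c d"
  using assms \<delta>(1) unfolding scalar_mk2 by (simp add: mat2_eq_iff distrib_left) (simp add: \<delta>_def field_simps)
 moreover have "det (mk2 (a / \<delta>) (b / \<delta>) (c / a * (a / \<delta>)) (c / a * (b / \<delta>) + 1)) ~= 0"
  unfolding det_mk2 using assms(2) \<delta>(1) by (simp add: field_simps)
 ultimately have "pgl (mk2 a b c d) = pgl (mk2 (a / \<delta>) (b / \<delta>) (c / a * (a / \<delta>)) (c / a * (b / \<delta>) + 1))"
  using pgl_scale[OF \<delta>(1)] by metis
 also have "\<dots> = nbar (c / a) * upper (a / \<delta>) (b / \<delta>)" unfolding upper_eq nbar_eq using assms(2) \<delta>(1)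
  by (subst pgl_mult) (simp_all add: det_mk2 mk2_mult)
 finally show ?thesis by (simp only: \<delta>)
qed

lemma pgl_wbar_decomp:
 assumes "a * d - b * c ~= 0" "c ~= (0::'a::field)"
 shows "pgl (mk2 a b c d) = wbar (a / c) * upper (c ^ 2 / (a * d - b * c)) (c * d / (a * d - b * c))"
proof -
 define \<delta> where "\<delta> = (a * d - b * c) / c"
 have \<delta>: "\<delta> ~= 0" "c ^ 2 / (a * d - b * c) = c / \<delta>" "c * d / (a * d - b * c) = d / \<delta>"
  using assms by (simp_all add: \<delta>_def power2_eq_square)
 have "mat \<delta> ** mk2 (a / c * (c / \<delta>)) (a / c * (d / \<delta>) - 1) (c / \<delta>) (d / \<delta>) = mk2 a b c d"
  using assms \<delta>(1) unfolding scalar_mk2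
  by (simp add: mat2_eq_iff right_diff_distrib) (simp add: \<delta>_def field_simps)
 moreover have "det (mk2 (a / c * (c / \<delta>)) (a / c * (d / \<delta>) - 1) (c / \<delta>) (d / \<delta>)) ~= 0"
  unfolding det_mk2 using assms(2) \<delta>(1) by (simp add: field_simps)
 ultimately have "pgl (mk2 a b c d) = pgl (mk2 (a / c * (c / \<delta>)) (a / c * (d / \<delta>) - 1) (c / \<delta>) (d / \<delta>))"
  using pgl_scale[OF \<delta>(1)] by metis
 also have "\<dots> = wbar (a / c) * upper (c / \<delta>) (d / \<delta>)" unfolding upper_eq wbar_def using assms(2) \<delta>(1)
  by (subst pgl_mult) (simp_all add: det_mk2 mk2_mult)
 finally show ?thesis by (simp only: \<delta>)
qed

lemma cell_iff:
 assumes "det (A :: ('a::field)^2^2) ~= 0"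
 shows "pgl A \<in> {nbar x * upper a b | x a b. a ~= 0} \<longleftrightarrow> A$1$1 ~= 0"
proof
 assume "pgl A \<in> {nbar x * upper a b | x a b. a ~= 0}"
 then obtain x a b where xab: "pgl A = nbar x * upper a b" "a ~= 0" by blast
 hence eq: "pgl (mk2 a b (x * a) (x * b + 1)) = pgl A"
  unfolding nbar_eq upper_eq by (simp add: pgl_mult det_mk2 mk2_mult)
 moreover have "det (mk2 a b (x * a) (x * b + 1)) ~= 0" using xab(2) by (simp add: det_mk2 algebra_simps)
 ultimately obtain c where "c ~= 0" "A = mat c ** mk2 a b (x * a) (x * b + 1)" using pgl_eq_iff[OF _ assms] by blast
 thus "A$1$1 ~= 0" using xab(2) by (simp add: scalar_mk2)
next
 assume "A$1$1 ~= 0"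
 thus "pgl A \<in> {nbar x * upper a b | x a b. a ~= 0}"
  using pgl_nbar_decomp[of "A$1$1" "A$2$2" "A$1$2" "A$2$1"] assms mk2_eta[of A] unfolding det_2 by (force intro!: exI)
qed

lemma left_mult_principal_series:
 assumes f: "f \<in> principal_series p chi s" shows "(%x. f (g * x)) \<in> principal_series p chi (s :: complex)"
proof -
 obtain B where B: "det B ~= 0" "g = pgl B" by (rule pgl_cases)
 have lc: "locally_constant f" using f by (simp add: principal_series_def)
 have "locally_constant (%x. f (g * x))" unfolding locally_constant_pgl2 proof (intro allI impI)
  fix A0 assume A0: "det (A0 :: ('a::nonarch_local_field)^2^2) ~= 0"
  hence "det (B ** A0) ~= 0" using B by (simp add: det_mul)
  then obtain m where m: "!!A. mnear m A (B ** A0) ==> det A ~= 0 & f (pgl A) = f (pgl (B ** A0))"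
   using lc unfolding locally_constant_pgl2 by blast
  obtain r where r: "!!i j. B$i$j \<in> pw r" using mat2_bounded by blast
  show "\<exists>m. \<forall>A. mnear m A A0 --> det A ~= 0 & f (g * pgl A) = f (g * pgl A0)" proof (intro exI[of _ "m - r"] allI impI)
   fix A assume A: "mnear (m - r) A A0"
   have "(B ** A)$i$j - (B ** A0)$i$j \<in> pw m" for i j proof -
    have "B$i$k * (A$k$j - A0$k$j) \<in> pw (r + (m - r))" for k using A by (intro pw_mult r) blast
    hence "B$i$1 * (A$1$j - A0$1$j) + B$i$2 * (A$2$j - A0$2$j) \<in> pw m" by (intro pw_add) simp_all
    thus ?thesis by (simp add: mat2_mult algebra_simps)
   qed
   hence mm: "det (B ** A) ~= 0 & f (pgl (B ** A)) = f (pgl (B ** A0))" using m by blast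
   hence "det A ~= 0" by (auto simp: det_mul)
   thus "det A ~= 0 & f (g * pgl A) = f (g * pgl A0)" using mm B A0 by (simp add: pgl_mult)
  qed
 qed
 thus ?thesis using f by (simp add: principal_series_def flip: mult.assoc)
qed

lemma principal_series_linear:
 assumes "f \<in> principal_series p chi s" "f' \<in> principal_series p chi s"
 shows "(%g. f g + f' g) \<in> principal_series p chi s" and "(%g. c * f g) \<in> principal_series p chi (s :: complex)"
proof -
 have eq: "!!g a b. a ~= 0 ==> f (g * upper a b) = inverse (quasi_char p chi (s + 1/2) a) * f g"
  "!!g a b. a ~= 0 ==> f' (g * upper a b) = inverse (quasi_char p chi (s + 1/2) a) * f' g"
  using assms by (simp_all add: principal_series_def)
 have lc: "locally_constant f" "locally_constant f'" using assms by (simp_all add: principal_series_def)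
 have "locally_constant (%g. f g + f' g)" "locally_constant (%g. c * f g)" unfolding locally_constant_def proof (safe)
  fix g
  obtain U where U: "open U" "g \<in> U" "f constant_on U" using lc(1) unfolding locally_constant_def by blast
  obtain U' where U': "open U'" "g \<in> U'" "f' constant_on U'" using lc(2) unfolding locally_constant_def by blast
  have "(%g. f g + f' g) constant_on (U \<inter> U')" using U(3) U'(3) unfolding constant_on_def by (metis IntD1 IntD2)
  thus "\<exists>U. open U & g \<in> U & (%g. f g + f' g) constant_on U" using U U' by (intro exI[of _ "U \<inter> U'"]) auto
  have "(%g. c * f g) constant_on U" using U(3) unfolding constant_on_def by metis
  thus "\<exists>U. open U & g \<in> U & (%g. c * f g) constant_on U" using U by blast
 qed
 thus "(%g. f g + f' g) \<in> principal_series p chi s" "(%g. c * f g) \<in> principal_series p chi s"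
  using eq by (simp_all add: principal_series_def algebra_simps)
qed

section \<open>Intertwiners and distributions\<close>

lemma divide_near:
 fixes a0 c0 :: "'a::nonarch_local_field"
 assumes a0: "a0 ~= 0"
 obtains m where "!!a c. a - a0 \<in> pw m ==> c - c0 \<in> pw m ==> a ~= 0 & c / a - c0 / a0 \<in> pw N"
proof -
 obtain r where r: "c0 \<in> pw r" using in_some_pw by blast
 define m where "m = max (val a0 + 1) (max (N + val a0) (N - r + 2 * val a0))"
 show thesis proof (rule that[of m])
  fix a c assume a: "a - a0 \<in> pw m" and c: "c - c0 \<in> pw m"
  have "a - a0 \<in> pw (val a0 + 1)" by (rule pw_mono[OF _ a]) (simp add: m_def)
  note near = inverse_near[OF a0 this]
  have "a * ((c - c0) / a) \<in> pw (N + val a0)" using pw_mono[of "N + val a0" m, OF _ c] near(1) by (simp add: m_def)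
  hence 1: "(c - c0) / a \<in> pw N" unfolding pw_mult_iff[OF near(1)] by (simp add: near(2))
  have "inverse a - inverse a0 \<in> pw (N - r)" unfolding near(3) by (rule pw_mono[OF _ a]) (simp add: m_def)
  hence "c0 * (inverse a - inverse a0) \<in> pw (r + (N - r))" by (rule pw_mult[OF r])
  hence "(c - c0) / a + c0 * (inverse a - inverse a0) \<in> pw N" using 1 by (intro pw_add) simp_all
  moreover have "(c - c0) / a + c0 * (inverse a - inverse a0) = c / a - c0 / a0"
   using near(1) a0 by (simp add: divide_inverse algebra_simps)
  ultimately show "a ~= 0 & c / a - c0 / a0 \<in> pw N" using near(1) by simp
 qed
qed

text \<open>A matrix congruent to 1 modulo \<open>pw n\<close> moves points of \<open>pw 0\<close>
  only within \<open>pw n\<close>. Permuting the entries gives the same for the other chart.\<close>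

lemma moebius_near:
 fixes x :: "'a::nonarch_local_field"
 assumes n: "n \<ge> 1" and x: "x \<in> pw 0" and k: "p - 1 \<in> pw n" "q \<in> pw n" "r \<in> pw n" "s - 1 \<in> pw n"
 shows "p + q * x - 1 \<in> pw n" "p + q * x ~= 0" "(r + s * x) / (p + q * x) - x \<in> pw n" "(r + s * x) / (p + q * x) \<in> pw 0"
proof -
 have px: "y * x \<in> pw n" if "y \<in> pw n" for y using pw_mult[OF that x] by simp
 have "(p - 1) + q * x \<in> pw n" by (intro pw_add px k)
 thus e: "p + q * x - 1 \<in> pw n" by (simp add: algebra_simps)
 note u = one_plus_pw[OF e n, simplified]
 show nz: "p + q * x ~= 0" by (rule u(1))
 have "(r + (s - 1) * x) - (p + q * x - 1) * x \<in> pw n" by (intro pw_diff pw_add px k e)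
 moreover have "(p + q * x) * ((r + s * x) / (p + q * x) - x) = (r + (s - 1) * x) - (p + q * x - 1) * x"
  using nz by (simp add: right_diff_distrib) (simp add: algebra_simps)
 ultimately have "(p + q * x) * ((r + s * x) / (p + q * x) - x) \<in> pw n" by simp
 thus d: "(r + s * x) / (p + q * x) - x \<in> pw n" unfolding pw_mult_iff[OF nz] by (simp add: u(2))
 have "((r + s * x) / (p + q * x) - x) + x \<in> pw 0" using pw_mono[OF _ d, of 0] n by (intro pw_add x) simp
 thus "(r + s * x) / (p + q * x) \<in> pw 0" by simp
qed

lemma map_mat2_simps:
 "map_mat2 f A $ i $ j = f (A $ i $ j)" by (simp add: map_mat2_def)

context kernel_setting
begin

abbreviation ka :: "complex => 'e => complex" where "ka s \<equiv> quasi_char pE chi (s + 1/2)"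
abbreviation PS :: "complex => ('e pgl2 => complex) set" where "PS s \<equiv> principal_series pE chi s"

lemma ka_nonzero: "x ~= 0 ==> ka s x ~= 0" by (rule quasi_char_nonzero[OF chi uniformizer_E])

lemma ka_mult: "ka s (x * y) = ka s x * ka s y" by (rule quasi_char_mult[OF chi uniformizer_E])

lemma ka_one [simp]: "ka s 1 = 1" by (rule quasi_char_one[OF chi])

lemma ka_mu: "ka s x = mu s x * of_real (absv x)"
proof (cases "x = 0")
 case False
 have "quasi_char pE chi (s - 1/2 + 1) x = mu s x * qexp TYPE('e) 1 powi val x" by (rule quasi_char_add)
 thus ?thesis using qexp_one_powi[OF False] by (simp add: algebra_simps)
qed simp

text \<open>The restrictions to the two charts. By \<open>PS_glue\<close> they are related through
  \<open>pull\<close>, so the variable of \<open>phi2\<close> is w = 1/x.\<close>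

definition phi1 :: "('e pgl2 => complex) => 'e => complex" where "phi1 f x = f (nbar x)"
definition phi2 :: "('e pgl2 => complex) => 'e => complex" where "phi2 f y = f (wbar y)"

lemma PS_upper: "f \<in> PS s ==> a ~= 0 ==> f (g * upper a b) = inverse (ka s a) * f g" by (simp add: principal_series_def)

lemma ka_square_divide: "dt ~= 0 ==> inverse (ka s (a ^ 2 / dt)) = ka s dt * gg s a"
proof -
 have "ka s (a ^ 2 / dt) = theta s a / ka s dt"
  unfolding theta_def by (simp only: quasi_char_divide[OF chi uniformizer_E] quasi_char_power[OF chi uniformizer_E])
 thus ?thesis by (simp only: inverse_divide) (simp only: divide_inverse)
qed

lemma PS_value1:
 assumes f: "f \<in> PS s" and nz: "a * dd - b * c ~= 0" "a ~= 0"
 shows "f (pgl (mk2 a b c dd)) = ka s (a * dd - b * c) * gg s a * phi1 f (c / a)"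
proof -
 have "a ^ 2 / (a * dd - b * c) ~= 0" using nz by simp
 from PS_upper[OF f this] show ?thesis unfolding pgl_nbar_decomp[OF nz] phi1_def ka_square_divide[OF nz(1)] .
qed

lemma PS_value2:
 assumes f: "f \<in> PS s" and nz: "a * dd - b * c ~= 0" "c ~= 0"
 shows "f (pgl (mk2 a b c dd)) = ka s (a * dd - b * c) * gg s c * phi2 f (a / c)"
proof -
 have "c ^ 2 / (a * dd - b * c) ~= 0" using nz by simp
 from PS_upper[OF f this] show ?thesis unfolding pgl_wbar_decomp[OF nz] phi2_def ka_square_divide[OF nz(1)] .
qed

lemma PS_glue:
 assumes f: "f \<in> PS s" and y: "y ~= 0" shows "phi2 f y = pull s (phi1 f) y"
proof -
 have d: "y * 0 - (- 1) * 1 = (1::'e)" by simp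
 have "f (pgl (mk2 y (- 1) 1 0)) = ka s 1 * gg s y * phi1 f (1 / y)"
  by (rule PS_value1[OF f, of y 0 "- 1" 1, unfolded d, OF one_neq_zero y])
 moreover have "1 / y = inverse y" by (simp only: divide_inverse mult_1_left)
 ultimately show ?thesis unfolding phi2_def wbar_def pull_def by (simp add: mult.commute)
qed

lemma PS_locally_constant:
 assumes f: "f \<in> PS s" shows "locally_constant (phi1 f)" "locally_constant (phi2 f)"
proof -
 have lc: "!!A0. det A0 ~= 0 ==> \<exists>m. \<forall>A. mnear m A A0 --> det A ~= 0 & f (pgl A) = f (pgl A0)"
  using f unfolding principal_series_def locally_constant_pgl2 by blast
 show "locally_constant (phi1 f)" unfolding locally_constant_pw proof
  fix x
  obtain m where "!!A. mnear m A (mk2 1 0 x 1) ==> f (pgl A) = f (pgl (mk2 1 0 x 1))"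
   using lc[of "mk2 1 0 x 1"] by (auto simp: det_mk2)
  note m = this
  have "phi1 f y = phi1 f x" if "y - x \<in> pw m" for y
   unfolding phi1_def nbar_eq by (rule m) (use that in \<open>simp add: forall_2\<close>)
  thus "\<exists>n. \<forall>y. y - x \<in> pw n --> phi1 f y = phi1 f x" by blast
 qed
 show "locally_constant (phi2 f)" unfolding locally_constant_pw proof
  fix x
  obtain m where "!!A. mnear m A (mk2 x (- 1) 1 0) ==> f (pgl A) = f (pgl (mk2 x (- 1) 1 0))"
   using lc[of "mk2 x (- 1) 1 0"] by (auto simp: det_mk2)
  note m = this
  have "phi2 f y = phi2 f x" if "y - x \<in> pw m" for y
   unfolding phi2_def wbar_def by (rule m) (use that in \<open>simp add: forall_2\<close>)
  thus "\<exists>n. \<forall>y. y - x \<in> pw n --> phi2 f y = phi2 f x" by blast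
 qed
qed

lemma PS_eqI:
 assumes f: "f \<in> PS s" and f': "f' \<in> PS s" and eq: "!!x. phi1 f x = phi1 f' x" "phi2 f 0 = phi2 f' 0" shows "f = f'"
proof
 fix g :: "'e pgl2"
 obtain A where A: "det A ~= 0" "g = pgl A" by (rule pgl_cases)
 have d: "A$1$1 * A$2$2 - A$1$2 * A$2$1 ~= 0" using A(1) by (simp add: det_2)
 have g: "g = pgl (mk2 (A$1$1) (A$1$2) (A$2$1) (A$2$2))" using A(2) mk2_eta[of A] by simp
 show "f g = f' g" proof (cases "A$1$1 = 0")
  case False
  thus ?thesis unfolding g PS_value1[OF f d False] PS_value1[OF f' d False] by (simp only: eq)
 next
  case True
  hence "A$2$1 ~= 0" using d by auto
  thus ?thesis
   unfolding g PS_value2[OF f d \<open>A$2$1 ~= 0\<close>] PS_value2[OF f' d \<open>A$2$1 ~= 0\<close>] using True eq by simp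
 qed
qed

text \<open>The construction inverse to restriction to the charts. It is made on matrices first;
  \<open>glue_mat_scale\<close> shows that the representative chosen in \<open>glue\<close> does not
  matter.\<close>

definition glue_mat :: "complex => ('e => complex) => ('e => complex) => 'e^2^2 => complex" where
 "glue_mat s \<phi> \<psi> A = ka s (det A) * (if A$1$1 ~= 0 then gg s (A$1$1) * \<phi> (A$2$1 / A$1$1) else gg s (A$2$1) * \<psi> 0)"

definition glue :: "complex => ('e => complex) => ('e => complex) => 'e pgl2 => complex" where
 "glue s \<phi> \<psi> g = glue_mat s \<phi> \<psi> (SOME A. det A ~= 0 & g = pgl A)"

lemma glue_mat_scale:
 assumes c: "c ~= 0" shows "glue_mat s \<phi> \<psi> (mat c ** A) = glue_mat s \<phi> \<psi> A"
proof -
 have d: "det (mat c ** A) = (c * c) * det A" by (simp add: det_2 mat_mult_nth algebra_simps)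
 have 1: "ka s (c * c) * gg s c = 1"
  unfolding ka_mult theta_def power2_eq_square using ka_nonzero[OF c, of s] by (intro right_inverse) simp
 have k: "ka s (det (mat c ** A)) * (gg s c * x) = ka s (det A) * x" for x proof -
  have "ka s (det (mat c ** A)) * (gg s c * x) = (ka s (c * c) * gg s c) * (ka s (det A) * x)"
   unfolding d ka_mult[of s "c * c"] by (simp only: mult_ac)
  thus ?thesis unfolding 1 by simp
 qed
 have g2: "gg s (c * x) = gg s c * gg s x" for x by (simp add: theta_mult)
 show ?thesis using c unfolding glue_mat_def mat_mult_nth g2 by (simp add: k mult.assoc)
qed

lemma glue_pgl:
 assumes "det A ~= 0" shows "glue s \<phi> \<psi> (pgl A) = glue_mat s \<phi> \<psi> A"
proof -
 have "\<exists>B. det B ~= 0 & pgl A = pgl B" using assms by blast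
 from someI_ex[OF this] obtain B where B: "det B ~= 0" "pgl A = pgl B" "glue s \<phi> \<psi> (pgl A) = glue_mat s \<phi> \<psi> B"
  unfolding glue_def by blast
 obtain c where "c ~= 0" "B = mat c ** A" using B(2) pgl_eq_iff[OF assms B(1)] by blast
 thus ?thesis using B(3) glue_mat_scale by simp
qed

text \<open>The definition favours the first chart. The transition relation gives the same formula
  in the second, which yields local constancy near \<open>wbar 0\<close>.\<close>

lemma glue_mat_other:
 assumes "!!y. y ~= 0 ==> \<psi> y = pull s \<phi> y" "A$2$1 ~= 0"
 shows "glue_mat s \<phi> \<psi> A = ka s (det A) * gg s (A$2$1) * \<psi> (A$1$1 / A$2$1)"
proof (cases "A$1$1 = 0")
 case False
 hence "\<psi> (A$1$1 / A$2$1) = pull s \<phi> (A$1$1 / A$2$1)" using assms by simp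
 thus ?thesis using False assms(2) theta_nonzero[of "A$2$1" s] theta_nonzero[of "A$1$1" s]
  by (simp add: glue_mat_def pull_def theta_divide field_simps)
qed (simp add: glue_mat_def)

lemma chart_near:
 fixes A0 :: "'e^2^2"
 assumes h: "locally_constant h" and nz: "A0$i$1 ~= 0" "det A0 ~= 0"
 obtains m where "!!A. mnear m A A0 ==> det A ~= 0 & A$i$1 ~= 0 &
  ka s (det A) * gg s (A$i$1) * h (A$l$1 / A$i$1) = ka s (det A0) * gg s (A0$i$1) * h (A0$l$1 / A0$i$1)"
proof -
 obtain n where n: "!!dt. dt - det A0 \<in> pw n ==> dt ~= 0 & ka s dt = ka s (det A0)"
  using quasi_char_locally_constant[OF uniformizer_E chi nz(2)] by blast
 obtain n0 where n0: "!!A. (!!i j. A$i$j - A0$i$j \<in> pw n0) ==> det A - det A0 \<in> pw n" using det_near[of A0 n] by blast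
 obtain n' where n': "!!a. a - A0$i$1 \<in> pw n' ==> theta s a = theta s (A0$i$1)"
  using theta_locally_constant[OF nz(1)] by blast
 obtain N where N: "!!y. y - A0$l$1 / A0$i$1 \<in> pw N ==> h y = h (A0$l$1 / A0$i$1)"
  using locally_constantE[OF h] by blast
 obtain k where k: "!!a c. a - A0$i$1 \<in> pw k ==> c - A0$l$1 \<in> pw k ==> a ~= 0 & c / a - A0$l$1 / A0$i$1 \<in> pw N"
  using divide_near[OF nz(1)] by blast
 show thesis proof (rule that[of "max n0 (max n' k)"])
  fix A assume A: "mnear (max n0 (max n' k)) A A0"
  have 1: "A$i$j - A0$i$j \<in> pw n0" "A$i$j - A0$i$j \<in> pw n'" "A$i$j - A0$i$j \<in> pw k" for i j
   using A[rule_format, of i j] by (auto elim!: pw_mono[rotated])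
  show "det A ~= 0 & A$i$1 ~= 0 & ka s (det A) * gg s (A$i$1) * h (A$l$1 / A$i$1) =
    ka s (det A0) * gg s (A0$i$1) * h (A0$l$1 / A0$i$1)"
   using n[OF n0[OF 1(1)]] n'[OF 1(2)] k[OF 1(3) 1(3)] N[of "A$l$1 / A$i$1"] by simp
 qed
qed

lemma glue_props:
 assumes lc: "locally_constant \<phi>" "locally_constant \<psi>" and gl: "!!y. y ~= 0 ==> \<psi> y = pull s \<phi> y"
 shows glue_PS: "glue s \<phi> \<psi> \<in> PS s" and phi1_glue: "phi1 (glue s \<phi> \<psi>) = \<phi>" and phi2_glue: "phi2 (glue s \<phi> \<psi>) = \<psi>"
proof -
 have "locally_constant (glue s \<phi> \<psi>)" unfolding locally_constant_pgl2 proof (intro allI impI)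
  fix A0 :: "'e^2^2" assume A0: "det A0 ~= 0"
  show "\<exists>m. \<forall>A. mnear m A A0 --> det A ~= 0 & glue s \<phi> \<psi> (pgl A) = glue s \<phi> \<psi> (pgl A0)" proof (cases "A0$1$1 = 0")
   case False
   show ?thesis proof (rule chart_near[OF lc(1) False A0, of s 2], intro exI allI impI)
    fix m A assume "!!A. mnear m A A0 ==> det A ~= 0 & A$1$1 ~= 0 &
     ka s (det A) * gg s (A$1$1) * \<phi> (A$2$1 / A$1$1) = ka s (det A0) * gg s (A0$1$1) * \<phi> (A0$2$1 / A0$1$1)"
     "mnear m A A0"
    from this(1)[OF this(2)] show "det A ~= 0 & glue s \<phi> \<psi> (pgl A) = glue s \<phi> \<psi> (pgl A0)"
     using A0 False by (simp add: glue_pgl glue_mat_def mult.assoc)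
   qed
  next
   case True
   hence c: "A0$2$1 ~= 0" using A0 by (auto simp: det_2)
   show ?thesis proof (rule chart_near[OF lc(2) c A0, of s 1], intro exI allI impI)
    fix m A assume "!!A. mnear m A A0 ==> det A ~= 0 & A$2$1 ~= 0 &
     ka s (det A) * gg s (A$2$1) * \<psi> (A$1$1 / A$2$1) = ka s (det A0) * gg s (A0$2$1) * \<psi> (A0$1$1 / A0$2$1)"
     "mnear m A A0"
    from this(1)[OF this(2)] show "det A ~= 0 & glue s \<phi> \<psi> (pgl A) = glue s \<phi> \<psi> (pgl A0)"
     using A0 c glue_mat_other[of \<psi> s \<phi> A, OF gl] glue_mat_other[of \<psi> s \<phi> A0, OF gl] by (simp add: glue_pgl)
   qed
  qed
 qed
 moreover have "glue s \<phi> \<psi> (g * upper a b) = inverse (ka s a) * glue s \<phi> \<psi> g" if a: "a ~= 0" for g a b proof -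
  obtain A :: "'e^2^2" where A: "det A ~= 0" "g = pgl A" by (rule pgl_cases)
  have U: "det (mk2 a b 0 1) = a" by (simp add: det_mk2)
  have "g * upper a b = pgl (A ** mk2 a b 0 1)" using A a U by (simp add: upper_eq pgl_mult)
  moreover have d: "det (A ** mk2 a b 0 1) = a * det A" using U by (simp add: det_mul)
  moreover have "ka s a * gg s a = inverse (ka s a)"
   using ka_nonzero[OF a, of s] by (simp add: theta_def power2_eq_square)
  ultimately show ?thesis using A a by (simp add: glue_pgl glue_mat_def mat2_mult ka_mult theta_mult mult_ac)
 qed
 ultimately show "glue s \<phi> \<psi> \<in> PS s" by (simp add: principal_series_def)
 show "phi1 (glue s \<phi> \<psi>) = \<phi>" by (simp add: fun_eq_iff phi1_def nbar_eq glue_pgl det_mk2 glue_mat_def)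
 show "phi2 (glue s \<phi> \<psi>) = \<psi>" proof
  fix y
  show "phi2 (glue s \<phi> \<psi>) y = \<psi> y" using glue_mat_other[of \<psi> s \<phi> "mk2 y (- 1) 1 0", OF gl]
   by (simp add: phi2_def wbar_def glue_pgl det_mk2)
 qed
qed

lemma locally_constant_pull:
 assumes \<phi>: "\<phi> \<in> TF" shows "locally_constant (pull s \<phi>)" unfolding locally_constant_pw
proof
 obtain n m where nm: "periodic n \<phi>" "supported m \<phi>" using \<phi> by (rule test_funE)
 fix x :: 'e
 show "\<exists>k. \<forall>y. y - x \<in> pw k --> pull s \<phi> y = pull s \<phi> x" proof (cases "x = 0")
  case True
  have "pull s \<phi> y = 0" if "y \<in> pw (1 - m)" for y proof (cases "y = 0")
   case False
   hence "inverse y \<notin> pw m" using that by (auto simp: pw_def val_inverse)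
   thus ?thesis using nm(2) by (simp add: supported_def pull_def)
  qed (simp add: pull_def)
  thus ?thesis using True by (intro exI[of _ "1 - m"]) (simp add: pull_def)
 next
  case False
  obtain k where k: "!!y. y - x \<in> pw k ==> theta s y = theta s x" using theta_locally_constant[OF False] by blast
  have "pull s \<phi> y = pull s \<phi> x" if y: "y - x \<in> pw (max k (max (val x + 1) (n + 2 * val x)))" for y proof -
   have 1: "y - x \<in> pw k" "y - x \<in> pw (val x + 1)" "y - x \<in> pw (n + 2 * val x)"
    using y by (auto elim!: pw_mono[rotated])
   have "\<phi> (inverse y) = \<phi> (inverse x)" using inverse_near(3)[OF False 1(2), of n] 1(3) periodicD[OF nm(1)] by blast
   thus ?thesis using k[OF 1(1)] by (simp add: pull_def)
  qed
  thus ?thesis by blast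
 qed
qed

abbreviation cell :: "complex => ('e => complex) => 'e pgl2 => complex" where
 "cell s \<equiv> cell_section pE chi s"

lemma cell_section_glue:
 assumes \<phi>: "\<phi> \<in> TF" shows "cell s \<phi> = glue s \<phi> (pull s \<phi>)"
proof -
 note lc = test_fun_locally_constant[OF \<phi>] locally_constant_pull[OF \<phi>, of s]
 note gl = glue_PS[OF lc] phi1_glue[OF lc] phi2_glue[OF lc]
 show ?thesis unfolding cell_section_def proof (rule the_equality)
  have "glue s \<phi> (pull s \<phi>) g = 0" if g: "g \<notin> {nbar x * upper a b | x a b. a ~= 0}" for g proof -
   obtain A :: "'e^2^2" where A: "det A ~= 0" "g = pgl A" by (rule pgl_cases)
   hence "A$1$1 = 0" using g cell_iff by blast
   thus ?thesis using A by (simp add: glue_pgl glue_mat_def pull_def)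
  qed
  thus "glue s \<phi> (pull s \<phi>) \<in> PS s & (\<forall>x. glue s \<phi> (pull s \<phi>) (nbar x) = \<phi> x) &
    (\<forall>g. g \<notin> {nbar x * upper a b | x a b. a ~= 0} --> glue s \<phi> (pull s \<phi>) g = 0)"
   using gl(1,2) by (auto simp: phi1_def fun_eq_iff)
  fix f assume f: "f \<in> PS s & (\<forall>x. f (nbar x) = \<phi> x) & (\<forall>g. g \<notin> {nbar x * upper a b | x a b. a ~= 0} --> f g = 0)"
  show "f = glue s \<phi> (pull s \<phi>)" proof (rule PS_eqI)
   show "f \<in> PS s" "glue s \<phi> (pull s \<phi>) \<in> PS s" using f gl(1) by auto
   show "phi1 f x = phi1 (glue s \<phi> (pull s \<phi>)) x" for x using f gl(2) by (simp add: phi1_def)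
   have "wbar 0 \<notin> {nbar x * upper a b | x a b. a ~= (0::'e)}"
    unfolding wbar_def using cell_iff[of "mk2 (0::'e) (- 1) 1 0"] by (simp add: det_mk2)
   hence "f (wbar 0) = 0" using f by blast
   thus "phi2 f 0 = phi2 (glue s \<phi> (pull s \<phi>)) 0" using gl(3) by (simp add: phi2_def[of f] pull_def)
  qed
 qed
qed

lemma cell_props:
 assumes \<phi>: "\<phi> \<in> TF"
 shows cell_PS: "cell s \<phi> \<in> PS s" and phi1_cell: "phi1 (cell s \<phi>) = \<phi>" and phi2_cell: "phi2 (cell s \<phi>) = pull s \<phi>"
 unfolding cell_section_glue[OF \<phi>]
 using glue_props[OF test_fun_locally_constant[OF \<phi>] locally_constant_pull[OF \<phi>, of s]] by auto

text \<open>Local constancy at the point at infinity turns vanishing there into compact support in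
  the chart x.\<close>

lemma PS_cell:
 assumes f: "f \<in> PS s" and z: "phi2 f 0 = 0" shows "phi1 f \<in> TF" and "f = cell s (phi1 f)"
proof -
 obtain n where n: "!!y. y - 0 \<in> pw n ==> phi2 f y = phi2 f 0"
  using locally_constantE[OF PS_locally_constant(2)[OF f]] by blast
 have "phi1 f x = 0" if x: "x \<notin> pw (1 - n)" for x proof -
  have x0: "x ~= 0" "inverse x \<in> pw n" using x by (auto simp: pw_def val_inverse)
  hence "pull s (phi1 f) (inverse x) = 0" using n[of "inverse x"] z PS_glue[OF f, of "inverse x"] by simp
  thus ?thesis using x0(1) theta_nonzero[of "inverse x" s] by (simp add: pull_def)
 qed
 thus t: "phi1 f \<in> TF" by (intro test_funI[OF PS_locally_constant(1)[OF f], of "1 - n"]) (simp add: supported_def)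
 show "f = cell s (phi1 f)"
  by (rule PS_eqI[OF f cell_PS[OF t]]) (simp_all add: phi1_cell[OF t] phi2_cell[OF t] z pull_def)
qed

lemma phi_linear: "phi1 (%g. f g + f' g) = (%x. phi1 f x + phi1 f' x)" "phi1 (%g. c * f g) = (%x. c * phi1 f x)"
 "phi2 (%g. f g + f' g) = (%x. phi2 f x + phi2 f' x)" "phi2 (%g. c * f g) = (%x. c * phi2 f x)"
 by (simp_all add: phi1_def phi2_def fun_eq_iff)

lemma cell_add:
 assumes "\<phi> \<in> TF" "\<psi> \<in> TF" shows "cell s (%x. \<phi> x + \<psi> x) = (%g. cell s \<phi> g + cell s \<psi> g)"
 using PS_cell(2)[OF principal_series_linear(1)[OF cell_PS[OF assms(1)] cell_PS[OF assms(2)]], of s]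
 by (simp add: phi_linear phi1_cell phi2_cell assms pull_def)

lemma cell_cmult:
 assumes "\<phi> \<in> TF" shows "cell s (%x. c * \<phi> x) = (%g. c * cell s \<phi> g)"
 using PS_cell(2)[OF principal_series_linear(2)[OF cell_PS[OF assms, of s] cell_PS[OF assms, of s], of c]]
 by (simp add: phi_linear phi1_cell phi2_cell assms pull_def)

lemma phi_diag:
 assumes f: "f \<in> PS s" and a: "a ~= 0" shows "phi1 (%x. f (upper a 0 * x)) x = inverse (ka s a) * phi1 f (x / a)"
  and "phi2 (%x. f (upper a 0 * x)) y = ka s a * phi2 f (a * y)"
proof -
 have k: "ka s a * gg s a = inverse (ka s a)" using ka_nonzero[OF a, of s] by (simp add: theta_def power2_eq_square)
 have 1: "upper a 0 * nbar x = pgl (mk2 a 0 x 1)" "upper a 0 * wbar y = pgl (mk2 (a * y) (- a) 1 0)"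
  using a by (simp_all add: upper_eq nbar_eq wbar_def pgl_mult det_mk2 mk2_mult)
 have d: "a * 1 - 0 * x = a" "a * y * 0 - - a * 1 = a" by simp_all
 show "phi1 (%x. f (upper a 0 * x)) x = inverse (ka s a) * phi1 f (x / a)"
  using PS_value1[OF f, of a 1 0 x, unfolded d, OF a a] unfolding k phi1_def[of "%x. f (upper a 0 * x)"] 1 .
 show "phi2 (%x. f (upper a 0 * x)) y = ka s a * phi2 f (a * y)"
  using PS_value2[OF f, of "a * y" 0 "- a" 1, unfolded d, OF a one_neq_zero] unfolding phi2_def[of "%x. f (upper a 0 * x)"] 1 by simp
qed

lemma phi_unip:
 assumes f: "f \<in> PS s"
 shows "1 + b * x ~= 0 ==> phi1 (%x. f (upper 1 b * x)) x = gg s (1 + b * x) * phi1 f (x / (1 + b * x))"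
  and "1 + b * x = 0 ==> phi1 (%x. f (upper 1 b * x)) x = gg s x * phi2 f 0"
  and "phi2 (%x. f (upper 1 b * x)) y = phi2 f (y + b)"
proof -
 have eq: "upper 1 b * nbar x = pgl (mk2 (1 + b * x) b x 1)" by (simp add: upper_eq nbar_eq pgl_mult det_mk2 mk2_mult)
 have d: "(1 + b * x) * 1 - b * x = 1" by simp
 show "phi1 (%x. f (upper 1 b * x)) x = gg s (1 + b * x) * phi1 f (x / (1 + b * x))" if "1 + b * x ~= 0"
  using PS_value1[OF f, of "1 + b * x" 1 b x] that by (simp add: phi1_def[of "%x. f (upper 1 b * x)"] eq)
 show "phi1 (%x. f (upper 1 b * x)) x = gg s x * phi2 f 0" if z: "1 + b * x = 0" proof -
  have "x ~= 0" using z by auto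
  from PS_value2[OF f, of "1 + b * x" 1 b x, unfolded d, OF one_neq_zero this] show ?thesis
   unfolding phi1_def eq z by simp
 qed
 show "phi2 (%x. f (upper 1 b * x)) y = phi2 f (y + b)"
  by (simp add: phi2_def upper_eq wbar_def pgl_mult det_mk2 mk2_mult)
qed

lemma map_emb:
 "map_mat2 J (A ** B) = map_mat2 J A ** map_mat2 J B" "map_mat2 J (mat c) = mat (J c)"
 "map_mat2 J (mk2 a b c' d') = mk2 (J a) (J b) (J c') (J d')" "det (map_mat2 J A) = J (det A)"
 by (simp_all add: mat2_eq_iff mat2_mult map_mat2_simps emb_add emb_mult emb_diff det_2 mat_def)

section \<open>From intertwiners to distributions and back\<close>

abbreviation H :: "complex => complex => (('e pgl2 => complex) => 'f pgl2 => complex) set" where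
 "H s t \<equiv> intertwiners J pE pF chi s eta t"

lemma H_translate:
 assumes A: "A \<in> H s t" and h: "det h ~= 0" and f: "f \<in> PS s"
 shows "A (%x. f (pgl (map_mat2 J h) * x)) g = A f (pgl h * g)"
proof -
 note i = matrix_inv_both[OF h]
 have "inverse (pgl (map_mat2 J (matrix_inv h))) = pgl (map_mat2 J h)"
  using i h by (intro pgl2_inverse_unique) (simp add: pgl_mult pgl_one map_emb emb_one flip: map_emb(1))
 moreover have "inverse (pgl (matrix_inv h)) = pgl h"
  using i h by (intro pgl2_inverse_unique) (simp add: pgl_mult pgl_one)
 moreover have "A (left_translate (pgl (map_mat2 J (matrix_inv h))) f) = left_translate (pgl (matrix_inv h)) (A f)"
  using A i(3) f unfolding intertwiners_def by blast
 ultimately show ?thesis by (simp add: left_translate_def fun_eq_iff)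
qed

lemma H_upper:
 assumes A: "A \<in> H s t" and a: "a ~= 0" and f: "f \<in> PS s"
 shows "A (%x. f (upper (J a) (J b) * x)) 1 = inverse (nu t a) * A f 1"
proof -
 have "A (%x. f (pgl (map_mat2 J (mk2 a b 0 1)) * x)) 1 = A f (pgl (mk2 a b 0 1) * 1)"
  by (rule H_translate[OF A _ f]) (simp add: det_mk2 a)
 moreover have "A f \<in> principal_series pF eta t" using A f by (simp add: intertwiners_def)
 hence "A f (1 * upper a b) = inverse (nu t a) * A f 1" using a unfolding principal_series_def by blast
 ultimately show ?thesis by (simp add: map_emb upper_eq emb_one)
qed

abbreviation Phi :: "complex => (('e pgl2 => complex) => 'f pgl2 => complex) => ('e => complex) => complex" where
 "Phi s \<equiv> intertwiner_kernel pE chi s"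

lemma Phi_eq: "\<phi> \<in> TF ==> Phi s A \<phi> = A (cell s \<phi>) 1" by (simp add: intertwiner_kernel_def)

text \<open>Equivariance evaluated at 1 becomes a condition for each \<open>upper a b\<close>:
  diagonal elements give homogeneity, unipotent ones the covariance under x/(1 + bx). In the latter
  case the test function vanishes at 1/b, so the translated section is again supported in the
  cell.\<close>

lemma Phi_in_D:
 assumes A: "A \<in> H s t" shows "Phi s A \<in> D s t" unfolding D_iff
proof (intro conjI allI ballI impI)
 have add: "!!f f'. f \<in> PS s ==> f' \<in> PS s ==> A (%g. f g + f' g) = (%g. A f g + A f' g)"
  and cm: "!!f c. f \<in> PS s ==> A (%g. c * f g) = (%g. c * A f g)" using A by (simp_all add: intertwiners_def)
 have Phi_cm: "Phi s A (%x. c * \<phi> x) = c * Phi s A \<phi>" if "\<phi> \<in> TF" for c \<phi>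
  using that by (simp add: Phi_eq test_fun_cmult cell_cmult cm cell_PS)
 show "linear_on_tf UNIV (Phi s A)" unfolding linear_on_tf_def using Phi_cm
  by (simp add: Phi_eq test_fun_add cell_add add cell_PS)
 show "Phi s A \<phi> = 0" if "\<phi> \<notin> TF" for \<phi> using that by (simp add: intertwiner_kernel_def)
 show "Phi s A (%x. \<phi> (inverse (J a) * x)) = kfac s t a * Phi s A \<phi>" if a: "a ~= 0" and \<phi>: "\<phi> \<in> TF" for a \<phi> proof -
  let ?F = "%x. cell s \<phi> (upper (J a) 0 * x)"
  have ia: "J a ~= 0" using a by simp
  have F: "?F \<in> PS s" by (rule left_mult_principal_series[OF cell_PS[OF \<phi>]])
  have p1: "phi1 ?F = (%x. inverse (ka s (J a)) * \<phi> (inverse (J a) * x))" proof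
   fix x
   have "x / J a = inverse (J a) * x" by (simp only: divide_inverse mult.commute)
   thus "phi1 ?F x = inverse (ka s (J a)) * \<phi> (inverse (J a) * x)"
    unfolding phi_diag(1)[OF cell_PS[OF \<phi>] ia] phi1_cell[OF \<phi>] by simp
  qed
  have "phi2 ?F 0 = 0" using phi_diag(2)[OF cell_PS[OF \<phi>] ia, of s 0] phi2_cell[OF \<phi>] by (simp add: pull_def)
  from PS_cell(2)[OF F this] have "?F = cell s (%x. inverse (ka s (J a)) * \<phi> (inverse (J a) * x))" unfolding p1 .
  moreover have t': "(%x. \<phi> (inverse (J a) * x)) \<in> TF" using \<phi> ia by (intro test_fun_scale) simp_all
  ultimately have "A ?F 1 = inverse (ka s (J a)) * Phi s A (%x. \<phi> (inverse (J a) * x))"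
   using Phi_cm[OF t'] Phi_eq[OF test_fun_cmult[OF t']] by simp
  hence "inverse (nu t a) * Phi s A \<phi> = inverse (ka s (J a)) * Phi s A (%x. \<phi> (inverse (J a) * x))"
   using H_upper[OF A a cell_PS[OF \<phi>], of 0] by (simp add: Phi_eq[OF \<phi>])
  moreover have "kfac s t a = ka s (J a) * inverse (nu t a)" by (simp add: kfac_def ka_mu)
  ultimately show ?thesis using ka_nonzero[OF ia, of s] by (simp add: field_simps)
 qed
 show "Phi s A (moved b \<phi>) = Phi s A (twisted s b \<phi>)" if b: "b ~= 0" and \<phi>: "\<phi> \<in> test_fun (UNIV - {inverse (J b)})" for b \<phi>
 proof -
  define \<psi> where "\<psi> = twisted s b \<phi>"
  have t: "\<psi> \<in> test_fun (UNIV - {inverse (J b)})" unfolding \<psi>_def by (rule test_fun_twisted[OF \<phi> b])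
  hence \<psi>: "\<psi> \<in> TF" "\<psi> (inverse (J b)) = 0" using test_fun_iff[of \<psi> "UNIV - {inverse (J b)}"] by auto
  let ?F = "%x. cell s \<psi> (upper (J 1) (J b) * x)"
  have F: "?F \<in> PS s" by (rule left_mult_principal_series[OF cell_PS[OF \<psi>(1)]])
  have p1: "phi1 ?F = moved b \<phi>" proof
   fix x
   show "phi1 ?F x = moved b \<phi> x" proof (cases "1 + J b * x = 0")
    case True
    thus ?thesis
     using phi_unip(2)[OF cell_PS[OF \<psi>(1)] True, of s] phi2_cell[OF \<psi>(1)] by (simp add: emb_one moved_def pull_def)
   next
    case False
    have "1 - J b * (x / (1 + J b * x)) = inverse (1 + J b * x)" using False by (simp add: field_simps)
    hence "\<psi> (x / (1 + J b * x)) = mu s (1 + J b * x) ^ 2 * \<phi> (x / (1 + J b * x))"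
     by (simp add: \<psi>_def twisted_def quasi_char_power[OF chi uniformizer_E] quasi_char_inverse[OF chi uniformizer_E] power_inverse)
    thus ?thesis using phi_unip(1)[OF cell_PS[OF \<psi>(1)] False, of s] phi1_cell[OF \<psi>(1)] False
      quasi_char_nonzero[OF chi uniformizer_E False, of "s - 1/2"] by (simp add: emb_one moved_def theta_mu)
   qed
  qed
  have "phi2 ?F 0 = 0"
   using phi_unip(3)[OF cell_PS[OF \<psi>(1)], of s "J b" 0] phi2_cell[OF \<psi>(1)] \<psi>(2) by (simp add: emb_one pull_def)
  note c = PS_cell[OF F this, unfolded p1]
  have "A ?F 1 = Phi s A \<psi>"
   using H_upper[OF A _ cell_PS[OF \<psi>(1)], of 1 b] quasi_char_one[OF eta] by (simp add: Phi_eq[OF \<psi>(1)])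
  thus ?thesis using c by (simp add: Phi_eq \<psi>_def)
 qed
qed

lemma ext_pull:
 assumes u: "covariant s t u" and \<phi>: "\<phi> \<in> TF0" shows "ext s u (pull s \<phi>) = u \<phi>"
 using covariant_off_zero[OF assms] inV_vhat_eq[OF test_fun_pull_UNIV[OF \<phi>] inV_ext[OF u]] by simp

text \<open>Glues \<open>u\<close> in the chart x to \<open>ext s u\<close> in the chart w along the
  cut \<open>pw k\<close>, whose complement inversion carries into
  \<open>pw (1 - k)\<close>.\<close>

definition ellk :: "complex => (('e => complex) => complex) => int => ('e pgl2 => complex) => complex" where
 "ellk s u k f = u (%x. phi1 f x * ball_ind 0 k x) + ext s u (%y. phi2 f y * ball_ind 0 (1 - k) y)"

lemma test_fun_cut: "locally_constant h ==> (%x. h x * ball_ind (0::'e) k x) \<in> TF"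
 by (rule test_fun_mult[OF test_fun_ball_ind_UNIV]) (simp add: locally_constant_pw)

lemma test_fun_PS:
 assumes "f \<in> PS s" shows "(%x. phi1 f x * ball_ind 0 k x) \<in> TF" "(%x. phi2 f x * ball_ind 0 k x) \<in> TF"
 using test_fun_cut PS_locally_constant[OF assms] by blast+

text \<open>Moving the cut hands a function vanishing near 0 from one chart to the other, and on
  such functions \<open>u\<close> and \<open>ext s u\<close> agree by
  \<open>ext_pull\<close>.\<close>

lemma ellk_step:
 assumes u: "covariant s t u" and f: "f \<in> PS s" shows "ellk s u (k + 1) f = ellk s u k f"
proof -
 define \<phi> where "\<phi> = (%x. phi1 f x * ball_ind 0 k x - phi1 f x * ball_ind 0 (k + 1) x)"
 have t: "\<phi> \<in> TF0" using test_fun_diff[OF test_fun_PS(1)[OF f, of k] test_fun_PS(1)[OF f, of "k + 1"]]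
  unfolding \<phi>_def by (subst test_fun_iff) (simp add: ball_ind_def)
 have lin: "linear_on_tf UNIV u" "linear_on_tf UNIV (ext s u)"
  using u inV_linear[OF inV_ext[OF u]] by (simp_all add: covariant_def)
 have 1: "u \<phi> = u (%x. phi1 f x * ball_ind 0 k x) - u (%x. phi1 f x * ball_ind 0 (k + 1) x)"
  unfolding \<phi>_def by (rule linear_on_tf_diff[OF lin(1) test_fun_PS(1)[OF f] test_fun_PS(1)[OF f]])
 have "(%y. phi2 f y * ball_ind 0 (1 - (k + 1)) y) = (%y. phi2 f y * ball_ind 0 (1 - k) y + pull s \<phi> y)" proof
  fix y
  show "phi2 f y * ball_ind 0 (1 - (k + 1)) y = phi2 f y * ball_ind 0 (1 - k) y + pull s \<phi> y" proof (cases "y = 0")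
   case False
   have "pull s \<phi> y = phi2 f y * (ball_ind 0 k (inverse y) - ball_ind 0 (k + 1) (inverse y))"
    using PS_glue[OF f False] by (simp add: pull_def \<phi>_def algebra_simps)
   thus ?thesis using False by (auto simp: ball_ind_def pw_def val_inverse)
  qed (simp add: pull_def ball_ind_def)
 qed
 hence "ext s u (%y. phi2 f y * ball_ind 0 (1 - (k + 1)) y) = ext s u (%y. phi2 f y * ball_ind 0 (1 - k) y) + u \<phi>"
  using linear_on_tf_add[OF lin(2) test_fun_PS(2)[OF f] test_fun_pull_UNIV[OF t]] ext_pull[OF u t] by simp
 thus ?thesis unfolding ellk_def 1 by simp
qed

lemma ellk_eq: "covariant s t u ==> f \<in> PS s ==> ellk s u k f = ellk s u 0 f"
proof (induction k rule: int_induct[where k = 0])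
 case (step1 i)
 thus ?case using ellk_step[of s t u f i] by simp
next
 case (step2 i)
 thus ?case using ellk_step[of s t u f "i - 1"] by simp
qed simp

lemma ellk_linear:
 assumes u: "covariant s t u" and f: "f \<in> PS s" "f' \<in> PS s"
 shows "ellk s u k (%g. f g + f' g) = ellk s u k f + ellk s u k f'" "ellk s u k (%g. c * f g) = c * ellk s u k f"
proof -
 have lin: "linear_on_tf UNIV u" "linear_on_tf UNIV (ext s u)"
  using u inV_linear[OF inV_ext[OF u]] by (simp_all add: covariant_def)
 show "ellk s u k (%g. f g + f' g) = ellk s u k f + ellk s u k f'"
  using linear_on_tf_add[OF lin(1) test_fun_PS(1)[OF f(1)] test_fun_PS(1)[OF f(2)]]
   linear_on_tf_add[OF lin(2) test_fun_PS(2)[OF f(1)] test_fun_PS(2)[OF f(2)]]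
  by (simp add: ellk_def phi_linear distrib_right)
 show "ellk s u k (%g. c * f g) = c * ellk s u k f"
  using linear_on_tf_cmult[OF lin(1) test_fun_PS(1)[OF f(1)]] linear_on_tf_cmult[OF lin(2) test_fun_PS(2)[OF f(1)]]
  by (simp add: ellk_def phi_linear mult.assoc distrib_left)
qed

text \<open>The dilation moves the cut from 0 to \<open>?k\<close>, which \<open>ellk_eq\<close>
  permits, and the two charts scale by the same factor.\<close>

lemma ellk_diag:
 assumes u: "covariant s t u" "u \<in> D s t" and f: "f \<in> PS s" and a: "a ~= 0"
 shows "ellk s u 0 (%x. f (upper (J a) 0 * x)) = inverse (nu t a) * ellk s u 0 f"
proof -
 let ?F = "%x. f (upper (J a) 0 * x)" and ?k = "- (e * val a)"
 have ia: "J a ~= 0" using a by simp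
 have lin: "linear_on_tf UNIV u" "linear_on_tf UNIV (ext s u)"
  using u inV_linear[OF inV_ext[OF u(1)]] by (simp_all add: covariant_def)
 have sc: "\<forall>a. a ~= 0 --> (\<forall>\<phi>\<in>TF. u (%x. \<phi> (inverse (J a) * x)) = kfac s t a * u \<phi>)" using u(2) unfolding D_iff by blast
 let ?p = "%x. phi1 f x * ball_ind 0 ?k x" and ?r = "%y. phi2 f y * ball_ind 0 (1 - ?k) y"
 have b1: "ball_ind 0 0 x = ball_ind 0 ?k (inverse (J a) * x)" for x
  using a by (simp add: ball_ind_def pw_mult_iff val_inverse val_emb)
 have b2: "ball_ind 0 (1 - 0) y = ball_ind 0 (1 - ?k) (J a * y)" for y
  using a by (simp add: ball_ind_def pw_mult_iff val_emb)
 have "(%x. phi1 ?F x * ball_ind 0 0 x) = (%x. inverse (ka s (J a)) * ?p (inverse (J a) * x))" proof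
  fix x
  have "x / J a = inverse (J a) * x" by (simp only: divide_inverse mult.commute)
  thus "phi1 ?F x * ball_ind 0 0 x = inverse (ka s (J a)) * ?p (inverse (J a) * x)"
   unfolding phi_diag(1)[OF f ia] b1 by simp
 qed
 hence "u (%x. phi1 ?F x * ball_ind 0 0 x) = inverse (ka s (J a)) * u (%x. ?p (inverse (J a) * x))"
  using linear_on_tf_cmult[OF lin(1) test_fun_scale[OF test_fun_PS(1)[OF f], of "inverse (J a)"]] ia by simp
 also have "u (%x. ?p (inverse (J a) * x)) = kfac s t a * u ?p" by (rule sc[rule_format, OF a test_fun_PS(1)[OF f]])
 finally have 1: "u (%x. phi1 ?F x * ball_ind 0 0 x) = inverse (ka s (J a)) * kfac s t a * u ?p" by simp
 have "(%y. phi2 ?F y * ball_ind 0 (1 - 0) y) = (%y. ka s (J a) * ?r (J a * y))"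
  unfolding phi_diag(2)[OF f ia] b2 by (simp add: mult_ac)
 hence "ext s u (%y. phi2 ?F y * ball_ind 0 (1 - 0) y) = ka s (J a) * ext s u (%y. ?r (J a * y))"
  using linear_on_tf_cmult[OF lin(2) test_fun_scale[OF test_fun_PS(2)[OF f] ia]] by simp
 also have "ext s u (%y. ?r (J a * y)) = of_real (inverse (absv (J a))) * inverse (\<sigma> (zz s t) a) * ext s u ?r"
  by (rule inV_scale[OF inV_ext[OF u(1)] test_fun_PS(2)[OF f] a])
 also have "ka s (J a) * (of_real (inverse (absv (J a))) * inverse (\<sigma> (zz s t) a) * ext s u ?r) =
   inverse (ka s (J a)) * kfac s t a * ext s u ?r"
  using ka_nonzero[OF ia, of s] unfolding kfac_sigma[OF a] theta_def by (simp add: power2_eq_square)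
 finally have 2: "ext s u (%y. phi2 ?F y * ball_ind 0 (1 - 0) y) = inverse (ka s (J a)) * kfac s t a * ext s u ?r" .
 have "kfac s t a = ka s (J a) * inverse (nu t a)" by (simp add: kfac_def ka_mu)
 hence 3: "inverse (ka s (J a)) * kfac s t a = inverse (nu t a)" using ka_nonzero[OF ia, of s] by simp
 have "ellk s u 0 ?F = inverse (nu t a) * ellk s u ?k f" unfolding ellk_def 1 2 3 by (simp add: distrib_left)
 thus ?thesis using ellk_eq[OF u(1) f] by simp
qed

text \<open>With the cut close enough to 0 the unipotent element has no effect on the x part; in the
  w part it is translation by \<open>J b\<close>, under which the ball \<open>pw (1 - k)\<close> is
  stable.\<close>

lemma ellk_unip:
 assumes u: "covariant s t u" and f: "f \<in> PS s" shows "ellk s u 0 (%x. f (upper 1 (J b) * x)) = ellk s u 0 f"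
proof -
 let ?F = "%x. f (upper 1 (J b) * x)"
 have F: "?F \<in> PS s" by (rule left_mult_principal_series[OF f])
 obtain n1 where n1: "!!y. y - 0 \<in> pw n1 ==> phi1 f y = phi1 f 0"
  using locally_constantE[OF PS_locally_constant(1)[OF f]] by blast
 obtain n0 where n0: "n0 \<ge> 1" "!!s h. h \<in> pw n0 ==> gg s (1 + h) = 1" using gg_near by metis
 obtain r where r: "J b \<in> pw r" using in_some_pw by blast
 define k where "k = max n1 (max (n0 - r) (1 - r))"
 have "(%x. phi1 ?F x * ball_ind 0 k x) = (%x. phi1 f x * ball_ind 0 k x)" proof
  fix x
  show "phi1 ?F x * ball_ind 0 k x = phi1 f x * ball_ind 0 k x" proof (cases "x \<in> pw k")
   case True
   have h: "J b * x \<in> pw n0" using pw_mono[OF _ pw_mult[OF r True], of n0] by (simp add: k_def)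
   note unit = one_plus_pw[OF h n0(1)]
   have "(1 + J b * x) * (x / (1 + J b * x)) \<in> pw k" using True unit(1) by simp
   hence "x / (1 + J b * x) \<in> pw k" unfolding pw_mult_iff[OF unit(1)] by (simp add: unit(2))
   hence "x / (1 + J b * x) \<in> pw n1" "x \<in> pw n1" using True by (auto simp: k_def elim!: pw_mono[rotated])
   hence "phi1 f (x / (1 + J b * x)) = phi1 f x" using n1[of "x / (1 + J b * x)"] n1[of x] by simp
   thus ?thesis using phi_unip(1)[OF f unit(1)] n0(2)[OF h] by simp
  qed (simp add: ball_ind_def)
 qed
 moreover have "(%y. phi2 ?F y * ball_ind 0 (1 - k) y) = (%y. phi2 f (y + J b) * ball_ind 0 (1 - k) (y + J b))" proof
  fix y
  have "J b \<in> pw (1 - k)" by (rule pw_mono[OF _ r]) (simp add: k_def)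
  thus "phi2 ?F y * ball_ind 0 (1 - k) y = phi2 f (y + J b) * ball_ind 0 (1 - k) (y + J b)"
   using phi_unip(3)[OF f] by (simp add: ball_ind_def pw_add_cancel)
 qed
 ultimately have "ellk s u k ?F = ellk s u k f"
  using inV_shift[OF inV_ext[OF u] test_fun_PS(2)[OF f, of "1 - k"], of b] by (simp add: ellk_def)
 thus ?thesis using ellk_eq[OF u f, of k] ellk_eq[OF u F, of k] by simp
qed

text \<open>The two integral charts \<open>pw 0\<close> cover the projective line, and on them the
  chart functions are uniformly locally constant; hence one congruence subgroup fixes
  \<open>f\<close>. Local constancy of \<open>AA\<close> requires such a neighbourhood valid for all
  arguments \<open>g\<close>.\<close>

lemma PS_smooth:
 assumes f: "f \<in> PS s"
 obtains n where "n \<ge> 1" "!!K g. (!!i j. K$i$j - (mat 1 :: 'e^2^2)$i$j \<in> pw n) ==> det K ~= 0 & f (pgl K * g) = f g"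
proof -
 obtain n1 m1 where n1: "periodic n1 (%x. phi1 f x * ball_ind 0 0 x)" "supported m1 (%x. phi1 f x * ball_ind 0 0 x)"
  using test_funE[OF test_fun_PS(1)[OF f]] by blast
 obtain n2 m2 where n2: "periodic n2 (%x. phi2 f x * ball_ind 0 0 x)" "supported m2 (%x. phi2 f x * ball_ind 0 0 x)"
  using test_funE[OF test_fun_PS(2)[OF f]] by blast
 obtain n0 where n0: "n0 \<ge> 1" "!!h. h \<in> pw n0 ==> chi (1 + h) = 1"
  using unit_character_trivial_near_one[OF chi] by blast
 obtain n' where n': "!!K. (!!i j. K$i$j - (mat 1 :: 'e^2^2)$i$j \<in> pw n') ==> det K - det (mat 1 :: 'e^2^2) \<in> pw n0"
  using det_near[of "mat 1 :: 'e^2^2" n0] by blast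
 define n where "n = max (max n1 n2) (max n0 n')"
 have n: "n \<ge> n1" "n \<ge> n2" "n \<ge> n0" "n \<ge> n'" "n \<ge> 1" using n0(1) by (auto simp: n_def)
 have ka1: "ka s dt = 1" "dt ~= 0" if "dt - 1 \<in> pw n0" for dt
  using n0(2)[OF that] quasi_char_unit[OF one_plus_pw(3)[OF that n0(1)]] one_plus_pw(1)[OF that n0(1)] by simp_all
 have gg1: "gg s dt = 1" if "dt - 1 \<in> pw n" for dt using ka1(1)[of dt] pw_mono[OF n(3) that] by (simp add: theta_def)
 show thesis proof (rule that[OF n(5)])
  fix K :: "'e^2^2" and g
  assume K: "!!i j. K$i$j - (mat 1 :: 'e^2^2)$i$j \<in> pw n"
  have "det K - det (mat 1 :: 'e^2^2) \<in> pw n0" by (rule n') (rule pw_mono[OF n(4) K])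
  hence dK: "ka s (det K) = 1" "det K ~= 0" using ka1 by (simp_all add: det_I)
  have k: "K$1$1 - 1 \<in> pw n" "K$1$2 \<in> pw n" "K$2$1 \<in> pw n" "K$2$2 - 1 \<in> pw n"
   using K[of 1 1] K[of 1 2] K[of 2 1] K[of 2 2] by (simp_all add: mat_def)
  obtain A :: "'e^2^2" where A: "det A ~= 0" "g = pgl A" by (rule pgl_cases)
  define a b c dd where "a = A$1$1" and "b = A$1$2" and "c = A$2$1" and "dd = A$2$2"
  have Ae: "A = mk2 a b c dd" unfolding a_def b_def c_def dd_def by (rule mk2_eta)
  have dt: "a * dd - b * c ~= 0" using A(1) by (simp add: Ae det_mk2)
  define a' b' c' d' where "a' = K$1$1 * a + K$1$2 * c" and "b' = K$1$1 * b + K$1$2 * dd"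
   and "c' = K$2$1 * a + K$2$2 * c" and "d' = K$2$1 * b + K$2$2 * dd"
  have KA: "K ** A = mk2 a' b' c' d'" by (simp add: mat2_eq_iff mat2_mult Ae a'_def b'_def c'_def d'_def)
  have D': "a' * d' - b' * c' = det K * (a * dd - b * c)" using det_mul[of K A] unfolding KA by (simp add: Ae det_mk2)
  hence D'0: "a' * d' - b' * c' ~= 0" using dK(2) dt by simp
  have gK: "pgl K * g = pgl (mk2 a' b' c' d')" using dK(2) A by (simp add: pgl_mult KA)
  have kD: "ka s (a' * d' - b' * c') = ka s (a * dd - b * c)" unfolding D' ka_mult dK(1) by simp
  have "f (pgl K * g) = f g" proof (cases "a ~= 0 & c / a \<in> pw 0")
   case True
   hence a0: "a ~= 0" and x: "c / a \<in> pw 0" by auto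
   note mo = moebius_near[OF n(5) x k]
   have a': "a' = a * (K$1$1 + K$1$2 * (c / a))" and c': "c' = a * (K$2$1 + K$2$2 * (c / a))"
    using a0 by (simp_all add: a'_def c'_def distrib_left)
   hence a'0: "a' ~= 0" using a0 mo(2) by simp
   have "c' / a' = (K$2$1 + K$2$2 * (c / a)) / (K$1$1 + K$1$2 * (c / a))"
    unfolding a' c' by (rule nonzero_mult_divide_mult_cancel_left[OF a0])
   hence "c' / a' - c / a \<in> pw n1" "c' / a' \<in> pw 0" using mo(3,4) pw_mono[OF n(1)] by simp_all
   hence "phi1 f (c' / a') = phi1 f (c / a)"
    using periodicD[OF n1(1), of "c' / a'" "c / a"] x by (simp add: ball_ind_def)
   moreover have "gg s a' = gg s a" unfolding a' theta_mult using gg1[OF mo(1)] by simp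
   ultimately show ?thesis unfolding gK unfolding A(2) Ae PS_value1[OF f D'0 a'0] PS_value1[OF f dt a0] kD by simp
  next
   case False
   have c0: "c ~= 0" using False dt by auto
   have x: "a / c \<in> pw 0" proof (cases "a = 0")
    case False
    hence "c / a \<notin> pw 0" using \<open>\<not> (a ~= 0 & c / a \<in> pw 0)\<close> by blast
    thus ?thesis using False c0 by (auto simp: pw_def val_divide)
   qed simp
   note mo = moebius_near[OF n(5) x k(4,3,2,1)]
   have c': "c' = c * (K$2$2 + K$2$1 * (a / c))" and a': "a' = c * (K$1$2 + K$1$1 * (a / c))"
    using c0 by (simp_all add: a'_def c'_def distrib_left)
   hence c'0: "c' ~= 0" using c0 mo(2) by simp
   have "a' / c' = (K$1$2 + K$1$1 * (a / c)) / (K$2$2 + K$2$1 * (a / c))"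
    unfolding a' c' by (rule nonzero_mult_divide_mult_cancel_left[OF c0])
   hence "a' / c' - a / c \<in> pw n2" "a' / c' \<in> pw 0" using mo(3,4) pw_mono[OF n(2)] by simp_all
   hence "phi2 f (a' / c') = phi2 f (a / c)"
    using periodicD[OF n2(1), of "a' / c'" "a / c"] x by (simp add: ball_ind_def)
   moreover have "gg s c' = gg s c" unfolding c' theta_mult using gg1[OF mo(1)] by simp
   ultimately show ?thesis unfolding gK unfolding A(2) Ae PS_value2[OF f D'0 c'0] PS_value2[OF f dt c0] kD by simp
  qed
  thus "det K ~= 0 & f (pgl K * g) = f g" using dK(2) by simp
 qed
qed

definition embp :: "'f pgl2 => 'e pgl2" where
 "embp g = pgl (map_mat2 J (SOME h. det h ~= 0 & g = pgl h))"

lemma embp_pgl: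
 assumes h: "det h ~= 0" shows "embp (pgl h) = pgl (map_mat2 J h)"
proof -
 have "\<exists>B. det B ~= 0 & pgl h = pgl B" using h by blast
 from someI_ex[OF this] obtain B where B: "det B ~= 0" "pgl h = pgl B" "embp (pgl h) = pgl (map_mat2 J B)"
  unfolding embp_def by blast
 obtain c where "c ~= 0" "B = mat c ** h" using B(2) pgl_eq_iff[OF h B(1)] by blast
 thus ?thesis using B(3) h by (simp add: map_emb pgl_scale)
qed

lemma embp_mult: "embp (g * h) = embp g * embp h"
proof -
 obtain A where A: "det A ~= 0" "g = pgl A" by (rule pgl_cases)
 obtain B where B: "det B ~= 0" "h = pgl B" by (rule pgl_cases)
 show ?thesis using A B by (simp add: pgl_mult embp_pgl map_emb det_mul)
qed

lemma embp_one: "embp 1 = 1" using embp_pgl[of "mat 1"] by (simp add: pgl_one map_emb emb_one)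

lemma embp_inverse: "embp (inverse g) = inverse (embp g)"
 by (rule pgl2_inverse_unique[symmetric]) (simp add: pgl2_inverse embp_one flip: embp_mult)

lemma embp_upper: "a ~= 0 ==> embp (upper a b) = upper 1 (J b) * upper (J a) 0"
 unfolding upper_eq by (subst embp_pgl) (simp_all add: det_mk2 map_emb emb_one pgl_mult mk2_mult)

text \<open>Frobenius reciprocity: an intertwiner is determined by its values at 1, and its value at
  g is the value at 1 on the translate by g.\<close>

definition AA :: "complex => (('e => complex) => complex) => ('e pgl2 => complex) => 'f pgl2 => complex" where
 "AA s u f g = (if f \<in> PS s then ellk s u 0 (%x. f (embp g * x)) else 0)"

lemma AA_in_H:
 assumes u: "u \<in> D s t" shows "AA s u \<in> H s t"
proof -
 note cov = D_covariant[OF u]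
 have PSm: "(%x. f (g * x)) \<in> PS s" if "f \<in> PS s" for f g by (rule left_mult_principal_series[OF that])
 have "AA s u f \<in> principal_series pF eta t" if f: "f \<in> PS s" for f proof -
  have "AA s u f (g * upper a b) = inverse (nu t a) * AA s u f g" if a: "a ~= 0" for g a b proof -
   let ?F = "%x. f (embp g * x)"
   have "ellk s u 0 (%x. ?F (upper 1 (J b) * (upper (J a) 0 * x))) = inverse (nu t a) * ellk s u 0 (%x. ?F (upper 1 (J b) * x))"
    by (rule ellk_diag[OF cov u PSm[OF PSm[OF f]] a])
   also have "ellk s u 0 (%x. ?F (upper 1 (J b) * x)) = ellk s u 0 ?F" by (rule ellk_unip[OF cov PSm[OF f]])
   finally show ?thesis using f a by (simp add: AA_def embp_mult embp_upper mult.assoc)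
  qed
  moreover have "locally_constant (AA s u f)" unfolding locally_constant_pgl2 proof (intro allI impI)
   fix h :: "'f^2^2" assume h: "det h ~= 0"
   note hi = matrix_inv_both[OF h]
   obtain n where n: "n \<ge> 1" "!!K g. (!!i j. K$i$j - (mat 1 :: 'e^2^2)$i$j \<in> pw n) ==>
     det K ~= 0 & f (embp (pgl h) * (pgl K * g)) = f (embp (pgl h) * g)"
    using PS_smooth[OF PSm[OF f, of "embp (pgl h)"]] by blast
   obtain r where r: "!!i j. (matrix_inv h)$i$j \<in> pw r" using mat2_bounded by blast
   show "\<exists>m. \<forall>A. mnear m A h --> det A ~= 0 & AA s u f (pgl A) = AA s u f (pgl h)"
   proof (intro exI[of _ "n - r"] allI impI)
    fix A assume A: "mnear (n - r) A h"
    \<comment> \<open>Factoring \<open>A = h ** K\<close> isolates a matrix \<open>K\<close> near 1,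
      to which \<open>PS_smooth\<close> for the translate by \<open>h\<close> applies.\<close>
    define K where "K = matrix_inv h ** A"
    have hK: "h ** K = A" by (simp add: K_def matrix_mul_assoc hi)
    have "K$i$j - (mat 1 :: 'f^2^2)$i$j \<in> pw n" for i j proof -
     have "(matrix_inv h)$i$k * (A$k$j - h$k$j) \<in> pw (r + (n - r))" for k using A by (intro pw_mult r) blast
     hence "(matrix_inv h)$i$1 * (A$1$j - h$1$j) + (matrix_inv h)$i$2 * (A$2$j - h$2$j) \<in> pw n"
      by (intro pw_add) simp_all
     moreover have "(mat 1 :: 'f^2^2)$i$j = (matrix_inv h)$i$1 * h$1$j + (matrix_inv h)$i$2 * h$2$j"
      unfolding hi(2)[symmetric] by (rule mat2_mult)
     ultimately show ?thesis by (simp add: K_def mat2_mult algebra_simps)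
    qed
    moreover have "n \<le> e * n" using e_pos n(1) mult_right_mono[of 1 e n] by simp
    ultimately have "J (K$i$j - (mat 1 :: 'f^2^2)$i$j) \<in> pw n" for i j
     using pw_mono[of n "e * n" "J (K$i$j - (mat 1 :: 'f^2^2)$i$j)"] by (simp add: pw_emb)
    hence "(map_mat2 J K)$i$j - (mat 1 :: 'e^2^2)$i$j \<in> pw n" for i j proof -
     have "(mat 1 :: 'e^2^2)$i$j = J ((mat 1 :: 'f^2^2)$i$j)" by (simp add: mat_def emb_one)
     thus ?thesis
      using \<open>J (K$i$j - (mat 1 :: 'f^2^2)$i$j) \<in> pw n\<close> by (simp only: map_mat2_simps emb_diff)
    qed
    hence K: "det (map_mat2 J K) ~= 0 & f (embp (pgl h) * (pgl (map_mat2 J K) * g)) = f (embp (pgl h) * g)" for g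
     by (intro n(2))
    hence dK: "det K ~= 0" by (simp add: map_emb)
    have "embp (pgl A) = embp (pgl h) * pgl (map_mat2 J K)"
     using embp_mult[of "pgl h" "pgl K"] h dK by (simp add: pgl_mult hK embp_pgl)
    moreover have "det A ~= 0" using h dK unfolding hK[symmetric] by (simp add: det_mul)
    ultimately show "det A ~= 0 & AA s u f (pgl A) = AA s u f (pgl h)" using K by (simp add: AA_def mult.assoc)
   qed
  qed
  ultimately show ?thesis by (simp add: principal_series_def)
 qed
 moreover have "AA s u (left_translate (pgl (map_mat2 J h)) f) = left_translate (pgl h) (AA s u f)"
  if h: "det h ~= 0" and f: "f \<in> PS s" for h f proof
  fix g
  have "left_translate (pgl (map_mat2 J h)) f \<in> PS s" unfolding left_translate_def by (rule PSm[OF f])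
  moreover have "embp (inverse (pgl h) * g) = inverse (pgl (map_mat2 J h)) * embp g"
   using h by (simp add: embp_mult embp_inverse embp_pgl)
  ultimately show "AA s u (left_translate (pgl (map_mat2 J h)) f) g = left_translate (pgl h) (AA s u f) g"
   using f by (simp add: AA_def left_translate_def mult.assoc)
 qed
 moreover have "AA s u (%g. f g + f' g) = (%g. AA s u f g + AA s u f' g)" if f: "f \<in> PS s" "f' \<in> PS s" for f f'
  using principal_series_linear(1)[OF f] f ellk_linear(1)[OF cov PSm[OF f(1)] PSm[OF f(2)]] by (simp add: AA_def fun_eq_iff)
 moreover have "AA s u (%g. c * f g) = (%g. c * AA s u f g)" if f: "f \<in> PS s" for c f
  using principal_series_linear(2)[OF f f] f ellk_linear(2)[OF cov PSm[OF f] PSm[OF f]] by (simp add: AA_def fun_eq_iff)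
 moreover have "AA s u f = (%g. 0)" if "f \<notin> PS s" for f using that by (simp add: AA_def fun_eq_iff)
 ultimately show ?thesis unfolding intertwiners_def by blast
qed

text \<open>For a section supported in the cell, a cut enclosing the support of \<phi> leaves only
  the x part, which is \<open>u \<phi>\<close>.\<close>

lemma Phi_AA:
 assumes u: "u \<in> D s t" shows "Phi s (AA s u) = u"
proof
 fix \<phi>
 show "Phi s (AA s u) \<phi> = u \<phi>" proof (cases "\<phi> \<in> TF")
  case False
  thus ?thesis using u by (simp add: D_iff intertwiner_kernel_def)
 next
  case True
  note cov = D_covariant[OF u] and P = cell_PS[OF True, of s]
  obtain n m where nm: "periodic n \<phi>" "supported m \<phi>" using True by (rule test_funE)
  have "(%x. \<phi> x * ball_ind 0 m x) = \<phi>" using nm(2) by (auto simp: fun_eq_iff ball_ind_def supported_def)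
  moreover have "(%y. pull s \<phi> y * ball_ind 0 (1 - m) y) = (%y. 0)" proof
   fix y
   show "pull s \<phi> y * ball_ind 0 (1 - m) y = 0" proof (cases "y ~= 0 & y \<in> pw (1 - m)")
    case True
    hence "inverse y \<notin> pw m" by (auto simp: pw_def val_inverse)
    thus ?thesis using nm(2) by (simp add: pull_def supported_def)
   qed (auto simp: pull_def ball_ind_def)
  qed
  ultimately have "ellk s u m (cell s \<phi>) = u \<phi>"
   using linear_on_tf_zero[OF inV_linear[OF inV_ext[OF cov]]] by (simp add: ellk_def phi1_cell[OF True] phi2_cell[OF True])
  thus ?thesis using ellk_eq[OF cov P, of m] P by (simp add: Phi_eq[OF True] AA_def embp_one)
 qed
qed

text \<open>Cut \<open>f\<close> at level 0. The part near x = 0 is a cell section, on which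
  \<open>A\<close> is given by \<open>Phi\<close>. The remainder has a zero on F in the chart w, and
  a unipotent translation moves it to infinity, so the remainder becomes a cell section too; its
  value is then that of \<open>ext\<close>.\<close>

lemma H_value_one:
 assumes A: "A \<in> H s t" and f: "f \<in> PS s" shows "A f 1 = ellk s (Phi s A) 0 f"
proof -
 define u where "u = Phi s A"
 note dt = Phi_in_D[OF A, folded u_def]
 note cov = D_covariant[OF dt]
 have add: "!!f f'. f \<in> PS s ==> f' \<in> PS s ==> A (%g. f g + f' g) = (%g. A f g + A f' g)"
  using A by (simp add: intertwiners_def)
 define \<phi> where "\<phi> = (%x. phi1 f x * ball_ind 0 0 x)"
 define \<psi> where "\<psi> = (%y. phi2 f y * ball_ind 0 (1 - 0) y)"
 have t: "\<phi> \<in> TF" "\<psi> \<in> TF" unfolding \<phi>_def \<psi>_def by (rule test_fun_PS[OF f])+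
 define f2 where "f2 = (%g. f g + (- 1) * cell s \<phi> g)"
 have f2: "f2 \<in> PS s"
  unfolding f2_def by (rule principal_series_linear(1)[OF f principal_series_linear(2)[OF cell_PS[OF t(1)] f]])
 have p2: "phi2 f2 = \<psi>" proof
  fix y
  have "phi2 f2 y = phi2 f y - pull s \<phi> y" unfolding f2_def phi_linear phi2_cell[OF t(1)] by simp
  also have "\<dots> = \<psi> y" proof (cases "y = 0")
   case False
   have "pull s \<phi> y = phi2 f y * ball_ind 0 0 (inverse y)" using PS_glue[OF f False] by (simp add: pull_def \<phi>_def)
   thus ?thesis using False by (auto simp: \<psi>_def ball_ind_def pw_def val_inverse)
  qed (simp add: \<psi>_def ball_ind_def pull_def)
  finally show "phi2 f2 y = \<psi> y" .
 qed
 have p1: "phi1 f2 0 = 0" unfolding f2_def phi_linear phi1_cell[OF t(1)] by (simp add: \<phi>_def ball_ind_def)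
 obtain b where b: "\<psi> (J b) = 0" using ex_common_zero[OF t(2) t(2)] by blast
 let ?F = "%x. f2 (upper (J 1) (J b) * x)"
 have F: "?F \<in> PS s" by (rule left_mult_principal_series[OF f2])
 have F2: "phi2 ?F y = \<psi> (y + J b)" for y using phi_unip(3)[OF f2, of "J b" y] by (simp add: emb_one p2)
 have F1: "phi1 ?F = push s (%w. \<psi> (w + J b))" proof
  fix x
  show "phi1 ?F x = push s (%w. \<psi> (w + J b)) x" proof (cases "x = 0")
   case True
   thus ?thesis using phi_unip(1)[OF f2, of "J b" 0] p1 by (simp add: emb_one push_def)
  next
   case False
   have "push s (phi2 ?F) x = push s (pull s (phi1 ?F)) x"
    using PS_glue[OF F, of "inverse x"] False by (simp add: push_def)
   also have "\<dots> = phi1 ?F x" using False theta_nonzero[of "inverse x" s] by (simp add: push_def pull_def)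
   finally show ?thesis unfolding F2[abs_def] by simp
  qed
 qed
 have "phi2 ?F 0 = 0" using F2[of 0] b by simp
 note c = PS_cell[OF F this, unfolded F1]
 have "A f2 1 = A ?F 1" using H_upper[OF A _ f2, of 1 b] quasi_char_one[OF eta] by simp
 also have "\<dots> = u (push s (%w. \<psi> (w + J b)))" using c(2) Phi_eq[OF c(1), of s A] by (simp add: u_def)
 also have "\<dots> = ext s u \<psi>" by (rule ext_eq[OF cov t(2) b, symmetric])
 finally have 2: "A f2 1 = ext s u \<psi>" .
 have "f = (%g. cell s \<phi> g + f2 g)" by (simp add: f2_def)
 hence "A f 1 = A (cell s \<phi>) 1 + A f2 1" using add[OF cell_PS[OF t(1)] f2] by metis
 thus ?thesis using 2 Phi_eq[OF t(1), of s A] by (simp add: ellk_def u_def \<phi>_def \<psi>_def)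
qed

lemma AA_Phi:
 assumes A: "A \<in> H s t" shows "AA s (Phi s A) = A"
proof (intro ext)
 fix f g
 show "AA s (Phi s A) f g = A f g" proof (cases "f \<in> PS s")
  case False
  hence "A f = (%g. 0)" using A by (simp add: intertwiners_def)
  thus ?thesis using False by (simp add: AA_def)
 next
  case True
  obtain h where h: "det h ~= 0" "g = pgl h" by (rule pgl_cases)
  have "A f g = A (%x. f (embp g * x)) 1" using H_translate[OF A h(1) True, of 1] h by (simp add: embp_pgl)
  thus ?thesis using True H_value_one[OF A left_mult_principal_series[OF True]] by (simp add: AA_def)
 qed
qed

theorem bij_betw_Phi: "bij_betw (Phi s) (H s t) (D s t)"
 by (rule bij_betw_byWitness[where f' = "AA s"]) (auto simp: AA_Phi Phi_AA Phi_in_D AA_in_H)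

lemma Phi_linear:
 "Phi s (%f g. A f g + B f g) = (%\<phi>. Phi s A \<phi> + Phi s B \<phi>)" "Phi s (%f g. c * A f g) = (%\<phi>. c * Phi s A \<phi>)"
 by (simp_all add: intertwiner_kernel_def fun_eq_iff)

end

lemma ex_kernel_setting:
 assumes "quadratic_local_extension \<iota> d \<alpha> pF pE" "normalized_haar M" "unit_character chi" "unit_character eta"
 obtains \<beta> e where "kernel_setting \<iota> d \<alpha> pF pE \<beta> e M chi eta"
proof -
 interpret quadratic_local_extension \<iota> d \<alpha> pF pE by fact
 show thesis proof (cases "unramified \<iota>")
  case True
  then obtain \<beta> where "lattice_extension \<iota> \<beta> 1" by (rule unramified_lattice)
  hence "kernel_setting \<iota> d \<alpha> pF pE \<beta> 1 M chi eta"
   using assms True by (intro kernel_setting.intro kernel_setting_axioms.intro) (auto simp: ram_def)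
  thus ?thesis by (rule that)
 next
  case False
  hence "kernel_setting \<iota> d \<alpha> pF pE \<alpha> 2 M chi eta" using assms ramified_lattice(1)[OF False]
   by (intro kernel_setting.intro kernel_setting_axioms.intro) (auto simp: ram_def)
  thus ?thesis by (rule that)
 qed
qed

theorem theoremC:
 fixes \<iota> :: "'f::nonarch_local_field \<Rightarrow> 'e::nonarch_local_field"
  and d pF :: 'f and \<alpha> pE :: 'e and dx :: "'e measure"
  and chi :: "'e \<Rightarrow> complex" and eta :: "'f \<Rightarrow> complex" and s t :: complex
 assumes "quadratic_local_extension \<iota> d \<alpha> pF pE" and "normalized_haar dx"
  and "unit_character chi" and "unit_character eta" shows "let H = intertwiners \<iota> pE pF chi s eta t;
       D = invariant_distributions \<iota> pE pF chi s eta t;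
       \<Phi> = intertwiner_kernel pE chi s;
       K = kernel_tilde dx \<iota> d \<alpha> pF pE chi s eta t;
       K' = kernel_tilde2 dx \<iota> d \<alpha> pF pE chi s eta t
     in (bij_betw \<Phi> H D \<and>
       (\<forall>A\<in>H. \<forall>B\<in>H. \<Phi> (\<lambda>f g. A f g + B f g) = (\<lambda>\<phi>. \<Phi> A \<phi> + \<Phi> B \<phi>)) \<and>
       (\<forall>c. \<forall>A\<in>H. \<Phi> (\<lambda>f g. c * A f g) = (\<lambda>\<phi>. c * \<Phi> A \<phi>))) \<and>
      (\<not> exceptional \<iota> chi s eta t \<longrightarrow> D = {\<lambda>\<phi>. c * K \<phi> |c. True}) \<and>
      (exceptional \<iota> chi s eta t \<longrightarrow>
       D = {\<lambda>\<phi>. a * dirac \<phi> + b * K' \<phi> |a b. True} \<and>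
       (\<forall>a b. (\<lambda>\<phi>. a * dirac \<phi> + b * K' \<phi>) = (\<lambda>\<phi>. 0) \<longrightarrow> a = 0 \<and> b = 0))"
proof -
 obtain \<beta> e where "kernel_setting \<iota> d \<alpha> pF pE \<beta> e dx chi eta" using ex_kernel_setting[OF assms] by blast
 then interpret kernel_setting \<iota> d \<alpha> pF pE \<beta> e dx chi eta .
 show ?thesis unfolding Let_def by (intro conjI impI ballI allI bij_betw_Phi Phi_linear D_generic D_exceptional(1))
   (use D_exceptional(2) in blast)+
qed

end
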